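(* Let $w\in A_p$ with $1\le p<n\,\ell_w$, where $\ell_w=\inf\{s\ge 1: w\in A_s\}$, and let $p^*_w$ be defined by $$\frac1p-\frac1{p^*_w}=\frac1n\,\frac1{\ell_w}.$$ Then, for each $1\le q<p^*_w$, we have $$\left(\frac1{w(B)}\int_B|f(x)-f_B|^q\,w(x)\,dx\right)^{\frac1q}\le C_w\,r(B)\left(\frac1{w(B)}\int_B|\nabla f(x)|^p\,w(x)\,dx\right)^{\frac1p}$$ for any ball $B\subset\mathbb{R}^n$, where $C_w$ is of the form $c_n\,p^*\,[w]_{A_r}^{\frac1p}$ for some $r>\ell_w$ depending on $q$. Here $c_n>0$ is a dimensional constant and $p^*=\frac{np}{n-p}$ is the classical Sobolev exponent.
   Context: A weight is a non-negative locally integrable function on $\mathbb{R}^n$; $w(B)=\int_B w(x)\,dx$; $r(B)$ is the radius of the ball $B$; $f$ is a function with gradient $\nabla f$, and $f_B=\frac1{|B|}\int_B f$ is its average over $B$; $p'$ is the conjugate exponent of $p$. For $p>1$, $w\in A_p$ means $[w]_{A_p}=\sup_B\left(\frac1{|B|}\int_B w\right)\left(\frac1{|B|}\int_B w^{1-p'}\right)^{p-1}<\infty$, the supremum being over all balls; $w\in A_1$ means $[w]_{A_1}=\|Mw/w\|_{L^\infty}<\infty$, where $Mw(x)=\sup_B\left(\frac1{|B|}\int_B|w(y)|\,dy\right)\chi_B(x)$ is the Hardy–Littlewood maximal function. With $A_\infty=\bigcup_{p>1}A_p$, the set $\{s\ge1: w\in A_s\}$ equals $[1,\infty)$ if $w\in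 A_1$ and $(\ell_w,\infty)$ if $w\in A_\infty\setminus A_1$.
   Formalization: For p ≥ n, where p* = np/(n−p) is negative or undefined and the stated bound fails, the factor c_n p* is replaced by a finite constant depending only on n and p; for p < n the constant is c_n p* [w]_{A_r}^{1/p} as stated. *)

theory Defs
  imports "HOL-Analysis.Analysis" "HOL-Probability.Essential_Supremum"
begin

definition locally_integrable :: "('a::euclidean_space \<Rightarrow> 'b::euclidean_space) \<Rightarrow> bool" where
  "locally_integrable f \<longleftrightarrow> (\<forall>K. compact K \<longrightarrow> f absolutely_integrable_on K)"

definition weight :: "(real ^ 'n \<Rightarrow> real) \<Rightarrow> bool" where
  "weight w \<longleftrightarrow> (\<forall>x. 0 \<le> w x) \<and> locally_integrable w"

text \<open>
  Powers of extended nonnegative reals, with the conventions of measure theory: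
  for \<open>a > 0\<close>, \<open>0\<close> and \<open>\<infinity>\<close> are fixed; for \<open>a < 0\<close> they are exchanged
  (whereas \<open>0 powr a = 0\<close> on the reals for every \<open>a\<close>).
\<close>
definition enn_powr :: "ennreal \<Rightarrow> real \<Rightarrow> ennreal" where
  "enn_powr x a =
     (if a = 0 then 1
      else if x = 0 then (if a < 0 then \<infinity> else 0)
      else if x = \<infinity> then (if a < 0 then 0 else \<infinity>)
      else ennreal (enn2real x powr a))"

definition enn_avg :: "(real ^ 'n) set \<Rightarrow> (real ^ 'n \<Rightarrow> ennreal) \<Rightarrow> ennreal" where
  "enn_avg B g = (\<integral>\<^sup>+ x \<in> B. g x \<partial>lebesgue) / emeasure lebesgue B"

definition avg :: "(real ^ 'n) set \<Rightarrow> (real ^ 'n \<Rightarrow> real) \<Rightarrow> real" where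
  "avg B f = (LINT x:B|lebesgue. f x) / measure lebesgue B"

definition HL_maximal :: "(real ^ 'n \<Rightarrow> real) \<Rightarrow> real ^ 'n \<Rightarrow> ennreal" where
  "HL_maximal w x =
     (SUP (z, r) \<in> {(z, r). 0 < r \<and> x \<in> ball z r}. enn_avg (ball z r) (\<lambda>y. ennreal \<bar>w y\<bar>))"

definition conj_exponent :: "real \<Rightarrow> real" where
  "conj_exponent p = p / (p - 1)"

definition Ap_const :: "real \<Rightarrow> (real ^ 'n \<Rightarrow> real) \<Rightarrow> ennreal" where
  "Ap_const p w =
     (if p = 1 then esssup lebesgue (\<lambda>x. HL_maximal w x / ennreal (w x))
      else (SUP (z, r) \<in> {(z, r). 0 < r}.
              enn_avg (ball z r) (\<lambda>x. ennreal (w x))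
              * enn_powr (enn_avg (ball z r) (\<lambda>x. enn_powr (ennreal (w x)) (1 - conj_exponent p)))
                         (p - 1)))"

definition Ap_class :: "real \<Rightarrow> (real ^ 'n \<Rightarrow> real) set" where
  "Ap_class p = {w. weight w \<and> Ap_const p w < \<infinity>}"

definition ell :: "(real ^ 'n \<Rightarrow> real) \<Rightarrow> real" where
  "ell w = Inf {s. 1 \<le> s \<and> w \<in> Ap_class s}"

text \<open>
  \<open>f\<close> is a locally integrable function whose distributional gradient is the locally integrable
  vector field \<open>g\<close>, so that \<open>f\<close> ranges over \<open>W\<^sup>1\<^sup>,\<^sup>1\<close> locally. Test functions are
  continuously differentiable with compact support; testing against smooth ones only gives
  the same notion, by mollification.
\<close>
definition has_weak_gradient :: "(real ^ 'n \<Rightarrow> real) \<Rightarrow> (real ^ 'n \<Rightarrow> real ^ 'n) \<Rightarrow> bool" where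
  "has_weak_gradient f g \<longleftrightarrow>
     locally_integrable f \<and> locally_integrable g \<and>
     (\<forall>\<phi> \<phi>'. (\<forall>x. GDERIV \<phi> x :> \<phi>' x) \<and> continuous_on UNIV \<phi>' \<and>
             compact (closure {x. \<phi> x \<noteq> 0}) \<longrightarrow>
        (LINT x|lebesgue. f x *\<^sub>R \<phi>' x) = - (LINT x|lebesgue. \<phi> x *\<^sub>R g x))"

text \<open>The normalized weighted norm: the power \<open>1 / q\<close> of the average of \<open>norm h powr q\<close> over \<open>B\<close>
  with respect to the measure \<open>w dx\<close>; it is \<open>\<infinity>\<close> when the integral diverges.\<close>
definition weighted_mean_norm ::
    "(real ^ 'n \<Rightarrow> real) \<Rightarrow> (real ^ 'n) set \<Rightarrow> real \<Rightarrow> (real ^ 'n \<Rightarrow> 'b::real_normed_vector) \<Rightarrow> ennreal" where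
  "weighted_mean_norm w B q h =
     enn_powr ((\<integral>\<^sup>+ x \<in> B. ennreal (norm (h x) powr q * w x) \<partial>lebesgue)
               / (\<integral>\<^sup>+ x \<in> B. ennreal (w x) \<partial>lebesgue)) (1 / q)"

end

theory Submission
  imports Defs "HOL-Probability.Probability_Measure"
begin

text \<open>
  On a ball \<open>B\<close> of radius \<open>\<rho>\<close> the deviation \<open>\<bar>f - f\<^sub>B\<bar>\<close> is bounded by the Riesz potential of \<open>\<bar>\<nabla>f\<bar>\<close>
  restricted to \<open>B\<close>. If \<open>w\<close> satisfies the \<open>A\<^sub>r\<close> condition with constant \<open>K\<close> for some \<open>r \<le> p\<close>, the part
  of the potential living at scale \<open>2\<^bsup>-k\<^esup>\<rho>\<close> is controlled in two ways: at small scales by applying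
  the condition on balls of that scale, at large scales by applying it on \<open>B\<close> itself. Both bounds contain
  \<open>K\<close> only in the power \<open>1/p\<close>, and their sum over \<open>k\<close> is a weak-type inequality at the
  exponent \<open>1/p - 1/(nr)\<close>. Truncating \<open>f\<close> between consecutive dyadic levels (Maz'ya) makes it a
  strong one, with constant \<open>c\<^sub>n (1 + p/(nr-p)) K\<^bsup>1/p\<^esup>\<close>.

  It remains to choose \<open>r\<close>. If \<open>[w]\<close> in \<open>A\<^sub>r\<close> is unbounded as \<open>r\<close> decreases to \<open>\<ell>\<^sub>w\<close>, any
  constant obtained for one subcritical \<open>r\<close> is absorbed by passing to another \<open>r\<close> closer to \<open>\<ell>\<^sub>w\<close>.
  If it stays bounded, then \<open>\<ell>\<^sub>w = 1\<close>, since the \<open>A\<^sub>r\<close> conditions with \<open>r > 1\<close> improve themselves, and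
  in the limit \<open>w\<close> satisfies the \<open>A\<^sub>1\<close> condition; the inequality with \<open>r = 1\<close> has the constant \<open>c\<^sub>n p\<^sup>*\<close>.
\<close>

section \<open>Weak-type bounds for a dyadic Riesz potential\<close>

text \<open>The form of the constant shapes the proof. Using the inequality directly with some
  \<open>r\<close> in \<open>(ell w, p]\<close> fails in two situations: for
  \<open>p = ell w\<close> no such \<open>r\<close> exists, and for \<open>p \<ge> n\<close> the
  expression \<open>n p / (n - p)\<close> is not a positive number, so no multiple of it can serve.
  The dichotomy on the boundedness of the constants settles both: unbounded constants force
  \<open>ell w < p\<close> and absorb any factor, bounded ones force \<open>ell w = 1\<close> and
  hence \<open>p < n\<close>. In the second case the strict inequality \<open>r > ell w\<close>
  costs a factor two, because the supremum of the constants over \<open>r > 1\<close> is only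
  approached. Self-improvement is needed in a uniform form: the gain may depend on a bound for the
  constants but must not shrink as \<open>r\<close> decreases to \<open>ell w > 1\<close>, so that
  an exponent slightly above \<open>ell w\<close> improves to one below it. The explicit gain of the
  Bellman argument provides this. The definitions also admit weights that vanish almost everywhere;
  every other member of a class is positive almost everywhere.\<close>

text \<open>Young's inequality for the quotients \<open>F x / a\<close> and \<open>G x / b\<close>,
  integrated. Bounds \<open>a\<close>, \<open>b\<close> stand in place of the integrals so that the
  right-hand side is real, and the product form with \<open>\<theta>\<close> covers all exponent
  pairs needed below.\<close>

lemma nn_integral_Holder:
  fixes F G :: "'a \<Rightarrow> real"
  assumes [measurable]: "F \<in> borel_measurable M" "G \<in> borel_measurable M"
    and nonneg: "\<And>x. 0 \<le> F x" "\<And>x. 0 \<le> G x"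
    and \<theta>: "0 \<le> \<theta>" "\<theta> \<le> 1" and "0 \<le> a" "0 \<le> b"
    and F: "(\<integral>\<^sup>+x. ennreal (F x) \<partial>M) \<le> ennreal a" and G: "(\<integral>\<^sup>+x. ennreal (G x) \<partial>M) \<le> ennreal b"
  shows "(\<integral>\<^sup>+x. ennreal (F x powr \<theta> * G x powr (1 - \<theta>)) \<partial>M) \<le> ennreal (a powr \<theta> * b powr (1 - \<theta>))"
\<comment> \<open>The convention \<open>0 powr 0 = 0\<close> lets the degenerate case include
  \<open>\<theta> = 0\<close> and \<open>\<theta> = 1\<close>: the integrand vanishes wherever one
  of the functions does.\<close>
proof (cases "a = 0 \<or> b = 0")
  case True
  have "AE x in M. F x = 0 \<or> G x = 0"
  proof (cases "a = 0")
    case True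
    then have "AE x in M. ennreal (F x) = 0" using F by (subst nn_integral_0_iff_AE [symmetric]) auto
    then show ?thesis by eventually_elim (use nonneg in \<open>simp add: ennreal_eq_0_iff order_antisym\<close>)
  next
    case False
    then have "AE x in M. ennreal (G x) = 0"
      using G True by (subst nn_integral_0_iff_AE [symmetric]) auto
    then show ?thesis by eventually_elim (use nonneg in \<open>simp add: ennreal_eq_0_iff order_antisym\<close>)
  qed
  then have "(\<integral>\<^sup>+x. ennreal (F x powr \<theta> * G x powr (1 - \<theta>)) \<partial>M) = (\<integral>\<^sup>+x. 0 \<partial>M)"
    by (intro nn_integral_cong_AE) (auto elim!: eventually_mono)
  then show ?thesis by simp
next
  case False
  then have ab: "a > 0" "b > 0" using assms by auto
  have young: "F x powr \<theta> * G x powr (1 - \<theta>) \<le> a powr \<theta> * b powr (1 - \<theta>) * (\<theta> / a * F x + (1 - \<theta>) / b * G x)" for x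
  proof (cases "F x = 0 \<or> G x = 0")
    case True
    moreover have "0 \<le> \<theta> / a * F x + (1 - \<theta>) / b * G x"
      using ab nonneg \<theta> by (intro add_nonneg_nonneg mult_nonneg_nonneg) auto
    ultimately have "0 \<le> a powr \<theta> * b powr (1 - \<theta>) * (\<theta> / a * F x + (1 - \<theta>) / b * G x)"
      by (intro mult_nonneg_nonneg) auto
    with True show ?thesis by auto
  next
    case False
    then have pos: "F x / a > 0" "G x / b > 0" using nonneg[of x] ab by (auto simp: less_le)
    have "(F x / a) powr \<theta> * (G x / b) powr (1 - \<theta>) \<le> \<theta> * (F x / a) + (1 - \<theta>) * (G x / b)"
      using pos \<theta> by (intro Youngs_inequality_0) auto
    then have "a powr \<theta> * b powr (1 - \<theta>) * ((F x / a) powr \<theta> * (G x / b) powr (1 - \<theta>))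
       \<le> a powr \<theta> * b powr (1 - \<theta>) * (\<theta> / a * F x + (1 - \<theta>) / b * G x)"
      by (intro mult_left_mono) auto
    moreover have "a powr \<theta> * b powr (1 - \<theta>) * ((F x / a) powr \<theta> * (G x / b) powr (1 - \<theta>))
       = F x powr \<theta> * G x powr (1 - \<theta>)"
      using ab nonneg by (simp add: powr_divide)
    ultimately show ?thesis by simp
  qed
  let ?c = "a powr \<theta> * b powr (1 - \<theta>)"
  have "(\<integral>\<^sup>+x. ennreal (F x powr \<theta> * G x powr (1 - \<theta>)) \<partial>M)
      \<le> (\<integral>\<^sup>+x. ennreal ?c * (ennreal (\<theta> / a) * ennreal (F x) + ennreal ((1 - \<theta>) / b) * ennreal (G x)) \<partial>M)"
    using young ab nonneg \<theta>
    by (intro nn_integral_mono) (simp flip: ennreal_mult'' ennreal_plus add: ennreal_leI)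
  also have "\<dots> = ennreal ?c * (ennreal (\<theta> / a) * (\<integral>\<^sup>+x. ennreal (F x) \<partial>M) + ennreal ((1 - \<theta>) / b) * (\<integral>\<^sup>+x. ennreal (G x) \<partial>M))"
    by (simp add: nn_integral_cmult nn_integral_add)
  also have "\<dots> \<le> ennreal ?c * (ennreal (\<theta> / a) * ennreal a + ennreal ((1 - \<theta>) / b) * ennreal b)"
    by (intro mult_left_mono add_mono F G) auto
  also have "\<dots> = ennreal ?c"
    using ab \<theta> by (simp flip: ennreal_mult'' ennreal_plus)
  finally show ?thesis .
qed

abbreviation ball_vol :: "'a::euclidean_space itself \<Rightarrow> real \<Rightarrow> real" where
  "ball_vol T t \<equiv> unit_ball_vol (real DIM('a)) * t ^ DIM('a)"

lemma unit_ball_vol_nonzero [simp]: "unit_ball_vol (real n) \<noteq> 0"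
  using unit_ball_vol_pos[of "real n"] by linarith

lemma nn_integral_pos_of_pos:
  fixes F :: "'a::euclidean_space \<Rightarrow> real"
  assumes [measurable]: "F \<in> borel_measurable borel" "A \<in> sets borel" and F: "\<And>x. 0 < F x" and A: "emeasure lborel A \<noteq> 0"
  shows "(\<integral>\<^sup>+x\<in>A. ennreal (F x) \<partial>lborel) \<noteq> 0"
proof
  assume "(\<integral>\<^sup>+x\<in>A. ennreal (F x) \<partial>lborel) = 0"
  then have "AE x in lborel. ennreal (F x) * indicator A x = 0"
    by (subst (asm) nn_integral_0_iff_AE) auto
  then have "AE x in lborel. x \<notin> A"
    by eventually_elim (use F in \<open>auto simp: indicator_def ennreal_eq_0_iff not_le [symmetric] split: if_splits\<close>)
  then have "emeasure lborel A = 0"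
    by (subst (asm) AE_iff_measurable[of A]) auto
  with A show False by simp
qed

text \<open>The centre of the ball varies too; joint measurability in centre and point is what the
  Fubini arguments below require.\<close>

lemma borel_measurable_indicator_ball [measurable]:
  fixes f g :: "'b \<Rightarrow> 'a::euclidean_space"
  assumes [measurable]: "f \<in> borel_measurable M" "g \<in> borel_measurable M"
  shows "(\<lambda>p. indicator (ball (f p) s) (g p) :: ennreal) \<in> borel_measurable M"
proof -
  have "(\<lambda>p. indicator (ball (f p) s) (g p) :: ennreal) = (\<lambda>p. if dist (f p) (g p) < s then 1 else 0)"
    by (auto simp: fun_eq_iff indicator_def)
  then show ?thesis by simp
qed

text \<open>The sum over \<open>k\<close> is comparable to the Riesz potential of order one of \<open>h\<close> restricted to the ball.\<close>

definition potential_term :: "'a::euclidean_space \<Rightarrow> real \<Rightarrow> ('a \<Rightarrow> real) \<Rightarrow> nat \<Rightarrow> 'a \<Rightarrow> ennreal" where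
  "potential_term z \<rho> h k x =
     ennreal ((\<rho> / 2 ^ k) / (\<rho> / 2 ^ k) ^ DIM('a)) *
       (\<integral>\<^sup>+y. ennreal (h y) * indicator (ball z \<rho>) y * indicator (ball x (2 * (\<rho> / 2 ^ k))) y \<partial>lborel)"

lemma borel_measurable_potential_term [measurable]:
  assumes [measurable]: "h \<in> borel_measurable borel"
  shows "potential_term z \<rho> h k \<in> borel_measurable borel"
  unfolding potential_term_def by measurable

section \<open>Positive weights and the averaging form of the Muckenhoupt condition\<close>

text \<open>Borel measurability and positivity at every point make negative powers of
  \<open>w\<close> and divisions by the mass of a ball available without exceptional sets. Weights
  that are positive almost everywhere are later replaced by such a representative.\<close>

locale positive_weight =
  fixes w :: "'a::euclidean_space \<Rightarrow> real"
  assumes w_measurable [measurable]: "w \<in> borel_measurable borel"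
    and w_pos: "\<And>x. 0 < w x"
    and w_finite: "\<And>z t. (\<integral>\<^sup>+x\<in>ball z t. ennreal (w x) \<partial>lborel) < \<infinity>"
begin

definition W :: "'a set \<Rightarrow> real" where
  "W A = measure (density lborel (\<lambda>x. ennreal (w x))) A"

lemma emeasure_W_ball: "emeasure (density lborel (\<lambda>x. ennreal (w x))) (ball z t) = ennreal (W (ball z t))"
  unfolding W_def using w_finite[of z t]
  by (intro emeasure_eq_ennreal_measure) (simp add: emeasure_density)

lemma nn_integral_W_ball: "(\<integral>\<^sup>+x\<in>ball z t. ennreal (w x) \<partial>lborel) = ennreal (W (ball z t))"
  by (subst emeasure_W_ball [symmetric]) (simp add: emeasure_density)

lemma W_nonneg [simp]: "0 \<le> W A"
  by (simp add: W_def)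

lemma W_ball_pos:
  assumes "0 < t"
  shows "0 < W (ball z t)"
proof -
  have "(\<integral>\<^sup>+x\<in>ball z t. ennreal (w x) \<partial>lborel) \<noteq> 0"
    by (rule nn_integral_pos_of_pos) (use assms w_pos in \<open>auto simp: emeasure_ball order_less_imp_not_eq2\<close>)
  then show ?thesis unfolding nn_integral_W_ball by (simp add: less_le)
qed

text \<open>The \<open>A\<^sub>r\<close> condition in its dual form, which needs no separate definition for \<open>r = 1\<close>.\<close>

definition averaging_bound :: "real \<Rightarrow> real \<Rightarrow> bool" where
  "averaging_bound r K \<longleftrightarrow>
    (\<forall>z t h X. 0 < t \<longrightarrow> h \<in> borel_measurable borel \<longrightarrow> (\<forall>x. 0 \<le> h x) \<longrightarrow> 0 \<le> X \<longrightarrow>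
       (\<integral>\<^sup>+x\<in>ball z t. ennreal (h x powr r * w x) \<partial>lborel) \<le> ennreal X \<longrightarrow>
       (\<integral>\<^sup>+x\<in>ball z t. ennreal (h x) \<partial>lborel) \<le> ennreal (ball_vol TYPE('a) t * (K * X / W (ball z t)) powr (1 / r)))"

text \<open>The averaging bound is applied to \<open>h powr (p / r)\<close> cut off to
  \<open>E\<close>, whose \<open>r\<close>-th power is \<open>h powr p\<close>; Hoelder's inequality
  with exponents \<open>r / p\<close> and \<open>1 - r / p\<close> then returns to \<open>h\<close>.
  Raising to the power \<open>r / p\<close> turns \<open>K powr (1 / r)\<close> into
  \<open>K powr (1 / p)\<close>, and the remaining exponent falls on the volume of \<open>E\<close>,
  which may be much smaller than the ball.\<close>

lemma averaging_bound_power: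
  assumes bd: "averaging_bound r K" and "1 \<le> r" "r \<le> p" "0 \<le> K" "0 < t"
    and [measurable]: "h \<in> borel_measurable borel" "E \<in> sets borel" and h: "\<And>x. 0 \<le> h x" and "0 \<le> X"
    and E: "E \<subseteq> ball z t" "emeasure lborel E \<le> ennreal V" "0 \<le> V"
    and X: "(\<integral>\<^sup>+x\<in>E. ennreal (h x powr p * w x) \<partial>lborel) \<le> ennreal X"
  shows "(\<integral>\<^sup>+x\<in>E. ennreal (h x) \<partial>lborel)
     \<le> ennreal (ball_vol TYPE('a) t powr (r / p) * V powr (1 - r / p) * (K * X / W (ball z t)) powr (1 / p))"
proof -
  let ?g = "\<lambda>x. h x powr (p / r) * indicator E x" and ?Y = "ball_vol TYPE('a) t * (K * X / W (ball z t)) powr (1 / r)"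
  have "(\<integral>\<^sup>+x\<in>ball z t. ennreal (?g x powr r * w x) \<partial>lborel) \<le> (\<integral>\<^sup>+x\<in>E. ennreal (h x powr p * w x) \<partial>lborel)"
    using assms(2,3) by (intro nn_integral_mono) (auto simp: indicator_def powr_powr)
  also note X
  finally have "(\<integral>\<^sup>+x\<in>ball z t. ennreal (?g x) \<partial>lborel) \<le> ennreal ?Y"
    using bd assms unfolding averaging_bound_def by auto
  moreover have "(\<integral>\<^sup>+x. ennreal (?g x) \<partial>lborel) = (\<integral>\<^sup>+x\<in>ball z t. ennreal (?g x) \<partial>lborel)"
    using E by (intro nn_integral_cong) (auto simp: indicator_def)
  ultimately have g: "(\<integral>\<^sup>+x. ennreal (?g x) \<partial>lborel) \<le> ennreal ?Y" by simp
  have "(\<integral>\<^sup>+x\<in>E. ennreal (h x) \<partial>lborel)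
     = (\<integral>\<^sup>+x. ennreal (?g x powr (r / p) * indicator E x powr (1 - r / p)) \<partial>lborel)"
    using assms(2,3) h by (intro nn_integral_cong) (auto simp: indicator_def powr_powr)
  also have "\<dots> \<le> ennreal (?Y powr (r / p) * V powr (1 - r / p))"
    using assms(2,3,4,5,9,12) E(2) g
    by (intro nn_integral_Holder) (auto simp: ennreal_indicator)
  also have "?Y powr (r / p) = ball_vol TYPE('a) t powr (r / p) * (K * X / W (ball z t)) powr (1 / p)"
    using assms(2,3,4,5,9) by (simp add: powr_mult powr_powr)
  finally show ?thesis by (simp add: mult_ac)
qed

end

section \<open>Two estimates for one scale of the potential\<close>

context positive_weight
begin

text \<open>The measure \<open>w dx\<close> on the ball, normalised to a probability measure.
  Weak-type bounds and the final power mean are all taken with respect to it.\<close>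

definition N :: "'a \<Rightarrow> real \<Rightarrow> 'a measure" where
  "N z \<rho> = density lborel (\<lambda>x. ennreal (w x / W (ball z \<rho>)) * indicator (ball z \<rho>) x)"

lemma sets_N [measurable_cong, simp]: "sets (N z \<rho>) = sets borel"
  and space_N [simp]: "space (N z \<rho>) = UNIV"
  by (simp_all add: N_def)

lemma nn_integral_N:
  assumes [measurable]: "f \<in> borel_measurable borel"
  shows "(\<integral>\<^sup>+x. f x \<partial>N z \<rho>) = (\<integral>\<^sup>+x\<in>ball z \<rho>. f x * ennreal (w x / W (ball z \<rho>)) \<partial>lborel)"
  unfolding N_def by (subst nn_integral_density) (auto simp: mult_ac)

lemma prob_space_N:
  assumes "0 < \<rho>"
  shows "prob_space (N z \<rho>)"
proof
  have pos: "0 < W (ball z \<rho>)" using assms by (rule W_ball_pos)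
  have "emeasure (N z \<rho>) (space (N z \<rho>)) = (\<integral>\<^sup>+x. 1 \<partial>N z \<rho>)" by simp
  also have "\<dots> = (\<integral>\<^sup>+x. ennreal (1 / W (ball z \<rho>)) * (ennreal (w x) * indicator (ball z \<rho>) x) \<partial>lborel)"
    using pos w_pos[THEN less_imp_le] by (subst nn_integral_N) (auto simp: indicator_def simp flip: ennreal_mult' intro!: nn_integral_cong)
  also have "\<dots> = ennreal (1 / W (ball z \<rho>)) * ennreal (W (ball z \<rho>))"
    by (subst nn_integral_cmult) (auto simp: nn_integral_W_ball)
  also have "\<dots> = 1" using pos by (simp flip: ennreal_mult'')
  finally show "emeasure (N z \<rho>) (space (N z \<rho>)) = 1" .
qed

lemma measure_N_le:
  assumes [measurable]: "A \<in> sets borel" and "0 < \<rho>" and "A \<subseteq> ball a t"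
  shows "measure (N z \<rho>) A \<le> W (ball a t) / W (ball z \<rho>)"
proof -
  interpret prob_space "N z \<rho>" by (rule prob_space_N) fact
  have pos: "0 < W (ball z \<rho>)" using assms by (intro W_ball_pos)
  have "emeasure (N z \<rho>) A \<le> (\<integral>\<^sup>+x. ennreal (1 / W (ball z \<rho>)) * (ennreal (w x) * indicator (ball a t) x) \<partial>lborel)"
    unfolding N_def using pos assms(3) w_pos[THEN less_imp_le]
    by (subst emeasure_density) (auto simp: indicator_def simp flip: ennreal_mult'' intro!: nn_integral_mono)
  also have "\<dots> = ennreal (1 / W (ball z \<rho>)) * ennreal (W (ball a t))"
    by (subst nn_integral_cmult) (auto simp: nn_integral_W_ball)
  also have "\<dots> = ennreal (W (ball a t) / W (ball z \<rho>))"
    using pos by (simp flip: ennreal_mult'')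
  finally show ?thesis by (simp add: emeasure_eq_measure)
qed

text \<open>Uniform in \<open>x\<close>, from the averaging bound on the whole ball with
  \<open>E\<close> the part of radius \<open>2 s\<close> around \<open>x\<close>, where
  \<open>s = \<rho> / 2 ^ k\<close>. Counting powers of \<open>s\<close> gives
  \<open>s * (\<rho> / s) powr (n * r / p)\<close>, which grows with \<open>k\<close> because
  \<open>p < n * r\<close>; the bound is therefore useful for the coarse scales only.\<close>

lemma potential_term_far:
  fixes r p K \<rho> X :: real
  assumes bd: "averaging_bound r K" and "1 \<le> r" "r \<le> p" "0 \<le> K" "0 < \<rho>"
    and [measurable]: "h \<in> borel_measurable borel" and h: "\<And>x. 0 \<le> h x" and "0 \<le> X"
    and X: "(\<integral>\<^sup>+x\<in>ball z \<rho>. ennreal (h x powr p * w x) \<partial>lborel) \<le> ennreal X"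
  shows "potential_term z \<rho> h k x \<le> ennreal (unit_ball_vol DIM('a) * 9 ^ DIM('a) * \<rho> * (K * X / W (ball z \<rho>)) powr (1 / p)
       * 2 powr (real k * (DIM('a) * r / p - 1)))"
proof -
  define s where "s = \<rho> / 2 ^ k"
  define n where "n = DIM('a)"
  define \<omega> where "\<omega> = unit_ball_vol (real n)"
  define Y where "Y = (K * X / W (ball z \<rho>)) powr (1 / p)"
  have s: "0 < s" using assms by (simp add: s_def)
  have \<omega>: "0 < \<omega>" by (simp add: \<omega>_def)
  let ?E = "ball z \<rho> \<inter> ball x (2 * s)"
  have "emeasure lborel ?E \<le> emeasure lborel (ball x (2 * s))"
    by (intro emeasure_mono) auto
  then have V: "emeasure lborel ?E \<le> ennreal (\<omega> * (2 * s) ^ n)"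
    using s by (simp add: emeasure_ball \<omega>_def n_def)
  have "(\<integral>\<^sup>+x\<in>?E. ennreal (h x powr p * w x) \<partial>lborel) \<le> (\<integral>\<^sup>+x\<in>ball z \<rho>. ennreal (h x powr p * w x) \<partial>lborel)"
    by (intro nn_integral_mono) (auto simp: indicator_def)
  also note X
  finally have "(\<integral>\<^sup>+x\<in>?E. ennreal (h x) \<partial>lborel)
     \<le> ennreal ((\<omega> * \<rho> ^ n) powr (r / p) * (\<omega> * (2 * s) ^ n) powr (1 - r / p) * Y)"
    unfolding Y_def \<omega>_def n_def using V s assms
    by (intro averaging_bound_power) (auto simp: \<omega>_def n_def)
  then have "potential_term z \<rho> h k x \<le> ennreal (s / s ^ n) * ennreal ((\<omega> * \<rho> ^ n) powr (r / p) * (\<omega> * (2 * s) ^ n) powr (1 - r / p) * Y)"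
    unfolding potential_term_def s_def [symmetric] n_def [symmetric]
    by (intro mult_left_mono) (auto simp: indicator_inter_arith mult_ac)
  also have "\<dots> = ennreal (s / s ^ n * ((\<omega> * \<rho> ^ n) powr (r / p) * (\<omega> * (2 * s) ^ n) powr (1 - r / p)) * Y)"
    using s by (subst ennreal_mult'' [symmetric]) (auto simp: Y_def mult_ac)
  also have "\<dots> \<le> ennreal (\<omega> * 9 ^ n * \<rho> * 2 powr (real k * (n * r / p - 1)) * Y)"
  proof (intro ennreal_leI mult_right_mono)
    have \<rho>s: "\<rho> = 2 ^ k * s" by (simp add: s_def)
    have e: "0 \<le> 1 - r / p" "1 - r / p \<le> 1" using assms by auto
    have "(\<omega> * \<rho> ^ n) powr (r / p) * (\<omega> * (2 * s) ^ n) powr (1 - r / p)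
        = (\<omega> * s ^ n) powr (r / p) * (\<omega> * s ^ n) powr (1 - r / p) * ((2 ^ k) ^ n) powr (r / p) * (2 ^ n) powr (1 - r / p)"
      using s \<omega> by (simp add: \<rho>s powr_mult power_mult_distrib)
    also have "\<dots> = \<omega> * s ^ n * ((2 ^ k) ^ n) powr (r / p) * (2 ^ n) powr (1 - r / p)"
      using s \<omega> by (simp flip: powr_add)
    also have "((2 ^ k) ^ n) powr (r / p) = 2 powr (real k * (n * r / p))"
      by (simp add: powr_powr mult_ac flip: powr_realpow power_mult)
    finally have eq: "s / s ^ n * ((\<omega> * \<rho> ^ n) powr (r / p) * (\<omega> * (2 * s) ^ n) powr (1 - r / p))
        = \<omega> * s * 2 powr (real k * (n * r / p)) * (2 ^ n) powr (1 - r / p)"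
      using s by simp
    \<comment> \<open>The true factor is at most \<open>2 ^ n\<close>; it is enlarged to
      \<open>9 ^ n\<close> so that both single-scale bounds carry the same prefactor.\<close>
    have "(2 ^ n :: real) powr (1 - r / p) \<le> (2 ^ n) powr 1"
      using e by (intro powr_mono) auto
    also have "\<dots> \<le> 9 ^ n" by (simp add: power_mono)
    finally have "s / s ^ n * ((\<omega> * \<rho> ^ n) powr (r / p) * (\<omega> * (2 * s) ^ n) powr (1 - r / p))
        \<le> \<omega> * s * 2 powr (real k * (n * r / p)) * 9 ^ n"
      unfolding eq using s \<omega> by (intro mult_left_mono) auto
    also have "\<omega> * s * 2 powr (real k * (n * r / p)) * 9 ^ n
        = \<omega> * 9 ^ n * \<rho> * (2 powr (- real k) * 2 powr (real k * (n * r / p)))"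
      by (simp add: s_def powr_minus powr_realpow field_simps)
    also have "2 powr (- real k) * 2 powr (real k * (n * r / p)) = 2 powr (real k * (n * r / p - 1))"
      by (simp add: algebra_simps flip: powr_add)
    finally show "s / s ^ n * ((\<omega> * \<rho> ^ n) powr (r / p) * (\<omega> * (2 * s) ^ n) powr (1 - r / p)) \<le> \<omega> * 9 ^ n * \<rho> * 2 powr (real k * (n * r / p - 1))" .
  qed (simp add: Y_def)
  finally show ?thesis by (simp add: Y_def \<omega>_def n_def mult_ac)
qed

text \<open>
  Averaging over the centres of all balls of radius \<open>\<rho>/2\<^sup>k\<close> replaces a covering argument; in this way no
  doubling constant of \<open>w\<close> enters.
\<close>

lemma potential_term_near:
  fixes r p K \<rho> X :: real
  assumes bd: "averaging_bound r K" and "1 \<le> r" "r \<le> p" "0 \<le> K" "0 < \<rho>"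
    and [measurable]: "h \<in> borel_measurable borel" "E \<in> sets borel" and h: "\<And>x. 0 \<le> h x" and "0 \<le> X"
    and X: "(\<integral>\<^sup>+x\<in>ball z \<rho>. ennreal (h x powr p * w x) \<partial>lborel) \<le> ennreal X"
  shows "(\<integral>\<^sup>+x\<in>E. potential_term z \<rho> h k x \<partial>N z \<rho>)
     \<le> ennreal (unit_ball_vol DIM('a) * 9 ^ DIM('a) * \<rho> * (K * X / W (ball z \<rho>)) powr (1 / p)
       * ((1 / 2 ^ k) * measure (N z \<rho>) E powr (1 - 1 / p)))"
proof -
  define s where "s = \<rho> / 2 ^ k"
  define n where "n = DIM('a)"
  define \<omega> where "\<omega> = unit_ball_vol (real n)"
  define W0 where "W0 = W (ball z \<rho>)"
  define e where "e = measure (N z \<rho>) E"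
  interpret N: prob_space "N z \<rho>" by (rule prob_space_N) fact
  interpret P: pair_sigma_finite "N z \<rho>" lborel
    by (intro pair_sigma_finite.intro N.sigma_finite_measure_axioms sigma_finite_lborel)
  have s: "0 < s" using assms by (simp add: s_def)
  have \<omega>: "0 < \<omega>" by (simp add: \<omega>_def)
  have W0: "0 < W0" unfolding W0_def by (intro W_ball_pos) fact
  have p: "1 \<le> p" using assms by simp
  \<comment> \<open>For a centre \<open>a\<close>: the mass of \<open>h\<close> and the weighted
    energy of \<open>h\<close> near \<open>a\<close>, both at radius \<open>3 s\<close>, and the
    part of \<open>E\<close> within distance \<open>s\<close> of \<open>a\<close>.\<close>
  define I where "I a = (\<integral>\<^sup>+y. ennreal (h y) * indicator (ball z \<rho>) y * indicator (ball a (3 * s)) y \<partial>lborel)" for a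
  define XX where "XX a = (\<integral>\<^sup>+y. ennreal (h y powr p * w y) * indicator (ball z \<rho>) y * indicator (ball a (3 * s)) y \<partial>lborel)" for a
  define NN where "NN a = (\<integral>\<^sup>+x. indicator E x * indicator (ball x s) a \<partial>N z \<rho>)" for a
  have [measurable]: "I \<in> borel_measurable borel" "XX \<in> borel_measurable borel" "NN \<in> borel_measurable borel"
    unfolding I_def XX_def NN_def by measurable
  have XX_le: "XX a \<le> ennreal X" for a
    unfolding XX_def by (rule order_trans[OF nn_integral_mono X]) (auto simp: indicator_def)
  define X' where "X' a = enn2real (XX a)" for a
  have X': "XX a = ennreal (X' a)" for a
    using XX_le[of a] unfolding X'_def by (metis ennreal_enn2real ennreal_less_top le_less_trans)
  have NN_eq: "NN a = emeasure (N z \<rho>) (E \<inter> ball a s)" for a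
  proof -
    have "NN a = (\<integral>\<^sup>+x. indicator (E \<inter> ball a s) x \<partial>N z \<rho>)"
      unfolding NN_def by (intro nn_integral_cong) (auto simp: indicator_def dist_commute)
    then show ?thesis by simp
  qed
  define M where "M a = measure (N z \<rho>) (E \<inter> ball a s)" for a
  have M: "NN a = ennreal (M a)" for a
    by (simp add: NN_eq M_def N.emeasure_eq_measure)
  have M_eq: "M = (\<lambda>a. enn2real (NN a))" by (simp add: fun_eq_iff M M_def)
  have [measurable]: "M \<in> borel_measurable borel" "X' \<in> borel_measurable borel"
    unfolding M_eq X'_def by measurable
  have M0: "0 \<le> M a" "0 \<le> X' a" for a by (auto simp: M_def X'_def)
  have bI: "I a \<le> ennreal (\<omega> * (3 * s) ^ n * (K * X' a / W (ball a (3 * s))) powr (1 / p))" for a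
  proof -
    let ?E = "ball z \<rho> \<inter> ball a (3 * s)" and ?v = "\<omega> * (3 * s) ^ n"
    have "emeasure lborel ?E \<le> emeasure lborel (ball a (3 * s))"
      by (intro emeasure_mono) auto
    then have "emeasure lborel ?E \<le> ennreal ?v"
      using s by (simp add: emeasure_ball \<omega>_def n_def)
    moreover have "(\<integral>\<^sup>+x\<in>?E. ennreal (h x powr p * w x) \<partial>lborel) \<le> ennreal (X' a)"
      unfolding X' [symmetric] XX_def by (simp add: indicator_inter_arith mult_ac)
    ultimately have le: "(\<integral>\<^sup>+x\<in>?E. ennreal (h x) \<partial>lborel)
       \<le> ennreal (?v powr (r / p) * ?v powr (1 - r / p) * (K * X' a / W (ball a (3 * s))) powr (1 / p))"
      unfolding \<omega>_def n_def
      using s assms M0 by (intro averaging_bound_power) (auto simp: \<omega>_def n_def)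
    have "?v powr (r / p) * ?v powr (1 - r / p) = ?v"
      using s \<omega> by (simp flip: powr_add)
    from le[unfolded this] show ?thesis by (simp add: I_def indicator_inter_arith mult_ac)
  qed
  define c where "c = \<omega> * (3 * s) ^ n * (K / W0) powr (1 / p)"
  have c: "0 \<le> c" using s \<omega> by (simp add: c_def)
  \<comment> \<open>The factor \<open>W (ball a (3 * s)) powr (- 1 / p)\<close> in the bound for
    \<open>I a\<close> is cancelled by \<open>M a powr (1 / p)\<close>, since \<open>M a\<close> is
    at most the mass of this very ball divided by \<open>W0\<close>. No two balls are compared, so
    doubling does not enter; the remaining powers of \<open>X' a\<close> and \<open>M a\<close> have
    exponents adding up to one and suit Hoelder's inequality in \<open>a\<close>.\<close>
  have IM: "I a * NN a \<le> ennreal c * ennreal (X' a powr (1 / p) * M a powr (1 - 1 / p))" for a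
  proof -
    let ?Wa = "W (ball a (3 * s))"
    have Wa: "0 < ?Wa" using s by (intro W_ball_pos) simp
    have "M a \<le> ?Wa / W0"
      unfolding M_def W0_def using s \<open>0 < \<rho>\<close> by (intro measure_N_le) auto
    then have "M a / ?Wa \<le> 1 / W0" using Wa W0 by (simp add: field_simps)
    then have "K * X' a * (M a / ?Wa) \<le> K * X' a * (1 / W0)"
      using \<open>0 \<le> K\<close> M0 by (intro mult_left_mono) auto
    then have "(K * X' a / ?Wa * M a) powr (1 / p) \<le> (K / W0 * X' a) powr (1 / p)"
      using \<open>0 \<le> K\<close> M0 p Wa by (intro powr_mono2) (auto simp: mult_ac)
    then have le: "(K * X' a / ?Wa) powr (1 / p) * M a powr (1 / p) \<le> (K / W0) powr (1 / p) * X' a powr (1 / p)"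
      using \<open>0 \<le> K\<close> M0 Wa W0 by (simp add: powr_mult powr_divide mult_ac)
    have Mp: "M a = M a powr (1 / p) * M a powr (1 - 1 / p)"
      using M0(1)[of a] by (cases "M a = 0") (auto simp flip: powr_add)
    have "I a * NN a \<le> ennreal (\<omega> * (3 * s) ^ n * (K * X' a / ?Wa) powr (1 / p)) * ennreal (M a)"
      unfolding M by (intro mult_right_mono bI) auto
    also have "\<dots> = ennreal (\<omega> * (3 * s) ^ n * (K * X' a / ?Wa) powr (1 / p) * M a)"
      using M0 s \<omega> by (simp flip: ennreal_mult'')
    also have "\<dots> = ennreal (\<omega> * (3 * s) ^ n * ((K * X' a / ?Wa) powr (1 / p) * M a powr (1 / p)) * M a powr (1 - 1 / p))"
      by (subst Mp) (simp add: mult_ac)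
    also have "\<dots> \<le> ennreal (\<omega> * (3 * s) ^ n * ((K / W0) powr (1 / p) * X' a powr (1 / p)) * M a powr (1 - 1 / p))"
      using s \<omega> by (intro ennreal_leI mult_right_mono mult_left_mono le) auto
    also have "\<dots> = ennreal c * ennreal (X' a powr (1 / p) * M a powr (1 - 1 / p))"
      using c by (simp add: c_def mult_ac flip: ennreal_mult')
    finally show ?thesis .
  qed
  have IX: "(\<integral>\<^sup>+a. ennreal (X' a) \<partial>lborel) \<le> ennreal (\<omega> * (3 * s) ^ n * X)"
  proof -
    have "(\<integral>\<^sup>+a. ennreal (X' a) \<partial>lborel)
       = (\<integral>\<^sup>+y. \<integral>\<^sup>+a. ennreal (h y powr p * w y) * indicator (ball z \<rho>) y * indicator (ball a (3 * s)) y \<partial>lborel \<partial>lborel)"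
      unfolding X' [symmetric] XX_def by (rule lborel_pair.Fubini') measurable
    also have "\<dots> = (\<integral>\<^sup>+y. ennreal (\<omega> * (3 * s) ^ n) * (ennreal (h y powr p * w y) * indicator (ball z \<rho>) y) \<partial>lborel)"
    proof (intro nn_integral_cong)
      fix y :: 'a
      have "(\<integral>\<^sup>+a. ennreal (h y powr p * w y) * indicator (ball z \<rho>) y * indicator (ball a (3 * s)) y \<partial>lborel)
          = (\<integral>\<^sup>+a. ennreal (h y powr p * w y) * indicator (ball z \<rho>) y * indicator (ball y (3 * s)) a \<partial>lborel)"
        by (intro nn_integral_cong) (auto simp: indicator_def dist_commute)
      also have "\<dots> = ennreal (h y powr p * w y) * indicator (ball z \<rho>) y * emeasure lborel (ball y (3 * s))"
        by (subst nn_integral_cmult) auto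
      finally show "(\<integral>\<^sup>+a. ennreal (h y powr p * w y) * indicator (ball z \<rho>) y * indicator (ball a (3 * s)) y \<partial>lborel)
         = ennreal (\<omega> * (3 * s) ^ n) * (ennreal (h y powr p * w y) * indicator (ball z \<rho>) y)"
        using s by (simp add: emeasure_ball \<omega>_def n_def mult_ac)
    qed
    also have "\<dots> = ennreal (\<omega> * (3 * s) ^ n) * (\<integral>\<^sup>+y\<in>ball z \<rho>. ennreal (h y powr p * w y) \<partial>lborel)"
      by (rule nn_integral_cmult) measurable
    also have "\<dots> \<le> ennreal (\<omega> * (3 * s) ^ n) * ennreal X"
      by (intro mult_left_mono X) auto
    finally show ?thesis using s \<omega> by (simp flip: ennreal_mult')
  qed
  have IMa: "(\<integral>\<^sup>+a. ennreal (M a) \<partial>lborel) \<le> ennreal (\<omega> * s ^ n * e)"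
  proof -
    have "(\<integral>\<^sup>+a. ennreal (M a) \<partial>lborel) = (\<integral>\<^sup>+x. \<integral>\<^sup>+a. indicator E x * indicator (ball x s) a \<partial>lborel \<partial>N z \<rho>)"
      unfolding M [symmetric] NN_def by (rule P.Fubini') measurable
    also have "\<dots> = (\<integral>\<^sup>+x. ennreal (\<omega> * s ^ n) * indicator E x \<partial>N z \<rho>)"
      using s by (intro nn_integral_cong) (simp add: nn_integral_cmult emeasure_ball \<omega>_def n_def mult_ac)
    also have "\<dots> = ennreal (\<omega> * s ^ n) * ennreal e"
      by (simp add: nn_integral_cmult e_def N.emeasure_eq_measure)
    finally show ?thesis using s \<omega> by (simp flip: ennreal_mult')
  qed
  let ?T = "\<lambda>x. \<integral>\<^sup>+y. ennreal (h y) * indicator (ball z \<rho>) y * indicator (ball x (2 * s)) y \<partial>lborel"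
  \<comment> \<open>The volume of \<open>ball x s\<close> is written as an integral over centres
    \<open>a\<close>. For each such \<open>a\<close> the ball of radius \<open>2 s\<close> about
    \<open>x\<close> lies in the ball of radius \<open>3 s\<close> about \<open>a\<close>, so
    \<open>?T x\<close> may be replaced by \<open>I a\<close>.\<close>
  have "ennreal (\<omega> * s ^ n) * (\<integral>\<^sup>+x\<in>E. ?T x \<partial>N z \<rho>) = (\<integral>\<^sup>+x. (\<integral>\<^sup>+a. indicator E x * indicator (ball x s) a * ?T x \<partial>lborel) \<partial>N z \<rho>)"
    using s by (subst nn_integral_cmult[symmetric])
      (auto intro!: nn_integral_cong simp: nn_integral_cmult nn_integral_multc emeasure_ball \<omega>_def n_def mult_ac)
  also have "\<dots> \<le> (\<integral>\<^sup>+x. (\<integral>\<^sup>+a. indicator E x * indicator (ball x s) a * I a \<partial>lborel) \<partial>N z \<rho>)"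
  proof (intro nn_integral_mono)
    fix x a
    have "?T x \<le> I a" if "a \<in> ball x s"
    proof -
      have "ball x (2 * s) \<subseteq> ball a (3 * s)"
      proof
        fix y assume "y \<in> ball x (2 * s)"
        then show "y \<in> ball a (3 * s)" using that dist_triangle[of a y x] by (simp add: dist_commute)
      qed
      then show ?thesis unfolding I_def by (intro nn_integral_mono mult_left_mono) (auto simp: indicator_def)
    qed
    then show "indicator E x * indicator (ball x s) a * ?T x \<le> indicator E x * indicator (ball x s) a * I a"
      by (auto simp: indicator_def)
  qed
  also have "\<dots> = (\<integral>\<^sup>+a. (\<integral>\<^sup>+x. indicator E x * indicator (ball x s) a * I a \<partial>N z \<rho>) \<partial>lborel)"
    by (rule P.Fubini'[symmetric]) measurable
  also have "\<dots> = (\<integral>\<^sup>+a. I a * NN a \<partial>lborel)"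
  proof (intro nn_integral_cong)
    fix a
    have "(\<integral>\<^sup>+x. indicator E x * indicator (ball x s) a * I a \<partial>N z \<rho>) = NN a * I a"
      unfolding NN_def by (rule nn_integral_multc) measurable
    then show "(\<integral>\<^sup>+x. indicator E x * indicator (ball x s) a * I a \<partial>N z \<rho>) = I a * NN a"
      by (simp add: mult.commute)
  qed
  also have "\<dots> \<le> (\<integral>\<^sup>+a. ennreal c * ennreal (X' a powr (1 / p) * M a powr (1 - 1 / p)) \<partial>lborel)"
    by (intro nn_integral_mono IM)
  also have "\<dots> = ennreal c * (\<integral>\<^sup>+a. ennreal (X' a powr (1 / p) * M a powr (1 - 1 / p)) \<partial>lborel)"
    by (rule nn_integral_cmult) measurable
  also have "\<dots> \<le> ennreal c * ennreal ((\<omega> * (3 * s) ^ n * X) powr (1 / p) * (\<omega> * s ^ n * e) powr (1 - 1 / p))"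
    using p M0 IX IMa s \<omega> \<open>0 \<le> X\<close> by (intro mult_left_mono nn_integral_Holder) (auto simp: e_def)
  finally have main: "ennreal (\<omega> * s ^ n) * (\<integral>\<^sup>+x\<in>E. ?T x \<partial>N z \<rho>)
      \<le> ennreal c * ennreal ((\<omega> * (3 * s) ^ n * X) powr (1 / p) * (\<omega> * s ^ n * e) powr (1 - 1 / p))" .
  have "(\<integral>\<^sup>+x\<in>E. potential_term z \<rho> h k x \<partial>N z \<rho>) = ennreal (s / s ^ n) * (\<integral>\<^sup>+x\<in>E. ?T x \<partial>N z \<rho>)"
    unfolding potential_term_def s_def [symmetric] n_def [symmetric] 
    by (subst nn_integral_cmult[symmetric]) (auto simp: mult_ac)
  also have "ennreal (s / s ^ n) = ennreal (s / (\<omega> * s ^ n * s ^ n)) * ennreal (\<omega> * s ^ n)"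
    using s \<omega> by (simp flip: ennreal_mult'')
  also have "\<dots> * (\<integral>\<^sup>+x\<in>E. ?T x \<partial>N z \<rho>) \<le> ennreal (s / (\<omega> * s ^ n * s ^ n)) * (ennreal c * ennreal ((\<omega> * (3 * s) ^ n * X) powr (1 / p) * (\<omega> * s ^ n * e) powr (1 - 1 / p)))"
    unfolding mult.assoc by (intro mult_left_mono main[unfolded mult.assoc]) auto
  also have "\<dots> = ennreal (s / (\<omega> * s ^ n * s ^ n) * (c * ((\<omega> * (3 * s) ^ n * X) powr (1 / p) * (\<omega> * s ^ n * e) powr (1 - 1 / p))))"
    using s \<omega> c by (simp flip: ennreal_mult'')
  also have "\<dots> \<le> ennreal (\<omega> * 9 ^ n * \<rho> * (K * X / W0) powr (1 / p) * ((1 / 2 ^ k) * e powr (1 - 1 / p)))"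
  proof (intro ennreal_leI)
    have e: "0 \<le> e" by (simp add: e_def)
    have "(\<omega> * (3 * s) ^ n * X) powr (1 / p) * (\<omega> * s ^ n * e) powr (1 - 1 / p)
        = ((\<omega> * s ^ n) powr (1 / p) * (\<omega> * s ^ n) powr (1 - 1 / p)) * (3 ^ n) powr (1 / p) * (X powr (1 / p) * e powr (1 - 1 / p))"
      using s \<omega> e \<open>0 \<le> X\<close> by (simp add: powr_mult power_mult_distrib)
    also have "(\<omega> * s ^ n) powr (1 / p) * (\<omega> * s ^ n) powr (1 - 1 / p) = \<omega> * s ^ n"
      using s \<omega> by (simp flip: powr_add)
    finally have "s / (\<omega> * s ^ n * s ^ n) * (c * ((\<omega> * (3 * s) ^ n * X) powr (1 / p) * (\<omega> * s ^ n * e) powr (1 - 1 / p)))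
      = s / (\<omega> * s ^ n * s ^ n) * ((\<omega> * s ^ n) * 3 ^ n * (K / W0) powr (1 / p) * ((\<omega> * s ^ n) * (3 ^ n) powr (1 / p) * (X powr (1 / p) * e powr (1 - 1 / p))))"
      by (simp add: c_def power_mult_distrib mult_ac)
    also have "\<dots> = s * (\<omega> * 3 ^ n * (3 ^ n) powr (1 / p)) * ((K / W0) powr (1 / p) * X powr (1 / p) * e powr (1 - 1 / p))"
      using s \<omega> by (simp add: field_simps)
    also have "\<dots> = s * (\<omega> * 3 ^ n * (3 ^ n) powr (1 / p)) * ((K * X / W0) powr (1 / p) * e powr (1 - 1 / p))"
      using \<open>0 \<le> K\<close> \<open>0 \<le> X\<close> W0 by (simp flip: powr_mult)
    \<comment> \<open>One \<open>3 ^ n\<close> is the volume ratio in the averaging bound at radius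
      \<open>3 s\<close>, the other bounds the overlap factor \<open>(3 ^ n) powr (1 / p)\<close>;
      together they give \<open>9 ^ n\<close>.\<close>
    also have "\<dots> \<le> s * (\<omega> * 3 ^ n * 3 ^ n) * ((K * X / W0) powr (1 / p) * e powr (1 - 1 / p))"
    proof (intro mult_right_mono mult_left_mono)
      have "(3 ^ n :: real) powr (1 / p) \<le> (3 ^ n) powr 1"
        using p by (intro powr_mono) auto
      then show "(3 ^ n :: real) powr (1 / p) \<le> 3 ^ n" by simp
    qed (use s \<omega> in auto)
    also have "(3 ^ n * 3 ^ n :: real) = 9 ^ n" by (simp flip: power_mult_distrib)
    then have "\<omega> * 3 ^ n * 3 ^ n = \<omega> * 9 ^ n" by simp
    also have "s * (\<omega> * 9 ^ n) * ((K * X / W0) powr (1 / p) * e powr (1 - 1 / p))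
       = \<omega> * 9 ^ n * \<rho> * (K * X / W0) powr (1 / p) * ((1 / 2 ^ k) * e powr (1 - 1 / p))"
      by (simp add: s_def)
    finally show "s / (\<omega> * s ^ n * s ^ n) * (c * ((\<omega> * (3 * s) ^ n * X) powr (1 / p) * (\<omega> * s ^ n * e) powr (1 - 1 / p)))
       \<le> \<omega> * 9 ^ n * \<rho> * (K * X / W0) powr (1 / p) * ((1 / 2 ^ k) * e powr (1 - 1 / p))" .
  qed
  finally show ?thesis by (simp add: W0_def \<omega>_def n_def e_def)
qed

end

section \<open>Summation over the scales and the weak-type inequality\<close>

text \<open>Keeps the denominator \<open>2 powr \<gamma> - 1\<close> of a geometric sum at least
  linear in \<open>\<gamma>\<close>, so that the constant has only a simple pole at the critical
  exponent.\<close>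

lemma two_powr_minus_one_ge:
  fixes x :: real
  assumes "0 \<le> x"
  shows "x / 2 \<le> 2 powr x - 1"
proof -
  have "1 + x * ln 2 \<le> exp (x * ln 2)" by (rule exp_ge_add_one_self)
  moreover have "x * (1 / 2) \<le> x * ln 2"
    using ln2_ge_two_thirds assms by (intro mult_left_mono) auto
  moreover have "2 powr x = exp (x * ln 2)" by (simp add: powr_def)
  ultimately show ?thesis by linarith
qed

lemma exists_power_between:
  fixes b e :: real
  assumes "0 < b" "b < 1" "0 < e" "e \<le> 1"
  obtains m :: nat where "e \<le> b ^ m" "b ^ Suc m < e"
proof -
  obtain j where "b ^ j < e" using real_arch_pow_inv assms by blast
  moreover have "b ^ Suc j \<le> b ^ j" using assms by simp
  ultimately have ex: "\<exists>j. b ^ Suc j < e" by (intro exI[of _ j]) linarith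
  define m where "m = (LEAST j. b ^ Suc j < e)"
  have 1: "b ^ Suc m < e" unfolding m_def using LeastI_ex[OF ex] .
  have "e \<le> b ^ m"
  proof (cases m)
    case 0
    then show ?thesis using assms by simp
  next
    case (Suc i)
    then have "\<not> b ^ Suc i < e" unfolding m_def by (intro not_less_Least) simp
    then show ?thesis using Suc by simp
  qed
  with 1 that show thesis by blast
qed

text \<open>Here \<open>e\<close> is the measure of the test set and \<open>g\<close> stands for
  \<open>n * r\<close>. The growing bound is used below a threshold and the decaying one from it on;
  at the threshold, where \<open>2 powr (- k)\<close> is about \<open>e powr (1 / g)\<close>, both
  are of size \<open>e powr (1 - (1 / p - 1 / g))\<close>. Both pieces of the sum are geometric and
  dominated by their values there.\<close>

lemma dyadic_sum_bound:
  fixes e g p :: real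
  assumes "0 < e" "e \<le> 1" "1 \<le> p" "p < g"
  obtains t :: "nat \<Rightarrow> real" where "\<And>k. 0 \<le> t k"
    and "\<And>k. t k = (1 / 2 ^ k) * e powr (1 - 1 / p) \<or> t k = 2 powr (real k * (g / p - 1)) * e"
    and "summable t" "suminf t \<le> (4 + 2 * p / (g - p)) * e powr (1 - (1 / p - 1 / g))"
proof -
  define \<gamma> where "\<gamma> = g / p - 1"
  have \<gamma>: "0 < \<gamma>" using assms by (simp add: \<gamma>_def)
  have g: "0 < g" using assms by simp
  have b: "0 < 2 powr (- g)" "2 powr (- g) < 1" using g by (auto simp: powr_less_one)
  \<comment> \<open>The threshold is the scale at which the relative volume to the power
    \<open>r\<close>, namely \<open>2 powr (- g * m)\<close>, matches \<open>e\<close>. The lower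
    estimate of \<open>e\<close> controls the tail, the upper one the initial segment.\<close>
  obtain m where m: "e \<le> (2 powr (- g)) ^ m" "(2 powr (- g)) ^ Suc m < e"
    using exists_power_between[OF b assms(1,2)] by blast
  have mp: "(2 powr (- g)) ^ j = 2 powr (- (g * real j))" for j
    by (simp add: powr_powr flip: powr_realpow)
  define t where "t k = (if k < m then 2 powr (real k * \<gamma>) * e else (1 / 2 ^ k) * e powr (1 - 1 / p))" for k
  have geo: "(\<lambda>k. (1 / 2) ^ k * ((1 / 2) ^ m * e powr (1 - 1 / p))) sums (2 * ((1 / 2) ^ m * e powr (1 - 1 / p)))"
    using sums_mult2[OF geometric_sums[of "1 / 2 :: real"]] by simp
  have shift: "(\<lambda>k. t (k + m)) = (\<lambda>k. (1 / 2) ^ k * ((1 / 2) ^ m * e powr (1 - 1 / p)))"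
    by (simp add: t_def fun_eq_iff power_add power_one_over)
  have sm: "summable t"
    using sums_summable[OF geo] unfolding shift[symmetric] by (simp add: summable_iff_shift)
  have "suminf t = (\<Sum>k. t (k + m)) + (\<Sum>k<m. t k)"
    by (rule suminf_split_initial_segment) fact
  also have "(\<Sum>k. t (k + m)) = 2 * ((1 / 2) ^ m * e powr (1 - 1 / p))"
    unfolding shift using geo by (rule sums_unique[symmetric])
  also have "(1 / 2) ^ m \<le> 2 * e powr (1 / g)"
  proof -
    have "(2 powr (- (g * real (Suc m)))) powr (1 / g) \<le> e powr (1 / g)"
      using m(2) g unfolding mp by (intro powr_mono2) auto
    then have "2 powr (- real (Suc m)) \<le> e powr (1 / g)"
      using g by (simp add: powr_powr)
    moreover have "2 powr (- real (Suc m)) = (1 / 2) ^ Suc m"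
      by (simp only: powr_minus powr_realpow zero_less_numeral power_one_over inverse_eq_divide)
    ultimately show ?thesis by simp
  qed
  also have "2 * (2 * e powr (1 / g) * e powr (1 - 1 / p)) = 4 * e powr (1 - (1 / p - 1 / g))"
    by (simp add: algebra_simps flip: powr_add)
  also have "(\<Sum>k<m. t k) = (\<Sum>k<m. (2 powr \<gamma>) ^ k) * e"
    by (simp add: t_def sum_distrib_left powr_powr mult_ac flip: powr_realpow)
  also have "(\<Sum>k<m. (2 powr \<gamma>) ^ k) = ((2 powr \<gamma>) ^ m - 1) / (2 powr \<gamma> - 1)"
    using \<gamma> by (subst geometric_sum) auto
  \<comment> \<open>Since \<open>\<gamma> = g / p - 1\<close>, the factor
    \<open>2 / \<gamma>\<close> is \<open>2 * p / (g - p)\<close>. This is the origin of the Sobolev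
    exponent in the constant: for \<open>r = 1\<close> it has the denominator
    \<open>n - p\<close>.\<close>
  also have "\<dots> \<le> (2 powr \<gamma>) ^ m / (\<gamma> / 2)"
    using \<gamma> two_powr_minus_one_ge[of \<gamma>] by (intro frac_le) auto
  also have "(2 powr \<gamma>) ^ m \<le> e powr (- (1 / p - 1 / g))"
  proof -
    have "e powr (\<gamma> / g) \<le> (2 powr (- (g * real m))) powr (\<gamma> / g)"
      using m(1) g \<gamma> assms unfolding mp by (intro powr_mono2) auto
    also have "\<dots> = 2 powr (- (\<gamma> * real m))"
      using g by (simp add: powr_powr mult.commute)
    finally have "e powr (\<gamma> / g) * 2 powr (\<gamma> * real m) \<le> 1"
      by (simp add: powr_minus field_simps)
    moreover have "\<gamma> / g = 1 / p - 1 / g" using g assms by (simp add: \<gamma>_def field_simps)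
    ultimately show ?thesis using assms
      by (simp add: powr_minus powr_powr field_simps flip: powr_realpow)
  qed
  also have "e powr (- (1 / p - 1 / g)) / (\<gamma> / 2) * e = (2 * p / (g - p)) * e powr (1 - (1 / p - 1 / g))"
  proof -
    have "2 / \<gamma> = 2 * p / (g - p)" using assms by (simp add: \<gamma>_def field_simps)
    moreover have "e powr (- (1 / p - 1 / g)) * e = e powr (1 - (1 / p - 1 / g))"
    proof -
      have "1 - (1 / p - 1 / g) = - (1 / p - 1 / g) + 1" by simp
      then have "e powr (1 - (1 / p - 1 / g)) = e powr (- (1 / p - 1 / g)) * e powr 1"
        by (simp only: powr_add)
      then show ?thesis using assms by simp
    qed
    ultimately show ?thesis by (metis (no_types, opaque_lifting) divide_divide_eq_right mult.commute mult.left_commute times_divide_eq_left)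
  qed
  finally have "suminf t \<le> (4 + 2 * p / (g - p)) * e powr (1 - (1 / p - 1 / g))"
    using \<gamma> assms by (simp add: mult_right_mono divide_right_mono algebra_simps)
  then show thesis using that[of t] sm assms by (auto simp: t_def \<gamma>_def)
qed

context positive_weight
begin

text \<open>Testing the potential against the indicator of \<open>E\<close> is the dual form of a
  weak-type bound: each scale may use whichever of the two estimates \<open>dyadic_sum_bound\<close>
  selects, the uniform one contributing a factor \<open>measure (N z \<rho>) E\<close>.\<close>

lemma nn_integral_potential:
  fixes r p K \<rho> X :: real
  assumes bd: "averaging_bound r K" and "1 \<le> r" "r \<le> p" "p < DIM('a) * r" "0 \<le> K" "0 < \<rho>"
    and [measurable]: "h \<in> borel_measurable borel" "E \<in> sets borel" and h: "\<And>x. 0 \<le> h x" and "0 \<le> X"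
    and X: "(\<integral>\<^sup>+x\<in>ball z \<rho>. ennreal (h x powr p * w x) \<partial>lborel) \<le> ennreal X"
  shows "(\<integral>\<^sup>+x\<in>E. (\<Sum>k. potential_term z \<rho> h k x) \<partial>N z \<rho>)
     \<le> ennreal (unit_ball_vol DIM('a) * 9 ^ DIM('a) * \<rho> * (K * X / W (ball z \<rho>)) powr (1 / p)
        * ((4 + 2 * p / (DIM('a) * r - p)) * measure (N z \<rho>) E powr (1 - (1 / p - 1 / (DIM('a) * r)))))"
proof -
  interpret N: prob_space "N z \<rho>" by (rule prob_space_N) fact
  define e where "e = measure (N z \<rho>) E"
  define D where "D = unit_ball_vol DIM('a) * 9 ^ DIM('a) * \<rho> * (K * X / W (ball z \<rho>)) powr (1 / p)"
  have D: "0 \<le> D" using assms by (simp add: D_def)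
  have p: "1 \<le> p" using assms by simp
  show ?thesis
  proof (cases "e = 0")
    case True
    then have "E \<in> null_sets (N z \<rho>)" by (simp add: e_def N.emeasure_eq_measure null_sets_def)
    then show ?thesis using nn_integral_null_set[of E "N z \<rho>"] by simp
  next
    case False
    then have e: "0 < e" "e \<le> 1" by (auto simp: e_def less_le)
    obtain t where t: "\<And>k. 0 \<le> t k"
      "\<And>k. t k = (1 / 2 ^ k) * e powr (1 - 1 / p) \<or> t k = 2 powr (real k * (DIM('a) * r / p - 1)) * e"
      and st: "summable t" "suminf t \<le> (4 + 2 * p / (DIM('a) * r - p)) * e powr (1 - (1 / p - 1 / (DIM('a) * r)))"
      using dyadic_sum_bound[OF e p assms(4)] by metis
    have le: "(\<integral>\<^sup>+x\<in>E. potential_term z \<rho> h k x \<partial>N z \<rho>) \<le> ennreal (D * t k)" for k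
    proof (cases "t k = (1 / 2 ^ k) * e powr (1 - 1 / p)")
      case True
      show ?thesis unfolding D_def True e_def by (rule potential_term_near[OF assms(1-3,5-)])
    next
      case False
      then have tk: "t k = 2 powr (real k * (DIM('a) * r / p - 1)) * e" using t(2)[of k] by simp
      have "(\<integral>\<^sup>+x\<in>E. potential_term z \<rho> h k x \<partial>N z \<rho>)
        \<le> (\<integral>\<^sup>+x\<in>E. ennreal (D * 2 powr (real k * (DIM('a) * r / p - 1))) \<partial>N z \<rho>)"
        unfolding D_def by (intro nn_integral_mono mult_right_mono potential_term_far[OF assms(1-3,5-7,9-)]) auto
      also have "\<dots> = ennreal (D * 2 powr (real k * (DIM('a) * r / p - 1))) * ennreal e"
        by (subst nn_integral_cmult_indicator) (auto simp: e_def N.emeasure_eq_measure)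
      also have "\<dots> = ennreal (D * t k)"
        using D e by (simp add: tk mult_ac flip: ennreal_mult'')
      finally show ?thesis .
    qed
    have "(\<integral>\<^sup>+x\<in>E. (\<Sum>k. potential_term z \<rho> h k x) \<partial>N z \<rho>) = (\<integral>\<^sup>+x. (\<Sum>k. potential_term z \<rho> h k x * indicator E x) \<partial>N z \<rho>)"
      by simp
    also have "\<dots> = (\<Sum>k. \<integral>\<^sup>+x\<in>E. potential_term z \<rho> h k x \<partial>N z \<rho>)"
      by (rule nn_integral_suminf) measurable
    also have "\<dots> \<le> (\<Sum>k. ennreal (D * t k))"
      by (intro suminf_le le) auto
    also have "\<dots> = ennreal (\<Sum>k. D * t k)"
      using D t st by (intro suminf_ennreal2 summable_mult) auto
    also have "(\<Sum>k. D * t k) = D * suminf t"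
      by (rule suminf_mult) fact
    also have "ennreal \<dots> \<le> ennreal (D * ((4 + 2 * p / (DIM('a) * r - p)) * e powr (1 - (1 / p - 1 / (DIM('a) * r)))))"
      using D st by (intro ennreal_leI mult_left_mono) auto
    finally show ?thesis unfolding D_def e_def .
  qed
qed

text \<open>The integrated potential bound is taken on the level set
  \<open>E = {x. L \<le> V x}\<close> itself. There the left side is at least \<open>L\<close> times
  its measure \<open>e\<close>, the right side contains \<open>e powr (1 - b)\<close>, and dividing
  leaves \<open>L * e powr b\<close>.\<close>

lemma weak_type_potential:
  fixes r p K \<rho> X c L :: real
  assumes bd: "averaging_bound r K" and "1 \<le> r" "r \<le> p" "p < DIM('a) * r" "0 \<le> K" "0 < \<rho>"
    and [measurable]: "h \<in> borel_measurable borel" and h: "\<And>x. 0 \<le> h x" and "0 \<le> X"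
    and X: "(\<integral>\<^sup>+x\<in>ball z \<rho>. ennreal (h x powr p * w x) \<partial>lborel) \<le> ennreal X"
    and [measurable]: "V \<in> borel_measurable borel" and "0 \<le> c" "0 \<le> L"
    and V: "AE x in lborel. x \<in> ball z \<rho> \<longrightarrow> ennreal (V x) \<le> ennreal c * (\<Sum>k. potential_term z \<rho> h k x)"
  shows "L * measure (N z \<rho>) {x. L \<le> V x} powr (1 / p - 1 / (DIM('a) * r))
     \<le> c * (unit_ball_vol DIM('a) * 9 ^ DIM('a) * \<rho> * (K * X / W (ball z \<rho>)) powr (1 / p) * (4 + 2 * p / (DIM('a) * r - p)))"
proof -
  interpret N: prob_space "N z \<rho>" by (rule prob_space_N) fact
  define E where "E = {x. L \<le> V x}"
  have [measurable]: "E \<in> sets borel" unfolding E_def by measurable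
  define e where "e = measure (N z \<rho>) E"
  define b where "b = 1 / p - 1 / (DIM('a) * r)"
  define D where "D = unit_ball_vol DIM('a) * 9 ^ DIM('a) * \<rho> * (K * X / W (ball z \<rho>)) powr (1 / p) * (4 + 2 * p / (DIM('a) * r - p))"
  have D: "0 \<le> D" using assms by (simp add: D_def)
  show ?thesis
  proof (cases "e = 0")
    case True
    then show ?thesis using D assms unfolding e_def E_def D_def by simp
  next
    case False
    then have e: "0 < e" by (simp add: e_def less_le)
    have AE_N: "AE x in N z \<rho>. x \<in> E \<longrightarrow> ennreal L \<le> ennreal c * (\<Sum>k. potential_term z \<rho> h k x)"
      unfolding N_def
    proof (subst AE_density)
      show "AE x in lborel. 0 < ennreal (w x / W (ball z \<rho>)) * indicator (ball z \<rho>) x \<longrightarrow>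
          x \<in> E \<longrightarrow> ennreal L \<le> ennreal c * (\<Sum>k. potential_term z \<rho> h k x)"
        using V by eventually_elim (auto simp: E_def indicator_def split: if_splits intro: order_trans[OF ennreal_leI])
    qed measurable
    have "ennreal (L * e) = (\<integral>\<^sup>+x. ennreal L * indicator E x \<partial>N z \<rho>)"
      using assms by (subst nn_integral_cmult_indicator) (auto simp: e_def N.emeasure_eq_measure ennreal_mult'')
    also have "\<dots> \<le> (\<integral>\<^sup>+x. ennreal c * ((\<Sum>k. potential_term z \<rho> h k x) * indicator E x) \<partial>N z \<rho>)"
      using AE_N by (intro nn_integral_mono_AE) (auto elim!: eventually_mono simp: indicator_def)
    also have "\<dots> = ennreal c * (\<integral>\<^sup>+x\<in>E. (\<Sum>k. potential_term z \<rho> h k x) \<partial>N z \<rho>)"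
      by (rule nn_integral_cmult) measurable
    also have "\<dots> \<le> ennreal c * ennreal (unit_ball_vol DIM('a) * 9 ^ DIM('a) * \<rho> * (K * X / W (ball z \<rho>)) powr (1 / p)
        * ((4 + 2 * p / (DIM('a) * r - p)) * measure (N z \<rho>) E powr (1 - (1 / p - 1 / (DIM('a) * r)))))"
      by (intro mult_left_mono nn_integral_potential[OF assms(1-7) _ h assms(9,10)]) auto
    also have "\<dots> = ennreal (c * D * e powr (1 - b))"
      using D assms by (simp add: D_def e_def b_def mult_ac flip: ennreal_mult')
    finally have "L * e \<le> c * D * e powr (1 - b)"
      using D assms by (simp add: ennreal_le_iff)
    also have "L * e = L * e powr b * e powr (1 - b)"
      using e by (simp flip: powr_add)
    finally have "L * e powr b \<le> c * D"
      using e by simp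
    then show ?thesis unfolding D_def b_def e_def E_def by (simp add: mult_ac)
  qed
qed

end

section \<open>Potential bounds for weakly differentiable functions\<close>

lemma GDERIV_imp_continuous_on:
  assumes "\<And>x. GDERIV u x :> u' x"
  shows "continuous_on UNIV u"
  using assms unfolding gderiv_def
  by (intro has_derivative_continuous_on) (auto intro: has_derivative_at_withinI)

lemma nn_integral_lborel_affine:
  fixes x0 :: "'a::euclidean_space"
  assumes [measurable]: "f \<in> borel_measurable borel" and "0 < t"
  shows "(\<integral>\<^sup>+y. f (x0 + t *\<^sub>R y) \<partial>lborel) = ennreal (1 / t ^ DIM('a)) * (\<integral>\<^sup>+y. f y \<partial>lborel)"
proof -
  have "(\<integral>\<^sup>+y. f y \<partial>lborel) = (\<integral>\<^sup>+y. f y \<partial>density (distr lborel borel (\<lambda>x. x0 + t *\<^sub>R x)) (\<lambda>_. ennreal (\<bar>t\<bar> ^ DIM('a))))"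
    using assms(2) lborel_affine[of t x0] by simp
  also have "\<dots> = ennreal (t ^ DIM('a)) * (\<integral>\<^sup>+y. f (x0 + t *\<^sub>R y) \<partial>lborel)"
    using assms(2) by (simp add: nn_integral_density nn_integral_distr nn_integral_cmult)
  finally have "ennreal (1 / t ^ DIM('a)) * (\<integral>\<^sup>+y. f y \<partial>lborel) =
     ennreal (1 / t ^ DIM('a)) * ennreal (t ^ DIM('a)) * (\<integral>\<^sup>+y. f (x0 + t *\<^sub>R y) \<partial>lborel)"
    by (simp add: mult.assoc)
  also have "ennreal (1 / t ^ DIM('a)) * ennreal (t ^ DIM('a)) = 1"
    using assms(2) by (simp flip: ennreal_mult')
  finally show ?thesis by simp
qed

lemma gradient_line_bound:
  fixes u :: "'a::euclidean_space \<Rightarrow> real"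
  assumes u: "\<And>x. GDERIV u x :> u' x" and cont: "continuous_on UNIV u'"
  shows "ennreal \<bar>u x - u y\<bar> \<le> (\<integral>\<^sup>+t. ennreal (norm (u' (x + t *\<^sub>R (y - x))) * norm (y - x)) * indicator {0<..1} t \<partial>lborel)"
proof -
  let ?d = "\<lambda>t. (y - x) \<bullet> u' (x + t *\<^sub>R (y - x))"
  have der: "((\<lambda>t. u (x + t *\<^sub>R (y - x))) has_real_derivative ?d t) (at t)" for t
  proof -
    have "((\<lambda>t. u (x + t *\<^sub>R (y - x))) has_derivative (\<lambda>h. (h *\<^sub>R (y - x)) \<bullet> u' (x + t *\<^sub>R (y - x)))) (at t)"
      by (rule has_derivative_compose[where f="\<lambda>t. x + t *\<^sub>R (y - x)", OF _ u[unfolded gderiv_def]])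
        (auto intro!: derivative_eq_intros)
    then show ?thesis by (simp add: has_field_derivative_def mult_commute_abs)
  qed
  have cd: "continuous_on {0..1} ?d"
    by (intro continuous_intros continuous_on_compose2[OF cont]) auto
  have int: "set_integrable lborel {0..1} ?d"
    by (rule borel_integrable_atLeastAtMost') (fact cd)
  have "(LBINT t:{0..1}. ?d t) = u (x + 1 *\<^sub>R (y - x)) - u (x + 0 *\<^sub>R (y - x))"
    unfolding set_lebesgue_integral_def
  proof (rule integral_FTC_atLeastAtMost)
    show "((\<lambda>t. u (x + t *\<^sub>R (y - x))) has_vector_derivative ?d t) (at t within {0..1})" if "0 \<le> t" "t \<le> 1" for t
      using der[of t] by (auto simp: has_real_derivative_iff_has_vector_derivative intro: has_vector_derivative_at_within)
  qed (use cd in auto)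
  then have "\<bar>u x - u y\<bar> = norm (integral\<^sup>L lborel (\<lambda>t. indicator {0..1} t *\<^sub>R ?d t))"
    by (simp add: set_lebesgue_integral_def)
  then have "ennreal \<bar>u x - u y\<bar> = ennreal (norm (integral\<^sup>L lborel (\<lambda>t. indicator {0..1} t *\<^sub>R ?d t)))"
    by simp
  also have "\<dots> \<le> (\<integral>\<^sup>+t. ennreal (norm (indicator {0..1} t *\<^sub>R ?d t)) \<partial>lborel)"
    using int unfolding set_integrable_def by (rule integral_norm_bound_ennreal)
  \<comment> \<open>Removing the null endpoint \<open>t = 0\<close> leaves \<open>(0, 1]\<close>,
    which half-open dyadic intervals partition exactly.\<close>
  also have "\<dots> \<le> (\<integral>\<^sup>+t. ennreal (norm (u' (x + t *\<^sub>R (y - x))) * norm (y - x)) * indicator {0<..1} t \<partial>lborel)"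
  proof (intro nn_integral_mono_AE)
    have "AE t in lborel. t \<noteq> (0::real)" by (rule AE_lborel_singleton)
    then show "AE t in lborel. ennreal (norm (indicator {0..1} t *\<^sub>R ?d t))
       \<le> ennreal (norm (u' (x + t *\<^sub>R (y - x))) * norm (y - x)) * indicator {0<..1} t"
      by eventually_elim (auto simp: indicator_def mult.commute intro!: ennreal_leI Cauchy_Schwarz_ineq2[THEN order_trans])
  qed
  finally show ?thesis .
qed

lemma integrable_on_ball_continuous:
  fixes u :: "'a::euclidean_space \<Rightarrow> real"
  assumes "continuous_on UNIV u"
  shows "set_integrable lborel (ball z \<rho>) u"
proof -
  have "set_integrable lborel (cball z \<rho>) u"
    unfolding set_integrable_def
    by (intro borel_integrable_compact) (auto intro: continuous_on_subset[OF assms])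
  then show ?thesis by (rule set_integrable_subset) auto
qed

lemma average_deviation_le:
  fixes u :: "'a::euclidean_space \<Rightarrow> real"
  assumes [measurable]: "u \<in> borel_measurable borel" and "0 < \<rho>" and int: "set_integrable lborel (ball z \<rho>) u"
  shows "ennreal \<bar>c - (LINT y:ball z \<rho>|lborel. u y) / ball_vol TYPE('a) \<rho>\<bar>
     \<le> ennreal (1 / ball_vol TYPE('a) \<rho>) * (\<integral>\<^sup>+y\<in>ball z \<rho>. ennreal \<bar>c - u y\<bar> \<partial>lborel)"
proof -
  let ?v = "ball_vol TYPE('a) \<rho>"
  have v: "0 < ?v" using assms by simp
  have c: "set_integrable lborel (ball z \<rho>) (\<lambda>_. c)"
    using assms by (simp add: set_integrable_def emeasure_ball integrable_mult_left)
  have "(LINT y:ball z \<rho>|lborel. c - u y) = (LINT y:ball z \<rho>|lborel. c) - (LINT y:ball z \<rho>|lborel. u y)"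
    using c int by (rule set_integral_diff)
  also have "(LINT y:ball z \<rho>|lborel. c) = ?v * c"
    using assms by (simp add: set_lebesgue_integral_def content_ball)
  finally have diff: "(LINT y:ball z \<rho>|lborel. c - u y) = ?v * c - (LINT y:ball z \<rho>|lborel. u y)" .
  have "c - I / v = (1 / v) * (v * c - I)" if "0 < v" for v I :: real
    using that by (simp add: field_simps)
  from this[OF v] have "c - (LINT y:ball z \<rho>|lborel. u y) / ?v = (1 / ?v) * (LINT y:ball z \<rho>|lborel. c - u y)"
    unfolding diff .
  then have "ennreal \<bar>c - (LINT y:ball z \<rho>|lborel. u y) / ?v\<bar> = ennreal (1 / ?v) * ennreal (norm (LINT y:ball z \<rho>|lborel. c - u y))"
    using v \<open>0 < \<rho>\<close> by (simp add: abs_mult flip: ennreal_mult')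
  also have "\<dots> \<le> ennreal (1 / ?v) * (\<integral>\<^sup>+y. ennreal (norm (indicator (ball z \<rho>) y *\<^sub>R (c - u y))) \<partial>lborel)"
    unfolding set_lebesgue_integral_def
    using set_integral_diff(1)[OF c int] unfolding set_integrable_def
    by (intro mult_left_mono integral_norm_bound_ennreal) auto
  also have "(\<integral>\<^sup>+y. ennreal (norm (indicator (ball z \<rho>) y *\<^sub>R (c - u y))) \<partial>lborel) = (\<integral>\<^sup>+y\<in>ball z \<rho>. ennreal \<bar>c - u y\<bar> \<partial>lborel)"
    by (intro nn_integral_cong) (auto simp: indicator_def)
  finally show ?thesis .
qed

text \<open>The deviation from the mean is an average of \<open>\<bar>u x - u y\<bar>\<close>, each
  bounded by the gradient along the segment from \<open>x\<close> to \<open>y\<close>. For a fixed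
  parameter \<open>t\<close> the substitution \<open>y \<mapsto> x + t (y - x)\<close> stays in the
  ball by convexity and moves within \<open>2 * \<rho> * t\<close> of \<open>x\<close>; splitting
  the parameter interval dyadically produces the terms of the potential without any singular
  kernel.\<close>

lemma potential_bound_C1:
  fixes u :: "'a::euclidean_space \<Rightarrow> real"
  assumes u: "\<And>x. GDERIV u x :> u' x" and cont: "continuous_on UNIV u'" and "0 < \<rho>" and x: "x \<in> ball z \<rho>"
  shows "ennreal \<bar>u x - (LINT y:ball z \<rho>|lborel. u y) / ball_vol TYPE('a) \<rho>\<bar>
     \<le> ennreal (2 ^ DIM('a) / unit_ball_vol DIM('a)) * (\<Sum>k. potential_term z \<rho> (\<lambda>y. norm (u' y)) k x)"
proof -
  define n where "n = DIM('a)"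
  define \<omega> where "\<omega> = unit_ball_vol (real n)"
  have \<omega>: "0 < \<omega>" by (simp add: \<omega>_def)
  define J where "J t = (\<integral>\<^sup>+y. ennreal (norm (u' y)) * indicator (ball z \<rho>) y * indicator (ball x (2 * (\<rho> * t))) y \<partial>lborel)" for t
  have cu: "continuous_on UNIV u"
    using u by (rule GDERIV_imp_continuous_on)
  have [measurable]: "u \<in> borel_measurable borel" "u' \<in> borel_measurable borel"
    using cu cont by (auto intro: borel_measurable_continuous_onI)
  have J_mono: "J t \<le> J t'" if "t \<le> t'" for t t'
  proof -
    have "2 * (\<rho> * t) \<le> 2 * (\<rho> * t')" using that \<open>0 < \<rho>\<close> by simp
    then have "ball x (2 * (\<rho> * t)) \<subseteq> ball x (2 * (\<rho> * t'))" by (rule subset_ball)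
    then show ?thesis unfolding J_def by (intro nn_integral_mono mult_left_mono) (auto simp: indicator_def)
  qed
  \<comment> \<open>Change of variables at fixed \<open>t\<close>: the Jacobian is
    \<open>1 / t ^ n\<close>, and \<open>2 * \<rho>\<close> bounds the length of the
    segment.\<close>
  have slice: "(\<integral>\<^sup>+y\<in>ball z \<rho>. ennreal (norm (u' (x + t *\<^sub>R (y - x))) * norm (y - x)) \<partial>lborel)
      \<le> ennreal (2 * \<rho> / t ^ n) * J t" if t: "0 < t" "t \<le> 1" for t
  proof -
    let ?f = "\<lambda>y. ennreal (norm (u' y)) * indicator (ball z \<rho>) y * indicator (ball x (2 * (\<rho> * t))) y"
    have "(\<integral>\<^sup>+y\<in>ball z \<rho>. ennreal (norm (u' (x + t *\<^sub>R (y - x))) * norm (y - x)) \<partial>lborel)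
       \<le> (\<integral>\<^sup>+y. ennreal (2 * \<rho>) * ?f ((1 - t) *\<^sub>R x + t *\<^sub>R y) \<partial>lborel)"
    proof (intro nn_integral_mono)
      fix y
      show "ennreal (norm (u' (x + t *\<^sub>R (y - x))) * norm (y - x)) * indicator (ball z \<rho>) y
         \<le> ennreal (2 * \<rho>) * ?f ((1 - t) *\<^sub>R x + t *\<^sub>R y)"
      proof (cases "y \<in> ball z \<rho>")
        case True
        have eq: "x + t *\<^sub>R (y - x) = (1 - t) *\<^sub>R x + t *\<^sub>R y" by (simp add: algebra_simps)
        have "dist x y < 2 * \<rho>"
          using x True dist_triangle[of x y z] by (simp add: dist_commute)
        then have yx: "norm (y - x) < 2 * \<rho>" by (simp add: dist_norm norm_minus_commute)
        have "(1 - t) *\<^sub>R x + t *\<^sub>R y \<in> ball z \<rho>"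
          using t x True by (intro convexD convex_ball) auto
        moreover have "dist x ((1 - t) *\<^sub>R x + t *\<^sub>R y) = t * norm (y - x)"
          using t unfolding eq [symmetric] by (simp add: dist_norm)
        then have "(1 - t) *\<^sub>R x + t *\<^sub>R y \<in> ball x (2 * (\<rho> * t))"
          using yx t by (simp add: mult_ac)
        ultimately show ?thesis
          unfolding eq using yx True \<open>0 < \<rho>\<close>
          by (simp add: mult.commute[of "norm (u' _)"] mult_right_mono less_imp_le ennreal_leI flip: ennreal_mult')
      qed auto
    qed
    also have "\<dots> = ennreal (2 * \<rho>) * (ennreal (1 / t ^ n) * J t)"
      using t nn_integral_lborel_affine[of ?f t "(1 - t) *\<^sub>R x"] by (simp add: nn_integral_cmult J_def n_def)
    also have "\<dots> = ennreal (2 * \<rho> / t ^ n) * J t"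
      using t \<open>0 < \<rho>\<close> by (simp add: mult.assoc[symmetric] flip: ennreal_mult')
    finally show ?thesis .
  qed
  let ?I = "\<lambda>k::nat. {(1 / 2) ^ Suc k<..(1 / 2) ^ k} :: real set"
  let ?a = "\<lambda>k::nat. ennreal (2 * \<rho> * 2 ^ (Suc k * n)) * J ((1 / 2) ^ k)"
  have "(\<integral>\<^sup>+y\<in>ball z \<rho>. ennreal \<bar>u x - u y\<bar> \<partial>lborel)
     \<le> (\<integral>\<^sup>+y\<in>ball z \<rho>. (\<integral>\<^sup>+t. ennreal (norm (u' (x + t *\<^sub>R (y - x))) * norm (y - x)) * indicator {0<..1} t \<partial>lborel) \<partial>lborel)"
    by (intro nn_integral_mono mult_right_mono gradient_line_bound u cont) auto
  also have "\<dots> = (\<integral>\<^sup>+y. (\<integral>\<^sup>+t. ennreal (norm (u' (x + t *\<^sub>R (y - x))) * norm (y - x)) * indicator {0<..1} t * indicator (ball z \<rho>) y \<partial>lborel) \<partial>lborel)"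
    by (intro nn_integral_cong nn_integral_multc[symmetric]) measurable
  also have "\<dots> = (\<integral>\<^sup>+t. (\<integral>\<^sup>+y. ennreal (norm (u' (x + t *\<^sub>R (y - x))) * norm (y - x)) * indicator {0<..1} t * indicator (ball z \<rho>) y \<partial>lborel) \<partial>lborel)"
    by (rule lborel_pair.Fubini') measurable
  also have "\<dots> \<le> (\<integral>\<^sup>+t. (\<Sum>k. ?a k * indicator (?I k) t) \<partial>lborel)"
  proof (intro nn_integral_mono)
    fix t :: real
    show "(\<integral>\<^sup>+y. ennreal (norm (u' (x + t *\<^sub>R (y - x))) * norm (y - x)) * indicator {0<..1} t * indicator (ball z \<rho>) y \<partial>lborel)
      \<le> (\<Sum>k. ?a k * indicator (?I k) t)"
    proof (cases "t \<in> {0<..1}")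
      case True
      then obtain m where m: "t \<le> (1 / 2) ^ m" "(1 / 2) ^ Suc m < t"
        using exists_power_between[of "1 / 2" t] by auto
      have "(\<integral>\<^sup>+y. ennreal (norm (u' (x + t *\<^sub>R (y - x))) * norm (y - x)) * indicator {0<..1} t * indicator (ball z \<rho>) y \<partial>lborel)
         \<le> ennreal (2 * \<rho> / t ^ n) * J t"
        using slice[of t] True by simp
      also have "\<dots> \<le> ?a m"
      proof (intro mult_mono ennreal_leI J_mono m)
        have "(1 / 2) ^ (Suc m * n) \<le> t ^ n"
          unfolding power_mult using m(2) by (intro power_mono) auto
        then have "2 * \<rho> / t ^ n \<le> 2 * \<rho> / (1 / 2) ^ (Suc m * n)"
          using \<open>0 < \<rho>\<close> True by (intro divide_left_mono) auto
        then show "2 * \<rho> / t ^ n \<le> 2 * \<rho> * 2 ^ (Suc m * n)"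
          by (simp add: power_one_over field_simps)
      qed auto
      also have "\<dots> = ?a m * indicator (?I m) t" using m by simp
      also have "\<dots> = (\<Sum>k\<in>{m}. ?a k * indicator (?I k) t)"
        by (simp only: sum.insert finite.emptyI empty_iff sum.empty add_0_right not_False_eq_True)
      also have "\<dots> \<le> (\<Sum>k. ?a k * indicator (?I k) t)" by (rule sum_le_suminf) auto
      finally show ?thesis .
    qed auto
  qed
  also have "\<dots> = (\<Sum>k. \<integral>\<^sup>+t. ?a k * indicator (?I k) t \<partial>lborel)"
    by (rule nn_integral_suminf) measurable
  also have "\<dots> = (\<Sum>k. ennreal (2 ^ n * \<rho> ^ n) * potential_term z \<rho> (\<lambda>y. norm (u' y)) k x)"
  proof (intro suminf_cong)
    fix k
    have "(\<integral>\<^sup>+t. ?a k * indicator (?I k) t \<partial>lborel) = ?a k * ennreal ((1 / 2) ^ Suc k)"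
      by (subst nn_integral_cmult_indicator) auto
    also have "\<dots> = (ennreal (2 * \<rho> * 2 ^ (Suc k * n)) * ennreal ((1 / 2) ^ Suc k)) * J ((1 / 2) ^ k)"
      by (simp add: mult_ac)
    \<comment> \<open>The Jacobian at the lower end of the interval times its length reproduces the
      kernel \<open>s / s ^ n\<close> at \<open>s = \<rho> / 2 ^ k\<close>. The extra
      \<open>2 ^ n\<close> comes from bounding \<open>t\<close> below by half of the upper
      end.\<close>
    also have "ennreal (2 * \<rho> * 2 ^ (Suc k * n)) * ennreal ((1 / 2) ^ Suc k) = ennreal (2 ^ n * \<rho> ^ n) * ennreal ((\<rho> / 2 ^ k) / (\<rho> / 2 ^ k) ^ n)"
      using \<open>0 < \<rho>\<close> by (simp add: power_divide power_one_over power_add field_simps flip: ennreal_mult' power_mult)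
    also have "\<dots> * J ((1 / 2) ^ k) = ennreal (2 ^ n * \<rho> ^ n) * potential_term z \<rho> (\<lambda>y. norm (u' y)) k x"
      unfolding potential_term_def J_def n_def [symmetric] by (simp add: power_one_over mult_ac)
    finally show "(\<integral>\<^sup>+t. ?a k * indicator (?I k) t \<partial>lborel) = ennreal (2 ^ n * \<rho> ^ n) * potential_term z \<rho> (\<lambda>y. norm (u' y)) k x" .
  qed
  also have "\<dots> = ennreal (2 ^ n * \<rho> ^ n) * (\<Sum>k. potential_term z \<rho> (\<lambda>y. norm (u' y)) k x)"
    by simp
  finally have le: "(\<integral>\<^sup>+y\<in>ball z \<rho>. ennreal \<bar>u x - u y\<bar> \<partial>lborel)
    \<le> ennreal (2 ^ n * \<rho> ^ n) * (\<Sum>k. potential_term z \<rho> (\<lambda>y. norm (u' y)) k x)" .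
  have "ennreal \<bar>u x - (LINT y:ball z \<rho>|lborel. u y) / ball_vol TYPE('a) \<rho>\<bar>
     \<le> ennreal (1 / (\<omega> * \<rho> ^ n)) * (\<integral>\<^sup>+y\<in>ball z \<rho>. ennreal \<bar>u x - u y\<bar> \<partial>lborel)"
    using average_deviation_le[OF _ \<open>0 < \<rho>\<close> integrable_on_ball_continuous[OF cu], where c="u x"]
    by (simp add: \<omega>_def n_def)
  also have "\<dots> \<le> ennreal (1 / (\<omega> * \<rho> ^ n)) * (ennreal (2 ^ n * \<rho> ^ n) * (\<Sum>k. potential_term z \<rho> (\<lambda>y. norm (u' y)) k x))"
    by (intro mult_left_mono le) auto
  also have "\<dots> = (ennreal (1 / (\<omega> * \<rho> ^ n)) * ennreal (2 ^ n * \<rho> ^ n)) * (\<Sum>k. potential_term z \<rho> (\<lambda>y. norm (u' y)) k x)"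
    by (simp add: mult.assoc)
  also have "ennreal (1 / (\<omega> * \<rho> ^ n)) * ennreal (2 ^ n * \<rho> ^ n) = ennreal (2 ^ n / \<omega>)"
    using \<omega> \<open>0 < \<rho>\<close> by (simp flip: ennreal_mult')
  finally show ?thesis by (simp add: \<omega>_def n_def)
qed

section \<open>Approximation in the mean and mollification\<close>

text \<open>Along a subsequence with integrals below \<open>(1 / 2) ^ n\<close> the sum of the
  functions has finite integral, hence is finite almost everywhere, and the terms of a convergent
  series tend to zero.\<close>

lemma nn_integral_tendsto_zero_AE_subseq:
  fixes a :: "nat \<Rightarrow> 'a \<Rightarrow> ennreal"
  assumes [measurable]: "\<And>n. a n \<in> borel_measurable M" and lim: "(\<lambda>n. \<integral>\<^sup>+x. a n x \<partial>M) \<longlonglongrightarrow> 0"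
  obtains r :: "nat \<Rightarrow> nat" where "strict_mono r" "AE x in M. (\<lambda>n. a (r n) x) \<longlonglongrightarrow> 0"
proof -
  have "\<exists>j>i. (\<integral>\<^sup>+x. a j x \<partial>M) < ennreal ((1 / 2) ^ k)" for i k
  proof -
    have "eventually (\<lambda>n. (\<integral>\<^sup>+x. a n x \<partial>M) < ennreal ((1 / 2) ^ k)) sequentially"
      using lim by (rule order_tendstoD) simp
    with eventually_gt_at_top[of i] have "eventually (\<lambda>n. n > i \<and> (\<integral>\<^sup>+x. a n x \<partial>M) < ennreal ((1 / 2) ^ k)) sequentially"
      by (rule eventually_conj)
    then show ?thesis by (auto simp: eventually_sequentially)
  qed
  then have "\<exists>r. \<forall>n. (\<integral>\<^sup>+x. a (r n) x \<partial>M) < ennreal ((1 / 2) ^ n) \<and> r n < r (Suc n)"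
    by (intro dependent_nat_choice) blast+
  then obtain r where r: "\<And>n. (\<integral>\<^sup>+x. a (r n) x \<partial>M) < ennreal ((1 / 2) ^ n)" "\<And>n. r n < r (Suc n)"
    by blast
  have "(\<integral>\<^sup>+x. (\<Sum>n. a (r n) x) \<partial>M) = (\<Sum>n. \<integral>\<^sup>+x. a (r n) x \<partial>M)"
    by (rule nn_integral_suminf) measurable
  also have "\<dots> \<le> (\<Sum>n. ennreal ((1 / 2) ^ n))"
    using r(1) by (intro suminf_le) (auto intro: less_imp_le)
  also have "\<dots> = ennreal (\<Sum>n. (1 / 2) ^ n)"
    by (intro suminf_ennreal2) auto
  finally have "(\<integral>\<^sup>+x. (\<Sum>n. a (r n) x) \<partial>M) < \<infinity>"
    using le_less_trans by fastforce
  then have "AE x in M. (\<Sum>n. a (r n) x) \<noteq> \<infinity>"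
    by (intro nn_integral_noteq_infinite) auto
  then have "AE x in M. (\<lambda>n. a (r n) x) \<longlonglongrightarrow> 0"
  proof eventually_elim
    case (elim x)
    have fin: "a (r n) x \<noteq> top" for n
    proof
      assume "a (r n) x = top"
      moreover have "a (r n) x \<le> (\<Sum>n. a (r n) x)"
        using sum_le_suminf[of "\<lambda>n. a (r n) x" "{n}"] by simp
      ultimately show False using elim by (simp add: top_unique)
    qed
    define b where "b n = enn2real (a (r n) x)" for n
    have b: "a (r n) x = ennreal (b n)" for n using fin[of n] by (simp add: b_def less_top)
    have "summable b"
      using elim unfolding b by (intro summable_suminf_not_top) (auto simp: b_def)
    then have "b \<longlonglongrightarrow> 0" by (rule summable_LIMSEQ_zero)
    then show ?case unfolding b using tendsto_ennrealI by fastforce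
  qed
  then show thesis using that[of r] r(2) by (simp add: strict_mono_Suc_iff)
qed

text \<open>Two applications of dominated convergence: truncating the values of \<open>f\<close> is
  harmless by integrability, and the truncation is the almost everywhere limit of continuous
  functions truncated at the same height, with a constant as majorant on the bounded set.\<close>

lemma continuous_approximation_L1:
  fixes f :: "'a::euclidean_space \<Rightarrow> 'b::euclidean_space"
  assumes [measurable]: "f \<in> borel_measurable borel" and int: "(\<integral>\<^sup>+x\<in>cball z R. ennreal (norm (f x)) \<partial>lborel) < \<infinity>"
    and "0 < e"
  obtains h :: "'a \<Rightarrow> 'b" where "continuous_on UNIV h" "(\<integral>\<^sup>+x\<in>cball z R. ennreal (norm (f x - h x)) \<partial>lborel) < ennreal e"
proof -
  \<comment> \<open>The radial retraction onto the ball of radius \<open>m\<close>. Being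
    continuous, it keeps the approximating functions continuous.\<close>
  define clamp :: "real \<Rightarrow> 'b \<Rightarrow> 'b" where "clamp m y = (m / max m (norm y)) *\<^sub>R y" for m y
  have clamp_cont: "continuous_on UNIV (clamp m)" if "0 < m" for m
    unfolding clamp_def using that by (intro continuous_intros) (auto simp: max_def)
  have clamp_norm: "norm (clamp m y) \<le> norm y" "norm (clamp m y) \<le> m" if "0 < m" for m y
  proof -
    have "0 < max m (norm y)" using that by simp
    then show "norm (clamp m y) \<le> norm y" "norm (clamp m y) \<le> m" using that 
      by (auto simp: clamp_def max_def)
  qed
  have clamp_meas: "clamp m \<in> borel_measurable borel" if "0 < m" for m
    using clamp_cont[OF that] by (rule borel_measurable_continuous_onI)
  have ind: "(\<lambda>x. indicator (cball z R) x *\<^sub>R F x) \<in> borel_measurable borel" if "F \<in> borel_measurable borel" for F :: "'a \<Rightarrow> 'b"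
    using that by (intro borel_measurable_scaleR borel_measurable_indicator) auto
  have ind': "(\<lambda>x. indicator (cball z R) x * F x) \<in> borel_measurable borel" if "F \<in> borel_measurable borel" for F :: "'a \<Rightarrow> real"
    using that by (intro borel_measurable_times borel_measurable_indicator) auto
  have e2: "0 < ennreal (e / 2)" using assms by simp
  have "(\<lambda>i. \<integral>\<^sup>+x. norm (indicator (cball z R) x *\<^sub>R f x - indicator (cball z R) x *\<^sub>R clamp (real (Suc i)) (f x)) \<partial>lborel) \<longlonglongrightarrow> 0"
  proof (rule nn_integral_dominated_convergence_norm[where w="\<lambda>x. indicator (cball z R) x * norm (f x)"])
    show "(\<lambda>x. indicator (cball z R) x *\<^sub>R clamp (real (Suc i)) (f x)) \<in> borel_measurable lborel" for i
    proof -
      have "(\<lambda>x. clamp (real (Suc i)) (f x)) \<in> borel_measurable borel"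
        by (rule measurable_compose[OF _ clamp_meas]) auto
      from ind[OF this] show ?thesis by (simp del: of_nat_Suc)
    qed
    show "AE x in lborel. norm (indicator (cball z R) x *\<^sub>R clamp (real (Suc j)) (f x)) \<le> indicator (cball z R) x * norm (f x)" for j
      using clamp_norm(1)[of "real (Suc j)"] by (auto simp: indicator_def)
    show "(\<integral>\<^sup>+x. ennreal (indicator (cball z R) x * norm (f x)) \<partial>lborel) < \<infinity>"
      using int by (simp add: ennreal_mult' ennreal_indicator mult.commute)
    show "AE x in lborel. (\<lambda>i. indicator (cball z R) x *\<^sub>R clamp (real (Suc i)) (f x)) \<longlonglongrightarrow> indicator (cball z R) x *\<^sub>R f x"
    proof (intro AE_I2 tendsto_scaleR tendsto_const)
      fix x
      obtain n where n: "norm (f x) < real n" using reals_Archimedean2 by blast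
      have "eventually (\<lambda>i. clamp (real (Suc i)) (f x) = f x) sequentially"
        using eventually_ge_at_top[of n] by eventually_elim (use n in \<open>simp add: clamp_def max_def\<close>)
      then show "(\<lambda>i. clamp (real (Suc i)) (f x)) \<longlonglongrightarrow> f x" by (rule tendsto_eventually)
    qed
  qed (auto intro!: ind ind')
  from order_tendstoD(2)[OF this e2] obtain i
    where i: "(\<integral>\<^sup>+x. norm (indicator (cball z R) x *\<^sub>R f x - indicator (cball z R) x *\<^sub>R clamp (real (Suc i)) (f x)) \<partial>lborel) < ennreal (e / 2)"
    by (auto simp: eventually_sequentially)
  define m where "m = real (Suc i)"
  have m: "0 < m" by (simp add: m_def)
  have c: "(\<lambda>x. clamp m (f x)) \<in> borel_measurable borel"
      by (rule measurable_compose[OF _ clamp_meas[OF m]]) auto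
  have "f \<in> borel_measurable lebesgue" by (simp add: measurable_completion)
  then have "f measurable_on UNIV" by (intro lebesgue_measurable_imp_measurable_on) auto
  then obtain Z g where Z: "negligible Z" and g: "\<And>n. continuous_on UNIV (g n)" and lim: "\<And>x. x \<notin> Z \<Longrightarrow> (\<lambda>n. g n x) \<longlonglongrightarrow> f x"
    unfolding measurable_on_def by auto
  have gc: "continuous_on UNIV (\<lambda>x. clamp m (g n x))" for n
    by (rule continuous_on_compose2[OF clamp_cont[OF m] g]) simp
  have [measurable]: "(\<lambda>x. clamp m (g n x)) \<in> borel_measurable borel" for n
    using gc by (rule borel_measurable_continuous_onI)
  have "AE x in lebesgue. x \<notin> Z" using Z unfolding negligible_iff_null_sets by (rule AE_not_in)
  then have AEZ: "AE x in lborel. x \<notin> Z" by (simp add: AE_completion_iff)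
  have "(\<lambda>n. \<integral>\<^sup>+x. norm (indicator (cball z R) x *\<^sub>R clamp m (f x) - indicator (cball z R) x *\<^sub>R clamp m (g n x)) \<partial>lborel) \<longlonglongrightarrow> 0"
  proof (rule nn_integral_dominated_convergence_norm[where w="\<lambda>x. indicator (cball z R) x * m"])
    show "AE x in lborel. norm (indicator (cball z R) x *\<^sub>R clamp m (g j x)) \<le> indicator (cball z R) x * m" for j
      using clamp_norm(2)[OF m] by (auto simp: indicator_def)
    show "(\<integral>\<^sup>+x. ennreal (indicator (cball z R) x * m) \<partial>lborel) < \<infinity>"
    proof -
      have "(\<integral>\<^sup>+x. ennreal (indicator (cball z R) x * m) \<partial>lborel) = (\<integral>\<^sup>+x. ennreal m * indicator (cball z R) x \<partial>lborel)"
        by (intro nn_integral_cong) (auto simp: indicator_def)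
      also have "\<dots> = ennreal m * emeasure lborel (cball z R)"
        by (rule nn_integral_cmult_indicator) simp
      also have "\<dots> < \<infinity>"
        using emeasure_lborel_cball_finite[of z R] ennreal_mult_less_top[of "ennreal m"] by auto
      finally show ?thesis .
    qed
    show "AE x in lborel. (\<lambda>n. indicator (cball z R) x *\<^sub>R clamp m (g n x)) \<longlonglongrightarrow> indicator (cball z R) x *\<^sub>R clamp m (f x)"
      using AEZ
    proof eventually_elim
      case (elim x)
      have "isCont (clamp m) (f x)" using clamp_cont[OF m] by (simp add: continuous_on_eq_continuous_at)
      from isCont_tendsto_compose[OF this lim[OF elim]] show ?case
        by (rule tendsto_scaleR[OF tendsto_const])
    qed
  qed (auto intro!: ind ind' c)
  from order_tendstoD(2)[OF this e2] obtain n
    where n: "(\<integral>\<^sup>+x. norm (indicator (cball z R) x *\<^sub>R clamp m (f x) - indicator (cball z R) x *\<^sub>R clamp m (g n x)) \<partial>lborel) < ennreal (e / 2)"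
    by (auto simp: eventually_sequentially)
  have "(\<integral>\<^sup>+x\<in>cball z R. ennreal (norm (f x - clamp m (g n x))) \<partial>lborel)
     \<le> (\<integral>\<^sup>+x. ennreal (norm (indicator (cball z R) x *\<^sub>R f x - indicator (cball z R) x *\<^sub>R clamp m (f x)))
       + ennreal (norm (indicator (cball z R) x *\<^sub>R clamp m (f x) - indicator (cball z R) x *\<^sub>R clamp m (g n x))) \<partial>lborel)"
  proof (intro nn_integral_mono)
    fix x
    have "norm (f x - clamp m (g n x)) \<le> norm (f x - clamp m (f x)) + norm (clamp m (f x) - clamp m (g n x))"
      using norm_triangle_ineq[of "f x - clamp m (f x)" "clamp m (f x) - clamp m (g n x)"] by simp
    then show "ennreal (norm (f x - clamp m (g n x))) * indicator (cball z R) x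
      \<le> ennreal (norm (indicator (cball z R) x *\<^sub>R f x - indicator (cball z R) x *\<^sub>R clamp m (f x)))
       + ennreal (norm (indicator (cball z R) x *\<^sub>R clamp m (f x) - indicator (cball z R) x *\<^sub>R clamp m (g n x)))"
      by (auto simp: indicator_def simp flip: ennreal_plus intro!: ennreal_leI)
  qed
  also have "\<dots> = (\<integral>\<^sup>+x. norm (indicator (cball z R) x *\<^sub>R f x - indicator (cball z R) x *\<^sub>R clamp m (f x)) \<partial>lborel)
       + (\<integral>\<^sup>+x. norm (indicator (cball z R) x *\<^sub>R clamp m (f x) - indicator (cball z R) x *\<^sub>R clamp m (g n x)) \<partial>lborel)"
  proof (rule nn_integral_add)
    have en: "(\<lambda>x. ennreal (norm (F x))) \<in> borel_measurable lborel" if "F \<in> borel_measurable borel" for F :: "'a \<Rightarrow> 'b"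
      using that by simp
    show "(\<lambda>x. ennreal (norm (indicator (cball z R) x *\<^sub>R f x - indicator (cball z R) x *\<^sub>R clamp m (f x)))) \<in> borel_measurable lborel"
      by (intro en borel_measurable_diff ind c assms(1))
    show "(\<lambda>x. ennreal (norm (indicator (cball z R) x *\<^sub>R clamp m (f x) - indicator (cball z R) x *\<^sub>R clamp m (g n x)))) \<in> borel_measurable lborel"
      by (intro en borel_measurable_diff ind c borel_measurable_continuous_onI[OF gc])
  qed
  also have "\<dots> < ennreal (e / 2) + ennreal (e / 2)"
    using i n unfolding m_def [symmetric] by (rule add_strict_mono)
  also have "\<dots> = ennreal e" using assms by (simp flip: ennreal_plus)
  finally show thesis by (rule that[OF gc])
qed

text \<open>The squared positive part is the building block of both the mollifier and the smooth
  step, which therefore are continuously differentiable.\<close>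

lemma DERIV_positive_part_square:
  "((\<lambda>x::real. (max 0 x)\<^sup>2) has_real_derivative 2 * max 0 x) (at x)"
proof (cases "x = 0")
  case True
  have "((\<lambda>h. (max 0 h)\<^sup>2 / h) \<longlongrightarrow> 0) (at (0::real))"
  proof (rule Lim_null_comparison[where g="\<lambda>h. \<bar>h\<bar>"])
    show "eventually (\<lambda>h::real. norm ((max 0 h)\<^sup>2 / h) \<le> \<bar>h\<bar>) (at 0)"
      by (rule always_eventually) (auto simp: max_def power2_eq_square)
  qed (auto intro!: tendsto_eq_intros)
  then show ?thesis using True by (simp add: DERIV_def)
next
  case False
  show ?thesis
  proof (cases "x > 0")
    case True
    have "((\<lambda>x::real. x\<^sup>2) has_real_derivative 2 * x) (at x)"
      by (auto intro!: derivative_eq_intros)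
    then have "((\<lambda>x::real. (max 0 x)\<^sup>2) has_real_derivative 2 * x) (at x)"
      by (rule has_field_derivative_transform_within_open[where S="{0<..}"]) (use True in auto)
    then show ?thesis using True by simp
  next
    case neg: False
    have "((\<lambda>x::real. 0) has_real_derivative 0) (at x)" by simp
    then have "((\<lambda>x::real. (max 0 x)\<^sup>2) has_real_derivative 0) (at x)"
      by (rule has_field_derivative_transform_within_open[where S="{..<0}"]) (use False neg in auto)
    then show ?thesis using neg by simp
  qed
qed

text \<open>Up to the factor \<open>- 4\<close> the map is the gradient of the bump
  \<open>(max 0 (1 - (norm x)\<^sup>2))\<^sup>2\<close>. Inside the unit ball the difference splits
  algebraically; across the sphere the factor \<open>1 - (norm x)\<^sup>2\<close> is small enough by
  itself.\<close>

lemma truncated_identity_Lipschitz: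
  fixes x y :: "'a::euclidean_space"
  shows "norm (max 0 (1 - (norm x)\<^sup>2) *\<^sub>R x - max 0 (1 - (norm y)\<^sup>2) *\<^sub>R y) \<le> 4 * norm (x - y)"
proof -
  have small: "norm (max 0 (1 - (norm x)\<^sup>2) *\<^sub>R x) \<le> 2 * norm (x - y)" if "norm x \<le> 1" "1 \<le> norm y" for x y :: 'a
  proof -
    have "0 \<le> 1 - (norm x)\<^sup>2" using that(1) by (simp add: power_le_one)
    then have "norm (max 0 (1 - (norm x)\<^sup>2) *\<^sub>R x) = (1 - (norm x)\<^sup>2) * norm x"
      by simp
    also have "\<dots> = (1 - norm x) * ((1 + norm x) * norm x)"
      by (simp add: power2_eq_square algebra_simps)
    also have "\<dots> \<le> (1 - norm x) * (2 * 1)"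
      using that(1) by (intro mult_left_mono mult_mono) auto
    also have "1 - norm x \<le> norm (x - y)"
      using that(2) norm_triangle_ineq2[of y x] by (simp add: norm_minus_commute)
    finally show ?thesis by simp
  qed
  have zero: "max 0 (1 - (norm x)\<^sup>2) *\<^sub>R x = 0" if "1 \<le> norm x" for x :: 'a
    using that by (simp add: one_le_power)
  consider "norm x \<le> 1" "norm y \<le> 1" | "norm x \<le> 1" "1 \<le> norm y" | "1 \<le> norm x" "norm y \<le> 1" | "1 \<le> norm x" "1 \<le> norm y"
    by linarith
  then show ?thesis
  proof cases
    case 1
    have "0 \<le> 1 - (norm x)\<^sup>2" "0 \<le> 1 - (norm y)\<^sup>2" using 1 by (auto simp: power_le_one)
    then have "max 0 (1 - (norm x)\<^sup>2) *\<^sub>R x - max 0 (1 - (norm y)\<^sup>2) *\<^sub>R y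
      = (1 - (norm x)\<^sup>2) *\<^sub>R (x - y) - ((norm x + norm y) * (norm x - norm y)) *\<^sub>R y"
      by (simp add: power2_eq_square algebra_simps)
    also have "norm \<dots> \<le> norm ((1 - (norm x)\<^sup>2) *\<^sub>R (x - y)) + norm (((norm x + norm y) * (norm x - norm y)) *\<^sub>R y)"
      by (rule norm_triangle_ineq4)
    also have "norm ((1 - (norm x)\<^sup>2) *\<^sub>R (x - y)) \<le> 1 * norm (x - y)"
      using 1 unfolding norm_scaleR by (intro mult_right_mono) (auto simp: power_le_one)
    also have "norm (((norm x + norm y) * (norm x - norm y)) *\<^sub>R y) = (norm x + norm y) * \<bar>norm x - norm y\<bar> * norm y"
      by (simp add: abs_mult)
    also have "\<dots> \<le> 2 * norm (x - y) * 1"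
      using 1 by (intro mult_mono norm_triangle_ineq3) auto
    finally show ?thesis using norm_ge_zero[of "x - y"] by linarith
  next
    case 2
    then have "norm (max 0 (1 - (norm x)\<^sup>2) *\<^sub>R x - max 0 (1 - (norm y)\<^sup>2) *\<^sub>R y) \<le> 2 * norm (x - y)"
      using small[of x y] zero[of y] by simp
    then show ?thesis using norm_ge_zero[of "x - y"] by linarith
  next
    case 3
    then have "norm (max 0 (1 - (norm x)\<^sup>2) *\<^sub>R x - max 0 (1 - (norm y)\<^sup>2) *\<^sub>R y) \<le> 2 * norm (x - y)"
      using small[of y x] zero[of x] by (simp add: norm_minus_commute)
    then show ?thesis using norm_ge_zero[of "x - y"] by linarith
  next
    case 4
    then show ?thesis using zero by simp
  qed
qed

text \<open>A kernel with Lipschitz gradient, which suffices because test functions are only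
  required to be continuously differentiable. The Lipschitz bound replaces differentiation under the
  integral, and the symmetry allows integration of \<open>\<phi> (x - y)\<close> in either
  variable.\<close>

definition mollifier :: "real \<Rightarrow> ('a::euclidean_space \<Rightarrow> real) \<Rightarrow> ('a \<Rightarrow> 'a) \<Rightarrow> bool" where
  "mollifier e \<phi> \<phi>' \<longleftrightarrow>
     (\<forall>x. 0 \<le> \<phi> x) \<and> (\<forall>x. \<phi> (- x) = \<phi> x) \<and> (\<forall>x. e \<le> norm x \<longrightarrow> \<phi> x = 0 \<and> \<phi>' x = 0) \<and>
     (\<integral>\<^sup>+x. ennreal (\<phi> x) \<partial>lborel) = 1 \<and>
     (\<forall>x. GDERIV \<phi> x :> \<phi>' x) \<and> (\<exists>L\<ge>0. \<forall>x y. norm (\<phi>' x - \<phi>' y) \<le> L * norm (x - y))"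

lemma GDERIV_bump:
  "GDERIV (\<lambda>x::'a::euclidean_space. (max 0 (1 - (norm x)\<^sup>2))\<^sup>2) x :> (- 4) *\<^sub>R (max 0 (1 - (norm x)\<^sup>2) *\<^sub>R x)"
proof -
  have "((\<lambda>x::'a. 1 - x \<bullet> x) has_derivative (\<lambda>h. h \<bullet> ((- 2) *\<^sub>R x))) (at x)"
    by (auto intro!: derivative_eq_intros simp: inner_commute)
  then have "GDERIV (\<lambda>x::'a. 1 - (norm x)\<^sup>2) x :> (- 2) *\<^sub>R x"
    by (simp add: gderiv_def power2_norm_eq_inner)
  from GDERIV_DERIV_compose[OF this DERIV_positive_part_square]
  show ?thesis by (simp add: mult.commute)
qed

lemma exists_mollifier:
  assumes "0 < e"
  obtains \<phi> :: "'a::euclidean_space \<Rightarrow> real" and \<phi>' where "mollifier e \<phi> \<phi>'"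
proof -
  let ?b = "\<lambda>x::'a. (max 0 (1 - (norm x)\<^sup>2))\<^sup>2"
  let ?b' = "\<lambda>x::'a. (- 4) *\<^sub>R (max 0 (1 - (norm x)\<^sup>2) *\<^sub>R x)"
  define I where "I = (\<integral>\<^sup>+x. ennreal (?b ((1 / e) *\<^sub>R x)) \<partial>(lborel :: 'a measure))"
  have zero: "?b x = 0" "?b' x = 0" if "1 \<le> norm x" for x
    using that by (auto simp: one_le_power)
  have out: "1 \<le> norm ((1 / e) *\<^sub>R x)" if "e \<le> norm x" for x :: 'a
    using that assms by simp
  have "I \<le> (\<integral>\<^sup>+x. indicator (ball 0 e) x \<partial>(lborel :: 'a measure))"
    unfolding I_def
  proof (intro nn_integral_mono)
    fix x :: 'a
    show "ennreal (?b ((1 / e) *\<^sub>R x)) \<le> indicator (ball 0 e) x"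
    proof (cases "norm x < e")
      case True
      have "?b ((1 / e) *\<^sub>R x) \<le> 1"
        by (intro power_le_one) auto
      then show ?thesis using True by simp
    next
      case False
      then show ?thesis using zero(1)[OF out[of x]] by simp
    qed
  qed
  also have "\<dots> < \<infinity>" using assms by (simp add: emeasure_ball)
  finally have I_fin: "I < \<infinity>" .
  have "I \<noteq> 0"
  proof
    assume "I = 0"
    then have "AE x in lborel. ?b ((1 / e) *\<^sub>R (x::'a)) = 0"
      unfolding I_def by (subst (asm) nn_integral_0_iff_AE) (auto simp: ennreal_eq_0_iff)
    then have "AE x in lborel. x \<notin> ball (0::'a) e"
    proof eventually_elim
      case (elim x)
      show ?case
      proof
        assume "x \<in> ball 0 e"
        then have "norm ((1 / e) *\<^sub>R x) < 1" using assms by simp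
        then have "(norm ((1 / e) *\<^sub>R x))\<^sup>2 < 1" by (simp add: abs_square_less_1)
        then show False using elim by simp
      qed
    qed
    then have "emeasure lborel (ball (0::'a) e) = 0"
      by (subst (asm) AE_iff_measurable[OF _ refl]) (auto simp: ball_def)
    then show False using assms by (simp add: emeasure_ball)
  qed
  define Z where "Z = enn2real I"
  have Z: "I = ennreal Z" "0 < Z"
    using I_fin \<open>I \<noteq> 0\<close> by (auto simp: Z_def enn2real_positive_iff zero_less_iff_neq_zero)
  define \<phi> where "\<phi> x = ?b ((1 / e) *\<^sub>R x) / Z" for x :: 'a
  define \<phi>' where "\<phi>' x = (1 / (e * Z)) *\<^sub>R ?b' ((1 / e) *\<^sub>R x)" for x :: 'a
  have "mollifier e \<phi> \<phi>'"
    unfolding mollifier_def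
  proof (intro conjI allI impI)
    show "0 \<le> \<phi> x" "\<phi> (- x) = \<phi> x" for x using Z by (auto simp: \<phi>_def)
    show "\<phi> x = 0" "\<phi>' x = 0" if "e \<le> norm x" for x
      using zero[OF out[OF that]] by (auto simp: \<phi>_def \<phi>'_def)
    have "(\<integral>\<^sup>+x. ennreal (\<phi> x) \<partial>lborel) = (\<integral>\<^sup>+x. ennreal (1 / Z) * ennreal (?b ((1 / e) *\<^sub>R x)) \<partial>(lborel :: 'a measure))"
      using Z by (intro nn_integral_cong) (simp add: \<phi>_def flip: ennreal_mult')
    also have "\<dots> = ennreal (1 / Z) * I"
      unfolding I_def by (rule nn_integral_cmult) measurable
    also have "\<dots> = 1" using Z by (simp flip: ennreal_mult')
    finally show "(\<integral>\<^sup>+x. ennreal (\<phi> x) \<partial>lborel) = 1" .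
    show "GDERIV \<phi> x :> \<phi>' x" for x
    proof -
      have "((\<lambda>x. ?b ((1 / e) *\<^sub>R x)) has_derivative (\<lambda>h. ((1 / e) *\<^sub>R h) \<bullet> ?b' ((1 / e) *\<^sub>R x))) (at x)"
        by (rule has_derivative_compose[where f="\<lambda>x. (1 / e) *\<^sub>R x", OF _ GDERIV_bump[unfolded gderiv_def]])
          (auto intro!: derivative_eq_intros)
      then have "((\<lambda>x. (1 / Z) * ?b ((1 / e) *\<^sub>R x)) has_derivative (\<lambda>h. (1 / Z) * (((1 / e) *\<^sub>R h) \<bullet> ?b' ((1 / e) *\<^sub>R x)))) (at x)"
        by (rule has_derivative_mult_right)
      then show ?thesis unfolding gderiv_def \<phi>_def \<phi>'_def by (simp add: mult_ac)
    qed
    show "\<exists>L\<ge>0. \<forall>x y. norm (\<phi>' x - \<phi>' y) \<le> L * norm (x - y)"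
    proof (intro exI conjI allI)
      fix x y
      let ?t = "\<lambda>x::'a. max 0 (1 - (norm x)\<^sup>2) *\<^sub>R x"
      have "\<phi>' x - \<phi>' y = (- 4 / (e * Z)) *\<^sub>R (?t ((1 / e) *\<^sub>R x) - ?t ((1 / e) *\<^sub>R y))"
        by (simp add: \<phi>'_def scaleR_diff_right)
      then have "norm (\<phi>' x - \<phi>' y) = (4 / (e * Z)) * norm (?t ((1 / e) *\<^sub>R x) - ?t ((1 / e) *\<^sub>R y))"
        using assms Z(2) by (simp only: norm_scaleR) simp
      also have "\<dots> \<le> (4 / (e * Z)) * (4 * norm ((1 / e) *\<^sub>R x - (1 / e) *\<^sub>R y))"
        using assms Z(2) by (intro mult_left_mono truncated_identity_Lipschitz) auto
      also have "norm ((1 / e) *\<^sub>R x - (1 / e) *\<^sub>R y) = (1 / e) * norm (x - y)"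
        using assms unfolding scaleR_diff_right [symmetric] by simp
      finally show "norm (\<phi>' x - \<phi>' y) \<le> ((4 / (e * Z)) * (4 * (1 / e))) * norm (x - y)"
        by (simp add: mult_ac)
    qed (use assms Z in simp)
  qed
  then show thesis by (rule that)
qed

text \<open>Mean value inequality for \<open>\<phi>\<close> minus its linear part at
  \<open>a\<close>, whose gradient is at most \<open>L * norm h\<close> on the segment.\<close>

lemma GDERIV_quadratic_remainder:
  fixes \<phi> :: "'a::euclidean_space \<Rightarrow> real"
  assumes "\<And>x. GDERIV \<phi> x :> \<phi>' x" and L: "\<And>x y. norm (\<phi>' x - \<phi>' y) \<le> L * norm (x - y)" "0 \<le> L"
  shows "\<bar>\<phi> (a + h) - \<phi> a - h \<bullet> \<phi>' a\<bar> \<le> L * (norm h)\<^sup>2"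
proof -
  have "norm ((\<phi> (a + h) - (a + h) \<bullet> \<phi>' a) - (\<phi> a - a \<bullet> \<phi>' a)) \<le> (L * norm h) * norm ((a + h) - a)"
  proof (rule differentiable_bound[where S="closed_segment a (a + h)"])
    show "((\<lambda>x. \<phi> x - x \<bullet> \<phi>' a) has_derivative (\<lambda>k. k \<bullet> \<phi>' x - k \<bullet> \<phi>' a)) (at x within closed_segment a (a + h))" for x
      using assms(1)[of x] unfolding gderiv_def
      by (auto intro!: derivative_eq_intros intro: has_derivative_at_withinI)
    show "onorm (\<lambda>k. k \<bullet> \<phi>' x - k \<bullet> \<phi>' a) \<le> L * norm h" if "x \<in> closed_segment a (a + h)" for x
    proof (rule onorm_le)
      fix k :: 'a
      have "norm (x - a) \<le> norm h" using segment_bound(1)[OF that] by simp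
      then have "norm (\<phi>' x - \<phi>' a) \<le> L * norm h" using L(1)[of x a] mult_left_mono[OF _ L(2)] order_trans by blast
      then have "norm k * norm (\<phi>' x - \<phi>' a) \<le> norm k * (L * norm h)" by (rule mult_left_mono) simp
      moreover have "norm (k \<bullet> \<phi>' x - k \<bullet> \<phi>' a) \<le> norm k * norm (\<phi>' x - \<phi>' a)"
        unfolding inner_diff_right [symmetric] real_norm_def by (rule Cauchy_Schwarz_ineq2)
      ultimately show "norm (k \<bullet> \<phi>' x - k \<bullet> \<phi>' a) \<le> L * norm h * norm k"
        by (simp add: mult.commute)
    qed
  qed auto
  then show ?thesis by (simp add: inner_add_left power2_eq_square algebra_simps)
qed

text \<open>Kernel and gradient both vanish at a point of norm \<open>e\<close>, and the support
  lies within distance \<open>2 * e\<close> of it.\<close>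

lemma mollifier_bounded:
  fixes \<phi> :: "'a::euclidean_space \<Rightarrow> real"
  assumes m: "mollifier e \<phi> \<phi>'" and "0 < e"
  obtains M where "\<And>x. norm (\<phi>' x) \<le> M" "\<And>x. \<bar>\<phi> x\<bar> \<le> M" "0 \<le> M"
proof -
  obtain L where L: "\<And>x y. norm (\<phi>' x - \<phi>' y) \<le> L * norm (x - y)" "0 \<le> L"
    using m unfolding mollifier_def by auto
  define b :: 'a where "b = (SOME b. b \<in> Basis)"
  have b: "norm b = 1" unfolding b_def by (rule norm_Basis[OF SOME_Basis])
  define p where "p = e *\<^sub>R b"
  have p: "norm p = e" "\<phi>' p = 0" "\<phi> p = 0" using m b \<open>0 < e\<close> by (auto simp: p_def mollifier_def)
  have 1: "norm (\<phi>' x) \<le> L * (2 * e)" for x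
  proof (cases "e \<le> norm x")
    case True
    then show ?thesis using m \<open>0 < e\<close> L(2) by (auto simp: mollifier_def)
  next
    case False
    have "norm (\<phi>' x) \<le> L * norm (x - p)" using L(1)[of x p] p by simp
    also have "\<dots> \<le> L * (2 * e)"
      using norm_triangle_ineq4[of x p] p False L(2) by (intro mult_left_mono) auto
    finally show ?thesis .
  qed
  have 2: "\<bar>\<phi> x\<bar> \<le> L * (2 * e)\<^sup>2" for x
  proof (cases "e \<le> norm x")
    case True
    then show ?thesis using m L(2) by (auto simp: mollifier_def)
  next
    case False
    have "\<bar>\<phi> (p + (x - p)) - \<phi> p - (x - p) \<bullet> \<phi>' p\<bar> \<le> L * (norm (x - p))\<^sup>2"
      by (rule GDERIV_quadratic_remainder) (use m L in \<open>auto simp: mollifier_def\<close>)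
    also have "\<dots> \<le> L * (2 * e)\<^sup>2"
      using norm_triangle_ineq4[of x p] p False L(2) by (intro mult_left_mono power_mono) auto
    finally show ?thesis using p by simp
  qed
  show thesis
    by (rule that[of "L * (2 * e) + L * (2 * e)\<^sup>2"]) (use 1 2 L \<open>0 < e\<close> in \<open>auto intro: order_trans[of _ _ "_ + _"] add_increasing add_increasing2\<close>)
qed

lemma mollifier_measurable:
  assumes "mollifier e \<phi> \<phi>'"
  shows "\<phi> \<in> borel_measurable borel" "\<phi>' \<in> borel_measurable borel" "continuous_on UNIV \<phi>'"
proof -
  have "continuous_on UNIV \<phi>"
    by (rule GDERIV_imp_continuous_on[where u'=\<phi>']) (use assms in \<open>simp add: mollifier_def\<close>)
  then show "\<phi> \<in> borel_measurable borel" by (rule borel_measurable_continuous_onI)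
  obtain L where L: "\<And>x y. norm (\<phi>' x - \<phi>' y) \<le> L * norm (x - y)" "0 \<le> L"
    using assms unfolding mollifier_def by auto
  have "L-lipschitz_on UNIV \<phi>'" using L by (auto simp: lipschitz_on_def dist_norm)
  then show "continuous_on UNIV \<phi>'" by (rule lipschitz_on_continuous_on)
  then show "\<phi>' \<in> borel_measurable borel" by (rule borel_measurable_continuous_onI)
qed

lemma ennreal_dense_real:
  assumes "(0 :: ennreal) < c"
  obtains e where "0 < e" "ennreal e < c"
proof -
  obtain b where b: "0 < b" "b < c" using dense[OF assms] by blast
  then have "b < top" using less_le_trans top_greatest by blast
  then obtain e where "b = ennreal e" "0 \<le> e" by (cases b) auto
  with b that[of e] show thesis by (cases "e = 0") auto
qed

lemma norm_integral_le_integral: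
  fixes f :: "'a \<Rightarrow> 'b::{banach, second_countable_topology}"
  assumes "\<And>x. norm (f x) \<le> g x" "integrable M f" "integrable M g"
  shows "norm (integral\<^sup>L M f) \<le> integral\<^sup>L M g"
  using assms by (intro order_trans[OF integral_norm_bound integral_mono]) auto

text \<open>The quadratic remainder of the kernel is uniform in the base point, so integrating it
  against \<open>f\<close> gives a quadratic remainder for the convolution; likewise the Lipschitz
  bound of the gradient is inherited.\<close>

lemma GDERIV_convolution:
  fixes f :: "'a::euclidean_space \<Rightarrow> real"
  assumes m: "mollifier e \<phi> \<phi>'" and "0 < e" and f: "integrable lborel f"
  defines "U \<equiv> \<lambda>x. LINT y|lborel. \<phi> (x - y) * f y" and "U' \<equiv> \<lambda>x. LINT y|lborel. f y *\<^sub>R \<phi>' (x - y)"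
  shows "GDERIV U x :> U' x" "continuous_on UNIV U'"
proof -
  note [measurable] = mollifier_measurable(1,2)[OF m]
  have [measurable]: "f \<in> borel_measurable borel" using f by auto
  obtain M where M: "\<And>x. norm (\<phi>' x) \<le> M" "\<And>x. \<bar>\<phi> x\<bar> \<le> M" "0 \<le> M"
    using mollifier_bounded[OF m \<open>0 < e\<close>] by blast
  obtain L where L: "\<And>x y. norm (\<phi>' x - \<phi>' y) \<le> L * norm (x - y)" "0 \<le> L"
    using m unfolding mollifier_def by auto
  have D: "GDERIV \<phi> x :> \<phi>' x" for x using m by (simp add: mollifier_def)
  have nf: "integrable lborel (\<lambda>y. c * \<bar>f y\<bar>)" for c using f by auto
  have int: "integrable lborel (\<lambda>y. \<phi> (x - y) * f y)" for x
    by (rule Bochner_Integration.integrable_bound[OF nf[of M]]) (use M in \<open>auto simp: abs_mult intro!: mult_mono\<close>)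
  have int': "integrable lborel (\<lambda>y. f y *\<^sub>R \<phi>' (x - y))" for x
    by (rule Bochner_Integration.integrable_bound[OF nf[of M]]) (use M in \<open>auto simp: mult.commute[of M] intro!: mult_left_mono\<close>)
  define C where "C = L * (LINT y|lborel. \<bar>f y\<bar>)"
  have C: "0 \<le> C" using L by (auto simp: C_def intro!: mult_nonneg_nonneg)
  have rem: "norm (U (x + h) - U x - h \<bullet> U' x) \<le> C * (norm h)\<^sup>2" for x h
  proof -
    have "U (x + h) - U x - h \<bullet> U' x
       = (LINT y|lborel. \<phi> (x + h - y) * f y) - (LINT y|lborel. \<phi> (x - y) * f y) - (LINT y|lborel. h \<bullet> (f y *\<^sub>R \<phi>' (x - y)))"
      unfolding U_def U'_def by (simp add: int' del: inner_scaleR_right)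
    also have "\<dots> = (LINT y|lborel. \<phi> (x + h - y) * f y - \<phi> (x - y) * f y - h \<bullet> (f y *\<^sub>R \<phi>' (x - y)))"
      by (simp add: int int' del: inner_scaleR_right)
    also have "norm \<dots> \<le> (LINT y|lborel. (L * (norm h)\<^sup>2) * \<bar>f y\<bar>)"
    proof (rule norm_integral_le_integral)
      fix y
      have "\<phi> (x + h - y) * f y - \<phi> (x - y) * f y - h \<bullet> (f y *\<^sub>R \<phi>' (x - y))
        = (\<phi> ((x - y) + h) - \<phi> (x - y) - h \<bullet> \<phi>' (x - y)) * f y"
        by (simp add: algebra_simps)
      also have "norm \<dots> = \<bar>\<phi> ((x - y) + h) - \<phi> (x - y) - h \<bullet> \<phi>' (x - y)\<bar> * \<bar>f y\<bar>"
        by (simp add: abs_mult)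
      also have "\<dots> \<le> (L * (norm h)\<^sup>2) * \<bar>f y\<bar>"
        by (intro mult_right_mono GDERIV_quadratic_remainder[OF D L]) auto
      finally show "norm (\<phi> (x + h - y) * f y - \<phi> (x - y) * f y - h \<bullet> (f y *\<^sub>R \<phi>' (x - y))) \<le> (L * (norm h)\<^sup>2) * \<bar>f y\<bar>" .
    qed (auto intro!: Bochner_Integration.integrable_diff int nf integrable_inner_right int' integrable_abs f simp del: inner_scaleR_right)
    also have "\<dots> = C * (norm h)\<^sup>2" by (simp add: C_def)
    finally show ?thesis .
  qed
  show "GDERIV U x :> U' x" unfolding gderiv_def
  proof (rule has_derivativeI_sandwich[where e=1 and H="\<lambda>y. C * norm (y - x)"])
    show "((\<lambda>y. C * norm (y - x)) \<longlongrightarrow> 0) (at x)"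
      by (auto intro!: tendsto_eq_intros)
    show "norm (U y - U x - (y - x) \<bullet> U' x) / norm (y - x) \<le> C * norm (y - x)" if "y \<noteq> x" for y
      using rem[of x "y - x"] that by (simp add: field_simps power2_eq_square)
  qed (auto intro: bounded_linear_inner_left)
  have "C-lipschitz_on UNIV U'"
  proof (rule lipschitz_onI)
    fix x x'
    have "U' x - U' x' = (LINT y|lborel. f y *\<^sub>R \<phi>' (x - y) - f y *\<^sub>R \<phi>' (x' - y))"
      unfolding U'_def by (simp add: int')
    also have "norm \<dots> \<le> (LINT y|lborel. (L * norm (x - x')) * \<bar>f y\<bar>)"
    proof (rule norm_integral_le_integral)
      fix y
      have "norm (f y *\<^sub>R \<phi>' (x - y) - f y *\<^sub>R \<phi>' (x' - y)) = \<bar>f y\<bar> * norm (\<phi>' (x - y) - \<phi>' (x' - y))"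
        by (simp flip: scaleR_diff_right)
      also have "\<dots> \<le> \<bar>f y\<bar> * (L * norm (x - x'))"
        using L(1)[of "x - y" "x' - y"] by (intro mult_left_mono) auto
      finally show "norm (f y *\<^sub>R \<phi>' (x - y) - f y *\<^sub>R \<phi>' (x' - y)) \<le> (L * norm (x - x')) * \<bar>f y\<bar>"
        by (simp add: mult.commute)
    qed (auto intro!: Bochner_Integration.integrable_diff nf int' integrable_abs f)
    also have "\<dots> = C * norm (x - x')" by (simp add: C_def)
    finally show "dist (U' x) (U' x') \<le> C * dist x x'" by (simp add: dist_norm)
  qed fact
  then show "continuous_on UNIV U'" by (rule lipschitz_on_continuous_on)
qed

lemma nn_integral_mollifier_shift:
  fixes \<phi> :: "'a::euclidean_space \<Rightarrow> real"
  assumes m: "mollifier e \<phi> \<phi>'"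
  shows "(\<integral>\<^sup>+x. ennreal (\<phi> (x - y)) \<partial>lborel) = 1" "(\<integral>\<^sup>+y. ennreal (\<phi> (x - y)) \<partial>lborel) = 1"
proof -
  note [measurable] = mollifier_measurable(1,2)[OF m]
  have 1: "(\<integral>\<^sup>+x. ennreal (\<phi> (x - y)) \<partial>lborel) = 1" for y
    using nn_integral_lborel_affine[of "\<lambda>x. ennreal (\<phi> x)" 1 "- y"] m by (simp add: mollifier_def)
  then show "(\<integral>\<^sup>+x. ennreal (\<phi> (x - y)) \<partial>lborel) = 1" .
  have "\<phi> (x - y) = \<phi> (y - x)" for y
    using m unfolding mollifier_def by (metis minus_diff_eq)
  then show "(\<integral>\<^sup>+y. ennreal (\<phi> (x - y)) \<partial>lborel) = 1" using 1[of x] by simp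
qed

text \<open>Comparison with a continuous \<open>h\<close> close to \<open>F\<close> in the mean on
  the ball enlarged by one, the largest mollifier radius. Its uniform continuity there supplies the
  third of the three errors, each at most a quarter of \<open>e\<close>.\<close>

lemma mollified_tendsto_L1:
  fixes F :: "'a::euclidean_space \<Rightarrow> 'b::euclidean_space"
  assumes F: "integrable lborel F" and m: "\<And>n. mollifier (1 / real (Suc n)) (\<phi> n) (\<phi>' n)" and "0 < \<rho>"
  shows "(\<lambda>n. \<integral>\<^sup>+x\<in>ball z \<rho>. ennreal (norm ((LINT y|lborel. \<phi> n (x - y) *\<^sub>R F y) - F x)) \<partial>lborel) \<longlonglongrightarrow> 0"
proof (rule order_tendstoI)
  fix a :: ennreal assume "0 < a"
  obtain e where e: "0 < e" "ennreal e < a" using ennreal_dense_real[OF \<open>0 < a\<close>] by blast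
  have [measurable]: "F \<in> borel_measurable borel" using F by auto
  define C where "C = cball z (\<rho> + 1)"
  define v where "v = ball_vol TYPE('a) \<rho>"
  have v: "0 \<le> v" using \<open>0 < \<rho>\<close> by (simp add: v_def)
  define \<kappa> where "\<kappa> = e / (4 * (v + 1))"
  have \<kappa>: "0 < \<kappa>" "\<kappa> * v \<le> e / 4" using e v by (auto simp: \<kappa>_def field_simps)
  have "(\<integral>\<^sup>+x\<in>cball z (\<rho> + 1). ennreal (norm (F x)) \<partial>lborel) \<le> (\<integral>\<^sup>+x. ennreal (norm (F x)) \<partial>lborel)"
    by (intro nn_integral_mono) (auto simp: indicator_def)
  also have "\<dots> < \<infinity>" using F by (simp add: integrable_iff_bounded)
  finally obtain h where h: "continuous_on UNIV h" "(\<integral>\<^sup>+x\<in>C. ennreal (norm (F x - h x)) \<partial>lborel) < ennreal (e / 4)"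
    using continuous_approximation_L1[of F z "\<rho> + 1" "e / 4"] e(1) unfolding C_def by auto
  have [measurable]: "h \<in> borel_measurable borel" using h(1) by (rule borel_measurable_continuous_onI)
  have C_sets [measurable]: "C \<in> sets borel" by (simp add: C_def)
  have "uniformly_continuous_on C h"
    unfolding C_def by (intro compact_uniformly_continuous continuous_on_subset[OF h(1)]) auto
  then obtain d where d: "0 < d" "\<And>x y. x \<in> C \<Longrightarrow> y \<in> C \<Longrightarrow> dist y x < d \<Longrightarrow> dist (h y) (h x) < \<kappa>"
    using \<kappa>(1) unfolding uniformly_continuous_on_def by metis
  obtain n0 :: nat where n0: "1 / real (Suc n0) < d" using d(1) nat_approx_posE by blast
  show "eventually (\<lambda>n. (\<integral>\<^sup>+x\<in>ball z \<rho>. ennreal (norm ((LINT y|lborel. \<phi> n (x - y) *\<^sub>R F y) - F x)) \<partial>lborel) < a) sequentially"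
    using eventually_ge_at_top[of n0]
  proof eventually_elim
    case (elim n)
    note [measurable] = mollifier_measurable(1)[OF m[of n]]
    have nd: "1 / real (Suc n) < d"
      using n0 elim by (meson frac_le le_less_trans of_nat_0_less_iff of_nat_mono Suc_le_mono zero_le_one zero_less_Suc order_refl)
    have \<phi>0: "0 \<le> \<phi> n x" for x using m[of n] by (simp add: mollifier_def)
    obtain M where M: "\<And>x. \<bar>\<phi> n x\<bar> \<le> M" "0 \<le> M"
      by (rule mollifier_bounded[OF m[of n]]) auto
    let ?A = "\<lambda>x. \<integral>\<^sup>+y. ennreal (\<phi> n (x - y)) * (ennreal (norm (F y - h y)) * indicator C y) \<partial>lborel"
    \<comment> \<open>The mollified function is compared with the constant \<open>h x\<close>, which
      equals its own mollification. The term \<open>?A\<close> is a mollification of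
      \<open>norm (F y - h y)\<close> on \<open>C\<close> and has the same integral by Tonelli's
      theorem.\<close>
    have pt: "ennreal (norm ((LINT y|lborel. \<phi> n (x - y) *\<^sub>R F y) - F x)) \<le> ?A x + ennreal \<kappa> + ennreal (norm (F x - h x))"
      if x: "x \<in> ball z \<rho>" for x
    proof -
      have i1: "integrable lborel (\<lambda>y. \<phi> n (x - y) *\<^sub>R F y)"
        by (rule Bochner_Integration.integrable_bound[of _ "\<lambda>y. M * norm (F y)"]) (use M F in \<open>auto intro!: mult_mono\<close>)
      have hb: "has_bochner_integral lborel (\<lambda>y. \<phi> n (x - y)) 1"
        by (rule has_bochner_integral_nn_integral) (use \<phi>0 nn_integral_mollifier_shift(2)[OF m[of n]] in auto)
      then have i2: "integrable lborel (\<lambda>y. \<phi> n (x - y) *\<^sub>R h x)" and eq: "(LINT y|lborel. \<phi> n (x - y) *\<^sub>R h x) = h x"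
        by (auto simp: has_bochner_integral_iff)
      have "norm ((LINT y|lborel. \<phi> n (x - y) *\<^sub>R F y) - F x) \<le> norm ((LINT y|lborel. \<phi> n (x - y) *\<^sub>R F y) - h x) + norm (F x - h x)"
        using norm_triangle_ineq4[of "(LINT y|lborel. \<phi> n (x - y) *\<^sub>R F y) - h x" "F x - h x"] by simp
      then have "ennreal (norm ((LINT y|lborel. \<phi> n (x - y) *\<^sub>R F y) - F x))
          \<le> ennreal (norm ((LINT y|lborel. \<phi> n (x - y) *\<^sub>R F y) - h x)) + ennreal (norm (F x - h x))"
        by (simp add: ennreal_leI flip: ennreal_plus)
      also have "(LINT y|lborel. \<phi> n (x - y) *\<^sub>R F y) - h x = (LINT y|lborel. \<phi> n (x - y) *\<^sub>R F y - \<phi> n (x - y) *\<^sub>R h x)"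
        using i1 i2 eq by simp
      also have "ennreal (norm \<dots>) \<le> (\<integral>\<^sup>+y. ennreal (norm (\<phi> n (x - y) *\<^sub>R F y - \<phi> n (x - y) *\<^sub>R h x)) \<partial>lborel)"
        by (intro integral_norm_bound_ennreal Bochner_Integration.integrable_diff i1 i2)
      also have "\<dots> \<le> (\<integral>\<^sup>+y. ennreal (\<phi> n (x - y)) * (ennreal (norm (F y - h y)) * indicator C y) + ennreal (\<phi> n (x - y)) * ennreal \<kappa> \<partial>lborel)"
      proof (intro nn_integral_mono)
        fix y
        show "ennreal (norm (\<phi> n (x - y) *\<^sub>R F y - \<phi> n (x - y) *\<^sub>R h x))
          \<le> ennreal (\<phi> n (x - y)) * (ennreal (norm (F y - h y)) * indicator C y) + ennreal (\<phi> n (x - y)) * ennreal \<kappa>"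
        proof (cases "1 / real (Suc n) \<le> norm (x - y)")
          case True
          then have "\<phi> n (x - y) = 0" using m[of n] by (simp add: mollifier_def)
          then show ?thesis by simp
        next
          case False
          then have xy: "dist x y < 1 / real (Suc n)" by (simp add: dist_norm)
          moreover have "1 / real (Suc n) \<le> 1" by simp
          ultimately have xy1: "dist x y \<le> 1" by linarith
          have yC: "y \<in> C" using x xy1 dist_triangle[of z y x] by (simp add: C_def)
          have "x \<in> C" using x by (simp add: C_def)
          then have "dist (h y) (h x) < \<kappa>" using d(2)[of x y] yC xy nd by (simp add: dist_commute)
          then have "norm (F y - h x) \<le> norm (F y - h y) + \<kappa>"
            using norm_triangle_ineq[of "F y - h y" "h y - h x"] by (simp add: dist_norm)
          then have "\<phi> n (x - y) * norm (F y - h x) \<le> \<phi> n (x - y) * (norm (F y - h y) + \<kappa>)"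
            by (rule mult_left_mono) (rule \<phi>0)
          moreover have "norm (\<phi> n (x - y) *\<^sub>R F y - \<phi> n (x - y) *\<^sub>R h x) = \<phi> n (x - y) * norm (F y - h x)"
            using \<phi>0 by (simp flip: scaleR_diff_right)
          ultimately show ?thesis using yC \<phi>0 \<kappa>(1)
            by (simp add: ennreal_leI distrib_left flip: ennreal_mult' ennreal_plus)
        qed
      qed
      also have "\<dots> = ?A x + (\<integral>\<^sup>+y. ennreal (\<phi> n (x - y)) \<partial>lborel) * ennreal \<kappa>"
        by (simp add: nn_integral_add nn_integral_multc)
      also have "(\<integral>\<^sup>+y. ennreal (\<phi> n (x - y)) \<partial>lborel) = 1" by (rule nn_integral_mollifier_shift[OF m])
      finally show ?thesis by (simp add: add_right_mono)
    qed
    have "(\<integral>\<^sup>+x\<in>ball z \<rho>. ennreal (norm ((LINT y|lborel. \<phi> n (x - y) *\<^sub>R F y) - F x)) \<partial>lborel)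
       \<le> (\<integral>\<^sup>+x. ?A x + (ennreal \<kappa> * indicator (ball z \<rho>) x + ennreal (norm (F x - h x)) * indicator C x) \<partial>lborel)"
    proof (intro nn_integral_mono)
      fix x
      show "ennreal (norm ((LINT y|lborel. \<phi> n (x - y) *\<^sub>R F y) - F x)) * indicator (ball z \<rho>) x
         \<le> ?A x + (ennreal \<kappa> * indicator (ball z \<rho>) x + ennreal (norm (F x - h x)) * indicator C x)"
        using pt[of x] by (cases "x \<in> ball z \<rho>") (auto simp: C_def add.assoc)
    qed
    also have "\<dots> = (\<integral>\<^sup>+x. ?A x \<partial>lborel) + (ennreal \<kappa> * ennreal v + (\<integral>\<^sup>+x\<in>C. ennreal (norm (F x - h x)) \<partial>lborel))"
      using \<open>0 < \<rho>\<close> by (simp add: nn_integral_add nn_integral_cmult_indicator emeasure_ball v_def)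
    also have "(\<integral>\<^sup>+x. ?A x \<partial>lborel) = (\<integral>\<^sup>+y. \<integral>\<^sup>+x. ennreal (\<phi> n (x - y)) * (ennreal (norm (F y - h y)) * indicator C y) \<partial>lborel \<partial>lborel)"
      by (rule lborel_pair.Fubini') measurable
    also have "\<dots> = (\<integral>\<^sup>+y\<in>C. ennreal (norm (F y - h y)) \<partial>lborel)"
      by (intro nn_integral_cong) (simp add: nn_integral_multc nn_integral_mollifier_shift[OF m])
    also have "\<dots> + (ennreal \<kappa> * ennreal v + (\<integral>\<^sup>+x\<in>C. ennreal (norm (F x - h x)) \<partial>lborel))
        \<le> ennreal (e / 4) + (ennreal (e / 4) + ennreal (e / 4))"
      using h(2) \<kappa> v by (intro add_mono) (auto simp: ennreal_leI simp flip: ennreal_mult')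
    also have "\<dots> \<le> ennreal e" using e by (simp flip: ennreal_plus)
    finally show ?case using e(2) by (rule le_less_trans)
  qed
qed auto

section \<open>Passage to weak gradients\<close>

text \<open>Mollification of \<open>f\<close> cut off to the ball enlarged by one. The cutoff makes
  the convolution global and is invisible from the original ball, where the gradient of the
  mollification is the mollification of \<open>g\<close>.\<close>

lemma weak_gradient_approximation:
  fixes f :: "'a::euclidean_space \<Rightarrow> real" and g :: "'a \<Rightarrow> 'a"
  assumes [measurable]: "f \<in> borel_measurable borel" "g \<in> borel_measurable borel"
    and fi: "\<And>R. set_integrable lborel (ball z R) f" and gi: "\<And>R. set_integrable lborel (ball z R) g"
    and test: "\<And>\<phi> \<phi>'. (\<And>x. GDERIV \<phi> x :> \<phi>' x) \<Longrightarrow> continuous_on UNIV \<phi>' \<Longrightarrow> compact (closure {x. \<phi> x \<noteq> 0}) \<Longrightarrow>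
        (LINT x|lborel. f x *\<^sub>R \<phi>' x) = - (LINT x|lborel. \<phi> x *\<^sub>R g x)"
    and "0 < \<rho>"
  obtains U :: "nat \<Rightarrow> 'a \<Rightarrow> real" and U' where "\<And>n x. GDERIV (U n) x :> U' n x" "\<And>n. continuous_on UNIV (U' n)"
    "(\<lambda>n. \<integral>\<^sup>+x\<in>ball z \<rho>. ennreal \<bar>U n x - f x\<bar> \<partial>lborel) \<longlonglongrightarrow> 0"
    "(\<lambda>n. \<integral>\<^sup>+x\<in>ball z \<rho>. ennreal (norm (U' n x - g x)) \<partial>lborel) \<longlonglongrightarrow> 0"
    "AE x in lborel. x \<in> ball z \<rho> \<longrightarrow> (\<lambda>n. U n x) \<longlonglongrightarrow> f x"
    "AE x in lborel. x \<in> ball z \<rho> \<longrightarrow> (\<lambda>n. U' n x) \<longlonglongrightarrow> g x"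
proof -
  define f1 where "f1 x = indicator (ball z (\<rho> + 1)) x *\<^sub>R f x" for x
  define g1 where "g1 x = indicator (ball z (\<rho> + 1)) x *\<^sub>R g x" for x
  have f1: "integrable lborel f1" and g1: "integrable lborel g1"
    using fi[of "\<rho> + 1"] gi[of "\<rho> + 1"] by (simp_all add: set_integrable_def f1_def[abs_def] g1_def[abs_def])
  have "\<exists>\<phi>. \<exists>\<phi>'. mollifier (1 / real (Suc n)) (\<phi> :: 'a \<Rightarrow> real) \<phi>'" for n
    by (rule exists_mollifier[of "1 / real (Suc n)"]) auto
  then obtain \<phi> \<phi>' where m: "\<And>n. mollifier (1 / real (Suc n)) (\<phi> n :: 'a \<Rightarrow> real) (\<phi>' n)"
    by metis
  define U where "U n x = (LINT y|lborel. \<phi> n (x - y) * f1 y)" for n x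
  define U' where "U' n x = (LINT y|lborel. f1 y *\<^sub>R \<phi>' n (x - y))" for n x
  have dU: "GDERIV (U n) x :> U' n x" "continuous_on UNIV (U' n)" for n x
    using GDERIV_convolution[OF m _ f1, of n] by (auto simp: U_def[abs_def] U'_def[abs_def])
  have [measurable]: "U n \<in> borel_measurable borel" "U' n \<in> borel_measurable borel" for n
  proof -
    show "U' n \<in> borel_measurable borel" using dU(2) by (rule borel_measurable_continuous_onI)
    have "continuous_on UNIV (U n)"
      using dU(1) by (rule GDERIV_imp_continuous_on)
    then show "U n \<in> borel_measurable borel" by (rule borel_measurable_continuous_onI)
  qed
  have far: "\<phi> n (x - y) = 0 \<and> \<phi>' n (x - y) = 0" if "x \<in> ball z \<rho>" "y \<notin> ball z (\<rho> + 1)" for n x y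
  proof -
    have "dist x y \<ge> 1" using that dist_triangle[of z y x] by simp
    moreover have "1 / real (Suc n) \<le> 1" by simp
    ultimately have "1 / real (Suc n) \<le> norm (x - y)" unfolding dist_norm by linarith
    then show ?thesis using m[of n] by (simp add: mollifier_def)
  qed
  \<comment> \<open>For fixed \<open>x\<close> the function
    \<open>y \<mapsto> \<phi> n (x - y)\<close> is a test function; the sign from differentiating in
    \<open>y\<close> cancels the sign in the definition of the weak gradient.\<close>
  have U'_eq: "U' n x = (LINT y|lborel. \<phi> n (x - y) *\<^sub>R g1 y)" if x: "x \<in> ball z \<rho>" for n x
  proof -
    have T: "(LINT y|lborel. f y *\<^sub>R (- \<phi>' n (x - y))) = - (LINT y|lborel. \<phi> n (x - y) *\<^sub>R g y)"
    proof (rule test)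
      show "GDERIV (\<lambda>y. \<phi> n (x - y)) y :> - \<phi>' n (x - y)" for y
      proof -
        have "GDERIV (\<phi> n) (x - y) :> \<phi>' n (x - y)" using m[of n] by (simp add: mollifier_def)
        then have "((\<lambda>y. \<phi> n (x - y)) has_derivative (\<lambda>h. (- h) \<bullet> \<phi>' n (x - y))) (at y)"
          unfolding gderiv_def
          by (rule has_derivative_compose[rotated]) (auto intro!: derivative_eq_intros)
        then show ?thesis by (simp add: gderiv_def)
      qed
      show "continuous_on UNIV (\<lambda>y. - \<phi>' n (x - y))"
        by (intro continuous_intros continuous_on_compose2[OF mollifier_measurable(3)[OF m[of n]]]) auto
      have "{y. \<phi> n (x - y) \<noteq> 0} \<subseteq> cball x 1"
      proof
        fix y assume "y \<in> {y. \<phi> n (x - y) \<noteq> 0}"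
        then have "norm (x - y) < 1 / real (Suc n)"
          using m[of n] unfolding mollifier_def by (metis mem_Collect_eq not_le)
        moreover have "1 / real (Suc n) \<le> 1" by simp
        ultimately have "norm (x - y) \<le> 1" by linarith
        then show "y \<in> cball x 1" by (simp add: dist_norm)
      qed
      then show "compact (closure {y. \<phi> n (x - y) \<noteq> 0})"
        by (meson bounded_cball bounded_subset compact_closure)
    qed
    have e: "f y *\<^sub>R (- \<phi>' n (x - y)) = - (f1 y *\<^sub>R \<phi>' n (x - y))" "\<phi> n (x - y) *\<^sub>R g y = \<phi> n (x - y) *\<^sub>R g1 y" for y
      using far[OF x, of y n] by (auto simp: f1_def g1_def indicator_def)
    show ?thesis using T unfolding e U'_def by simp
  qed
  have L1: "(\<lambda>n. \<integral>\<^sup>+x\<in>ball z \<rho>. ennreal \<bar>U n x - f x\<bar> \<partial>lborel) \<longlonglongrightarrow> 0"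
  proof -
    have "(\<integral>\<^sup>+x\<in>ball z \<rho>. ennreal \<bar>U n x - f x\<bar> \<partial>lborel) = (\<integral>\<^sup>+x\<in>ball z \<rho>. ennreal (norm ((LINT y|lborel. \<phi> n (x - y) *\<^sub>R f1 y) - f1 x)) \<partial>lborel)" for n
      by (intro nn_integral_cong) (auto simp: indicator_def U_def f1_def)
    then show ?thesis using mollified_tendsto_L1[OF f1 m \<open>0 < \<rho>\<close>] by simp
  qed
  have L2: "(\<lambda>n. \<integral>\<^sup>+x\<in>ball z \<rho>. ennreal (norm (U' n x - g x)) \<partial>lborel) \<longlonglongrightarrow> 0"
  proof -
    have "(\<integral>\<^sup>+x\<in>ball z \<rho>. ennreal (norm (U' n x - g x)) \<partial>lborel) = (\<integral>\<^sup>+x\<in>ball z \<rho>. ennreal (norm ((LINT y|lborel. \<phi> n (x - y) *\<^sub>R g1 y) - g1 x)) \<partial>lborel)" for n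
      by (intro nn_integral_cong) (auto simp: U'_eq g1_def indicator_def)
    then show ?thesis using mollified_tendsto_L1[OF g1 m \<open>0 < \<rho>\<close>] by simp
  qed
  \<comment> \<open>The two errors are added so that a single subsequence serves both pointwise
    limits.\<close>
  let ?a = "\<lambda>n x. ennreal \<bar>U n x - f x\<bar> * indicator (ball z \<rho>) x + ennreal (norm (U' n x - g x)) * indicator (ball z \<rho>) x"
  have a_meas: "?a n \<in> borel_measurable lborel" for n by measurable
  have a_lim: "(\<lambda>n. \<integral>\<^sup>+x. ?a n x \<partial>lborel) \<longlonglongrightarrow> 0"
    using tendsto_add[OF L1 L2] by (simp add: nn_integral_add)
  obtain r where r: "strict_mono r" "AE x in lborel. (\<lambda>n. ?a (r n) x) \<longlonglongrightarrow> 0"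
    by (rule nn_integral_tendsto_zero_AE_subseq[OF a_meas a_lim])
  have lim0: "(\<lambda>n. b n) \<longlonglongrightarrow> 0" if "(\<lambda>n. ennreal (b n) + c n) \<longlonglongrightarrow> 0" "\<And>n. 0 \<le> b n" for b :: "nat \<Rightarrow> real" and c
  proof -
    have "(\<lambda>n. ennreal (b n)) \<longlonglongrightarrow> ennreal 0"
      by (rule tendsto_sandwich[OF _ _ tendsto_const, where h="\<lambda>n. ennreal (b n) + c n"]) (use that in auto)
    then show ?thesis using that(2) by (subst (asm) tendsto_ennreal_iff) auto
  qed
  have 1: "AE x in lborel. x \<in> ball z \<rho> \<longrightarrow> (\<lambda>n. U (r n) x) \<longlonglongrightarrow> f x"
    using r(2)
  proof eventually_elim
    case (elim x)
    show ?case
    proof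
      assume "x \<in> ball z \<rho>"
      then have "(\<lambda>n. ennreal \<bar>U (r n) x - f x\<bar> + ennreal (norm (U' (r n) x - g x))) \<longlonglongrightarrow> 0"
        using elim by (simp only: indicator_simps mult_1_right)
      from lim0[OF this] have "(\<lambda>n. \<bar>U (r n) x - f x\<bar>) \<longlonglongrightarrow> 0" by simp
      then show "(\<lambda>n. U (r n) x) \<longlonglongrightarrow> f x" by (rule LIM_zero_cancel[OF tendsto_rabs_zero_cancel])
    qed
  qed
  have 2: "AE x in lborel. x \<in> ball z \<rho> \<longrightarrow> (\<lambda>n. U' (r n) x) \<longlonglongrightarrow> g x"
    using r(2)
  proof eventually_elim
    case (elim x)
    show ?case
    proof
      assume "x \<in> ball z \<rho>"
      then have "(\<lambda>n. ennreal (norm (U' (r n) x - g x)) + ennreal \<bar>U (r n) x - f x\<bar>) \<longlonglongrightarrow> 0"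
        using elim by (simp only: indicator_simps mult_1_right add.commute[of "ennreal (norm _)"])
      from lim0[OF this] have "(\<lambda>n. norm (U' (r n) x - g x)) \<longlonglongrightarrow> 0" by simp
      then show "(\<lambda>n. U' (r n) x) \<longlonglongrightarrow> g x" by (rule LIM_zero_cancel[OF tendsto_norm_zero_cancel])
    qed
  qed
  show thesis
    using that[of "\<lambda>n. U (r n)" "\<lambda>n. U' (r n)", OF dU(1) dU(2) _ _ 1 2]
      LIMSEQ_subseq_LIMSEQ[OF L1 r(1)] LIMSEQ_subseq_LIMSEQ[OF L2 r(1)] by (simp add: o_def)
qed

text \<open>Tonelli's theorem gives the term of index \<open>k\<close> the total mass of
  \<open>h\<close> times a multiple of \<open>\<rho> / 2 ^ k\<close>, and the scales sum to twice
  the first. The result serves both to make the potential of vanishing errors vanish and to obtain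
  the unweighted mean deviation.\<close>

lemma nn_integral_potential_L1:
  fixes h :: "'a::euclidean_space \<Rightarrow> real"
  assumes [measurable]: "h \<in> borel_measurable borel" and "0 < \<rho>"
  shows "(\<integral>\<^sup>+x. (\<Sum>k. potential_term z \<rho> h k x) \<partial>lborel)
     = ennreal (2 * \<rho> * (unit_ball_vol DIM('a) * 2 ^ DIM('a))) * (\<integral>\<^sup>+y\<in>ball z \<rho>. ennreal (h y) \<partial>lborel)"
proof -
  define n where "n = DIM('a)"
  define \<omega> where "\<omega> = unit_ball_vol (real n)"
  have \<omega>: "0 < \<omega>" by (simp add: \<omega>_def)
  define J where "J = (\<integral>\<^sup>+y\<in>ball z \<rho>. ennreal (h y) \<partial>lborel)"
  have tm: "(\<integral>\<^sup>+x. potential_term z \<rho> h k x \<partial>lborel) = ennreal (\<rho> * (\<omega> * 2 ^ n) * (1 / 2) ^ k) * J" for k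
  proof -
    define s where "s = \<rho> / 2 ^ k"
    have s: "0 < s" using assms by (simp add: s_def)
    have "(\<integral>\<^sup>+x. potential_term z \<rho> h k x \<partial>lborel) = ennreal (s / s ^ n) *
       (\<integral>\<^sup>+x. (\<integral>\<^sup>+y. ennreal (h y) * indicator (ball z \<rho>) y * indicator (ball x (2 * s)) y \<partial>lborel) \<partial>lborel)"
      unfolding potential_term_def s_def [symmetric] n_def [symmetric] by (rule nn_integral_cmult) measurable
    also have "(\<integral>\<^sup>+x. (\<integral>\<^sup>+y. ennreal (h y) * indicator (ball z \<rho>) y * indicator (ball x (2 * s)) y \<partial>lborel) \<partial>lborel)
      = (\<integral>\<^sup>+y. (\<integral>\<^sup>+x. ennreal (h y) * indicator (ball z \<rho>) y * indicator (ball x (2 * s)) y \<partial>lborel) \<partial>lborel)"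
      by (rule lborel_pair.Fubini') measurable
    also have "\<dots> = (\<integral>\<^sup>+y. ennreal (h y) * indicator (ball z \<rho>) y * ennreal (\<omega> * (2 * s) ^ n) \<partial>lborel)"
    proof (intro nn_integral_cong)
      fix y :: 'a
      have "(\<integral>\<^sup>+x. ennreal (h y) * indicator (ball z \<rho>) y * indicator (ball x (2 * s)) y \<partial>lborel)
         = (\<integral>\<^sup>+x. ennreal (h y) * indicator (ball z \<rho>) y * indicator (ball y (2 * s)) x \<partial>lborel)"
        by (intro nn_integral_cong) (auto simp: indicator_def dist_commute)
      also have "\<dots> = ennreal (h y) * indicator (ball z \<rho>) y * emeasure lborel (ball y (2 * s))"
        by (rule nn_integral_cmult_indicator) simp
      finally show "(\<integral>\<^sup>+x. ennreal (h y) * indicator (ball z \<rho>) y * indicator (ball x (2 * s)) y \<partial>lborel)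
         = ennreal (h y) * indicator (ball z \<rho>) y * ennreal (\<omega> * (2 * s) ^ n)"
        using s by (simp add: emeasure_ball \<omega>_def n_def)
    qed
    also have "\<dots> = J * ennreal (\<omega> * (2 * s) ^ n)"
      unfolding J_def by (rule nn_integral_multc) measurable
    also have "ennreal (s / s ^ n) * (J * ennreal (\<omega> * (2 * s) ^ n)) = (ennreal (s / s ^ n) * ennreal (\<omega> * (2 * s) ^ n)) * J"
      by (simp add: mult_ac)
    also have "ennreal (s / s ^ n) * ennreal (\<omega> * (2 * s) ^ n) = ennreal (\<rho> * (\<omega> * 2 ^ n) * (1 / 2) ^ k)"
    proof -
      have "ennreal (s / s ^ n) * ennreal (\<omega> * (2 * s) ^ n) = ennreal (s / s ^ n * (\<omega> * (2 * s) ^ n))"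
        using s \<omega> by (simp flip: ennreal_mult')
      also have "s / s ^ n * (\<omega> * (2 * s) ^ n) = s * (\<omega> * 2 ^ n)"
        using s by (simp add: power_mult_distrib)
      also have "\<dots> = \<rho> * (\<omega> * 2 ^ n) * (1 / 2) ^ k"
        by (simp add: s_def power_one_over)
      finally show ?thesis .
    qed
    finally show ?thesis .
  qed
  have "(\<integral>\<^sup>+x. (\<Sum>k. potential_term z \<rho> h k x) \<partial>lborel) = (\<Sum>k. \<integral>\<^sup>+x. potential_term z \<rho> h k x \<partial>lborel)"
    by (rule nn_integral_suminf) measurable
  also have "\<dots> = (\<Sum>k. ennreal (\<rho> * (\<omega> * 2 ^ n) * (1 / 2) ^ k)) * J"
    unfolding tm by simp
  also have "(\<Sum>k. ennreal (\<rho> * (\<omega> * 2 ^ n) * (1 / 2) ^ k)) = ennreal (\<Sum>k. \<rho> * (\<omega> * 2 ^ n) * (1 / 2) ^ k)"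
    using \<open>0 < \<rho>\<close> \<omega> by (intro suminf_ennreal2 summable_mult) auto
  also have "(\<Sum>k. \<rho> * (\<omega> * 2 ^ n) * (1 / 2) ^ k) = \<rho> * (\<omega> * 2 ^ n) * (\<Sum>k. (1 / 2) ^ k)"
    by (rule suminf_mult) auto
  also have "(\<Sum>k. (1 / 2 :: real) ^ k) = 2" by (simp add: suminf_geometric)
  finally show ?thesis by (simp add: J_def \<omega>_def n_def mult_ac)
qed

lemma potential_mono_add:
  fixes h1 h2 h3 :: "'a::euclidean_space \<Rightarrow> real"
  assumes [measurable]: "h2 \<in> borel_measurable borel" "h3 \<in> borel_measurable borel"
    and "\<And>x. h1 x \<le> h2 x + h3 x" and "\<And>x. 0 \<le> h2 x" "\<And>x. 0 \<le> h3 x"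
  shows "(\<Sum>k. potential_term z \<rho> h1 k x) \<le> (\<Sum>k. potential_term z \<rho> h2 k x) + (\<Sum>k. potential_term z \<rho> h3 k x)"
proof -
  have "potential_term z \<rho> h1 k x \<le> potential_term z \<rho> h2 k x + potential_term z \<rho> h3 k x" for k
  proof -
    have "(\<integral>\<^sup>+y. ennreal (h1 y) * indicator (ball z \<rho>) y * indicator (ball x (2 * (\<rho> / 2 ^ k))) y \<partial>lborel)
       \<le> (\<integral>\<^sup>+y. ennreal (h2 y) * indicator (ball z \<rho>) y * indicator (ball x (2 * (\<rho> / 2 ^ k))) y
            + ennreal (h3 y) * indicator (ball z \<rho>) y * indicator (ball x (2 * (\<rho> / 2 ^ k))) y \<partial>lborel)"
      using assms(3-5) by (intro nn_integral_mono) (auto simp: indicator_def ennreal_leI simp flip: ennreal_plus)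
    also have "\<dots> = (\<integral>\<^sup>+y. ennreal (h2 y) * indicator (ball z \<rho>) y * indicator (ball x (2 * (\<rho> / 2 ^ k))) y \<partial>lborel)
       + (\<integral>\<^sup>+y. ennreal (h3 y) * indicator (ball z \<rho>) y * indicator (ball x (2 * (\<rho> / 2 ^ k))) y \<partial>lborel)"
      by (rule nn_integral_add) measurable
    finally show ?thesis unfolding potential_term_def distrib_left [symmetric] by (rule mult_left_mono) simp
  qed
  then have "(\<Sum>k. potential_term z \<rho> h1 k x) \<le> (\<Sum>k. potential_term z \<rho> h2 k x + potential_term z \<rho> h3 k x)"
    by (intro suminf_le) auto
  also have "\<dots> = (\<Sum>k. potential_term z \<rho> h2 k x) + (\<Sum>k. potential_term z \<rho> h3 k x)"
    by (intro suminf_add[symmetric]) auto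
  finally show ?thesis .
qed

lemma nn_integral_affine_bound_tendsto_zero:
  fixes M :: real
  assumes "(\<lambda>n. a n) \<longlonglongrightarrow> (0::ennreal)" "(\<lambda>n. b n) \<longlonglongrightarrow> (0::ennreal)" and "\<And>n. c n \<le> ennreal M * a n + b n"
  shows "c \<longlonglongrightarrow> 0"
proof (rule tendsto_sandwich[OF _ _ tendsto_const])
  have "(\<lambda>n. ennreal M * a n + b n) \<longlonglongrightarrow> ennreal M * 0 + 0"
    by (intro tendsto_add ennreal_tendsto_cmult assms) auto
  then show "(\<lambda>n. ennreal M * a n + b n) \<longlonglongrightarrow> 0" by simp
qed (use assms(3) in auto)

text \<open>The bound for continuously differentiable functions is applied to \<open>\<tau>\<close>
  composed with the approximations and passed to the limit. This yields truncations of
  \<open>f\<close> directly, without a chain rule for weak gradients.\<close>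

lemma weak_gradient_potential_bound:
  fixes f :: "'a::euclidean_space \<Rightarrow> real" and g :: "'a \<Rightarrow> 'a"
  assumes [measurable]: "f \<in> borel_measurable borel" "g \<in> borel_measurable borel"
    and fi: "\<And>R. set_integrable lborel (ball z R) f" and gi: "\<And>R. set_integrable lborel (ball z R) g"
    and test: "\<And>\<phi> \<phi>'. (\<And>x. GDERIV \<phi> x :> \<phi>' x) \<Longrightarrow> continuous_on UNIV \<phi>' \<Longrightarrow> compact (closure {x. \<phi> x \<noteq> 0}) \<Longrightarrow>
        (LINT x|lborel. f x *\<^sub>R \<phi>' x) = - (LINT x|lborel. \<phi> x *\<^sub>R g x)"
    and "0 < \<rho>"
    and \<tau>: "\<And>t. (\<tau> has_real_derivative \<tau>' t) (at t)" "continuous_on UNIV \<tau>'" and M: "\<And>t. \<bar>\<tau>' t\<bar> \<le> M"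
  shows "AE x in lborel. x \<in> ball z \<rho> \<longrightarrow>
     ennreal \<bar>\<tau> (f x) - (LINT y:ball z \<rho>|lborel. \<tau> (f y)) / ball_vol TYPE('a) \<rho>\<bar>
       \<le> ennreal (2 ^ DIM('a) / unit_ball_vol DIM('a)) * (\<Sum>k. potential_term z \<rho> (\<lambda>y. \<bar>\<tau>' (f y)\<bar> * norm (g y)) k x)"
proof -
  let ?B = "ball z \<rho>" and ?c = "2 ^ DIM('a) / unit_ball_vol DIM('a)" and ?v = "ball_vol TYPE('a) \<rho>"
  obtain U U' where U: "\<And>n x. GDERIV (U n) x :> U' n x" "\<And>n. continuous_on UNIV (U' n)"
    "(\<lambda>n. \<integral>\<^sup>+x\<in>?B. ennreal \<bar>U n x - f x\<bar> \<partial>lborel) \<longlonglongrightarrow> 0"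
    "(\<lambda>n. \<integral>\<^sup>+x\<in>?B. ennreal (norm (U' n x - g x)) \<partial>lborel) \<longlonglongrightarrow> 0"
    "AE x in lborel. x \<in> ?B \<longrightarrow> (\<lambda>n. U n x) \<longlonglongrightarrow> f x"
    "AE x in lborel. x \<in> ?B \<longrightarrow> (\<lambda>n. U' n x) \<longlonglongrightarrow> g x"
    using weak_gradient_approximation[OF assms(1-6)] by blast
  have M0: "0 \<le> M" using M[of 0] by linarith
  have v: "0 < ?v" using \<open>0 < \<rho>\<close> by simp
  have cU: "continuous_on UNIV (U n)" for n
    using U(1) by (rule GDERIV_imp_continuous_on)
  have c\<tau>: "continuous_on UNIV \<tau>" using \<tau>(1) by (intro DERIV_continuous_on) (auto intro: has_field_derivative_at_within)
  have [measurable]: "\<tau> \<in> borel_measurable borel" "\<tau>' \<in> borel_measurable borel"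
    using c\<tau> \<tau>(2) by (auto intro: borel_measurable_continuous_onI)
  have [measurable]: "U n \<in> borel_measurable borel" "U' n \<in> borel_measurable borel" for n
    using cU U(2) by (auto intro: borel_measurable_continuous_onI)
  have Lip: "\<bar>\<tau> s - \<tau> t\<bar> \<le> M * \<bar>s - t\<bar>" for s t
    using field_differentiable_bound[of UNIV \<tau> \<tau>' M s t] \<tau>(1) M by auto
  have cTU: "continuous_on UNIV (\<lambda>x. \<tau> (U n x))" for n
    by (rule continuous_on_compose2[OF c\<tau> cU]) auto
  have \<tau>fi: "set_integrable lborel ?B (\<lambda>x. \<tau> (f x))"
    unfolding set_integrable_def
  proof (rule Bochner_Integration.integrable_bound)
    show "integrable lborel (\<lambda>x. indicator ?B x *\<^sub>R \<bar>\<tau> 0\<bar> + M * \<bar>indicator ?B x *\<^sub>R f x\<bar>)"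
      using fi[of \<rho>] \<open>0 < \<rho>\<close> unfolding set_integrable_def
      by (intro Bochner_Integration.integrable_add integrable_scaleR_left integrable_real_indicator integrable_mult_right integrable_abs)
        (auto simp: emeasure_ball)
    have "\<bar>\<tau> (f x)\<bar> \<le> \<bar>\<tau> 0\<bar> + M * \<bar>f x\<bar>" for x
      using Lip[of "f x" 0] by simp
    then show "AE x in lborel. norm (indicator ?B x *\<^sub>R \<tau> (f x)) \<le> norm (indicator ?B x *\<^sub>R \<bar>\<tau> 0\<bar> + M * \<bar>indicator ?B x *\<^sub>R f x\<bar>)"
      using M0 by (auto simp: indicator_def)
    show "(\<lambda>x. indicator ?B x *\<^sub>R \<tau> (f x)) \<in> borel_measurable lborel"
      by (intro borel_measurable_scaleR borel_measurable_indicator) auto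
  qed
  define av where "av = (LINT y:?B|lborel. \<tau> (f y)) / ?v"
  define avn where "avn n = (LINT y:?B|lborel. \<tau> (U n y)) / ?v" for n
  have avlim: "avn \<longlonglongrightarrow> av"
    unfolding av_def avn_def[abs_def] set_lebesgue_integral_def
  proof (intro tendsto_divide tendsto_const tendsto_L1_int)
    show "integrable lborel (\<lambda>x. indicator ?B x *\<^sub>R \<tau> (U n x))" for n
      using integrable_on_ball_continuous[OF cTU] by (simp add: set_integrable_def)
    show "integrable lborel (\<lambda>x. indicator ?B x *\<^sub>R \<tau> (f x))" using \<tau>fi by (simp add: set_integrable_def)
    show "(\<lambda>n. \<integral>\<^sup>+x. ennreal (norm (indicator ?B x *\<^sub>R \<tau> (U n x) - indicator ?B x *\<^sub>R \<tau> (f x))) \<partial>lborel) \<longlonglongrightarrow> 0"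
    proof (rule nn_integral_affine_bound_tendsto_zero[OF U(3), of "\<lambda>_. 0" _ M])
      fix n
      have "(\<integral>\<^sup>+x. ennreal (norm (indicator ?B x *\<^sub>R \<tau> (U n x) - indicator ?B x *\<^sub>R \<tau> (f x))) \<partial>lborel)
        \<le> (\<integral>\<^sup>+x. ennreal M * (ennreal \<bar>U n x - f x\<bar> * indicator ?B x) \<partial>lborel)"
        using M0 Lip by (intro nn_integral_mono) (auto simp: indicator_def ennreal_leI simp flip: ennreal_mult')
      also have "\<dots> = ennreal M * (\<integral>\<^sup>+x\<in>?B. ennreal \<bar>U n x - f x\<bar> \<partial>lborel)"
        by (rule nn_integral_cmult) measurable
      finally show "(\<integral>\<^sup>+x. ennreal (norm (indicator ?B x *\<^sub>R \<tau> (U n x) - indicator ?B x *\<^sub>R \<tau> (f x))) \<partial>lborel)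
         \<le> ennreal M * (\<integral>\<^sup>+x\<in>?B. ennreal \<bar>U n x - f x\<bar> \<partial>lborel) + 0" by simp
    qed simp
  qed (use \<open>0 < \<rho>\<close> in auto)
  define h where "h y = \<bar>\<tau>' (f y)\<bar> * norm (g y)" for y
  \<comment> \<open>Bounds the excess of the approximating gradient over \<open>h\<close>. The first
    summand tends to zero in the mean, the second by dominated convergence with majorant
    \<open>2 * M * norm (g y)\<close>, where only pointwise convergence of
    \<open>\<tau>' (U n y)\<close> is available.\<close>
  define d where "d n y = M * norm (U' n y - g y) + \<bar>\<tau>' (U n y) - \<tau>' (f y)\<bar> * norm (g y)" for n y
  have [measurable]: "h \<in> borel_measurable borel" "d n \<in> borel_measurable borel" for n
    unfolding h_def[abs_def] d_def[abs_def] by measurable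
  have d0: "0 \<le> d n y" "0 \<le> h y" for n y using M0 by (auto simp: d_def h_def)
  have hd: "norm (\<tau>' (U n y) *\<^sub>R U' n y) \<le> h y + d n y" for n y
  proof -
    have "norm (\<tau>' (U n y) *\<^sub>R U' n y) \<le> \<bar>\<tau>' (U n y)\<bar> * (norm (g y) + norm (U' n y - g y))"
      unfolding norm_scaleR using norm_triangle_ineq[of "g y" "U' n y - g y"] by (intro mult_left_mono) auto
    also have "\<dots> = \<bar>\<tau>' (U n y)\<bar> * norm (g y) + \<bar>\<tau>' (U n y)\<bar> * norm (U' n y - g y)"
      by (simp add: distrib_left)
    also have "\<dots> \<le> (\<bar>\<tau>' (f y)\<bar> + \<bar>\<tau>' (U n y) - \<tau>' (f y)\<bar>) * norm (g y) + M * norm (U' n y - g y)"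
      using M by (intro add_mono mult_right_mono) auto
    finally show ?thesis by (simp add: h_def d_def algebra_simps)
  qed
  have dlim: "(\<lambda>n. \<integral>\<^sup>+y\<in>?B. ennreal (d n y) \<partial>lborel) \<longlonglongrightarrow> 0"
  proof (rule nn_integral_affine_bound_tendsto_zero[OF U(4)])
    have "(\<lambda>n. \<integral>\<^sup>+y. ennreal (\<bar>\<tau>' (U n y) - \<tau>' (f y)\<bar> * norm (g y)) * indicator ?B y \<partial>lborel) \<longlonglongrightarrow> (\<integral>\<^sup>+y. 0 \<partial>(lborel :: 'a measure))"
    proof (rule nn_integral_dominated_convergence[where w="\<lambda>y. ennreal (2 * M) * (ennreal (norm (g y)) * indicator ?B y)"])
      have "(\<integral>\<^sup>+y. ennreal (norm (g y)) * indicator ?B y \<partial>lborel) = (\<integral>\<^sup>+y. ennreal (norm (indicator ?B y *\<^sub>R g y)) \<partial>lborel)"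
        by (intro nn_integral_cong) (auto simp: indicator_def)
      also have "\<dots> < \<infinity>" using gi[of \<rho>] by (simp add: set_integrable_def integrable_iff_bounded)
      finally show "(\<integral>\<^sup>+y. ennreal (2 * M) * (ennreal (norm (g y)) * indicator ?B y) \<partial>lborel) < \<infinity>"
        by (simp add: nn_integral_cmult ennreal_mult_less_top)
      show "AE y in lborel. ennreal (\<bar>\<tau>' (U j y) - \<tau>' (f y)\<bar> * norm (g y)) * indicator ?B y \<le> ennreal (2 * M) * (ennreal (norm (g y)) * indicator ?B y)" for j
      proof (rule AE_I2)
        fix y
        have "\<bar>\<tau>' (U j y) - \<tau>' (f y)\<bar> \<le> 2 * M" using M[of "U j y"] M[of "f y"] by linarith
        then have "\<bar>\<tau>' (U j y) - \<tau>' (f y)\<bar> * norm (g y) \<le> 2 * M * norm (g y)" by (rule mult_right_mono) simp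
        then show "ennreal (\<bar>\<tau>' (U j y) - \<tau>' (f y)\<bar> * norm (g y)) * indicator ?B y \<le> ennreal (2 * M) * (ennreal (norm (g y)) * indicator ?B y)"
          using M0 by (auto simp: indicator_def ennreal_leI simp flip: ennreal_mult')
      qed
      show "AE y in lborel. (\<lambda>n. ennreal (\<bar>\<tau>' (U n y) - \<tau>' (f y)\<bar> * norm (g y)) * indicator ?B y) \<longlonglongrightarrow> 0"
        using U(5)
      proof eventually_elim
        case (elim y)
        show ?case
        proof (cases "y \<in> ?B")
          case True
          then have lim: "(\<lambda>n. U n y) \<longlonglongrightarrow> f y" using elim by simp
          have "isCont \<tau>' (f y)" using \<tau>(2) by (simp add: continuous_on_eq_continuous_at)
          from isCont_tendsto_compose[OF this lim]
          have "(\<lambda>n. \<bar>\<tau>' (U n y) - \<tau>' (f y)\<bar> * norm (g y)) \<longlonglongrightarrow> \<bar>\<tau>' (f y) - \<tau>' (f y)\<bar> * norm (g y)"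
            by (intro tendsto_intros)
          then have "(\<lambda>n. ennreal (\<bar>\<tau>' (U n y) - \<tau>' (f y)\<bar> * norm (g y))) \<longlonglongrightarrow> ennreal 0"
            by (intro tendsto_ennrealI) simp
          then show ?thesis using True by simp
        qed simp
      qed
    qed measurable
    then show "(\<lambda>n. \<integral>\<^sup>+y. ennreal (\<bar>\<tau>' (U n y) - \<tau>' (f y)\<bar> * norm (g y)) * indicator ?B y \<partial>lborel) \<longlonglongrightarrow> 0" by simp
    show "(\<integral>\<^sup>+y\<in>?B. ennreal (d n y) \<partial>lborel) \<le> ennreal M * (\<integral>\<^sup>+x\<in>?B. ennreal (norm (U' n x - g x)) \<partial>lborel)
        + (\<integral>\<^sup>+y. ennreal (\<bar>\<tau>' (U n y) - \<tau>' (f y)\<bar> * norm (g y)) * indicator ?B y \<partial>lborel)" for n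
    proof -
      have "(\<integral>\<^sup>+y\<in>?B. ennreal (d n y) \<partial>lborel) = (\<integral>\<^sup>+y. ennreal M * (ennreal (norm (U' n y - g y)) * indicator ?B y)
         + ennreal (\<bar>\<tau>' (U n y) - \<tau>' (f y)\<bar> * norm (g y)) * indicator ?B y \<partial>lborel)"
        using M0 by (intro nn_integral_cong) (auto simp: d_def indicator_def simp flip: ennreal_mult' ennreal_plus)
      also have "\<dots> = ennreal M * (\<integral>\<^sup>+x\<in>?B. ennreal (norm (U' n x - g x)) \<partial>lborel)
        + (\<integral>\<^sup>+y. ennreal (\<bar>\<tau>' (U n y) - \<tau>' (f y)\<bar> * norm (g y)) * indicator ?B y \<partial>lborel)"
        by (simp add: nn_integral_add nn_integral_cmult)
      finally show ?thesis by simp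
    qed
  qed
  let ?P = "\<lambda>h x. \<Sum>k. potential_term z \<rho> h k x"
  have P_meas: "?P (d n) \<in> borel_measurable lborel" for n by measurable
  have P_lim: "(\<lambda>n. \<integral>\<^sup>+x. ?P (d n) x \<partial>lborel) \<longlonglongrightarrow> 0"
    unfolding nn_integral_potential_L1[OF \<open>d _ \<in> borel_measurable borel\<close> \<open>0 < \<rho>\<close>]
    by (rule nn_integral_affine_bound_tendsto_zero[OF dlim tendsto_const[of 0], where M="2 * \<rho> * (unit_ball_vol DIM('a) * 2 ^ DIM('a))"]) simp
  obtain r where r: "strict_mono r" "AE x in lborel. (\<lambda>n. ?P (d (r n)) x) \<longlonglongrightarrow> 0"
    by (rule nn_integral_tendsto_zero_AE_subseq[OF P_meas P_lim])
  show ?thesis using r(2) U(5)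
  proof eventually_elim
    case (elim x)
    show ?case
    proof
      assume x: "x \<in> ?B"
      have bd: "ennreal \<bar>\<tau> (U (r n) x) - avn (r n)\<bar> \<le> ennreal ?c * (?P h x + ?P (d (r n)) x)" for n
      proof -
        have "ennreal \<bar>\<tau> (U (r n) x) - avn (r n)\<bar> \<le> ennreal ?c * ?P (\<lambda>y. norm (\<tau>' (U (r n) y) *\<^sub>R U' (r n) y)) x"
          unfolding avn_def
        proof (rule potential_bound_C1[OF _ _ \<open>0 < \<rho>\<close> x])
          show "GDERIV (\<lambda>y. \<tau> (U (r n) y)) y :> \<tau>' (U (r n) y) *\<^sub>R U' (r n) y" for y
            using U(1) \<tau>(1) by (rule GDERIV_DERIV_compose)
          show "continuous_on UNIV (\<lambda>y. \<tau>' (U (r n) y) *\<^sub>R U' (r n) y)"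
            by (intro continuous_intros U(2) continuous_on_compose2[OF \<tau>(2) cU]) auto
        qed
        also have "\<dots> \<le> ennreal ?c * (?P h x + ?P (d (r n)) x)"
          by (intro mult_left_mono potential_mono_add hd d0) auto
        finally show ?thesis .
      qed
      have "isCont \<tau> (f x)" using c\<tau> by (simp add: continuous_on_eq_continuous_at)
      moreover have "(\<lambda>n. U (r n) x) \<longlonglongrightarrow> f x"
        using elim x LIMSEQ_subseq_LIMSEQ[OF _ r(1)] by (auto simp: o_def)
      ultimately have "(\<lambda>n. \<tau> (U (r n) x)) \<longlonglongrightarrow> \<tau> (f x)" by (rule isCont_tendsto_compose)
      moreover have "(\<lambda>n. avn (r n)) \<longlonglongrightarrow> av" using LIMSEQ_subseq_LIMSEQ[OF avlim r(1)] by (simp add: o_def)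
      ultimately have lim1: "(\<lambda>n. ennreal \<bar>\<tau> (U (r n) x) - avn (r n)\<bar>) \<longlonglongrightarrow> ennreal \<bar>\<tau> (f x) - av\<bar>"
        by (intro tendsto_ennrealI tendsto_intros)
      have lim2: "(\<lambda>n. ennreal ?c * (?P h x + ?P (d (r n)) x)) \<longlonglongrightarrow> ennreal ?c * (?P h x + 0)"
        using elim by (intro ennreal_tendsto_cmult tendsto_add tendsto_const) auto
      show "ennreal \<bar>\<tau> (f x) - (LINT y:?B|lborel. \<tau> (f y)) / ?v\<bar> \<le> ennreal ?c * ?P (\<lambda>y. \<bar>\<tau>' (f y)\<bar> * norm (g y)) x"
        using LIMSEQ_le[OF lim1 lim2] bd by (auto simp: av_def h_def[abs_def])
    qed
  qed
qed

section \<open>The critical weighted Sobolev-Poincare inequality\<close>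

text \<open>A second difference of the squared positive part, so that the step is continuously differentiable.\<close>

definition smooth_step :: "real \<Rightarrow> real" where
  "smooth_step x = 2 * ((max 0 x)\<^sup>2 - 2 * (max 0 (x - 1 / 2))\<^sup>2 + (max 0 (x - 1))\<^sup>2)"

definition smooth_step' :: "real \<Rightarrow> real" where
  "smooth_step' x = 4 * (max 0 x - 2 * max 0 (x - 1 / 2) + max 0 (x - 1))"

lemma DERIV_smooth_step: "(smooth_step has_real_derivative smooth_step' x) (at x)"
proof -
  have d: "((\<lambda>x. (max 0 (x - c))\<^sup>2) has_real_derivative 2 * max 0 (x - c)) (at x)" for c :: real
  proof -
    have "((\<lambda>x. x - c) has_real_derivative 1) (at x)" by (auto intro!: derivative_eq_intros)
    from DERIV_chain2[where f="\<lambda>x. (max 0 x)\<^sup>2" and g="\<lambda>x. x - c", OF DERIV_positive_part_square this]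
    show ?thesis by simp
  qed
  have "((\<lambda>x. 2 * ((max 0 (x - 0))\<^sup>2 - 2 * (max 0 (x - 1 / 2))\<^sup>2 + (max 0 (x - 1))\<^sup>2)) has_real_derivative
      2 * (2 * max 0 (x - 0) - 2 * (2 * max 0 (x - 1 / 2)) + 2 * max 0 (x - 1))) (at x)"
    by (intro DERIV_cmult DERIV_add DERIV_diff d)
  then show ?thesis
    unfolding smooth_step_def[abs_def] smooth_step'_def by (simp add: algebra_simps)
qed

lemma continuous_smooth_step': "continuous_on UNIV smooth_step'"
  unfolding smooth_step'_def[abs_def] by (intro continuous_intros)

lemma smooth_step_props:
  "x \<le> 0 \<Longrightarrow> smooth_step x = 0" "1 \<le> x \<Longrightarrow> smooth_step x = 1" "0 \<le> smooth_step x" "smooth_step x \<le> 1"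
proof -
  show 0: "smooth_step x = 0" if "x \<le> 0" for x using that by (simp add: smooth_step_def)
  show 1: "smooth_step x = 1" if "1 \<le> x" for x using that by (simp add: smooth_step_def power2_eq_square algebra_simps)
  have "0 \<le> smooth_step x \<and> smooth_step x \<le> 1"
  proof -
    consider "x \<le> 0" | "0 \<le> x" "x \<le> 1 / 2" | "1 / 2 \<le> x" "x \<le> 1" | "1 \<le> x" by linarith
    then show ?thesis
    proof cases
      case 2
      then have "x\<^sup>2 \<le> (1 / 2)\<^sup>2" by (intro power_mono) auto
      then show ?thesis using 2 by (simp add: smooth_step_def power2_eq_square)
    next
      case 3
      then have "smooth_step x = 1 - 2 * (1 - x)\<^sup>2" by (simp add: smooth_step_def power2_eq_square algebra_simps)
      moreover have "(1 - x)\<^sup>2 \<le> (1 / 2)\<^sup>2" using 3 by (intro power_mono) auto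
      ultimately show ?thesis by (simp add: power2_eq_square)
    qed (simp_all add: 0 1)
  qed
  then show "0 \<le> smooth_step x" "smooth_step x \<le> 1" by auto
qed

lemma smooth_step'_props:
  "x \<le> 0 \<Longrightarrow> smooth_step' x = 0" "1 \<le> x \<Longrightarrow> smooth_step' x = 0" "0 \<le> smooth_step' x" "smooth_step' x \<le> 2"
  by (auto simp: smooth_step'_def max_def)

text \<open>A smoothed form of \<open>min (max (\<bar>t - c\<bar> - L) 0) L\<close>: the two
  summands treat the sides \<open>t > c\<close> and \<open>t < c\<close>, so upper and lower level
  sets are handled together.\<close>

definition shell_cutoff :: "real \<Rightarrow> real \<Rightarrow> real \<Rightarrow> real" where
  "shell_cutoff c L t = L * (smooth_step ((t - c - L) / L) + smooth_step ((c - t - L) / L))"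

definition shell_cutoff' :: "real \<Rightarrow> real \<Rightarrow> real \<Rightarrow> real" where
  "shell_cutoff' c L t = smooth_step' ((t - c - L) / L) - smooth_step' ((c - t - L) / L)"

lemma shell_cutoff_props:
  assumes L: "0 < L"
  shows "(shell_cutoff c L has_real_derivative shell_cutoff' c L t) (at t)"
    and "continuous_on UNIV (shell_cutoff' c L)"
    and "\<bar>shell_cutoff' c L t\<bar> \<le> 2 * indicator {t. L < \<bar>t - c\<bar> \<and> \<bar>t - c\<bar> < 2 * L} t"
    and "0 \<le> shell_cutoff c L t" "shell_cutoff c L t \<le> \<bar>t - c\<bar>"
    and "2 * L \<le> \<bar>t - c\<bar> \<Longrightarrow> shell_cutoff c L t = L"
proof -
  show "(shell_cutoff c L has_real_derivative shell_cutoff' c L t) (at t)"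
    unfolding shell_cutoff_def[abs_def] shell_cutoff'_def using L
    by (auto intro!: derivative_eq_intros DERIV_chain2[OF DERIV_smooth_step] simp: field_simps)
  show "continuous_on UNIV (shell_cutoff' c L)"
    unfolding shell_cutoff'_def[abs_def]
    by (intro continuous_intros continuous_on_compose2[OF continuous_smooth_step']) (use L in auto)
  have low: "(t - c - L) / L \<le> 0 \<longleftrightarrow> t - c \<le> L" "(c - t - L) / L \<le> 0 \<longleftrightarrow> c - t \<le> L"
    "1 \<le> (t - c - L) / L \<longleftrightarrow> 2 * L \<le> t - c" "1 \<le> (c - t - L) / L \<longleftrightarrow> 2 * L \<le> c - t"
    using L by (auto simp: field_simps)
  note s = smooth_step_props smooth_step'_props
  consider "\<bar>t - c\<bar> \<le> L" | "L < t - c" | "L < c - t" by linarith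
  then show "\<bar>shell_cutoff' c L t\<bar> \<le> 2 * indicator {t. L < \<bar>t - c\<bar> \<and> \<bar>t - c\<bar> < 2 * L} t"
  proof cases
    case 1
    then show ?thesis using low s(5)[of "(t - c - L) / L"] s(5)[of "(c - t - L) / L"] by (simp add: shell_cutoff'_def)
  next
    case 2
    then have "smooth_step' ((c - t - L) / L) = 0" using low L by (intro s) linarith
    then show ?thesis using 2 L low s(6-8)[of "(t - c - L) / L"] by (auto simp: shell_cutoff'_def indicator_def)
  next
    case 3
    then have "smooth_step' ((t - c - L) / L) = 0" using low L by (intro s) linarith
    then show ?thesis using 3 L low s(6-8)[of "(c - t - L) / L"] by (auto simp: shell_cutoff'_def indicator_def)
  qed
  show "0 \<le> shell_cutoff c L t" using L s(3) by (simp add: shell_cutoff_def)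
  consider "\<bar>t - c\<bar> \<le> L" | "L < t - c" | "L < c - t" by linarith
  then show "shell_cutoff c L t \<le> \<bar>t - c\<bar>"
  proof cases
    case 1
    then show ?thesis using low s(1)[of "(t - c - L) / L"] s(1)[of "(c - t - L) / L"] by (simp add: shell_cutoff_def)
  next
    case 2
    then have "smooth_step ((c - t - L) / L) = 0" using low L by (intro s) linarith
    moreover have "L * smooth_step ((t - c - L) / L) \<le> L * 1" using L by (intro mult_left_mono s) auto
    ultimately show ?thesis using 2 by (simp add: shell_cutoff_def)
  next
    case 3
    then have "smooth_step ((t - c - L) / L) = 0" using low L by (intro s) linarith
    moreover have "L * smooth_step ((c - t - L) / L) \<le> L * 1" using L by (intro mult_left_mono s) auto
    ultimately show ?thesis using 3 by (simp add: shell_cutoff_def)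
  qed
  show "shell_cutoff c L t = L" if "2 * L \<le> \<bar>t - c\<bar>"
  proof (cases "2 * L \<le> t - c")
    case True
    then have "smooth_step ((c - t - L) / L) = 0" "smooth_step ((t - c - L) / L) = 1"
      using low L by (auto intro!: s)
    then show ?thesis by (simp add: shell_cutoff_def)
  next
    case False
    then have "2 * L \<le> c - t" using that by linarith
    then have "smooth_step ((t - c - L) / L) = 0" "smooth_step ((c - t - L) / L) = 1"
      using low L by (auto intro!: s)
    then show ?thesis by (simp add: shell_cutoff_def)
  qed
qed

section \<open>Dyadic levels and the strong-type estimate\<close>

lemma powr_add_le_powr:
  fixes x y q :: real
  assumes "0 \<le> x" "0 \<le> y" "1 \<le> q"
  shows "x powr q + y powr q \<le> (x + y) powr q"
proof (cases "x = 0 \<or> y = 0")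
  case False
  then have pos: "0 < x" "0 < y" using assms by auto
  have split: "u powr q = u * u powr (q - 1)" if "0 < u" for u :: real
    using that by (simp add: powr_mult_base)
  have "x powr q + y powr q = x * x powr (q - 1) + y * y powr (q - 1)"
    using pos by (simp add: split)
  also have "\<dots> \<le> x * (x + y) powr (q - 1) + y * (x + y) powr (q - 1)"
    using pos assms by (intro add_mono mult_left_mono powr_mono2) auto
  also have "\<dots> = (x + y) powr q"
    using pos by (simp add: split[of "x + y"] distrib_right)
  finally show ?thesis .
qed (use assms in auto)

text \<open>A discrete layer-cake formula. For \<open>t \<ge> 2 * L\<close> the single term with
  \<open>2 * (2 ^ m * L) \<le> t < 4 * (2 ^ m * L)\<close> already dominates.\<close>

lemma powr_le_dyadic_sum:
  fixes t L q :: real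
  assumes "0 < L" "0 \<le> t" "0 \<le> q"
  shows "ennreal (t powr q) \<le> ennreal ((2 * L) powr q)
     + (\<Sum>j. ennreal ((4 * (2 ^ j * L)) powr q) * indicator {s. 2 * (2 ^ j * L) \<le> s} t)"
proof (cases "t < 2 * L")
  case True
  have "t powr q \<le> (2 * L) powr q" using True assms by (intro powr_mono2) auto
  then show ?thesis by (intro add_increasing2) (auto intro: ennreal_leI)
next
  case False
  have "0 < 2 * L / t" "2 * L / t \<le> 1" using False assms by (auto simp: field_simps)
  then obtain m where m: "2 * L / t \<le> (1 / 2) ^ m" "(1 / 2) ^ Suc m < 2 * L / t"
    using exists_power_between[of "1 / 2" "2 * L / t"] by auto
  have t: "0 < t" using False assms by linarith
  have le: "2 * (2 ^ m * L) \<le> t" using m(1) t by (simp add: power_one_over field_simps)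
  have "t < 4 * (2 ^ m * L)" using m(2) t by (simp add: power_one_over field_simps)
  then have "t powr q \<le> (4 * (2 ^ m * L)) powr q" using t assms by (intro powr_mono2) auto
  then have "ennreal (t powr q) \<le> ennreal ((4 * (2 ^ m * L)) powr q) * indicator {s. 2 * (2 ^ m * L) \<le> s} t"
    using le by (simp add: ennreal_leI)
  also have "\<dots> \<le> (\<Sum>j. ennreal ((4 * (2 ^ j * L)) powr q) * indicator {s. 2 * (2 ^ j * L) \<le> s} t)"
    using sum_le_suminf[of "\<lambda>j. ennreal ((4 * (2 ^ j * L)) powr q) * indicator {s. 2 * (2 ^ j * L) \<le> s} t" "{m}"]
    by (simp only: sum.insert finite.emptyI finite.insertI empty_iff sum.empty add_0_right not_False_eq_True) auto
  finally show ?thesis by (intro add_increasing) auto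
qed

context positive_weight
begin

text \<open>The weak-type inequality for the cutoff of \<open>f\<close> between \<open>L\<close> and
  \<open>2 * L\<close> sees only the energy of \<open>g\<close> on that shell. Raised to the power
  \<open>q \<ge> p\<close>, these energies can be summed, because dyadic shells are disjoint; levels
  below \<open>L0\<close> contribute at most the constant \<open>2 * L0\<close>.\<close>

lemma Sobolev_Poincare_critical:
  fixes f :: "'a \<Rightarrow> real" and g :: "'a \<Rightarrow> 'a" and r p K \<rho> X q :: real
  assumes [measurable]: "f \<in> borel_measurable borel" "g \<in> borel_measurable borel"
    and fi: "\<And>R. set_integrable lborel (ball z R) f" and gi: "\<And>R. set_integrable lborel (ball z R) g"
    and test: "\<And>\<phi> \<phi>'. (\<And>x. GDERIV \<phi> x :> \<phi>' x) \<Longrightarrow> continuous_on UNIV \<phi>' \<Longrightarrow> compact (closure {x. \<phi> x \<noteq> 0}) \<Longrightarrow>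
        (LINT x|lborel. f x *\<^sub>R \<phi>' x) = - (LINT x|lborel. \<phi> x *\<^sub>R g x)"
    and bd: "averaging_bound r K" and r: "1 \<le> r" "r \<le> p" "p < DIM('a) * r" "0 \<le> K" "0 < \<rho>"
    and X: "0 \<le> X" "(\<integral>\<^sup>+x\<in>ball z \<rho>. ennreal (norm (g x) powr p * w x) \<partial>lborel) \<le> ennreal X"
    and q: "1 / q = 1 / p - 1 / (DIM('a) * r)"
  shows "(\<integral>\<^sup>+x. ennreal (\<bar>f x - (LINT y:ball z \<rho>|lborel. f y) / ball_vol TYPE('a) \<rho>\<bar> powr q) \<partial>N z \<rho>)
    \<le> ennreal ((18 * 18 ^ DIM('a) * (4 + 2 * p / (DIM('a) * r - p)) * (\<rho> * (K * X / W (ball z \<rho>)) powr (1 / p))) powr q)"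
proof -
  define n where "n = DIM('a)"
  define \<omega> where "\<omega> = unit_ball_vol (real n)"
  define v where "v = \<omega> * \<rho> ^ n"
  define c0 where "c0 = 2 ^ n / \<omega>"
  define \<Gamma> where "\<Gamma> = 4 + 2 * p / (real n * r - p)"
  define Y where "Y = (K * X / W (ball z \<rho>)) powr (1 / p)"
  define S where "S = \<rho> * Y"
  define av where "av = (LINT y:ball z \<rho>|lborel. f y) / v"
  let ?B = "ball z \<rho>"
  interpret N: prob_space "N z \<rho>" by (rule prob_space_N) fact
  have \<omega>: "0 < \<omega>" by (simp add: \<omega>_def)
  have v: "0 < v" using \<omega> r by (simp add: v_def)
  have c0: "0 < c0" using \<omega> by (simp add: c0_def)
  have p: "1 \<le> p" using r by simp
  have W0: "0 < W ?B" using r by (intro W_ball_pos)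
  have nr: "p < real n * r" using r by (simp add: n_def)
  have \<Gamma>: "4 \<le> \<Gamma>" using nr p by (simp add: \<Gamma>_def)
  have Y0: "0 \<le> Y" by (simp add: Y_def)
  have S0: "0 \<le> S" using r Y0 by (simp add: S_def)
  have q1: "1 / q = 1 / p - 1 / (real n * r)" using q by (simp add: n_def)
  have qpos: "0 < 1 / q" unfolding q1 using nr p by (simp add: frac_less2)
  have "1 / q \<le> 1 / p" unfolding q1 using nr p by simp
  then have qp: "p \<le> q" using qpos p by (simp add: field_simps)
  have q_ge1: "1 \<le> q" using qp p by simp
  \<comment> \<open>An unweighted mean deviation in terms of the weighted quantity \<open>S\<close>:
    the averaging bound turns the energy of \<open>g\<close> into its plain integral. It controls
    the means of all cutoffs below.\<close>
  have a1: "(\<integral>\<^sup>+x\<in>?B. ennreal \<bar>f x - av\<bar> \<partial>lborel) \<le> ennreal (v * (2 * 4 ^ n * S))"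
  proof -
    have rep: "AE x in lborel. x \<in> ?B \<longrightarrow> ennreal \<bar>f x - av\<bar> \<le> ennreal c0 * (\<Sum>k. potential_term z \<rho> (\<lambda>y. norm (g y)) k x)"
      using weak_gradient_potential_bound[OF assms(1-5) \<open>0 < \<rho>\<close>, of "\<lambda>t. t" "\<lambda>_. 1" 1]
      by (simp add: c0_def av_def v_def \<omega>_def n_def)
    have "(\<integral>\<^sup>+x\<in>?B. ennreal (norm (g x)) \<partial>lborel) \<le> ennreal (ball_vol TYPE('a) \<rho> powr (r / p) * v powr (1 - r / p) * Y)"
      unfolding Y_def using r X v
      by (intro averaging_bound_power[OF bd]) (auto simp: v_def \<omega>_def n_def emeasure_ball)
    also have "ball_vol TYPE('a) \<rho> powr (r / p) * v powr (1 - r / p) = v"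
      using v unfolding n_def [symmetric] \<omega>_def [symmetric] v_def [symmetric] by (simp flip: powr_add)
    finally have gY: "(\<integral>\<^sup>+x\<in>?B. ennreal (norm (g x)) \<partial>lborel) \<le> ennreal (v * Y)" .
    have "(\<integral>\<^sup>+x\<in>?B. ennreal \<bar>f x - av\<bar> \<partial>lborel) \<le> (\<integral>\<^sup>+x. ennreal c0 * (\<Sum>k. potential_term z \<rho> (\<lambda>y. norm (g y)) k x) \<partial>lborel)"
      using rep by (intro nn_integral_mono_AE) (auto elim!: eventually_mono simp: indicator_def)
    also have "\<dots> = ennreal c0 * (ennreal (2 * \<rho> * (\<omega> * 2 ^ n)) * (\<integral>\<^sup>+x\<in>?B. ennreal (norm (g x)) \<partial>lborel))"
      using r by (subst nn_integral_cmult) (auto simp: nn_integral_potential_L1 \<omega>_def n_def)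
    also have "\<dots> \<le> ennreal c0 * (ennreal (2 * \<rho> * (\<omega> * 2 ^ n)) * ennreal (v * Y))"
      by (intro mult_left_mono gY) auto
    also have "\<dots> = ennreal (c0 * (2 * \<rho> * (\<omega> * 2 ^ n) * (v * Y)))"
      using c0 \<omega> r by (simp flip: ennreal_mult')
    also have "c0 * (2 * \<rho> * (\<omega> * 2 ^ n) * (v * Y)) = v * (2 * (2 ^ n * 2 ^ n) * S)"
      using \<omega> by (simp add: c0_def S_def)
    also have "(2 ^ n * 2 ^ n :: real) = 4 ^ n" by (simp flip: power_mult_distrib)
    finally show ?thesis .
  qed
  show ?thesis
  proof (cases "S = 0")
    case True
    then have "(\<integral>\<^sup>+x\<in>?B. ennreal \<bar>f x - av\<bar> \<partial>lborel) = 0" using a1 by simp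
    then have "AE x in lborel. ennreal \<bar>f x - av\<bar> * indicator ?B x = 0"
      by (subst (asm) nn_integral_0_iff_AE) auto
    then have "AE x in lborel. x \<in> ?B \<longrightarrow> f x = av"
      by eventually_elim (auto simp: indicator_def ennreal_eq_0_iff split: if_splits)
    then have "AE x in lborel. ennreal (\<bar>f x - av\<bar> powr q) * ennreal (w x / W ?B) * indicator ?B x = 0"
      by eventually_elim (auto simp: indicator_def)
    then have "(\<integral>\<^sup>+x. ennreal (\<bar>f x - av\<bar> powr q) * ennreal (w x / W ?B) * indicator ?B x \<partial>lborel) = 0"
      by (subst nn_integral_0_iff_AE) auto
    then have "(\<integral>\<^sup>+x. ennreal (\<bar>f x - av\<bar> powr q) \<partial>N z \<rho>) = 0"
      by (subst nn_integral_N) auto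
    then show ?thesis by (simp add: av_def v_def \<omega>_def n_def)
  next
    case False
    then have S: "0 < S" using S0 by simp
    \<comment> \<open>Twice the mean deviation. From this level on, the mean \<open>\<alpha>\<close>
      of a cutoff is at most \<open>L / 2\<close>. The case \<open>S = 0\<close> is separated
      because the starting level must be positive.\<close>
    define L0 where "L0 = 4 * 4 ^ n * S"
    have L0: "0 < L0" using S by (simp add: L0_def)
    define A where "A L = {x. L < \<bar>f x - av\<bar> \<and> \<bar>f x - av\<bar> < 2 * L}" for L
    define XL where "XL L = (\<integral>\<^sup>+x\<in>?B. ennreal (norm (g x) powr p * w x) * indicator (A L) x \<partial>lborel)" for L
    have [measurable]: "A L \<in> sets borel" for L unfolding A_def by measurable
    have XL_le: "XL L \<le> ennreal X" for L
      unfolding XL_def by (rule order_trans[OF nn_integral_mono X(2)]) (auto simp: indicator_def)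
    define x where "x L = enn2real (XL L)" for L
    have xL: "XL L = ennreal (x L)" for L
      unfolding x_def by (metis XL_le ennreal_enn2real ennreal_less_top le_less_trans)
    have x0: "0 \<le> x L" "x L \<le> X" for L
      using XL_le[of L] X(1) unfolding xL by (auto simp: x_def)
    define D where "D = 4 * 18 ^ n * \<Gamma> * \<rho> * (K / W ?B) powr (1 / p)"
    have D0: "0 \<le> D" using \<Gamma> r by (simp add: D_def)
    have level: "L * measure (N z \<rho>) {y. 2 * L \<le> \<bar>f y - av\<bar>} powr (1 / q) \<le> D * x L powr (1 / p)" if L: "L0 \<le> L" for L
    proof -
      have Lpos: "0 < L" using L L0 by simp
      let ?\<tau> = "shell_cutoff av L" and ?\<tau>' = "shell_cutoff' av L"
      note sc = shell_cutoff_props[OF Lpos, where c=av]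
      have M: "\<bar>?\<tau>' t\<bar> \<le> 2" for t using order_trans[OF sc(3)[of t], of 2] by (auto simp: indicator_def)
      define \<alpha> where "\<alpha> = (LINT y:?B|lborel. ?\<tau> (f y)) / v"
      define h where "h y = \<bar>?\<tau>' (f y)\<bar> * norm (g y)" for y
      have [measurable]: "?\<tau> \<in> borel_measurable borel" "?\<tau>' \<in> borel_measurable borel"
        using sc(2) DERIV_continuous_on[of UNIV ?\<tau> ?\<tau>'] sc(1)
        by (auto intro!: borel_measurable_continuous_onI intro: has_field_derivative_at_within)
      have [measurable]: "h \<in> borel_measurable borel" unfolding h_def[abs_def] by measurable
      have rep: "AE y in lborel. y \<in> ?B \<longrightarrow> ennreal \<bar>?\<tau> (f y) - \<alpha>\<bar> \<le> ennreal c0 * (\<Sum>k. potential_term z \<rho> h k y)"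
        using weak_gradient_potential_bound[OF assms(1-5) \<open>0 < \<rho>\<close> sc(1) sc(2) M]
        by (simp add: c0_def \<alpha>_def v_def \<omega>_def n_def h_def[abs_def])
      have hX: "(\<integral>\<^sup>+y\<in>?B. ennreal (h y powr p * w y) \<partial>lborel) \<le> ennreal (2 powr p * x L)"
      proof -
        have "(\<integral>\<^sup>+y\<in>?B. ennreal (h y powr p * w y) \<partial>lborel)
           \<le> (\<integral>\<^sup>+y. ennreal (2 powr p) * (ennreal (norm (g y) powr p * w y) * indicator (A L) y * indicator ?B y) \<partial>lborel)"
        proof (intro nn_integral_mono)
          fix y
          have "h y \<le> 2 * norm (g y) * indicator (A L) y"
            using mult_right_mono[OF sc(3)[of "f y"], of "norm (g y)"] 
            by (cases "L < \<bar>f y - av\<bar> \<and> \<bar>f y - av\<bar> < 2 * L") (auto simp: h_def A_def)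
          then have "h y powr p \<le> (2 * norm (g y) * indicator (A L) y) powr p"
            using p by (intro powr_mono2) (auto simp: h_def)
          also have "\<dots> = 2 powr p * norm (g y) powr p * indicator (A L) y"
            using p by (auto simp: indicator_def powr_mult)
          finally have "h y powr p * w y \<le> 2 powr p * norm (g y) powr p * indicator (A L) y * w y"
            using w_pos[of y] by (intro mult_right_mono) auto
          then show "ennreal (h y powr p * w y) * indicator ?B y
             \<le> ennreal (2 powr p) * (ennreal (norm (g y) powr p * w y) * indicator (A L) y * indicator ?B y)"
            using w_pos[of y] by (auto simp: indicator_def ennreal_leI mult.assoc simp flip: ennreal_mult' split: if_splits)
        qed
        also have "\<dots> = ennreal (2 powr p) * XL L"
          unfolding XL_def by (rule nn_integral_cmult) measurable
        also have "\<dots> = ennreal (2 powr p * x L)" by (simp add: xL ennreal_mult')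
        finally show ?thesis .
      qed
      have \<alpha>: "0 \<le> \<alpha>" "\<alpha> \<le> L / 2"
      proof -
        show "0 \<le> \<alpha>" using v sc(4) by (auto simp: \<alpha>_def set_lebesgue_integral_def intro!: divide_nonneg_pos Bochner_Integration.integral_nonneg)
        have "(\<integral>\<^sup>+y. ennreal (indicator ?B y *\<^sub>R ?\<tau> (f y)) \<partial>lborel) \<le> (\<integral>\<^sup>+x\<in>?B. ennreal \<bar>f x - av\<bar> \<partial>lborel)"
          using sc(5) by (intro nn_integral_mono) (auto simp: indicator_def ennreal_leI)
        also note a1
        finally have le: "(\<integral>\<^sup>+y. ennreal (indicator ?B y *\<^sub>R ?\<tau> (f y)) \<partial>lborel) \<le> ennreal (v * (2 * 4 ^ n * S))" .
        have "(LINT y:?B|lborel. ?\<tau> (f y)) \<le> v * (2 * 4 ^ n * S)"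
          unfolding set_lebesgue_integral_def
        proof (subst integral_eq_nn_integral)
          show "enn2real (\<integral>\<^sup>+y. ennreal (indicator ?B y *\<^sub>R ?\<tau> (f y)) \<partial>lborel) \<le> v * (2 * 4 ^ n * S)"
            using enn2real_mono[OF le] v S by simp
          show "(\<lambda>y. indicator ?B y *\<^sub>R ?\<tau> (f y)) \<in> borel_measurable lborel"
            by (intro borel_measurable_scaleR borel_measurable_indicator) auto
        qed (use sc(4) in auto)
        then have "\<alpha> \<le> 2 * 4 ^ n * S" using v by (simp add: \<alpha>_def field_simps)
        then show "\<alpha> \<le> L / 2" using L by (simp add: L0_def)
      qed
      \<comment> \<open>Beyond \<open>2 * L\<close> the cutoff equals \<open>L\<close>, so
        subtracting a mean in \<open>[0, L / 2]\<close> leaves at least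
        \<open>L / 2\<close>.\<close>
      have "{y. 2 * L \<le> \<bar>f y - av\<bar>} \<subseteq> {y. L / 2 \<le> \<bar>?\<tau> (f y) - \<alpha>\<bar>}"
        using sc(6) \<alpha> by fastforce
      then have "measure (N z \<rho>) {y. 2 * L \<le> \<bar>f y - av\<bar>} \<le> measure (N z \<rho>) {y. L / 2 \<le> \<bar>?\<tau> (f y) - \<alpha>\<bar>}"
        by (intro N.finite_measure_mono) auto
      then have "L / 2 * measure (N z \<rho>) {y. 2 * L \<le> \<bar>f y - av\<bar>} powr (1 / q)
         \<le> L / 2 * measure (N z \<rho>) {y. L / 2 \<le> \<bar>?\<tau> (f y) - \<alpha>\<bar>} powr (1 / q)"
        using Lpos qpos by (intro mult_left_mono powr_mono2) auto
      also have "\<dots> \<le> c0 * (\<omega> * 9 ^ n * \<rho> * (K * (2 powr p * x L) / W ?B) powr (1 / p) * \<Gamma>)"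
        unfolding q1 \<Gamma>_def \<omega>_def n_def
        by (rule weak_type_potential[OF bd r]) (use hX rep x0 c0 Lpos in \<open>auto simp: h_def\<close>)
      also have "(K * (2 powr p * x L) / W ?B) powr (1 / p) = 2 * ((K / W ?B) powr (1 / p) * x L powr (1 / p))"
        using r W0 x0 p by (simp add: powr_mult powr_divide powr_powr)
      also have "c0 * (\<omega> * 9 ^ n * \<rho> * (2 * ((K / W ?B) powr (1 / p) * x L powr (1 / p))) * \<Gamma>)
         = 2 * (2 ^ n * 9 ^ n) * \<Gamma> * \<rho> * (K / W ?B) powr (1 / p) * x L powr (1 / p)"
        using \<omega> by (simp add: c0_def)
      also have "(2 ^ n * 9 ^ n :: real) = 18 ^ n" by (simp flip: power_mult_distrib)
      finally show ?thesis by (simp add: D_def)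
    qed
    define Lj where "Lj j = 2 ^ j * L0" for j :: nat
    have Lj: "0 < Lj j" "L0 \<le> Lj j" for j using L0 by (auto simp: Lj_def)
    have level_q: "ennreal ((4 * Lj j) powr q) * emeasure (N z \<rho>) {y. 2 * Lj j \<le> \<bar>f y - av\<bar>}
        \<le> ennreal ((4 * D) powr q * X powr (q / p - 1)) * XL (Lj j)" for j
    proof -
      let ?m = "measure (N z \<rho>) {y. 2 * Lj j \<le> \<bar>f y - av\<bar>}"
      have "(4 * Lj j * ?m powr (1 / q)) powr q \<le> (4 * D * x (Lj j) powr (1 / p)) powr q"
        using level[OF Lj(2)[of j]] Lj(1)[of j] q_ge1 by (intro powr_mono2) auto
      then have "(4 * Lj j) powr q * ?m \<le> (4 * D) powr q * x (Lj j) powr (q / p)"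
        using Lj(1)[of j] D0 q_ge1 by (simp add: powr_mult powr_powr)
      \<comment> \<open>Here \<open>q \<ge> p\<close> is used: all but one power of the shell energy
        is bounded by the total energy, which leaves a quantity that is additive over
        shells.\<close>
      also have "x (Lj j) powr (q / p) \<le> X powr (q / p - 1) * x (Lj j)"
      proof (cases "x (Lj j) = 0")
        case False
        then have xp: "0 < x (Lj j)" using x0(1)[of "Lj j"] by simp
        have "x (Lj j) powr (q / p) = x (Lj j) powr (q / p - 1) * x (Lj j)"
          using xp powr_add[of "x (Lj j)" "q / p - 1" 1] by simp
        also have "\<dots> \<le> X powr (q / p - 1) * x (Lj j)"
          using x0 qp p by (intro mult_right_mono powr_mono2) auto
        finally show ?thesis .
      qed simp
      finally have "(4 * Lj j) powr q * ?m \<le> (4 * D) powr q * (X powr (q / p - 1) * x (Lj j))"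
        by (simp add: mult_left_mono)
      then show ?thesis using x0(1)[of "Lj j"]
        by (simp add: N.emeasure_eq_measure xL ennreal_leI mult.assoc flip: ennreal_mult'')
    qed
    have sumX: "(\<Sum>j. XL (Lj j)) \<le> ennreal X"
    proof -
      have "(\<Sum>j. XL (Lj j)) = (\<integral>\<^sup>+y. (\<Sum>j. ennreal (norm (g y) powr p * w y) * indicator (A (Lj j)) y * indicator ?B y) \<partial>lborel)"
        unfolding XL_def by (rule nn_integral_suminf[symmetric]) measurable
      also have "\<dots> \<le> (\<integral>\<^sup>+y\<in>?B. ennreal (norm (g y) powr p * w y) \<partial>lborel)"
      proof (intro nn_integral_mono)
        fix y
        have disj: "disjoint_family (\<lambda>j. A (Lj j))"
        proof -
          have less: "A (Lj i) \<inter> A (Lj j) = {}" if "i < j" for i j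
          proof -
            have "(2::real) ^ Suc i \<le> 2 ^ j" using that by (intro power_increasing) auto
            then have "2 * Lj i \<le> Lj j" using L0 by (simp add: Lj_def)
            then show ?thesis by (auto simp: A_def)
          qed
          show ?thesis unfolding disjoint_family_on_def using less by (metis inf_commute linorder_neqE_nat)
        qed
        have "(\<Sum>j. ennreal (norm (g y) powr p * w y) * indicator (A (Lj j)) y * indicator ?B y)
            = ennreal (norm (g y) powr p * w y) * (\<Sum>j. indicator (A (Lj j)) y) * indicator ?B y"
          by simp
        also have "(\<Sum>j. indicator (A (Lj j)) y :: ennreal) = indicator (\<Union>j. A (Lj j)) y"
          by (rule suminf_indicator[OF disj])
        also have "ennreal (norm (g y) powr p * w y) * indicator (\<Union>j. A (Lj j)) y * indicator ?B y
           \<le> ennreal (norm (g y) powr p * w y) * 1 * indicator ?B y"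
          by (intro mult_left_mono mult_right_mono) (auto simp: indicator_def)
        finally show "(\<Sum>j. ennreal (norm (g y) powr p * w y) * indicator (A (Lj j)) y * indicator ?B y)
           \<le> ennreal (norm (g y) powr p * w y) * indicator ?B y" by simp
      qed
      also note X(2)
      finally show ?thesis .
    qed
    have "(\<integral>\<^sup>+y. ennreal (\<bar>f y - av\<bar> powr q) \<partial>N z \<rho>)
       \<le> (\<integral>\<^sup>+y. ennreal ((2 * L0) powr q) + (\<Sum>j. ennreal ((4 * Lj j) powr q) * indicator {y. 2 * Lj j \<le> \<bar>f y - av\<bar>} y) \<partial>N z \<rho>)"
    proof (intro nn_integral_mono)
      fix y
      have "indicator {s. 2 * Lj j \<le> s} \<bar>f y - av\<bar> = (indicator {y. 2 * Lj j \<le> \<bar>f y - av\<bar>} y :: ennreal)" for j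
        by (simp add: indicator_def)
      then show "ennreal (\<bar>f y - av\<bar> powr q) \<le> ennreal ((2 * L0) powr q) + (\<Sum>j. ennreal ((4 * Lj j) powr q) * indicator {y. 2 * Lj j \<le> \<bar>f y - av\<bar>} y)"
        using powr_le_dyadic_sum[OF L0, of "\<bar>f y - av\<bar>" q] q_ge1 by (simp add: Lj_def)
    qed
    also have "\<dots> = ennreal ((2 * L0) powr q) + (\<Sum>j. ennreal ((4 * Lj j) powr q) * emeasure (N z \<rho>) {y. 2 * Lj j \<le> \<bar>f y - av\<bar>})"
      using N.emeasure_space_1 by (simp add: nn_integral_add nn_integral_suminf nn_integral_cmult_indicator)
    also have "\<dots> \<le> ennreal ((2 * L0) powr q) + (\<Sum>j. ennreal ((4 * D) powr q * X powr (q / p - 1)) * XL (Lj j))"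
      by (intro add_left_mono suminf_le level_q) auto
    also have "\<dots> = ennreal ((2 * L0) powr q) + ennreal ((4 * D) powr q * X powr (q / p - 1)) * (\<Sum>j. XL (Lj j))"
      by simp
    also have "\<dots> \<le> ennreal ((2 * L0) powr q) + ennreal ((4 * D) powr q * X powr (q / p - 1)) * ennreal X"
      by (intro add_left_mono mult_left_mono sumX) auto
    also have "\<dots> = ennreal ((2 * L0) powr q + (4 * D) powr q * (X powr (q / p - 1) * X))"
      using X(1) by (simp add: mult.assoc flip: ennreal_mult' ennreal_plus)
    also have "X powr (q / p - 1) * X = (X powr (1 / p)) powr q"
    proof (cases "X = 0")
      case False
      then show ?thesis using X(1) powr_add[of X "q / p - 1" 1] by (simp add: powr_powr)
    qed simp
    also have "(4 * D) powr q * (X powr (1 / p)) powr q = (4 * D * X powr (1 / p)) powr q"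
      using D0 by (simp add: powr_mult)
    also have "ennreal ((2 * L0) powr q + (4 * D * X powr (1 / p)) powr q) \<le> ennreal ((2 * L0 + 4 * D * X powr (1 / p)) powr q)"
      using L0 D0 q_ge1 by (intro ennreal_leI powr_add_le_powr) auto
    \<comment> \<open>The shells contribute \<open>16 * 18 ^ n * \<Gamma> * S\<close>, the low
      levels at most \<open>2 * 18 ^ n * \<Gamma> * S\<close> because
      \<open>\<Gamma> \<ge> 4\<close>.\<close>
    also have "\<dots> \<le> ennreal ((18 * 18 ^ n * \<Gamma> * S) powr q)"
    proof (intro ennreal_leI powr_mono2)
      have "4 * D * X powr (1 / p) = 16 * 18 ^ n * \<Gamma> * S"
        using r X(1) W0 by (simp add: D_def S_def Y_def powr_mult powr_divide)
      moreover have "2 * L0 \<le> 2 * 18 ^ n * \<Gamma> * S"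
      proof -
        have "(4::real) ^ n * 4 \<le> 18 ^ n * \<Gamma>" using \<Gamma> by (intro mult_mono power_mono) auto
        then have "2 * (4 ^ n * 4) * S \<le> 2 * (18 ^ n * \<Gamma>) * S" using S0 by (intro mult_right_mono mult_left_mono) auto
        then show ?thesis by (simp add: L0_def mult_ac)
      qed
      ultimately show "2 * L0 + 4 * D * X powr (1 / p) \<le> 18 * 18 ^ n * \<Gamma> * S" by (simp add: algebra_simps)
    qed (use L0 D0 q_ge1 in auto)
    finally show ?thesis by (simp add: av_def v_def \<omega>_def n_def \<Gamma>_def S_def Y_def)
  qed
qed

end

section \<open>Self-improvement of the Muckenhoupt condition\<close>

text \<open>Quantifies the concavity of the logarithm on \<open>(0, D]\<close>. The difference of
  the two sides has derivative \<open>(t - 1) * (1 / t - 1 / D\<^sup>2)\<close>, hence its minimum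
  at \<open>1\<close>; the second factor is nonnegative because
  \<open>t \<le> D \<le> D\<^sup>2\<close>.\<close>

lemma ln_le_quadratic:
  fixes v D :: real
  assumes "0 < v" "v \<le> D" "1 \<le> D"
  shows "ln v \<le> (v - 1) - (v - 1)\<^sup>2 / (2 * D\<^sup>2)"
proof -
  define g where "g t = t - 1 - ln t - (t - 1)\<^sup>2 / (2 * D\<^sup>2)" for t
  have D2: "D \<le> D\<^sup>2" using assms by (simp add: power2_eq_square)
  have der: "(g has_real_derivative (t - 1) * (1 / t - 1 / D\<^sup>2)) (at t)" if "0 < t" for t
    unfolding g_def[abs_def] using that assms
    by (auto intro!: derivative_eq_intros simp: field_simps power2_eq_square)
  have inv: "0 \<le> 1 / t - 1 / D\<^sup>2" if "0 < t" "t \<le> D" for t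
    using that D2 by (simp add: frac_le)
  have "g 1 \<le> g v"
  proof (cases "1 \<le> v")
    case True
    show ?thesis
    proof (rule DERIV_nonneg_imp_nondecreasing[OF True])
      fix t assume t: "1 \<le> t" "t \<le> v"
      have "0 \<le> (t - 1) * (1 / t - 1 / D\<^sup>2)"
        by (rule mult_nonneg_nonneg) (use t assms inv in auto)
      then show "\<exists>y. (g has_real_derivative y) (at t) \<and> 0 \<le> y"
        using der[of t] t by auto
    qed
  next
    case False
    show ?thesis
    proof (rule DERIV_nonpos_imp_nonincreasing[of v 1])
      fix t assume t: "v \<le> t" "t \<le> 1"
      have "(t - 1) * (1 / t - 1 / D\<^sup>2) \<le> 0"
        by (rule mult_nonpos_nonneg) (use t assms inv in auto)
      then show "\<exists>y. (g has_real_derivative y) (at t) \<and> y \<le> 0"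
        using der[of t] t assms by auto
    qed (use False in simp)
  qed
  then show ?thesis by (simp add: g_def)
qed

text \<open>Bernoulli's inequality for \<open>v powr d\<close>, multiplied by \<open>v\<close>. The
  point is that the quadratic error carries the small factor \<open>d\<close>.\<close>

lemma powr_le_second_order:
  fixes v d :: real
  assumes "0 < v" "0 \<le> d" "d \<le> 1"
  shows "v powr (1 + d) \<le> 1 + (1 + d) * (v - 1) + d * (v - 1)\<^sup>2"
proof -
  have "v powr d \<le> 1 + d * (v - 1)"
    using Youngs_inequality_0[of d "1 - d" v 1] assms by (simp add: algebra_simps)
  then have "v * v powr d \<le> v * (1 + d * (v - 1))" using assms by (intro mult_left_mono) auto
  then show ?thesis using assms by (simp add: powr_add power2_eq_square algebra_simps)
qed

text \<open>
  The function \<open>2 y\<^bsup>1+d\<^esup> - x\<^bsup>-a\<^esup> y\<^bsup>-1\<^esup>\<close> is a Bellman function: the strict convexity of the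
  second term beats the slight convexity of the first one on the region \<open>x y\<^bsup>s-1\<^esup> \<le> C\<close>.
  Only the average has to lie in this region, not the segments joining the points.
\<close>

lemma Bellman_average:
  fixes x y :: "'i \<Rightarrow> real" and d C s D :: real
  assumes I: "finite I" "D = real (card I)" "I \<noteq> {}" and pos: "\<And>i. i \<in> I \<Longrightarrow> 0 < x i" "\<And>i. i \<in> I \<Longrightarrow> 0 < y i"
    and X: "X = (\<Sum>i\<in>I. x i) / D" and Y: "Y = (\<Sum>i\<in>I. y i) / D"
    and s: "1 < s" and d: "0 \<le> d" "d \<le> 1" "d \<le> C powr (- 3 / (s - 1)) / (4 * D\<^sup>2)" and C: "1 \<le> C" "X * Y powr (s - 1) \<le> C"
  defines "a \<equiv> (2 + d) / (s - 1)"
  shows "(\<Sum>i\<in>I. 2 * y i powr (1 + d) - x i powr (- a) / y i) / D \<le> 2 * Y powr (1 + d) - X powr (- a) / Y"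
proof -
  have D: "1 \<le> D" using I by (simp add: Suc_le_eq card_gt_0_iff)
  have a: "0 < a" using s d by (simp add: a_def)
  have XY: "0 < X" "0 < Y" unfolding X Y using I pos D by (auto intro!: divide_pos_pos sum_pos)
  \<comment> \<open>Normalised to mean one, so that linear terms cancel in the sums. Positivity then
    bounds each \<open>v i\<close> by the number \<open>D\<close> of points.\<close>
  define u where "u i = x i / X" for i
  define v where "v i = y i / Y" for i
  have u: "0 < u i" if "i \<in> I" for i using that pos XY by (simp add: u_def)
  have v: "0 < v i" if "i \<in> I" for i using that pos XY by (simp add: v_def)
  have "(\<Sum>i\<in>I. x i) = D * X" "(\<Sum>i\<in>I. y i) = D * Y" using D by (simp_all add: X Y)
  then have su: "(\<Sum>i\<in>I. u i) = D" and sv: "(\<Sum>i\<in>I. v i) = D"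
    using XY unfolding u_def v_def sum_divide_distrib[symmetric] by simp_all
  have su1: "(\<Sum>i\<in>I. u i - 1) = 0" and sv1: "(\<Sum>i\<in>I. v i - 1) = 0"
    using su sv I by (simp_all add: sum_subtractf)
  have vD: "v i \<le> D" if "i \<in> I" for i
    unfolding sv[symmetric] by (rule member_le_sum) (use that I v in \<open>auto intro: less_imp_le\<close>)
  define Q where "Q = (\<Sum>i\<in>I. (v i - 1)\<^sup>2)"
  have Q: "0 \<le> Q" by (simp add: Q_def sum_nonneg)
  define V where "V = X powr (- a) / Y"
  have V: "0 < V" using XY by (simp add: V_def)
  have "(\<Sum>i\<in>I. y i powr (1 + d)) = Y powr (1 + d) * (\<Sum>i\<in>I. v i powr (1 + d))"
    using XY pos by (simp add: sum_distrib_left v_def powr_divide less_imp_le)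
  also have "\<dots> \<le> Y powr (1 + d) * (\<Sum>i\<in>I. 1 + (1 + d) * (v i - 1) + d * (v i - 1)\<^sup>2)"
    by (intro mult_left_mono sum_mono powr_le_second_order v d) auto
  also have "(\<Sum>i\<in>I. 1 + (1 + d) * (v i - 1) + d * (v i - 1)\<^sup>2) = D + d * Q"
    using I sv1 by (simp add: sum.distrib Q_def flip: sum_distrib_left)
  finally have 1: "(\<Sum>i\<in>I. y i powr (1 + d)) \<le> Y powr (1 + d) * (D + d * Q)" .
  \<comment> \<open>Tangent line of the exponential at zero, with the quadratic gain kept only in
    the logarithm of \<open>v i\<close>; this is the variable in which the other term of the Bellman
    function loses.\<close>
  have low: "1 - a * (u i - 1) - (v i - 1) + (v i - 1)\<^sup>2 / (2 * D\<^sup>2) \<le> u i powr (- a) / v i" if i: "i \<in> I" for i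
  proof -
    have "a * ln (u i) \<le> a * (u i - 1)" using a u[OF i] ln_le_minus_one[of "u i"] by (intro mult_left_mono) auto
    moreover have "ln (v i) \<le> (v i - 1) - (v i - 1)\<^sup>2 / (2 * D\<^sup>2)"
      by (rule ln_le_quadratic[OF v[OF i] vD[OF i] D])
    moreover have "1 + (- a * ln (u i) - ln (v i)) \<le> exp (- a * ln (u i) - ln (v i))"
      by (rule exp_ge_add_one_self)
    moreover have "exp (- a * ln (u i) - ln (v i)) = u i powr (- a) / v i"
      using u[OF i] v[OF i] by (simp add: powr_def exp_diff)
    ultimately show ?thesis by linarith
  qed
  have "V * (D + Q / (2 * D\<^sup>2)) = V * (\<Sum>i\<in>I. 1 - a * (u i - 1) - (v i - 1) + (v i - 1)\<^sup>2 / (2 * D\<^sup>2))"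
  proof -
    have "(\<Sum>i\<in>I. a * (u i - 1)) = 0" by (simp only: sum_distrib_left[symmetric] su1 mult_zero_right)
    moreover have "(\<Sum>i\<in>I. (v i - 1)\<^sup>2 / (2 * D\<^sup>2)) = Q / (2 * D\<^sup>2)" by (simp add: Q_def sum_divide_distrib)
    ultimately have "(\<Sum>i\<in>I. 1 - a * (u i - 1) - (v i - 1) + (v i - 1)\<^sup>2 / (2 * D\<^sup>2)) = D + Q / (2 * D\<^sup>2)"
      unfolding sum.distrib sum_subtractf[of "\<lambda>i. 1 - a * (u i - 1)"] sum_subtractf[of "\<lambda>i. 1"] sv1 using I by simp
    then show ?thesis by simp
  qed
  also have "\<dots> \<le> V * (\<Sum>i\<in>I. u i powr (- a) / v i)"
    using V by (intro mult_left_mono sum_mono low) auto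
  also have "\<dots> = (\<Sum>i\<in>I. x i powr (- a) / y i)"
    using XY pos by (simp add: sum_distrib_left u_def v_def V_def powr_divide less_imp_le)
  finally have 2: "V * (D + Q / (2 * D\<^sup>2)) \<le> (\<Sum>i\<in>I. x i powr (- a) / y i)" .
  \<comment> \<open>The exponent \<open>a\<close> is chosen so that \<open>V\<close> equals
    \<open>Y powr (1 + d)\<close> times \<open>(X * Y powr (s - 1)) powr (- a)\<close>. The
    constraint on the average bounds the last factor below by \<open>C powr (- a)\<close>, and
    \<open>d \<le> 1\<close> gives \<open>a \<le> 3 / (s - 1)\<close>, the exponent in the
    hypothesis on \<open>d\<close>.\<close>
  have key: "2 * d * Y powr (1 + d) \<le> V / (2 * D\<^sup>2)"
  proof -
    have "C powr (- 3 / (s - 1)) \<le> C powr (- a)"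
      using C s d by (intro powr_mono) (auto simp: a_def divide_right_mono)
    also have "\<dots> \<le> (X * Y powr (s - 1)) powr (- a)"
      using C XY a by (intro powr_mono2') auto
    also have "\<dots> = X powr (- a) * Y powr (- (2 + d))"
      using XY s by (simp add: powr_mult powr_powr a_def)
    finally have "C powr (- 3 / (s - 1)) * Y powr (1 + d) \<le> X powr (- a) * Y powr (- (2 + d)) * Y powr (1 + d)"
      by (rule mult_right_mono) simp
    also have "\<dots> = X powr (- a) * Y powr (-1)" by (simp add: mult.assoc flip: powr_add)
    also have "\<dots> = V" using XY by (simp add: V_def powr_minus field_simps)
    finally have "C powr (- 3 / (s - 1)) * Y powr (1 + d) \<le> V" .
    moreover have "2 * d * Y powr (1 + d) \<le> 2 * (C powr (- 3 / (s - 1)) / (4 * D\<^sup>2)) * Y powr (1 + d)"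
      using d by (intro mult_right_mono mult_left_mono) auto
    ultimately show ?thesis using D by (simp add: field_simps)
  qed
  have "(\<Sum>i\<in>I. 2 * y i powr (1 + d) - x i powr (- a) / y i) = 2 * (\<Sum>i\<in>I. y i powr (1 + d)) - (\<Sum>i\<in>I. x i powr (- a) / y i)"
    by (simp add: sum_subtractf sum_distrib_left)
  also have "\<dots> \<le> 2 * (Y powr (1 + d) * (D + d * Q)) - V * (D + Q / (2 * D\<^sup>2))"
    using 1 2 by linarith
  also have "\<dots> = D * (2 * Y powr (1 + d) - V) + Q * (2 * d * Y powr (1 + d) - V / (2 * D\<^sup>2))"
    by (simp add: algebra_simps)
  also have "\<dots> \<le> D * (2 * Y powr (1 + d) - V)"
    using mult_nonneg_nonpos[OF Q, of "2 * d * Y powr (1 + d) - V / (2 * D\<^sup>2)"] key by linarith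
  finally show ?thesis using D by (simp add: V_def field_simps)
qed

section \<open>Dyadic cubes and dyadic averages\<close>

text \<open>Half-open, so that the dyadic children partition the cube exactly.\<close>

definition cube :: "'a::euclidean_space \<Rightarrow> real \<Rightarrow> 'a set" where
  "cube a l = {x. \<forall>b\<in>Basis. a \<bullet> b \<le> x \<bullet> b \<and> x \<bullet> b < a \<bullet> b + l}"

text \<open>A child is indexed by the set \<open>T\<close> of coordinate directions in which it
  occupies the upper half; thus the subsets of \<open>Basis\<close> enumerate all children.\<close>

definition subcorner :: "'a::euclidean_space \<Rightarrow> real \<Rightarrow> 'a set \<Rightarrow> 'a" where
  "subcorner a l T = a + (l / 2) *\<^sub>R \<Sum>T"

lemma cube_sets [measurable, simp]: "cube a l \<in> sets borel"
  unfolding cube_def by measurable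

lemma subcorner_inner:
  assumes "T \<subseteq> Basis" "b \<in> Basis"
  shows "subcorner a l T \<bullet> b = a \<bullet> b + (if b \<in> T then l / 2 else 0)"
proof -
  have "finite T" using assms finite_subset finite_Basis by blast
  have "\<Sum>T \<bullet> b = (\<Sum>c\<in>T. c \<bullet> b)" by (rule inner_sum_left)
  also have "\<dots> = (\<Sum>c\<in>T. if c = b then 1 else 0)"
    by (intro sum.cong refl) (use assms in \<open>auto simp: inner_Basis subset_iff\<close>)
  also have "\<dots> = (if b \<in> T then 1 else 0)" using \<open>finite T\<close> by simp
  finally show ?thesis by (simp only: subcorner_def inner_add_left inner_scaleR_left) auto
qed

lemma cube_subcubes:
  fixes a :: "'a::euclidean_space"
  assumes "0 < l"
  shows "cube a l = (\<Union>T\<in>Pow Basis. cube (subcorner a l T) (l / 2))"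
    and "disjoint_family_on (\<lambda>T. cube (subcorner a l T) (l / 2)) (Pow Basis)"
proof -
  have mem: "x \<in> cube (subcorner a l T) (l / 2) \<longleftrightarrow> (x \<in> cube a l \<and> T = {b\<in>Basis. a \<bullet> b + l / 2 \<le> x \<bullet> b})"
    if T: "T \<subseteq> Basis" for x T
  proof
    assume L: "x \<in> cube (subcorner a l T) (l / 2)"
    have b: "(if b \<in> T then a \<bullet> b + l / 2 \<le> x \<bullet> b \<and> x \<bullet> b < a \<bullet> b + l else a \<bullet> b \<le> x \<bullet> b \<and> x \<bullet> b < a \<bullet> b + l / 2)" if "b \<in> Basis" for b
      using L that T by (auto simp: cube_def subcorner_inner dest!: bspec[of _ _ b])
    have "x \<in> cube a l" using b assms by (fastforce simp: cube_def split: if_splits)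
    moreover have "T = {b\<in>Basis. a \<bullet> b + l / 2 \<le> x \<bullet> b}"
      using b T by (fastforce split: if_splits)
    ultimately show "x \<in> cube a l \<and> T = {b\<in>Basis. a \<bullet> b + l / 2 \<le> x \<bullet> b}" by simp
  next
    assume R: "x \<in> cube a l \<and> T = {b\<in>Basis. a \<bullet> b + l / 2 \<le> x \<bullet> b}"
    then show "x \<in> cube (subcorner a l T) (l / 2)"
      using T by (auto simp: cube_def subcorner_inner)
  qed
  show "cube a l = (\<Union>T\<in>Pow Basis. cube (subcorner a l T) (l / 2))"
  proof (intro equalityI subsetI)
    fix x assume "x \<in> cube a l"
    then have "x \<in> cube (subcorner a l {b\<in>Basis. a \<bullet> b + l / 2 \<le> x \<bullet> b}) (l / 2)"
      by (subst mem) auto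
    then show "x \<in> (\<Union>T\<in>Pow Basis. cube (subcorner a l T) (l / 2))" by (rule UN_I[rotated]) auto
  next
    fix x assume "x \<in> (\<Union>T\<in>Pow Basis. cube (subcorner a l T) (l / 2))"
    then obtain T where "T \<subseteq> Basis" "x \<in> cube (subcorner a l T) (l / 2)" by auto
    then show "x \<in> cube a l" by (simp only: mem)
  qed
  show "disjoint_family_on (\<lambda>T. cube (subcorner a l T) (l / 2)) (Pow Basis)"
    unfolding disjoint_family_on_def
  proof (intro ballI impI)
    fix S T :: "'a set" assume "S \<in> Pow Basis" "T \<in> Pow Basis" "S \<noteq> T"
    show "cube (subcorner a l S) (l / 2) \<inter> cube (subcorner a l T) (l / 2) = {}"
    proof (rule equals0I)
      fix x assume "x \<in> cube (subcorner a l S) (l / 2) \<inter> cube (subcorner a l T) (l / 2)"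
      with \<open>S \<in> _\<close> \<open>T \<in> _\<close> mem[of S x] mem[of T x] have "S = T" by simp
      with \<open>S \<noteq> T\<close> show False by simp
    qed
  qed
qed

lemma indicator_cube_subcubes:
  fixes a :: "'a::euclidean_space"
  assumes "0 < l"
  shows "(indicator (cube a l) x :: ennreal) = (\<Sum>T\<in>Pow Basis. indicator (cube (subcorner a l T) (l / 2)) x)"
  unfolding cube_subcubes(1)[OF assms, of a]
  by (rule indicator_UN_disjoint) (use cube_subcubes(2)[OF assms, of a] finite_Basis in auto)

lemma nn_integral_cube_subcubes:
  fixes a :: "'a::euclidean_space" and F :: "'a \<Rightarrow> ennreal"
  assumes [measurable]: "F \<in> borel_measurable borel" and "0 < l"
  shows "(\<integral>\<^sup>+x\<in>cube a l. F x \<partial>lborel) = (\<Sum>T\<in>Pow Basis. \<integral>\<^sup>+x\<in>cube (subcorner a l T) (l / 2). F x \<partial>lborel)"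
  unfolding indicator_cube_subcubes[OF assms(2)] sum_distrib_left by (rule nn_integral_sum) measurable

lemma emeasure_cube:
  fixes a :: "'a::euclidean_space"
  assumes "0 < l"
  shows "emeasure lborel (cube a l) = ennreal (l ^ DIM('a))"
proof (rule antisym)
  have in_cbox: "cube a l \<subseteq> cbox a (a + l *\<^sub>R One)" and in_box: "box a (a + l *\<^sub>R One) \<subseteq> cube a l"
    by (auto simp: cube_def mem_box inner_add_left less_imp_le)
  have prod: "(\<Prod>b\<in>Basis. (a + l *\<^sub>R One - a) \<bullet> b) = l ^ DIM('a)" by simp
  have "emeasure lborel (cube a l) \<le> emeasure lborel (cbox a (a + l *\<^sub>R One))"
    by (intro emeasure_mono in_cbox) simp
  also have "\<dots> = ennreal (l ^ DIM('a))"
    using assms unfolding prod[symmetric] by (subst emeasure_lborel_cbox) (auto simp: inner_add_left)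
  finally show "emeasure lborel (cube a l) \<le> ennreal (l ^ DIM('a))" .
  have "ennreal (l ^ DIM('a)) = emeasure lborel (box a (a + l *\<^sub>R One))"
    using assms unfolding prod[symmetric] by (subst emeasure_lborel_box) (auto simp: inner_add_left)
  also have "\<dots> \<le> emeasure lborel (cube a l)" by (intro emeasure_mono in_box) simp
  finally show "ennreal (l ^ DIM('a)) \<le> emeasure lborel (cube a l)" .
qed

lemma dist_le_cube:
  fixes x y :: "'a::euclidean_space" and l :: real
  assumes "\<And>b. b \<in> Basis \<Longrightarrow> \<bar>x \<bullet> b - y \<bullet> b\<bar> \<le> l"
  shows "dist x y \<le> DIM('a) * l"
proof -
  have "norm (x - y) \<le> (\<Sum>b\<in>Basis. \<bar>(x - y) \<bullet> b\<bar>)" by (rule norm_le_l1)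
  also have "\<dots> \<le> (\<Sum>b\<in>(Basis :: 'a set). l)" by (intro sum_mono) (use assms in \<open>simp add: inner_diff_left\<close>)
  finally show ?thesis by (simp add: dist_norm)
qed

definition cube_avg :: "('a::euclidean_space \<Rightarrow> real) \<Rightarrow> 'a \<Rightarrow> real \<Rightarrow> real" where
  "cube_avg F a l = enn2real (\<integral>\<^sup>+x\<in>cube a l. ennreal (F x) \<partial>lborel) / l ^ DIM('a)"

text \<open>The conditional expectation of \<open>F\<close> on the dyadic subcubes of generation
  \<open>N\<close>, extended by zero. The recursion descends to the children first, so inductions
  over \<open>N\<close> run with an arbitrary cube.\<close>

primrec dyadic_average :: "nat \<Rightarrow> ('a::euclidean_space \<Rightarrow> real) \<Rightarrow> 'a \<Rightarrow> real \<Rightarrow> 'a \<Rightarrow> real" where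
  "dyadic_average 0 F a l x = cube_avg F a l * indicator (cube a l) x"
| "dyadic_average (Suc N) F a l x = (\<Sum>T\<in>Pow Basis. dyadic_average N F (subcorner a l T) (l / 2) x)"

lemma dyadic_average_measurable [measurable]: "dyadic_average N F a l \<in> borel_measurable borel"
proof (induction N arbitrary: a l)
  case 0
  have "(\<lambda>x. cube_avg F a l * indicator (cube a l) x) \<in> borel_measurable borel"
    by (intro borel_measurable_times borel_measurable_indicator) auto
  then show ?case by (subst measurable_cong[where g="\<lambda>x. cube_avg F a l * indicator (cube a l) x"]) auto
next
  case (Suc N)
  have "(\<lambda>x. \<Sum>T\<in>Pow Basis. dyadic_average N F (subcorner a l T) (l / 2) x) \<in> borel_measurable borel"
    by (intro borel_measurable_sum Suc)
  then show ?case by (subst measurable_cong[where g="\<lambda>x. \<Sum>T\<in>Pow Basis. dyadic_average N F (subcorner a l T) (l / 2) x"]) auto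
qed

lemma cube_avg_nonneg: "0 \<le> l \<Longrightarrow> 0 \<le> cube_avg F a l"
  by (simp add: cube_avg_def)

lemma dyadic_average_nonneg: "0 < l \<Longrightarrow> 0 \<le> dyadic_average N F a l x"
  by (induction N arbitrary: a l) (auto intro!: sum_nonneg mult_nonneg_nonneg cube_avg_nonneg)

lemma dyadic_average_outside:
  assumes "0 < l" "x \<notin> cube a l"
  shows "dyadic_average N F a l x = 0"
  using assms
proof (induction N arbitrary: a l)
  case (Suc N)
  have "x \<notin> cube (subcorner a l T) (l / 2)" if "T \<in> Pow Basis" for T
    using Suc.prems cube_subcubes(1)[of l a] that by auto
  then show ?case using Suc.prems(1) by (auto intro!: sum.neutral Suc.IH)
qed simp

lemma dyadic_average_single:
  fixes a :: "'a::euclidean_space"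
  assumes "0 < l"
  obtains S where "S \<subseteq> Basis" "\<And>T. T \<subseteq> Basis \<Longrightarrow> T \<noteq> S \<Longrightarrow> x \<notin> cube (subcorner a l T) (l / 2)"
proof (cases "\<exists>S\<subseteq>Basis. x \<in> cube (subcorner a l S) (l / 2)")
  case True
  then obtain S where S: "S \<subseteq> Basis" "x \<in> cube (subcorner a l S) (l / 2)" by blast
  show thesis
  proof (rule that[OF S(1)])
    fix T :: "'a set" assume "T \<subseteq> Basis" "T \<noteq> S"
    then have "cube (subcorner a l T) (l / 2) \<inter> cube (subcorner a l S) (l / 2) = {}"
      using cube_subcubes(2)[OF assms, of a] S(1) by (auto simp: disjoint_family_on_def)
    then show "x \<notin> cube (subcorner a l T) (l / 2)" using S(2) by blast
  qed
next
  case False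
  then show thesis using that[of "{}"] by blast
qed

text \<open>At each point at most one child contributes, so a positive power passes through the
  sum.\<close>

lemma dyadic_average_Suc_powr:
  fixes a :: "'a::euclidean_space"
  assumes "0 < l" "0 < q"
  shows "dyadic_average (Suc N) F a l x powr q = (\<Sum>T\<in>Pow Basis. dyadic_average N F (subcorner a l T) (l / 2) x powr q)"
proof -
  obtain S where S: "S \<subseteq> Basis" "\<And>T. T \<subseteq> Basis \<Longrightarrow> T \<noteq> S \<Longrightarrow> x \<notin> cube (subcorner a l T) (l / 2)"
    using dyadic_average_single[OF assms(1)] by blast
  have zero: "dyadic_average N F (subcorner a l T) (l / 2) x = 0" if "T \<in> Pow Basis - {S}" for T
    using that S(2) assms by (intro dyadic_average_outside) auto
  have fin: "finite (Pow (Basis :: 'a set))" by simp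
  have sin: "S \<in> Pow Basis" using S by simp
  show ?thesis
    by (simp add: sum.remove[OF fin sin] zero)
qed

lemma cube_avg_subcubes:
  fixes a :: "'a::euclidean_space"
  assumes [measurable]: "F \<in> borel_measurable borel" and fin: "\<And>a l. (\<integral>\<^sup>+x\<in>cube a l. ennreal (F x) \<partial>lborel) < \<infinity>" and "0 < l"
  shows "cube_avg F a l = (\<Sum>T\<in>Pow Basis. cube_avg F (subcorner a l T) (l / 2)) / 2 ^ DIM('a)"
proof -
  have "enn2real (\<integral>\<^sup>+x\<in>cube a l. ennreal (F x) \<partial>lborel)
      = (\<Sum>T\<in>Pow Basis. enn2real (\<integral>\<^sup>+x\<in>cube (subcorner a l T) (l / 2). ennreal (F x) \<partial>lborel))"
    using fin by (subst nn_integral_cube_subcubes) (auto simp: assms enn2real_sum o_def)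
  then show ?thesis
    using assms(3) by (simp add: cube_avg_def power_divide sum_divide_distrib sum_distrib_left)
qed

lemma cube_integral_eq:
  fixes F :: "'a::euclidean_space \<Rightarrow> real"
  assumes "(\<integral>\<^sup>+x\<in>cube a l. ennreal (F x) \<partial>lborel) < \<infinity>" "0 < l"
  shows "(\<integral>\<^sup>+x\<in>cube a l. ennreal (F x) \<partial>lborel) = ennreal (l ^ DIM('a) * cube_avg F a l)"
  using assms by (simp add: cube_avg_def less_top)

text \<open>The right-hand side is the volume times the Bellman function at the pair of averages
  over the cube. Its values at the children average to at most its value at the cube, which is the
  induction step; at generation zero it dominates \<open>cube_avg \<sigma> a l powr (1 + d)\<close>,
  because the product of averages is at least one.\<close>

lemma dyadic_average_power_bound:
  fixes w \<sigma> :: "'a::euclidean_space \<Rightarrow> real" and d C s :: real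
  assumes [measurable]: "w \<in> borel_measurable borel" "\<sigma> \<in> borel_measurable borel"
    and fin: "\<And>a l. (\<integral>\<^sup>+x\<in>cube a l. ennreal (w x) \<partial>lborel) < \<infinity>" "\<And>a l. (\<integral>\<^sup>+x\<in>cube a l. ennreal (\<sigma> x) \<partial>lborel) < \<infinity>"
    and pos: "\<And>a l. 0 < l \<Longrightarrow> 0 < cube_avg w a l" "\<And>a l. 0 < l \<Longrightarrow> 0 < cube_avg \<sigma> a l"
    and C: "1 \<le> C" "\<And>a l. 0 < l \<Longrightarrow> cube_avg w a l * cube_avg \<sigma> a l powr (s - 1) \<le> C"
    and low: "\<And>a l. 0 < l \<Longrightarrow> 1 \<le> cube_avg w a l * cube_avg \<sigma> a l powr (s - 1)"
    and s: "1 < s" and d: "0 \<le> d" "d \<le> 1" "d \<le> C powr (- 3 / (s - 1)) / (4 * (2 ^ DIM('a))\<^sup>2)" and l: "0 < l"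
  defines "\<alpha> \<equiv> (2 + d) / (s - 1)"
  shows "(\<integral>\<^sup>+x. ennreal (dyadic_average N \<sigma> a l x powr (1 + d)) \<partial>lborel)
     \<le> ennreal (l ^ DIM('a) * (2 * cube_avg \<sigma> a l powr (1 + d) - cube_avg w a l powr (- \<alpha>) / cube_avg \<sigma> a l))"
  using l
proof (induction N arbitrary: a l)
  case (0 a l)
  let ?x = "cube_avg w a l" and ?y = "cube_avg \<sigma> a l"
  have xy: "0 < ?x" "0 < ?y" using pos 0 by auto
  have "?x powr (- \<alpha>) / ?y = (?x * ?y powr (s - 1)) powr (- \<alpha>) * ?y powr (1 + d)"
  proof -
    have "(?x * ?y powr (s - 1)) powr (- \<alpha>) = ?x powr (- \<alpha>) * ?y powr (- (2 + d))"
      using xy s by (simp add: powr_mult powr_powr \<alpha>_def)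
    then have "(?x * ?y powr (s - 1)) powr (- \<alpha>) * ?y powr (1 + d) = ?x powr (- \<alpha>) * ?y powr (- 1)"
      by (simp add: mult.assoc flip: powr_add)
    then show ?thesis using xy by (simp add: powr_minus field_simps)
  qed
  also have "\<dots> \<le> 1 * ?y powr (1 + d)"
  proof (rule mult_right_mono)
    have "(?x * ?y powr (s - 1)) powr (- \<alpha>) \<le> 1 powr (- \<alpha>)"
      using low[OF 0] s d by (intro powr_mono2') (auto simp: \<alpha>_def)
    then show "(?x * ?y powr (s - 1)) powr (- \<alpha>) \<le> 1" by simp
  qed simp
  finally have le: "?y powr (1 + d) \<le> 2 * ?y powr (1 + d) - ?x powr (- \<alpha>) / ?y" by simp
  have "(\<integral>\<^sup>+x. ennreal (dyadic_average 0 \<sigma> a l x powr (1 + d)) \<partial>lborel) = (\<integral>\<^sup>+x. ennreal (?y powr (1 + d)) * indicator (cube a l) x \<partial>lborel)"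
    using d by (intro nn_integral_cong) (auto simp: indicator_def)
  also have "\<dots> = ennreal (?y powr (1 + d)) * emeasure lborel (cube a l)"
    by (rule nn_integral_cmult_indicator) simp
  also have "\<dots> = ennreal (l ^ DIM('a) * ?y powr (1 + d))"
    using 0 by (simp add: emeasure_cube mult.commute flip: ennreal_mult')
  also have "\<dots> \<le> ennreal (l ^ DIM('a) * (2 * ?y powr (1 + d) - ?x powr (- \<alpha>) / ?y))"
    using 0 le by (intro ennreal_leI mult_left_mono) auto
  finally show ?case .
next
  case (Suc N a l)
  let ?c = "\<lambda>T. subcorner a l T" and ?D = "2 ^ DIM('a) :: real"
  let ?b = "\<lambda>T. 2 * cube_avg \<sigma> (?c T) (l / 2) powr (1 + d) - cube_avg w (?c T) (l / 2) powr (- \<alpha>) / cube_avg \<sigma> (?c T) (l / 2)"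
  have l2: "0 < l / 2" using Suc.prems by simp
  have cardD: "?D = real (card (Pow (Basis :: 'a set)))" by (simp add: card_Pow)
  have bell: "(\<Sum>T\<in>Pow Basis. ?b T) / ?D \<le> 2 * cube_avg \<sigma> a l powr (1 + d) - cube_avg w a l powr (- \<alpha>) / cube_avg \<sigma> a l"
    unfolding \<alpha>_def
    by (rule Bellman_average[OF _ cardD _ _ _ _ _ s d C(1)])
      (use pos l2 C(2)[OF Suc.prems] cube_avg_subcubes[OF assms(1) fin(1) Suc.prems] cube_avg_subcubes[OF assms(2) fin(2) Suc.prems] in auto)
  \<comment> \<open>Nonnegativity is required for adding the bounds of the children as extended
    reals; it rests on the same lower bound for the product of averages.\<close>
  have b0: "0 \<le> ?b T" for T
  proof -
    have "0 \<le> 2 * y powr (1 + d) - x powr (- \<alpha>) / y" if "0 < x" "0 < y" "1 \<le> x * y powr (s - 1)" for x y :: real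
    proof -
      have "x powr (- \<alpha>) = x powr (- \<alpha>) * (y powr (s - 1)) powr (- \<alpha>) * y powr (2 + d)"
        using that s by (simp add: powr_powr \<alpha>_def mult.assoc flip: powr_add)
      also have "\<dots> = (x * y powr (s - 1)) powr (- \<alpha>) * y powr (2 + d)"
        using that by (simp add: powr_mult)
      also have "\<dots> \<le> 1 * y powr (2 + d)"
      proof (rule mult_right_mono)
        have "(x * y powr (s - 1)) powr (- \<alpha>) \<le> 1 powr (- \<alpha>)"
          using that s d by (intro powr_mono2') (auto simp: \<alpha>_def)
        then show "(x * y powr (s - 1)) powr (- \<alpha>) \<le> 1" by simp
      qed simp
      also have "1 * y powr (2 + d) = y powr (1 + d) * y"
        using that powr_add[of y "1 + d" 1] by (simp add: add.commute)
      finally have "x powr (- \<alpha>) / y \<le> y powr (1 + d)" using that by (simp add: field_simps)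
      then show ?thesis using powr_ge_zero[of y "1 + d"] by linarith
    qed
    then show ?thesis using pos[OF l2] low[OF l2] by blast
  qed
  have "(\<integral>\<^sup>+x. ennreal (dyadic_average (Suc N) \<sigma> a l x powr (1 + d)) \<partial>lborel)
     = (\<integral>\<^sup>+x. (\<Sum>T\<in>Pow Basis. ennreal (dyadic_average N \<sigma> (?c T) (l / 2) x powr (1 + d))) \<partial>lborel)"
    using d Suc.prems by (subst dyadic_average_Suc_powr) (auto intro!: nn_integral_cong simp: sum_ennreal)
  also have "\<dots> = (\<Sum>T\<in>Pow Basis. \<integral>\<^sup>+x. ennreal (dyadic_average N \<sigma> (?c T) (l / 2) x powr (1 + d)) \<partial>lborel)"
    by (rule nn_integral_sum) measurable
  also have "\<dots> \<le> (\<Sum>T\<in>Pow Basis. ennreal ((l / 2) ^ DIM('a) * ?b T))"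
    by (intro sum_mono Suc.IH l2)
  also have "\<dots> = ennreal (\<Sum>T\<in>Pow Basis. (l / 2) ^ DIM('a) * ?b T)"
    using b0 l2 by (intro sum_ennreal mult_nonneg_nonneg) auto
  also have "(\<Sum>T\<in>Pow Basis. (l / 2) ^ DIM('a) * ?b T) = l ^ DIM('a) * ((\<Sum>T\<in>Pow Basis. ?b T) / ?D)"
    by (simp add: sum_distrib_left[symmetric] sum_divide_distrib[symmetric] power_divide)
  also have "ennreal \<dots> \<le> ennreal (l ^ DIM('a) * (2 * cube_avg \<sigma> a l powr (1 + d) - cube_avg w a l powr (- \<alpha>) / cube_avg \<sigma> a l))"
    using Suc.prems bell by (intro ennreal_leI mult_left_mono) auto
  finally show ?case .
qed

text \<open>On a cube of the last generation both \<open>\<sigma>\<close> and its mean are compared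
  with one value of \<open>h\<close>, which explains the factor two. Halving the side while lowering
  \<open>N\<close> keeps \<open>l / 2 ^ N\<close> fixed, so the oscillation hypothesis passes to the
  children.\<close>

lemma dyadic_average_L1_bound:
  fixes \<sigma> h :: "'a::euclidean_space \<Rightarrow> real" and l \<eta> :: real
  assumes [measurable]: "\<sigma> \<in> borel_measurable borel" "h \<in> borel_measurable borel" and \<sigma>: "\<And>x. 0 \<le> \<sigma> x"
    and fin: "\<And>a l. (\<integral>\<^sup>+x\<in>cube a l. ennreal (\<sigma> x) \<partial>lborel) < \<infinity>"
    and "0 < l" "0 \<le> \<eta>" and osc: "\<And>x y. x \<in> cube a l \<Longrightarrow> y \<in> cube a l \<Longrightarrow> dist x y \<le> DIM('a) * l / 2 ^ N \<Longrightarrow> \<bar>h x - h y\<bar> \<le> \<eta>"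
  shows "(\<integral>\<^sup>+x\<in>cube a l. ennreal \<bar>dyadic_average N \<sigma> a l x - \<sigma> x\<bar> \<partial>lborel)
     \<le> 2 * (\<integral>\<^sup>+x\<in>cube a l. ennreal \<bar>\<sigma> x - h x\<bar> \<partial>lborel) + ennreal (2 * \<eta> * l ^ DIM('a))"
  using assms(5,7)
proof (induction N arbitrary: a l)
  case (0 a l)
  let ?Q = "cube a l" and ?v = "l ^ DIM('a)"
  have v: "0 < ?v" using 0 by simp
  have aQ: "a \<in> ?Q" using 0 by (simp add: cube_def)
  have dQ: "dist x y \<le> DIM('a) * l" if "x \<in> ?Q" "y \<in> ?Q" for x y
  proof (rule dist_le_cube)
    fix b :: 'a assume "b \<in> Basis"
    then have "a \<bullet> b \<le> x \<bullet> b" "x \<bullet> b < a \<bullet> b + l" "a \<bullet> b \<le> y \<bullet> b" "y \<bullet> b < a \<bullet> b + l"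
      using that by (auto simp: cube_def)
    then show "\<bar>x \<bullet> b - y \<bullet> b\<bar> \<le> l" by linarith
  qed
  define k where "k = h a"
  define I where "I = (\<integral>\<^sup>+x\<in>?Q. ennreal \<bar>\<sigma> x - k\<bar> \<partial>lborel)"
  have I: "I \<le> (\<integral>\<^sup>+x\<in>?Q. ennreal \<bar>\<sigma> x - h x\<bar> \<partial>lborel) + ennreal (\<eta> * ?v)"
  proof -
    have "I \<le> (\<integral>\<^sup>+x. ennreal \<bar>\<sigma> x - h x\<bar> * indicator ?Q x + ennreal \<eta> * indicator ?Q x \<partial>lborel)"
      unfolding I_def
    proof (intro nn_integral_mono)
      fix x
      have "\<bar>\<sigma> x - k\<bar> \<le> \<bar>\<sigma> x - h x\<bar> + \<eta>" if "x \<in> ?Q"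
        using 0(2)[OF that aQ] dQ[OF that aQ] by (simp add: k_def)
      then show "ennreal \<bar>\<sigma> x - k\<bar> * indicator ?Q x \<le> ennreal \<bar>\<sigma> x - h x\<bar> * indicator ?Q x + ennreal \<eta> * indicator ?Q x"
        using \<open>0 \<le> \<eta>\<close> by (auto simp: indicator_def ennreal_leI simp flip: ennreal_plus)
    qed
    also have "\<dots> = (\<integral>\<^sup>+x\<in>?Q. ennreal \<bar>\<sigma> x - h x\<bar> \<partial>lborel) + ennreal \<eta> * emeasure lborel ?Q"
      by (simp add: nn_integral_add nn_integral_cmult_indicator)
    finally show ?thesis using 0 \<open>0 \<le> \<eta>\<close> by (simp add: emeasure_cube flip: ennreal_mult')
  qed
  have mean: "ennreal (?v * \<bar>cube_avg \<sigma> a l - k\<bar>) \<le> I"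
  proof -
    have i1: "integrable lborel (\<lambda>x. indicator ?Q x *\<^sub>R \<sigma> x)"
    proof (rule integrableI_bounded)
      show "(\<lambda>x. indicator ?Q x *\<^sub>R \<sigma> x) \<in> borel_measurable lborel"
        by (intro borel_measurable_scaleR borel_measurable_indicator) auto
      have "(\<integral>\<^sup>+x. ennreal (norm (indicator ?Q x *\<^sub>R \<sigma> x)) \<partial>lborel) = (\<integral>\<^sup>+x\<in>?Q. ennreal (\<sigma> x) \<partial>lborel)"
        using \<sigma> by (intro nn_integral_cong) (auto simp: indicator_def)
      then show "(\<integral>\<^sup>+x. ennreal (norm (indicator ?Q x *\<^sub>R \<sigma> x)) \<partial>lborel) < \<infinity>" using fin by simp
    qed
    have i2: "integrable lborel (\<lambda>x. indicator ?Q x *\<^sub>R k)"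
      using 0 by (intro integrable_scaleR_left integrable_real_indicator) (auto simp: emeasure_cube)
    have e1: "(LINT x|lborel. indicator ?Q x *\<^sub>R \<sigma> x) = ?v * cube_avg \<sigma> a l"
    proof (subst integral_eq_nn_integral)
      have "(\<integral>\<^sup>+x. ennreal (indicator ?Q x *\<^sub>R \<sigma> x) \<partial>lborel) = (\<integral>\<^sup>+x\<in>?Q. ennreal (\<sigma> x) \<partial>lborel)"
        by (intro nn_integral_cong) (auto simp: indicator_def)
      then show "enn2real (\<integral>\<^sup>+x. ennreal (indicator ?Q x *\<^sub>R \<sigma> x) \<partial>lborel) = ?v * cube_avg \<sigma> a l"
        using 0(1) by (simp add: cube_avg_def)
    qed (use i1 \<sigma> in auto)
    have e2: "(LINT x|lborel. indicator ?Q x *\<^sub>R k) = ?v * k"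
      using 0 by (simp add: measure_def emeasure_cube)
    have "?v * \<bar>cube_avg \<sigma> a l - k\<bar> = norm (LINT x|lborel. indicator ?Q x *\<^sub>R \<sigma> x - indicator ?Q x *\<^sub>R k)"
    proof -
      have "?v * \<bar>cube_avg \<sigma> a l - k\<bar> = \<bar>?v * cube_avg \<sigma> a l - ?v * k\<bar>"
        using v by (simp only: right_diff_distrib [symmetric] abs_mult abs_of_pos)
      then show ?thesis
        unfolding Bochner_Integration.integral_diff[OF i1 i2] e1 e2 real_norm_def .
    qed
    then have "ennreal (?v * \<bar>cube_avg \<sigma> a l - k\<bar>) \<le> (\<integral>\<^sup>+x. ennreal (norm (indicator ?Q x *\<^sub>R \<sigma> x - indicator ?Q x *\<^sub>R k)) \<partial>lborel)"
      using integral_norm_bound_ennreal[OF Bochner_Integration.integrable_diff[OF i1 i2]] by simp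
    also have "\<dots> = I" unfolding I_def by (intro nn_integral_cong) (auto simp: indicator_def)
    finally show ?thesis .
  qed
  have "(\<integral>\<^sup>+x\<in>?Q. ennreal \<bar>dyadic_average 0 \<sigma> a l x - \<sigma> x\<bar> \<partial>lborel)
     \<le> (\<integral>\<^sup>+x. ennreal \<bar>cube_avg \<sigma> a l - k\<bar> * indicator ?Q x + ennreal \<bar>\<sigma> x - k\<bar> * indicator ?Q x \<partial>lborel)"
    by (intro nn_integral_mono) (auto simp: indicator_def simp flip: ennreal_plus intro!: ennreal_leI)
  also have "\<dots> = ennreal \<bar>cube_avg \<sigma> a l - k\<bar> * emeasure lborel ?Q + I"
    by (simp add: nn_integral_add nn_integral_cmult_indicator I_def)
  also have "ennreal \<bar>cube_avg \<sigma> a l - k\<bar> * emeasure lborel ?Q = ennreal (?v * \<bar>cube_avg \<sigma> a l - k\<bar>)"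
    using 0 by (simp add: emeasure_cube mult.commute flip: ennreal_mult')
  also have "\<dots> + I \<le> I + I" by (intro add_right_mono mean)
  also have "\<dots> \<le> ((\<integral>\<^sup>+x\<in>?Q. ennreal \<bar>\<sigma> x - h x\<bar> \<partial>lborel) + ennreal (\<eta> * ?v)) + ((\<integral>\<^sup>+x\<in>?Q. ennreal \<bar>\<sigma> x - h x\<bar> \<partial>lborel) + ennreal (\<eta> * ?v))"
    by (intro add_mono I)
  also have "\<dots> = 2 * (\<integral>\<^sup>+x\<in>?Q. ennreal \<bar>\<sigma> x - h x\<bar> \<partial>lborel) + (ennreal (\<eta> * ?v) + ennreal (\<eta> * ?v))"
    by (simp add: mult_2 ac_simps)
  also have "ennreal (\<eta> * ?v) + ennreal (\<eta> * ?v) = ennreal (2 * \<eta> * ?v)"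
    using v \<open>0 \<le> \<eta>\<close> by (simp flip: ennreal_plus)
  finally show ?case .
next
  case (Suc N a l)
  let ?c = "\<lambda>T. subcorner a l T"
  have l2: "0 < l / 2" using Suc.prems by simp
  have child: "(\<integral>\<^sup>+x\<in>cube (?c T) (l / 2). ennreal \<bar>dyadic_average (Suc N) \<sigma> a l x - \<sigma> x\<bar> \<partial>lborel)
      \<le> 2 * (\<integral>\<^sup>+x\<in>cube (?c T) (l / 2). ennreal \<bar>\<sigma> x - h x\<bar> \<partial>lborel) + ennreal (2 * \<eta> * (l / 2) ^ DIM('a))"
    if T: "T \<in> Pow Basis" for T
  proof -
    have sub: "cube (?c T) (l / 2) \<subseteq> cube a l"
      using cube_subcubes(1)[OF Suc.prems(1), of a] T by blast
    have eq: "dyadic_average (Suc N) \<sigma> a l x = dyadic_average N \<sigma> (?c T) (l / 2) x" if x: "x \<in> cube (?c T) (l / 2)" for x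
    proof -
      have zero: "dyadic_average N \<sigma> (?c S) (l / 2) x = 0" if "S \<in> Pow Basis - {T}" for S
      proof (rule dyadic_average_outside[OF l2])
        have "cube (?c S) (l / 2) \<inter> cube (?c T) (l / 2) = {}"
          using cube_subcubes(2)[OF Suc.prems(1), of a] that T unfolding disjoint_family_on_def by auto
        then show "x \<notin> cube (?c S) (l / 2)" using x by blast
      qed
      show ?thesis using T by (simp add: sum.remove[of "Pow Basis" T] zero)
    qed
    have "(\<integral>\<^sup>+x\<in>cube (?c T) (l / 2). ennreal \<bar>dyadic_average (Suc N) \<sigma> a l x - \<sigma> x\<bar> \<partial>lborel)
       = (\<integral>\<^sup>+x\<in>cube (?c T) (l / 2). ennreal \<bar>dyadic_average N \<sigma> (?c T) (l / 2) x - \<sigma> x\<bar> \<partial>lborel)"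
      by (intro nn_integral_cong) (use eq in \<open>auto simp: indicator_def simp del: dyadic_average.simps\<close>)
    also have "\<dots> \<le> 2 * (\<integral>\<^sup>+x\<in>cube (?c T) (l / 2). ennreal \<bar>\<sigma> x - h x\<bar> \<partial>lborel) + ennreal (2 * \<eta> * (l / 2) ^ DIM('a))"
    proof (rule Suc.IH[OF l2])
      fix x y assume "x \<in> cube (?c T) (l / 2)" "y \<in> cube (?c T) (l / 2)" "dist x y \<le> DIM('a) * (l / 2) / 2 ^ N"
      then show "\<bar>h x - h y\<bar> \<le> \<eta>" using sub by (intro Suc.prems(2)) auto
    qed
    finally show ?thesis .
  qed
  have "(\<integral>\<^sup>+x\<in>cube a l. ennreal \<bar>dyadic_average (Suc N) \<sigma> a l x - \<sigma> x\<bar> \<partial>lborel)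
     = (\<Sum>T\<in>Pow Basis. \<integral>\<^sup>+x\<in>cube (?c T) (l / 2). ennreal \<bar>dyadic_average (Suc N) \<sigma> a l x - \<sigma> x\<bar> \<partial>lborel)"
    using Suc.prems by (intro nn_integral_cube_subcubes) measurable
  also have "\<dots> \<le> (\<Sum>T\<in>Pow Basis. 2 * (\<integral>\<^sup>+x\<in>cube (?c T) (l / 2). ennreal \<bar>\<sigma> x - h x\<bar> \<partial>lborel) + ennreal (2 * \<eta> * (l / 2) ^ DIM('a)))"
    by (intro sum_mono child)
  also have "\<dots> = 2 * (\<Sum>T\<in>Pow Basis. \<integral>\<^sup>+x\<in>cube (?c T) (l / 2). ennreal \<bar>\<sigma> x - h x\<bar> \<partial>lborel)
       + (\<Sum>T\<in>Pow (Basis :: 'a set). ennreal (2 * \<eta> * (l / 2) ^ DIM('a)))"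
    by (simp only: sum.distrib sum_distrib_left)
  also have "(\<Sum>T\<in>Pow Basis. \<integral>\<^sup>+x\<in>cube (?c T) (l / 2). ennreal \<bar>\<sigma> x - h x\<bar> \<partial>lborel) = (\<integral>\<^sup>+x\<in>cube a l. ennreal \<bar>\<sigma> x - h x\<bar> \<partial>lborel)"
    using Suc.prems by (intro nn_integral_cube_subcubes[symmetric]) measurable
  also have "(\<Sum>T\<in>Pow (Basis :: 'a set). ennreal (2 * \<eta> * (l / 2) ^ DIM('a))) = ennreal (\<Sum>T\<in>Pow (Basis :: 'a set). 2 * \<eta> * (l / 2) ^ DIM('a))"
    using \<open>0 \<le> \<eta>\<close> Suc.prems by (intro sum_ennreal) auto
  also have "(\<Sum>T\<in>Pow (Basis :: 'a set). 2 * \<eta> * (l / 2) ^ DIM('a)) = 2 * \<eta> * l ^ DIM('a)"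
    by (simp add: card_Pow power_divide)
  finally show ?case .
qed

lemma cube_empty:
  fixes l :: real
  assumes "l \<le> 0"
  shows "cube a l = {}"
proof -
  have "x \<notin> cube a l" for x
  proof
    assume "x \<in> cube a l"
    then have "a \<bullet> (SOME b. b \<in> Basis) \<le> x \<bullet> (SOME b. b \<in> Basis)" "x \<bullet> (SOME b. b \<in> Basis) < a \<bullet> (SOME b. b \<in> Basis) + l"
      using SOME_Basis by (auto simp: cube_def)
    then show False using assms by linarith
  qed
  then show ?thesis by blast
qed

lemma cube_subset_cball:
  fixes a :: "'a::euclidean_space" and l :: real
  assumes "0 < l"
  shows "cube a l \<subseteq> cball a (DIM('a) * l)"
proof
  fix x assume "x \<in> cube a l"
  then have "dist a x \<le> DIM('a) * l"
    by (intro dist_le_cube) (fastforce simp: cube_def)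
  then show "x \<in> cball a (DIM('a) * l)" by simp
qed

text \<open>A mean-convergence form of Lebesgue differentiation: \<open>\<sigma>\<close> is replaced
  by a nearby continuous function, which is uniformly continuous on a ball containing the cube, and
  the generation is taken so large that it hardly oscillates on its cubes.\<close>

lemma dyadic_average_tendsto_L1:
  fixes \<sigma> :: "'a::euclidean_space \<Rightarrow> real" and l :: real
  assumes [measurable]: "\<sigma> \<in> borel_measurable borel" and \<sigma>: "\<And>x. 0 \<le> \<sigma> x"
    and fin: "\<And>z R. (\<integral>\<^sup>+x\<in>cball z R. ennreal (\<sigma> x) \<partial>lborel) < \<infinity>" and "0 < l"
  shows "(\<lambda>N. \<integral>\<^sup>+x\<in>cube a l. ennreal \<bar>dyadic_average N \<sigma> a l x - \<sigma> x\<bar> \<partial>lborel) \<longlonglongrightarrow> 0"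
proof (rule order_tendstoI)
  fix c :: ennreal assume "0 < c"
  obtain e where e: "0 < e" "ennreal e < c" using ennreal_dense_real[OF \<open>0 < c\<close>] by blast
  let ?R = "DIM('a) * l" and ?v = "l ^ DIM('a)"
  have cfin: "(\<integral>\<^sup>+x\<in>cube a l. ennreal (\<sigma> x) \<partial>lborel) < \<infinity>" if "0 < l" for a l
  proof (rule le_less_trans[OF _ fin[of a "DIM('a) * l"]])
    show "(\<integral>\<^sup>+x\<in>cube a l. ennreal (\<sigma> x) \<partial>lborel) \<le> (\<integral>\<^sup>+x\<in>cball a (DIM('a) * l). ennreal (\<sigma> x) \<partial>lborel)"
      using cube_subset_cball[OF that, of a] by (intro nn_integral_mono) (auto simp: indicator_def)
  qed
  have cfin': "(\<integral>\<^sup>+x\<in>cube a l. ennreal (\<sigma> x) \<partial>lborel) < \<infinity>" for a l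
  proof (cases "0 < l")
    case False
    then show ?thesis by (simp add: cube_empty)
  qed (rule cfin)
  have "(\<integral>\<^sup>+x\<in>cball a ?R. ennreal (norm (\<sigma> x)) \<partial>lborel) < \<infinity>" using fin[of a ?R] \<sigma> by simp
  then obtain h where h: "continuous_on UNIV h" "(\<integral>\<^sup>+x\<in>cball a ?R. ennreal (norm (\<sigma> x - h x)) \<partial>lborel) < ennreal (e / 4)"
    using continuous_approximation_L1[of \<sigma> a ?R "e / 4"] e(1) by auto
  have [measurable]: "h \<in> borel_measurable borel" using h(1) by (rule borel_measurable_continuous_onI)
  define \<eta> where "\<eta> = e / (4 * ?v)"
  have \<eta>: "0 < \<eta>" "2 * \<eta> * ?v = e / 2" using e \<open>0 < l\<close> by (auto simp: \<eta>_def field_simps)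
  have "uniformly_continuous_on (cball a ?R) h"
    by (intro compact_uniformly_continuous continuous_on_subset[OF h(1)]) auto
  then obtain d where d: "0 < d" "\<And>x y. x \<in> cball a ?R \<Longrightarrow> y \<in> cball a ?R \<Longrightarrow> dist y x < d \<Longrightarrow> dist (h y) (h x) < \<eta>"
    using \<eta>(1) unfolding uniformly_continuous_on_def by metis
  have "0 < d / (?R + 1)" using d \<open>0 < l\<close> by (intro divide_pos_pos add_nonneg_pos) auto
  then obtain N0 where N0: "(1 / 2) ^ N0 < d / (?R + 1)" using real_arch_pow_inv[of _ "1 / 2"] by auto
  show "eventually (\<lambda>N. (\<integral>\<^sup>+x\<in>cube a l. ennreal \<bar>dyadic_average N \<sigma> a l x - \<sigma> x\<bar> \<partial>lborel) < c) sequentially"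
    using eventually_ge_at_top[of N0]
  proof eventually_elim
    case (elim N)
    have "(1 / 2 :: real) ^ N \<le> (1 / 2) ^ N0" using elim by (intro power_decreasing) auto
    then have "(1 / 2) ^ N < d / (?R + 1)" using N0 by linarith
    then have small: "?R / 2 ^ N < d"
    proof -
      assume *: "(1 / 2) ^ N < d / (?R + 1)"
      have "0 < ?R" using \<open>0 < l\<close> by simp
      then have "(1 / 2) ^ N * (?R + 1) < d" using * by (simp add: field_simps)
      moreover have "?R / 2 ^ N \<le> (1 / 2) ^ N * (?R + 1)" by (simp add: power_one_over field_simps)
      ultimately show ?thesis by linarith
    qed
    have "(\<integral>\<^sup>+x\<in>cube a l. ennreal \<bar>dyadic_average N \<sigma> a l x - \<sigma> x\<bar> \<partial>lborel)
       \<le> 2 * (\<integral>\<^sup>+x\<in>cube a l. ennreal \<bar>\<sigma> x - h x\<bar> \<partial>lborel) + ennreal (2 * \<eta> * ?v)"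
    proof (rule dyadic_average_L1_bound)
      fix x y assume "x \<in> cube a l" "y \<in> cube a l" "dist x y \<le> DIM('a) * l / 2 ^ N"
      then have "dist (h x) (h y) < \<eta>"
        using small cube_subset_cball[OF \<open>0 < l\<close>, of a] by (intro d(2)) auto
      then show "\<bar>h x - h y\<bar> \<le> \<eta>" by (simp add: dist_real_def)
    qed (use \<eta> \<sigma> \<open>0 < l\<close> cfin' in auto)
    also have "\<dots> \<le> 2 * (\<integral>\<^sup>+x\<in>cball a ?R. ennreal (norm (\<sigma> x - h x)) \<partial>lborel) + ennreal (2 * \<eta> * ?v)"
      using cube_subset_cball[OF \<open>0 < l\<close>, of a]
      by (intro add_right_mono mult_left_mono nn_integral_mono) (auto simp: indicator_def)
    also have "\<dots> \<le> 2 * ennreal (e / 4) + ennreal (e / 2)"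
      unfolding \<eta>(2) using h(2) by (intro add_mono mult_left_mono) auto
    also have "\<dots> = ennreal e" using e
      by (simp flip: ennreal_plus ennreal_numeral ennreal_mult')
    finally show ?case using e(2) by (rule le_less_trans)
  qed
qed auto

text \<open>The Bellman bound is uniform in the generation, and Fatou's lemma carries it to
  \<open>\<sigma>\<close> along a subsequence converging almost everywhere. The factor two is the
  coefficient in the Bellman function, whose negative term is dropped.\<close>

lemma reverse_Holder_cube:
  fixes w \<sigma> :: "'a::euclidean_space \<Rightarrow> real" and d C s l :: real
  assumes [measurable]: "w \<in> borel_measurable borel" "\<sigma> \<in> borel_measurable borel" and \<sigma>: "\<And>x. 0 \<le> \<sigma> x"
    and fin: "\<And>a l. (\<integral>\<^sup>+x\<in>cube a l. ennreal (w x) \<partial>lborel) < \<infinity>" "\<And>z R. (\<integral>\<^sup>+x\<in>cball z R. ennreal (\<sigma> x) \<partial>lborel) < \<infinity>"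
      "\<And>a l. (\<integral>\<^sup>+x\<in>cube a l. ennreal (\<sigma> x) \<partial>lborel) < \<infinity>"
    and pos: "\<And>a l. 0 < l \<Longrightarrow> 0 < cube_avg w a l" "\<And>a l. 0 < l \<Longrightarrow> 0 < cube_avg \<sigma> a l"
    and C: "1 \<le> C" "\<And>a l. 0 < l \<Longrightarrow> cube_avg w a l * cube_avg \<sigma> a l powr (s - 1) \<le> C"
    and low: "\<And>a l. 0 < l \<Longrightarrow> 1 \<le> cube_avg w a l * cube_avg \<sigma> a l powr (s - 1)"
    and s: "1 < s" and d: "0 \<le> d" "d \<le> 1" "d \<le> C powr (- 3 / (s - 1)) / (4 * (2 ^ DIM('a))\<^sup>2)" and l: "0 < l"
  shows "(\<integral>\<^sup>+x\<in>cube a l. ennreal (\<sigma> x powr (1 + d)) \<partial>lborel) \<le> ennreal (2 * l ^ DIM('a) * cube_avg \<sigma> a l powr (1 + d))"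
proof -
  let ?S = "\<lambda>N x. dyadic_average N \<sigma> a l x" and ?B = "ennreal (2 * l ^ DIM('a) * cube_avg \<sigma> a l powr (1 + d))"
  have S_le: "(\<integral>\<^sup>+x. ennreal (?S N x powr (1 + d)) \<partial>lborel) \<le> ?B" for N
  proof (rule order_trans[OF dyadic_average_power_bound[OF assms(1,2) fin(1,3) pos C low s d l]])
    have "2 * cube_avg \<sigma> a l powr (1 + d) - cube_avg w a l powr (- ((2 + d) / (s - 1))) / cube_avg \<sigma> a l \<le> 2 * cube_avg \<sigma> a l powr (1 + d)"
      using pos[OF l] by (simp add: less_imp_le)
    then have "l ^ DIM('a) * (2 * cube_avg \<sigma> a l powr (1 + d) - cube_avg w a l powr (- ((2 + d) / (s - 1))) / cube_avg \<sigma> a l)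
      \<le> l ^ DIM('a) * (2 * cube_avg \<sigma> a l powr (1 + d))"
      using l by (intro mult_left_mono) auto
    then show "ennreal (l ^ DIM('a) * (2 * cube_avg \<sigma> a l powr (1 + d) - cube_avg w a l powr (- ((2 + d) / (s - 1))) / cube_avg \<sigma> a l)) \<le> ?B"
      by (intro ennreal_leI) (simp add: mult_ac)
  qed
  have a_meas: "(\<lambda>x. ennreal \<bar>?S N x - \<sigma> x\<bar> * indicator (cube a l) x) \<in> borel_measurable lborel" for N by measurable
  obtain r where r: "strict_mono r" "AE x in lborel. (\<lambda>N. ennreal \<bar>?S (r N) x - \<sigma> x\<bar> * indicator (cube a l) x) \<longlonglongrightarrow> 0"
    by (rule nn_integral_tendsto_zero_AE_subseq[OF a_meas dyadic_average_tendsto_L1[OF assms(2) \<sigma> fin(2) l]])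
  have "(\<integral>\<^sup>+x\<in>cube a l. ennreal (\<sigma> x powr (1 + d)) \<partial>lborel) \<le> (\<integral>\<^sup>+x. liminf (\<lambda>N. ennreal (?S (r N) x powr (1 + d))) \<partial>lborel)"
  proof (rule nn_integral_mono_AE)
    show "AE x in lborel. ennreal (\<sigma> x powr (1 + d)) * indicator (cube a l) x \<le> liminf (\<lambda>N. ennreal (?S (r N) x powr (1 + d)))"
      using r(2)
    proof eventually_elim
      case (elim x)
      show ?case
      proof (cases "x \<in> cube a l")
        case True
        then have "(\<lambda>N. ennreal \<bar>?S (r N) x - \<sigma> x\<bar>) \<longlonglongrightarrow> ennreal 0" using elim by simp
        then have "(\<lambda>N. \<bar>?S (r N) x - \<sigma> x\<bar>) \<longlonglongrightarrow> 0" by (subst (asm) tendsto_ennreal_iff) auto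
        then have "(\<lambda>N. ?S (r N) x) \<longlonglongrightarrow> \<sigma> x"
          by (rule LIM_zero_cancel[OF tendsto_rabs_zero_cancel])
        moreover have "eventually (\<lambda>N. 0 \<le> ?S (r N) x) sequentially"
          by (intro always_eventually allI dyadic_average_nonneg l)
        ultimately have "(\<lambda>N. ?S (r N) x powr (1 + d)) \<longlonglongrightarrow> \<sigma> x powr (1 + d)"
          using d by (intro tendsto_powr' tendsto_const) auto
        then have "(\<lambda>N. ennreal (?S (r N) x powr (1 + d))) \<longlonglongrightarrow> ennreal (\<sigma> x powr (1 + d))"
          by (rule tendsto_ennrealI)
        then have "liminf (\<lambda>N. ennreal (?S (r N) x powr (1 + d))) = ennreal (\<sigma> x powr (1 + d))"
          by (intro lim_imp_Liminf) auto
        then show ?thesis using True by simp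
      qed simp
    qed
  qed
  also have "\<dots> \<le> liminf (\<lambda>N. \<integral>\<^sup>+x. ennreal (?S (r N) x powr (1 + d)) \<partial>lborel)"
    by (rule nn_integral_liminf) measurable
  also have "\<dots> \<le> liminf (\<lambda>N::nat. ?B)"
    by (intro Liminf_mono always_eventually allI S_le)
  also have "\<dots> = ?B" by (simp add: Liminf_const)
  finally show ?thesis .
qed

section \<open>Muckenhoupt bounds on balls\<close>

context positive_weight
begin

text \<open>The \<open>A_r\<close> condition with constant \<open>K\<close>, solved for the integral
  of the dual weight \<open>w powr (- 1 / (r - 1))\<close>. In this form it includes the finiteness
  of that integral.\<close>

definition Ap_bound :: "real \<Rightarrow> real \<Rightarrow> bool" where
  "Ap_bound r K \<longleftrightarrow> (\<forall>z t. 0 < t \<longrightarrow>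
     (\<integral>\<^sup>+x\<in>ball z t. ennreal (w x powr (- 1 / (r - 1))) \<partial>lborel)
       \<le> ennreal (ball_vol TYPE('a) t * (K * ball_vol TYPE('a) t / W (ball z t)) powr (1 / (r - 1))))"

text \<open>The \<open>A_1\<close> condition ball by ball; the exceptional null set may depend on
  the ball, and no maximal function appears.\<close>

definition A1_bound :: "real \<Rightarrow> bool" where
  "A1_bound K \<longleftrightarrow> (\<forall>z t. 0 < t \<longrightarrow> (AE x in lborel. x \<in> ball z t \<longrightarrow> W (ball z t) \<le> K * ball_vol TYPE('a) t * w x))"

text \<open>Hoelder's inequality for \<open>h\<close> written as
  \<open>(h powr r * w) powr (1 / r)\<close> times a power of the dual weight.\<close>

lemma Ap_bound_averaging:
  assumes "Ap_bound r K" "1 < r" "0 \<le> K"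
  shows "averaging_bound r K"
  unfolding averaging_bound_def
proof (intro allI impI)
  fix z t h X
  assume t: "0 < t" and [measurable]: "h \<in> borel_measurable borel" and h: "\<forall>x. 0 \<le> h x" and X: "0 \<le> X"
    "(\<integral>\<^sup>+x\<in>ball z t. ennreal (h x powr r * w x) \<partial>lborel) \<le> ennreal X"
  let ?v = "ball_vol TYPE('a) t" and ?W = "W (ball z t)"
  let ?F = "\<lambda>x. h x powr r * w x * indicator (ball z t) x" and ?G = "\<lambda>x. w x powr (- 1 / (r - 1)) * indicator (ball z t) x"
  have v: "0 < ?v" using t by simp
  have W: "0 < ?W" using t by (rule W_ball_pos)
  have ind [measurable]: "(\<lambda>x. indicator (ball z t) x :: real) \<in> borel_measurable borel"
    by (intro borel_measurable_indicator) auto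
  have exp: "(1 / (r - 1)) * (1 - 1 / r) = 1 / r" using assms by (simp add: field_simps)
  have "(\<integral>\<^sup>+x\<in>ball z t. ennreal (h x) \<partial>lborel) = (\<integral>\<^sup>+x. ennreal (?F x powr (1 / r) * ?G x powr (1 - 1 / r)) \<partial>lborel)"
  proof (intro nn_integral_cong)
    fix x
    have wx: "w x powr (1 / r) * (w x powr (- 1 / (r - 1))) powr (1 - 1 / r) = 1"
    proof -
      have "(- 1 / (r - 1)) * (1 - 1 / r) = - (1 / r)" using exp by (simp add: field_simps)
      then show ?thesis using w_pos[of x] by (simp add: powr_powr flip: powr_add)
    qed
    have E: "(h x powr r * w x) powr (1 / r) * (w x powr (- 1 / (r - 1))) powr (1 - 1 / r)
       = h x * (w x powr (1 / r) * (w x powr (- 1 / (r - 1))) powr (1 - 1 / r))"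
      using h w_pos[of x] assms by (simp add: powr_mult powr_powr)
    show "ennreal (h x) * indicator (ball z t) x = ennreal (?F x powr (1 / r) * ?G x powr (1 - 1 / r))"
    proof (cases "x \<in> ball z t")
      case True
      then show ?thesis by (simp only: indicator_simps mult_1_right E wx)
    next
      case False
      then show ?thesis by simp
    qed
  qed
  also have "\<dots> \<le> ennreal (X powr (1 / r) * (?v * (K * ?v / ?W) powr (1 / (r - 1))) powr (1 - 1 / r))"
  proof (rule nn_integral_Holder)
    show "(\<integral>\<^sup>+x. ennreal (?F x) \<partial>lborel) \<le> ennreal X"
      using X(2) by (simp add: ennreal_mult'' ennreal_indicator)
    show "(\<integral>\<^sup>+x. ennreal (?G x) \<partial>lborel) \<le> ennreal (?v * (K * ?v / ?W) powr (1 / (r - 1)))"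
      using assms(1) t unfolding Ap_bound_def by (simp add: ennreal_mult'' ennreal_indicator)
  qed (use assms h X w_pos[THEN less_imp_le] v in \<open>auto intro!: mult_nonneg_nonneg simp: ind\<close>)
  also have "X powr (1 / r) * (?v * (K * ?v / ?W) powr (1 / (r - 1))) powr (1 - 1 / r) = ?v * (K * X / ?W) powr (1 / r)"
  proof -
    have "(?v * (K * ?v / ?W) powr (1 / (r - 1))) powr (1 - 1 / r) = ?v powr (1 - 1 / r) * (K * ?v / ?W) powr (1 / r)"
      using v by (simp only: powr_mult powr_powr exp)
    also have "(K * ?v / ?W) powr (1 / r) = ?v powr (1 / r) * (K / ?W) powr (1 / r)"
      using v W assms by (simp add: mult_ac flip: powr_mult)
    also have "?v powr (1 - 1 / r) * (?v powr (1 / r) * (K / ?W) powr (1 / r)) = ?v * (K / ?W) powr (1 / r)"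
      using v by (simp add: mult.assoc[symmetric] flip: powr_add)
    finally show ?thesis
      using v W assms X by (simp add: powr_mult powr_divide)
  qed
  finally show "(\<integral>\<^sup>+x\<in>ball z t. ennreal (h x) \<partial>lborel) \<le> ennreal (?v * (K * X / ?W) powr (1 / r))" .
qed

text \<open>Hoelder's inequality against the constant one. The constant \<open>K\<close> is
  preserved, so the Muckenhoupt constants decrease in the exponent.\<close>

lemma Ap_bound_mono:
  assumes "Ap_bound s K" "1 < s" "s \<le> r" "0 \<le> K"
  shows "Ap_bound r K"
  unfolding Ap_bound_def
proof (intro allI impI)
  fix z :: 'a and t :: real assume t: "0 < t"
  let ?v = "ball_vol TYPE('a) t" and ?W = "W (ball z t)" and ?\<theta> = "(s - 1) / (r - 1)"
  let ?F = "\<lambda>x. w x powr (- 1 / (s - 1)) * indicator (ball z t) x" and ?G = "\<lambda>x. indicator (ball z t) x :: real"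
  have v: "0 < ?v" using t by simp
  have W: "0 < ?W" using t by (rule W_ball_pos)
  have ind [measurable]: "(\<lambda>x. indicator (ball z t) x :: real) \<in> borel_measurable borel"
    by (intro borel_measurable_indicator) auto
  have \<theta>: "0 \<le> ?\<theta>" "?\<theta> \<le> 1" using assms by auto
  have ne: "s - 1 \<noteq> 0" "r - 1 \<noteq> 0" using assms by auto
  then have e1: "- 1 / (s - 1) * ?\<theta> = - 1 / (r - 1)" and e2: "1 / (s - 1) * ?\<theta> = 1 / (r - 1)" by auto
  have "(\<integral>\<^sup>+x\<in>ball z t. ennreal (w x powr (- 1 / (r - 1))) \<partial>lborel) = (\<integral>\<^sup>+x. ennreal (?F x powr ?\<theta> * ?G x powr (1 - ?\<theta>)) \<partial>lborel)"
    by (intro nn_integral_cong) (simp only: powr_mult powr_powr e1, auto simp: indicator_def powr_powr e1)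
  also have "\<dots> \<le> ennreal ((?v * (K * ?v / ?W) powr (1 / (s - 1))) powr ?\<theta> * ?v powr (1 - ?\<theta>))"
  proof (rule nn_integral_Holder)
    show "(\<integral>\<^sup>+x. ennreal (?F x) \<partial>lborel) \<le> ennreal (?v * (K * ?v / ?W) powr (1 / (s - 1)))"
      using assms(1) t unfolding Ap_bound_def by (simp add: ennreal_mult'' ennreal_indicator)
    show "(\<integral>\<^sup>+x. ennreal (?G x) \<partial>lborel) \<le> ennreal ?v"
      using t by (simp add: ennreal_indicator emeasure_ball)
  qed (use \<theta> v in \<open>auto simp: ind\<close>)
  also have "(?v * (K * ?v / ?W) powr (1 / (s - 1))) powr ?\<theta> * ?v powr (1 - ?\<theta>) = (?v powr ?\<theta> * ?v powr (1 - ?\<theta>)) * (K * ?v / ?W) powr (1 / (r - 1))"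
    using v by (simp only: powr_mult powr_powr e2 mult_ac)
  also have "?v powr ?\<theta> * ?v powr (1 - ?\<theta>) = ?v" using v by (simp flip: powr_add)
  finally show "(\<integral>\<^sup>+x\<in>ball z t. ennreal (w x powr (- 1 / (r - 1))) \<partial>lborel) \<le> ennreal (?v * (K * ?v / ?W) powr (1 / (r - 1)))" .
qed

lemma A1_bound_averaging:
  assumes "A1_bound K" "0 \<le> K"
  shows "averaging_bound 1 K"
  unfolding averaging_bound_def
proof (intro allI impI)
  fix z t h X
  assume t: "0 < t" and [measurable]: "h \<in> borel_measurable borel" and h: "\<forall>x. 0 \<le> h x" and X: "0 \<le> X"
    "(\<integral>\<^sup>+x\<in>ball z t. ennreal (h x powr 1 * w x) \<partial>lborel) \<le> ennreal X"
  let ?v = "ball_vol TYPE('a) t" and ?W = "W (ball z t)"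
  have v: "0 < ?v" using t by simp
  have W: "0 < ?W" using t by (rule W_ball_pos)
  have "AE x in lborel. x \<in> ball z t \<longrightarrow> ?W \<le> K * ?v * w x"
    using assms(1) t unfolding A1_bound_def by blast
  then have "AE x in lborel. ennreal (h x) * indicator (ball z t) x \<le> ennreal (K * ?v / ?W) * (ennreal (h x powr 1 * w x) * indicator (ball z t) x)"
  proof eventually_elim
    case (elim x)
    show ?case
    proof (cases "x \<in> ball z t")
      case True
      then have "1 \<le> K * ?v / ?W * w x" using elim W by (simp add: field_simps)
      then have "h x * 1 \<le> h x * (K * ?v / ?W * w x)" using h by (intro mult_left_mono) auto
      then have "ennreal (h x) \<le> ennreal (K * ?v / ?W * (h x powr 1 * w x))"
        using h by (intro ennreal_leI) (simp add: mult_ac)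
      also have "\<dots> = ennreal (K * ?v / ?W) * ennreal (h x powr 1 * w x)"
        using assms(2) v W by (intro ennreal_mult') auto
      finally show ?thesis using True by simp
    qed simp
  qed
  then have "(\<integral>\<^sup>+x\<in>ball z t. ennreal (h x) \<partial>lborel) \<le> (\<integral>\<^sup>+x. ennreal (K * ?v / ?W) * (ennreal (h x powr 1 * w x) * indicator (ball z t) x) \<partial>lborel)"
    by (rule nn_integral_mono_AE)
  also have "\<dots> = ennreal (K * ?v / ?W) * (\<integral>\<^sup>+x\<in>ball z t. ennreal (h x powr 1 * w x) \<partial>lborel)"
    by (rule nn_integral_cmult) measurable
  also have "\<dots> \<le> ennreal (K * ?v / ?W) * ennreal X" by (intro mult_left_mono X) auto
  also have "\<dots> = ennreal (?v * (K * X / ?W) powr (1 / 1))"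
    using v W assms X by (simp add: mult_ac flip: ennreal_mult'')
  finally show "(\<integral>\<^sup>+x\<in>ball z t. ennreal (h x) \<partial>lborel) \<le> ennreal (?v * (K * X / ?W) powr (1 / 1))" .
qed

lemma A1_bound_imp_Ap_bound:
  assumes "A1_bound K" "0 \<le> K" "1 < r"
  shows "Ap_bound r K"
  unfolding Ap_bound_def
proof (intro allI impI)
  fix z :: 'a and t :: real assume t: "0 < t"
  let ?v = "ball_vol TYPE('a) t" and ?W = "W (ball z t)"
  have v: "0 < ?v" using t by simp
  have W: "0 < ?W" using t by (rule W_ball_pos)
  have "AE x in lborel. x \<in> ball z t \<longrightarrow> ?W \<le> K * ?v * w x"
    using assms(1) t unfolding A1_bound_def by blast
  then have "AE x in lborel. ennreal (w x powr (- 1 / (r - 1))) * indicator (ball z t) x \<le> ennreal ((K * ?v / ?W) powr (1 / (r - 1))) * indicator (ball z t) x"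
  proof eventually_elim
    case (elim x)
    show ?case
    proof (cases "x \<in> ball z t")
      case True
      then have "1 / w x \<le> K * ?v / ?W" using elim W w_pos[of x] by (simp add: field_simps)
      then have "(1 / w x) powr (1 / (r - 1)) \<le> (K * ?v / ?W) powr (1 / (r - 1))"
        using w_pos[of x] assms by (intro powr_mono2) auto
      moreover have "(1 / w x) powr (1 / (r - 1)) = w x powr (- 1 / (r - 1))"
        using w_pos[of x] by (simp add: powr_divide powr_minus field_simps)
      ultimately show ?thesis using True by (simp add: ennreal_leI)
    qed simp
  qed
  then have "(\<integral>\<^sup>+x\<in>ball z t. ennreal (w x powr (- 1 / (r - 1))) \<partial>lborel) \<le> (\<integral>\<^sup>+x\<in>ball z t. ennreal ((K * ?v / ?W) powr (1 / (r - 1))) \<partial>lborel)"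
    by (rule nn_integral_mono_AE)
  also have "\<dots> = ennreal ((K * ?v / ?W) powr (1 / (r - 1))) * emeasure lborel (ball z t)"
    by (rule nn_integral_cmult_indicator) simp
  also have "\<dots> = ennreal (?v * (K * ?v / ?W) powr (1 / (r - 1)))"
    using t v by (simp add: emeasure_ball mult.commute flip: ennreal_mult')
  finally show "(\<integral>\<^sup>+x\<in>ball z t. ennreal (w x powr (- 1 / (r - 1))) \<partial>lborel) \<le> ennreal (?v * (K * ?v / ?W) powr (1 / (r - 1)))" .
qed

text \<open>With \<open>1 / (r - 1)\<close> tending to infinity the conditions bound high power
  means of \<open>1 / w\<close> over the ball. In the limit they bound its essential supremum, with
  the same \<open>K\<close>.\<close>

lemma A1_bound_limit:
  assumes Ap: "\<And>r. 1 < r \<Longrightarrow> Ap_bound r K" and "0 < K"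
  shows "A1_bound K"
  unfolding A1_bound_def
proof (intro allI impI)
  fix z :: 'a and t :: real assume t: "0 < t"
  let ?v = "ball_vol TYPE('a) t" and ?W = "W (ball z t)"
  have v: "0 < ?v" using t by simp
  have W: "0 < ?W" using t by (rule W_ball_pos)
  define m where "m = ?W / (K * ?v)"
  have m: "0 < m" using v W \<open>0 < K\<close> by (simp add: m_def)
  have null: "AE x in lborel. x \<in> ball z t \<longrightarrow> m' \<le> w x" if m': "0 < m'" "m' < m" for m'
  proof -
    define F where "F = {x. x \<in> ball z t \<and> w x < m'}"
    have F_sets [measurable]: "F \<in> sets borel"
    proof -
      have "F = ball z t \<inter> {x. w x < m'}" by (auto simp: F_def)
      moreover have "{x. w x < m'} \<in> sets borel" by measurable
      ultimately show ?thesis by simp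
    qed
    have "emeasure lborel F \<le> emeasure lborel (ball z t)" by (intro emeasure_mono) (auto simp: F_def)
    then have Ff: "emeasure lborel F < \<infinity>" using t by (auto simp: emeasure_ball intro: le_less_trans)
    define f where "f = measure lborel F"
    have f: "emeasure lborel F = ennreal f" using Ff by (simp add: f_def emeasure_eq_ennreal_measure)
    have le: "f \<le> ?v * (m' / m) ^ Suc k" for k
    proof -
      \<comment> \<open>This makes the dual exponent the integer \<open>Suc k\<close>. Comparing the
        powers on the set where \<open>w < m'\<close> then bounds its measure by a geometric
        sequence of ratio \<open>m' / m\<close>.\<close>
      define r where "r = 1 + 1 / real (Suc k)"
      have r: "1 < r" "1 / (r - 1) = real (Suc k)" "- 1 / (r - 1) = - real (Suc k)" by (auto simp: r_def)
      have "ennreal (m' powr (- real (Suc k))) * ennreal f = (\<integral>\<^sup>+x. ennreal (m' powr (- real (Suc k))) * indicator F x \<partial>lborel)"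
        by (subst nn_integral_cmult_indicator) (auto simp: f)
      also have "\<dots> \<le> (\<integral>\<^sup>+x\<in>ball z t. ennreal (w x powr (- 1 / (r - 1))) \<partial>lborel)"
        unfolding r(3)
      proof (intro nn_integral_mono)
        fix x
        show "ennreal (m' powr (- real (Suc k))) * indicator F x \<le> ennreal (w x powr (- real (Suc k))) * indicator (ball z t) x"
          using w_pos[of x] by (auto simp: F_def indicator_def intro!: ennreal_leI powr_mono2')
      qed
      also have "\<dots> \<le> ennreal (?v * (K * ?v / ?W) powr (1 / (r - 1)))"
        using Ap[OF r(1)] t unfolding Ap_bound_def by blast
      also have "(K * ?v / ?W) = 1 / m" by (simp add: m_def)
      finally have le: "m' powr (- real (Suc k)) * f \<le> ?v * (1 / m) powr (real (Suc k))"
        unfolding r(2) using v by (simp add: ennreal_le_iff f_def flip: ennreal_mult')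
      have eqs: "m' powr (- real (Suc k)) = 1 / m' ^ Suc k" "(1 / m) powr (real (Suc k)) = 1 / m ^ Suc k"
        using m' m by (simp_all only: powr_minus powr_realpow zero_less_divide_1_iff power_one_over inverse_eq_divide)
      have "f \<le> ?v * (1 / m ^ Suc k) * m' ^ Suc k"
        using le[unfolded eqs] m' by (simp add: pos_divide_le_eq del: power_Suc)
      then show ?thesis by (simp add: power_divide del: power_Suc)
    qed
    have "(\<lambda>k. ?v * (m' / m) ^ Suc k) \<longlonglongrightarrow> ?v * 0"
      using m m' by (intro tendsto_mult tendsto_const LIMSEQ_Suc LIMSEQ_power_zero) auto
    then have "f \<le> 0" using le by (intro LIMSEQ_le_const[where X="\<lambda>k. ?v * (m' / m) ^ Suc k"]) auto
    then have "F \<in> null_sets lborel" using f by (auto simp: null_sets_def ennreal_neg)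
    then have "AE x in lborel. x \<notin> F" by (rule AE_not_in)
    then show ?thesis by eventually_elim (auto simp: F_def)
  qed
  \<comment> \<open>Countably many levels increasing to \<open>m\<close> keep the exceptional set
    null; the shift by two makes every level positive.\<close>
  have "AE x in lborel. \<forall>j. x \<in> ball z t \<longrightarrow> m * (1 - 1 / real (j + 2)) \<le> w x"
    unfolding AE_all_countable
  proof
    fix j
    have "0 < m * (1 - 1 / real (j + 2))" "m * (1 - 1 / real (j + 2)) < m * 1"
    proof -
      have "0 < 1 - 1 / real (j + 2)" "1 - 1 / real (j + 2) < 1" by auto
      then show "0 < m * (1 - 1 / real (j + 2))" "m * (1 - 1 / real (j + 2)) < m * 1"
        using m by (simp_all only: mult_pos_pos mult_strict_left_mono)
    qed
    then show "AE x in lborel. x \<in> ball z t \<longrightarrow> m * (1 - 1 / real (j + 2)) \<le> w x" by (intro null) auto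
  qed
  then show "AE x in lborel. x \<in> ball z t \<longrightarrow> ?W \<le> K * ?v * w x"
  proof eventually_elim
    case (elim x)
    show ?case
    proof
      assume x: "x \<in> ball z t"
      have "(\<lambda>j. 1 / real (j + 2)) \<longlonglongrightarrow> 0"
        using LIMSEQ_ignore_initial_segment[OF lim_1_over_n, of 2] by simp
      then have "(\<lambda>j. m * (1 - 1 / real (j + 2))) \<longlonglongrightarrow> m * (1 - 0)" by (intro tendsto_intros)
      then have "m * (1 - 0) \<le> w x" by (rule LIMSEQ_le_const2) (use elim x in auto)
      then show "?W \<le> K * ?v * w x" using v \<open>0 < K\<close> by (simp add: m_def field_simps)
    qed
  qed
qed

end

section \<open>Openness of the Muckenhoupt condition\<close>

lemma cube_subset_ball:
  fixes a :: "'a::euclidean_space" and l :: real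
  assumes "0 < l"
  shows "cube a l \<subseteq> ball (a + (l / 2) *\<^sub>R One) (DIM('a) * l)"
proof
  fix x assume x: "x \<in> cube a l"
  have "dist (a + (l / 2) *\<^sub>R One) x \<le> DIM('a) * (l / 2)"
  proof (rule dist_le_cube)
    fix b :: 'a assume b: "b \<in> Basis"
    then have "a \<bullet> b \<le> x \<bullet> b" "x \<bullet> b < a \<bullet> b + l" using x by (auto simp: cube_def)
    then show "\<bar>(a + (l / 2) *\<^sub>R One) \<bullet> b - x \<bullet> b\<bar> \<le> l / 2"
    proof -
      have "(a + (l / 2) *\<^sub>R One) \<bullet> b = a \<bullet> b + l / 2" using b by (simp add: inner_add_left)
      then show ?thesis using \<open>a \<bullet> b \<le> _\<close> \<open>x \<bullet> b < _\<close> by linarith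
    qed
  qed
  also have "\<dots> < DIM('a) * l" using assms by simp
  finally show "x \<in> ball (a + (l / 2) *\<^sub>R One) (DIM('a) * l)" by simp
qed

lemma ball_subset_cube:
  fixes z :: "'a::euclidean_space" and t :: real
  shows "ball z t \<subseteq> cube (z - t *\<^sub>R One) (2 * t)"
proof
  fix x assume x: "x \<in> ball z t"
  have "\<bar>x \<bullet> b - z \<bullet> b\<bar> < t" if "b \<in> Basis" for b
    using Basis_le_norm[OF that, of "x - z"] x by (simp add: inner_diff_left dist_norm norm_minus_commute)
  then show "x \<in> cube (z - t *\<^sub>R One) (2 * t)"
    unfolding cube_def by (auto simp: inner_diff_left abs_less_iff) (smt (verit))+
qed

context positive_weight
begin

lemma W_mono: "ball z t \<subseteq> ball z' t' \<Longrightarrow> W (ball z t) \<le> W (ball z' t')"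
proof -
  assume "ball z t \<subseteq> ball z' t'"
  then have "emeasure (density lborel (\<lambda>x. ennreal (w x))) (ball z t) \<le> emeasure (density lborel (\<lambda>x. ennreal (w x))) (ball z' t')"
    by (intro emeasure_mono) auto
  then show ?thesis by (simp add: emeasure_W_ball)
qed

text \<open>A reverse Hoelder inequality for the dual weight with power \<open>1 + d\<close> is an
  \<open>A\<close>-condition for the exponent whose dual exponent is \<open>1 + d\<close> times
  larger. Passing from balls to cubes and back costs dimensional factors, which enter the
  requirement on \<open>C\<close> and the new constant but not the form of the gain.\<close>

lemma Ap_bound_improve:
  fixes r K C d :: real
  assumes Ap: "Ap_bound r K" and r: "1 < r" and K: "0 \<le> K" and C: "1 \<le> C" "K * (unit_ball_vol DIM('a) * DIM('a) ^ DIM('a)) powr r \<le> C"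
    and d: "0 \<le> d" "d \<le> 1" "d \<le> C powr (- 3 / (r - 1)) / (4 * (2 ^ DIM('a))\<^sup>2)"
  shows "\<exists>K'\<ge>0. Ap_bound (1 + (r - 1) / (1 + d)) K'"
proof -
  define n where "n = DIM('a)"
  define \<omega> where "\<omega> = unit_ball_vol (real n)"
  \<comment> \<open>The ball of radius \<open>n * l\<close> around a cube of side \<open>l\<close>
    has volume \<open>\<kappa> * l ^ n\<close>. It enters once through the averages of
    \<open>w\<close> and \<open>r - 1\<close> times through those of \<open>\<sigma>\<close>, hence
    the power \<open>r\<close> in the assumption.\<close>
  define \<kappa> where "\<kappa> = \<omega> * real n ^ n"
  define \<sigma> where "\<sigma> x = w x powr (- 1 / (r - 1))" for x
  have \<omega>: "0 < \<omega>" by (simp add: \<omega>_def)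
  have n: "0 < n" by (simp add: n_def)
  have \<kappa>: "0 < \<kappa>" using \<omega> n by (simp add: \<kappa>_def)
  have [measurable]: "\<sigma> \<in> borel_measurable borel" unfolding \<sigma>_def[abs_def] by measurable
  have \<sigma>pos: "0 < \<sigma> x" for x using w_pos[of x] by (simp add: \<sigma>_def)
  have \<sigma>ball: "(\<integral>\<^sup>+x\<in>ball z t. ennreal (\<sigma> x) \<partial>lborel) \<le> ennreal (\<omega> * t ^ n * (K * (\<omega> * t ^ n) / W (ball z t)) powr (1 / (r - 1)))"
    if "0 < t" for z t
    using Ap that unfolding Ap_bound_def \<sigma>_def \<omega>_def n_def by blast
  have cube_le: "(\<integral>\<^sup>+x\<in>cube a l. ennreal (F x) \<partial>lborel) \<le> (\<integral>\<^sup>+x\<in>ball (a + (l / 2) *\<^sub>R One) (n * l). ennreal (F x) \<partial>lborel)"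
    if "0 < l" for a and l :: real and F :: "'a \<Rightarrow> real"
    using cube_subset_ball[OF that, of a] by (intro nn_integral_mono) (auto simp: indicator_def n_def)
  have wfin: "(\<integral>\<^sup>+x\<in>cube a l. ennreal (w x) \<partial>lborel) < \<infinity>" for a :: 'a and l :: real
    by (cases "0 < l") (use le_less_trans[OF cube_le w_finite] in \<open>auto simp: cube_empty\<close>)
  have \<sigma>fin: "(\<integral>\<^sup>+x\<in>cube a l. ennreal (\<sigma> x) \<partial>lborel) < \<infinity>" for a :: 'a and l :: real
  proof (cases "0 < l")
    case True
    then have "0 < n * l" using n by simp
    from le_less_trans[OF order_trans[OF cube_le[OF True] \<sigma>ball[OF this]] ennreal_less_top] show ?thesis by simp
  qed (simp add: cube_empty)
  have \<sigma>cball: "(\<integral>\<^sup>+x\<in>cball z R. ennreal (\<sigma> x) \<partial>lborel) < \<infinity>" for z R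
  proof -
    have "(\<integral>\<^sup>+x\<in>cball z R. ennreal (\<sigma> x) \<partial>lborel) \<le> (\<integral>\<^sup>+x\<in>ball z (\<bar>R\<bar> + 1). ennreal (\<sigma> x) \<partial>lborel)"
      by (intro nn_integral_mono) (auto simp: indicator_def)
    also have "\<dots> < \<infinity>"
      by (rule le_less_trans[OF \<sigma>ball]) auto
    finally show ?thesis .
  qed
  have avg_pos: "0 < cube_avg F a l" if "F \<in> borel_measurable borel" "\<And>x. 0 < F x" "(\<integral>\<^sup>+x\<in>cube a l. ennreal (F x) \<partial>lborel) < \<infinity>" "0 < l" for F and a :: 'a and l :: real
  proof -
    have "(\<integral>\<^sup>+x\<in>cube a l. ennreal (F x) \<partial>lborel) \<noteq> 0"
      using that by (intro nn_integral_pos_of_pos) (auto simp: emeasure_cube)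
    then have "0 < enn2real (\<integral>\<^sup>+x\<in>cube a l. ennreal (F x) \<partial>lborel)"
      using that(3) by (simp add: enn2real_positive_iff zero_less_iff_neq_zero)
    then show ?thesis using that(4) by (simp add: cube_avg_def)
  qed
  note wpos = avg_pos[OF w_measurable w_pos wfin] and spos = avg_pos[OF \<open>\<sigma> \<in> _\<close> \<sigma>pos \<sigma>fin]
  have w_le: "l ^ n * cube_avg w a l \<le> W (ball (a + (l / 2) *\<^sub>R One) (n * l))" if "0 < l" for a :: 'a and l :: real
  proof -
    have "ennreal (l ^ n * cube_avg w a l) \<le> ennreal (W (ball (a + (l / 2) *\<^sub>R One) (n * l)))"
      unfolding n_def cube_integral_eq[OF wfin that, symmetric] nn_integral_W_ball[symmetric]
      using cube_le[OF that, of w a] by (simp add: n_def)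
    then show ?thesis by (simp add: ennreal_le_iff)
  qed
  have s_le: "cube_avg \<sigma> a l \<le> \<kappa> * (K * \<kappa> * l ^ n / W (ball (a + (l / 2) *\<^sub>R One) (n * l))) powr (1 / (r - 1))" if l: "0 < l" for a :: 'a and l :: real
  proof -
    have nl: "0 < n * l" using n l by simp
    have vol: "\<omega> * (n * l) ^ n = \<kappa> * l ^ n" by (simp add: \<kappa>_def power_mult_distrib)
    let ?W = "W (ball (a + (l / 2) *\<^sub>R One) (n * l))"
    have "ennreal (l ^ n * cube_avg \<sigma> a l) \<le> ennreal (\<omega> * (n * l) ^ n * (K * (\<omega> * (n * l) ^ n) / ?W) powr (1 / (r - 1)))"
      unfolding n_def cube_integral_eq[OF \<sigma>fin l, symmetric]
      using order_trans[OF cube_le[OF l] \<sigma>ball[OF nl]] by (simp add: n_def)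
    then have "l ^ n * cube_avg \<sigma> a l \<le> \<kappa> * l ^ n * (K * (\<kappa> * l ^ n) / ?W) powr (1 / (r - 1))"
      unfolding vol using \<kappa> l by (subst (asm) ennreal_le_iff) auto
    then have "l ^ n * cube_avg \<sigma> a l \<le> l ^ n * (\<kappa> * (K * \<kappa> * l ^ n / ?W) powr (1 / (r - 1)))"
      by (simp add: mult_ac)
    then show ?thesis using l by simp
  qed
  have Cb: "cube_avg w a l * cube_avg \<sigma> a l powr (r - 1) \<le> C" if l: "0 < l" for a :: 'a and l :: real
  proof -
    let ?W = "W (ball (a + (l / 2) *\<^sub>R One) (n * l))"
    have W: "0 < ?W" using n l by (intro W_ball_pos) simp
    have "cube_avg w a l \<le> ?W / l ^ n" using w_le[OF l, of a] l by (simp add: field_simps)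
    moreover have "cube_avg \<sigma> a l powr (r - 1) \<le> (\<kappa> * (K * \<kappa> * l ^ n / ?W) powr (1 / (r - 1))) powr (r - 1)"
      using s_le[OF l, of a] spos[OF l, of a] r by (intro powr_mono2) auto
    moreover have "(\<kappa> * (K * \<kappa> * l ^ n / ?W) powr (1 / (r - 1))) powr (r - 1) = \<kappa> powr (r - 1) * (K * \<kappa> * l ^ n / ?W)"
      using r \<kappa> K l W by (simp add: powr_mult powr_powr)
    ultimately have "cube_avg w a l * cube_avg \<sigma> a l powr (r - 1) \<le> (?W / l ^ n) * (\<kappa> powr (r - 1) * (K * \<kappa> * l ^ n / ?W))"
      using W l wpos[OF l, of a] by (intro mult_mono) auto
    also have "\<dots> = K * (\<kappa> powr (r - 1) * \<kappa>)" using W l by simp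
    also have "\<kappa> powr (r - 1) * \<kappa> = \<kappa> powr r" using \<kappa> powr_add[of \<kappa> "r - 1" 1] by simp
    finally show ?thesis using C(2) by (simp add: \<kappa>_def \<omega>_def n_def)
  qed
  \<comment> \<open>Hoelder's inequality applied to
    \<open>w x powr (1 / r) * \<sigma> x powr (1 - 1 / r) = 1\<close>.\<close>
  have low: "1 \<le> cube_avg w a l * cube_avg \<sigma> a l powr (r - 1)" if l: "0 < l" for a :: 'a and l :: real
  proof -
    have ind [measurable]: "(\<lambda>x. indicator (cube a l) x :: real) \<in> borel_measurable borel"
      by (intro borel_measurable_indicator) auto
    let ?F = "\<lambda>x. w x * indicator (cube a l) x" and ?G = "\<lambda>x. \<sigma> x * indicator (cube a l) x"
    have one: "w x powr (1 / r) * \<sigma> x powr (1 - 1 / r) = 1" for x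
    proof -
      have "(- 1 / (r - 1)) * (1 - 1 / r) = - (1 / r)" using r by (simp add: field_simps)
      then show ?thesis using w_pos[of x] unfolding \<sigma>_def powr_powr by (simp flip: powr_add)
    qed
    have "ennreal (l ^ n) = (\<integral>\<^sup>+x. indicator (cube a l) x \<partial>lborel)"
      using l by (simp add: emeasure_cube n_def)
    also have "\<dots> = (\<integral>\<^sup>+x. ennreal (?F x powr (1 / r) * ?G x powr (1 - 1 / r)) \<partial>lborel)"
    proof (intro nn_integral_cong)
      fix x
      show "indicator (cube a l) x = ennreal (?F x powr (1 / r) * ?G x powr (1 - 1 / r))"
        using one[of x] by (cases "x \<in> cube a l") auto
    qed
    also have "\<dots> \<le> ennreal ((l ^ n * cube_avg w a l) powr (1 / r) * (l ^ n * cube_avg \<sigma> a l) powr (1 - 1 / r))"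
    proof (rule nn_integral_Holder)
      show "(\<integral>\<^sup>+x. ennreal (?F x) \<partial>lborel) \<le> ennreal (l ^ n * cube_avg w a l)"
        unfolding n_def cube_integral_eq[OF wfin l, symmetric] by (simp add: ennreal_mult'' ennreal_indicator)
      show "(\<integral>\<^sup>+x. ennreal (?G x) \<partial>lborel) \<le> ennreal (l ^ n * cube_avg \<sigma> a l)"
        unfolding n_def cube_integral_eq[OF \<sigma>fin l, symmetric] by (simp add: ennreal_mult'' ennreal_indicator)
    qed (use r l w_pos \<sigma>pos wpos[OF l] spos[OF l] in \<open>auto simp: ind less_imp_le\<close>)
    finally have "l ^ n \<le> (l ^ n * cube_avg w a l) powr (1 / r) * (l ^ n * cube_avg \<sigma> a l) powr (1 - 1 / r)"
      by (simp add: ennreal_le_iff)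
    also have "\<dots> = ((l ^ n) powr (1 / r) * (l ^ n) powr (1 - 1 / r)) * (cube_avg w a l powr (1 / r) * cube_avg \<sigma> a l powr (1 - 1 / r))"
      using l wpos[OF l, of a] spos[OF l, of a] by (simp add: powr_mult)
    also have "(l ^ n) powr (1 / r) * (l ^ n) powr (1 - 1 / r) = l ^ n"
      using l by (simp flip: powr_add)
    finally have "1 \<le> cube_avg w a l powr (1 / r) * cube_avg \<sigma> a l powr (1 - 1 / r)" using l by simp
    then have "1 powr r \<le> (cube_avg w a l powr (1 / r) * cube_avg \<sigma> a l powr (1 - 1 / r)) powr r"
      using r by (intro powr_mono2) auto
    also have "\<dots> = cube_avg w a l * cube_avg \<sigma> a l powr (r - 1)"
    proof -
      have "(1 - 1 / r) * r = r - 1" using r by (simp add: field_simps)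
      then show ?thesis using r wpos[OF l, of a] spos[OF l, of a] by (simp add: powr_mult powr_powr)
    qed
    finally show ?thesis by simp
  qed
  define e where "e = (1 + d) / (r - 1)"
  \<comment> \<open>Volume ratio of the cube of side \<open>2 * t\<close> to the ball of radius
    \<open>t\<close> inside it. The constant \<open>K'\<close> is then what makes the factor in
    front fit inside the power \<open>e\<close>, the new dual exponent.\<close>
  define \<beta> where "\<beta> = 2 ^ n / \<omega>"
  define K' where "K' = K * \<kappa> * \<beta> * (2 * \<beta> * \<kappa> powr (1 + d)) powr (1 / e)"
  have e: "0 < e" using r d by (simp add: e_def)
  have \<beta>: "0 < \<beta>" using \<omega> by (simp add: \<beta>_def)
  have "Ap_bound (1 + (r - 1) / (1 + d)) K'"
    unfolding Ap_bound_def
  proof (intro allI impI)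
    fix z :: 'a and t :: real assume t: "0 < t"
    define a where "a = z - t *\<^sub>R One"
    define l where "l = 2 * t"
    define v where "v = \<omega> * t ^ n"
    have l: "0 < l" using t by (simp add: l_def)
    have v: "0 < v" using t \<omega> by (simp add: v_def)
    have W: "0 < W (ball z t)" using t by (rule W_ball_pos)
    have ln: "l ^ n = \<beta> * v" using \<omega> by (simp add: l_def v_def \<beta>_def power_mult_distrib)
    have center: "a + (l / 2) *\<^sub>R One = z" by (simp add: a_def l_def)
    have "t \<le> real n * l"
      using n t mult_right_mono[of 1 "real n" t] by (simp add: l_def Suc_le_eq)
    then have W_le: "W (ball z t) \<le> W (ball z (n * l))" by (intro W_mono subset_ball)
    have Wn: "0 < W (ball z (n * l))" using n l by (intro W_ball_pos) simp
    have "cube_avg \<sigma> a l \<le> \<kappa> * (K * \<kappa> * l ^ n / W (ball z (n * l))) powr (1 / (r - 1))"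
      using s_le[OF l, of a] unfolding center .
    also have "\<dots> \<le> \<kappa> * (K * \<kappa> * l ^ n / W (ball z t)) powr (1 / (r - 1))"
      using \<kappa> K l W W_le Wn r by (intro mult_left_mono powr_mono2 divide_left_mono) auto
    finally have "cube_avg \<sigma> a l powr (1 + d) \<le> (\<kappa> * (K * \<kappa> * l ^ n / W (ball z t)) powr (1 / (r - 1))) powr (1 + d)"
      using spos[OF l, of a] d by (intro powr_mono2) auto
    also have "\<dots> = \<kappa> powr (1 + d) * (K * \<kappa> * l ^ n / W (ball z t)) powr e"
      using \<kappa> by (simp add: powr_mult powr_powr e_def)
    finally have sa: "cube_avg \<sigma> a l powr (1 + d) \<le> \<kappa> powr (1 + d) * (K * \<kappa> * l ^ n / W (ball z t)) powr e" .
    have ex: "1 / ((1 + (r - 1) / (1 + d)) - 1) = e" "- 1 / ((1 + (r - 1) / (1 + d)) - 1) = - 1 / (r - 1) * (1 + d)"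
      using r d by (auto simp: e_def field_simps)
    have "(\<integral>\<^sup>+x\<in>ball z t. ennreal (w x powr (- 1 / ((1 + (r - 1) / (1 + d)) - 1))) \<partial>lborel)
       = (\<integral>\<^sup>+x\<in>ball z t. ennreal (\<sigma> x powr (1 + d)) \<partial>lborel)"
      unfolding ex(2) \<sigma>_def powr_powr ..
    also have "\<dots> \<le> (\<integral>\<^sup>+x\<in>cube a l. ennreal (\<sigma> x powr (1 + d)) \<partial>lborel)"
      using ball_subset_cube[of z t] by (intro nn_integral_mono) (auto simp: indicator_def a_def l_def)
    also have "\<dots> \<le> ennreal (2 * l ^ DIM('a) * cube_avg \<sigma> a l powr (1 + d))"
      by (rule reverse_Holder_cube[OF w_measurable \<open>\<sigma> \<in> _\<close> less_imp_le[OF \<sigma>pos] wfin \<sigma>cball \<sigma>fin wpos spos C(1) Cb low r d l])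
    also have "\<dots> \<le> ennreal (2 * l ^ n * (\<kappa> powr (1 + d) * (K * \<kappa> * l ^ n / W (ball z t)) powr e))"
      unfolding n_def [symmetric] using l by (intro ennreal_leI mult_left_mono sa) auto
    also have "2 * l ^ n * (\<kappa> powr (1 + d) * (K * \<kappa> * l ^ n / W (ball z t)) powr e) = v * (K' * v / W (ball z t)) powr e"
    proof -
      have "(K' * v / W (ball z t)) powr e = (K * \<kappa> * \<beta> * v / W (ball z t)) powr e * ((2 * \<beta> * \<kappa> powr (1 + d)) powr (1 / e)) powr e"
        using K \<kappa> \<beta> v W by (simp add: K'_def mult_ac flip: powr_mult)
      also have "((2 * \<beta> * \<kappa> powr (1 + d)) powr (1 / e)) powr e = 2 * \<beta> * \<kappa> powr (1 + d)"
        using e \<beta> by (simp add: powr_powr)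
      finally show ?thesis by (simp add: ln mult_ac)
    qed
    finally show "(\<integral>\<^sup>+x\<in>ball z t. ennreal (w x powr (- 1 / ((1 + (r - 1) / (1 + d)) - 1))) \<partial>lborel)
        \<le> ennreal (ball_vol TYPE('a) t * (K' * ball_vol TYPE('a) t / W (ball z t)) powr (1 / ((1 + (r - 1) / (1 + d)) - 1)))"
      unfolding ex(1) by (simp add: v_def \<omega>_def n_def)
  qed
  moreover have "0 \<le> K'" using K \<kappa> \<beta> by (simp add: K'_def)
  ultimately show ?thesis by blast
qed

text \<open>Because \<open>K\<close> serves all exponents above \<open>e\<close>, the gain
  \<open>d\<close> can be fixed before the starting exponent is chosen; taking the latter close
  enough to \<open>e\<close> lets the improvement cross \<open>e\<close>.\<close>

lemma Ap_bound_open: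
  fixes e K :: real
  assumes Ap: "\<And>r. e < r \<Longrightarrow> Ap_bound r K" and e: "1 < e" and K: "0 \<le> K"
  shows "\<exists>s K'. 1 < s \<and> s < e \<and> 0 \<le> K' \<and> Ap_bound s K'"
proof -
  define \<kappa> where "\<kappa> = max 1 (unit_ball_vol DIM('a) * DIM('a) ^ DIM('a))"
  \<comment> \<open>Large enough for every starting exponent up to \<open>e + 1\<close>. Defining
    \<open>d\<close> with \<open>e\<close> in the exponent makes it admissible for every larger
    \<open>r\<close> as well.\<close>
  define C where "C = max 1 (K * \<kappa> powr (e + 1))"
  define d where "d = C powr (- 3 / (e - 1)) / (4 * (2 ^ DIM('a))\<^sup>2)"
  \<comment> \<open>Ensures \<open>r - 1 < (e - 1) * (1 + d)\<close> for
    \<open>r = e + \<eta>\<close>, which says exactly that the improved exponent is below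
    \<open>e\<close>.\<close>
  define \<eta> where "\<eta> = min 1 (d * (e - 1) / 2)"
  have C: "1 \<le> C" by (simp add: C_def)
  have "C powr (- 3 / (e - 1)) \<le> C powr 0" using C e by (intro powr_mono) auto
  moreover have "(1::real) \<le> (2 ^ DIM('a))\<^sup>2" by simp
  moreover have "C powr 0 = 1" using C by simp
  ultimately have "C powr (- 3 / (e - 1)) \<le> 4 * (2 ^ DIM('a))\<^sup>2" by linarith
  then have d: "0 < d" "d \<le> 1" using C by (auto simp: d_def)
  have \<eta>: "0 < \<eta>" "\<eta> \<le> 1" "\<eta> < d * (e - 1)" using d e by (auto simp: \<eta>_def min_less_iff_disj)
  define r where "r = e + \<eta>"
  have r: "e < r" "r \<le> e + 1" "1 < r" using \<eta> e by (auto simp: r_def)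
  have "(unit_ball_vol DIM('a) * DIM('a) ^ DIM('a)) powr r \<le> \<kappa> powr r"
    using r by (intro powr_mono2) (auto simp: \<kappa>_def)
  also have "\<dots> \<le> \<kappa> powr (e + 1)" using r by (intro powr_mono) (auto simp: \<kappa>_def)
  finally have "K * (unit_ball_vol DIM('a) * DIM('a) ^ DIM('a)) powr r \<le> K * \<kappa> powr (e + 1)"
    using K by (rule mult_left_mono)
  then have KC: "K * (unit_ball_vol DIM('a) * DIM('a) ^ DIM('a)) powr r \<le> C" by (simp add: C_def)
  have "3 / (r - 1) \<le> 3 / (e - 1)" using r e by (intro divide_left_mono) auto
  then have "C powr (- 3 / (e - 1)) \<le> C powr (- 3 / (r - 1))" using C by (intro powr_mono) auto
  then have "d \<le> C powr (- 3 / (r - 1)) / (4 * (2 ^ DIM('a))\<^sup>2)" unfolding d_def by (intro divide_right_mono) auto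
  from Ap_bound_improve[OF Ap[OF r(1)] r(3) K C KC less_imp_le[OF d(1)] d(2) this]
  obtain K' where K': "0 \<le> K'" "Ap_bound (1 + (r - 1) / (1 + d)) K'" by blast
  have "r - 1 < (e - 1) * (1 + d)" using \<eta>(3) by (simp add: r_def algebra_simps)
  then have "(r - 1) / (1 + d) < e - 1" using d by (simp add: field_simps)
  moreover have "0 < (r - 1) / (1 + d)" using r d by simp
  ultimately show ?thesis using K' by (intro exI[of _ "1 + (r - 1) / (1 + d)"] exI[of _ K']) auto
qed

end

section \<open>Muckenhoupt classes and the main theorem\<close>

lemma locally_integrable_measurable:
  fixes f :: "'a::euclidean_space \<Rightarrow> 'b::euclidean_space"
  assumes "locally_integrable f"
  shows "f \<in> borel_measurable lebesgue"
proof (rule borel_measurable_LIMSEQ_metric)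
  fix k :: nat
  have "f absolutely_integrable_on cball 0 (real k)"
    using assms by (simp add: locally_integrable_def)
  then show "(\<lambda>x. indicator (cball 0 (real k)) x *\<^sub>R f x) \<in> borel_measurable lebesgue"
    unfolding set_integrable_def by (rule borel_measurable_integrable)
next
  fix x :: 'a
  obtain n where n: "norm x < real n" using reals_Archimedean2 by blast
  have "eventually (\<lambda>k. indicator (cball 0 (real k)) x *\<^sub>R f x = f x) sequentially"
    using eventually_ge_at_top[of n] by eventually_elim (use n in \<open>simp add: indicator_def\<close>)
  then show "(\<lambda>k. indicator (cball 0 (real k)) x *\<^sub>R f x) \<longlonglongrightarrow> f x" by (rule tendsto_eventually)
qed

lemma lebesgue_ex_borel_measurable:
  fixes f :: "'a::euclidean_space \<Rightarrow> 'b::euclidean_space"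
  assumes "f \<in> borel_measurable lebesgue"
  obtains g where "g \<in> borel_measurable borel" "AE x in lborel. f x = g x"
proof -
  have "\<exists>g\<in>borel_measurable lborel. AE x in lborel. f x \<bullet> b = g x" for b
    by (rule completion_ex_borel_measurable_real) (use assms in measurable)
  then obtain g where g: "\<And>b. g b \<in> borel_measurable lborel" "\<And>b. AE x in lborel. f x \<bullet> b = g b x"
    by metis
  have [measurable]: "g b \<in> borel_measurable borel" for b using g(1)[of b] by simp
  have "AE x in lborel. \<forall>b\<in>Basis. f x \<bullet> b = g b x"
    using g(2) by (intro AE_finite_allI) auto
  then have "AE x in lborel. f x = (\<Sum>b\<in>Basis. g b x *\<^sub>R b)"
    by eventually_elim (metis (mono_tags, lifting) euclidean_representation sum.cong)
  then show thesis by (rule that[rotated]) measurable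
qed

lemma enn_powr_ennreal:
  assumes "0 \<le> x" "0 < a"
  shows "enn_powr (ennreal x) a = ennreal (x powr a)"
  using assms by (auto simp: enn_powr_def)

lemma enn_powr_neg_ennreal:
  assumes "0 < x" "a < 0"
  shows "enn_powr (ennreal x) a = ennreal (x powr a)"
  using assms by (auto simp: enn_powr_def)

lemma enn_powr_le:
  assumes "x \<le> ennreal (y powr q)" "0 \<le> y" "0 < q"
  shows "enn_powr x (1 / q) \<le> ennreal y"
proof -
  obtain u where u: "x = ennreal u" "0 \<le> u"
    using assms(1) by (metis ennreal_cases ennreal_less_top le_less_trans less_irrefl)
  have "u \<le> y powr q" using assms(1) u by (simp add: ennreal_le_iff)
  then have "u powr (1 / q) \<le> (y powr q) powr (1 / q)" using u assms by (intro powr_mono2) auto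
  also have "\<dots> = y" using assms by (simp add: powr_powr)
  finally show ?thesis using u assms by (simp add: enn_powr_ennreal ennreal_leI)
qed

lemma nn_integral_lebesgue_cong_AE:
  assumes "AE x in lborel. F x = G x"
  shows "(\<integral>\<^sup>+x\<in>A. F x \<partial>lebesgue) = (\<integral>\<^sup>+x\<in>A. G x \<partial>lborel)"
  unfolding nn_integral_completion by (rule nn_integral_cong_AE) (use assms in eventually_elim, simp)

lemma ennreal_divide_real:
  assumes "0 \<le> a" "0 < b"
  shows "ennreal a / ennreal b = ennreal (a / b)"
  using assms by (simp add: divide_ennreal)

section \<open>Comparison with the classes of the statement\<close>

context positive_weight
begin

text \<open>The one-ball condition solved for the dual integral \<open>I\<close>. An infinite
  \<open>I\<close> violates both sides, since the mass of the ball is positive.\<close>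

lemma Ap_bound_iff_ball:
  assumes r: "1 < r" and K: "0 \<le> K" and t: "0 < t"
  shows "ennreal (W (ball z t) / ball_vol TYPE('a) t) * enn_powr (I / ennreal (ball_vol TYPE('a) t)) (r - 1) \<le> ennreal K
     \<longleftrightarrow> I \<le> ennreal (ball_vol TYPE('a) t * (K * ball_vol TYPE('a) t / W (ball z t)) powr (1 / (r - 1)))"
proof -
  let ?v = "ball_vol TYPE('a) t" and ?W = "W (ball z t)"
  have v: "0 < ?v" using t by simp
  have W: "0 < ?W" using t by (rule W_ball_pos)
  show ?thesis
  proof (cases I)
    case (real i)
    have "ennreal (?W / ?v) * enn_powr (I / ennreal ?v) (r - 1) = ennreal (?W / ?v) * ennreal ((i / ?v) powr (r - 1))"
      using real v r by (simp add: ennreal_divide_real enn_powr_ennreal)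
    also have "\<dots> = ennreal (?W / ?v * (i / ?v) powr (r - 1))"
      using v W by (simp flip: ennreal_mult'')
    finally have "ennreal (?W / ?v) * enn_powr (I / ennreal ?v) (r - 1) \<le> ennreal K \<longleftrightarrow> ?W / ?v * (i / ?v) powr (r - 1) \<le> K"
      using K by (simp add: ennreal_le_iff)
    also have "\<dots> \<longleftrightarrow> (i / ?v) powr (r - 1) \<le> K * ?v / ?W"
    proof -
      have "a / b * c \<le> K \<longleftrightarrow> c \<le> K * b / a" if "0 < a" "0 < b" for a b c :: real
        using that by (simp add: field_simps)
      from this[OF W v] show ?thesis .
    qed
    also have "\<dots> \<longleftrightarrow> i / ?v \<le> (K * ?v / ?W) powr (1 / (r - 1))"
    proof -
      have nn: "0 \<le> i / ?v" "0 \<le> K * ?v / ?W" using real K v W by simp_all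
      have "x powr (r - 1) \<le> y \<longleftrightarrow> x \<le> y powr (1 / (r - 1))" if "0 \<le> x" "0 \<le> y" for x y :: real
      proof
        assume "x powr (r - 1) \<le> y"
        then have "(x powr (r - 1)) powr (1 / (r - 1)) \<le> y powr (1 / (r - 1))" using r by (intro powr_mono2) auto
        then show "x \<le> y powr (1 / (r - 1))" using r that by (simp add: powr_powr)
      next
        assume "x \<le> y powr (1 / (r - 1))"
        then have "x powr (r - 1) \<le> (y powr (1 / (r - 1))) powr (r - 1)" using r that by (intro powr_mono2) auto
        then show "x powr (r - 1) \<le> y" using r that by (simp add: powr_powr)
      qed
      from this[OF nn] show ?thesis .
    qed
    also have "\<dots> \<longleftrightarrow> i \<le> ?v * (K * ?v / ?W) powr (1 / (r - 1))"
      using v by (simp add: pos_divide_le_eq mult.commute)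
    also have "\<dots> \<longleftrightarrow> I \<le> ennreal (?v * (K * ?v / ?W) powr (1 / (r - 1)))"
      using real v by (simp add: ennreal_le_iff)
    finally show ?thesis .
  next
    case top
    have "top / ennreal ?v = top" by (simp add: ennreal_top_divide)
    moreover have "0 < ?W / ?v" using v W by simp
    ultimately have "ennreal (?W / ?v) * enn_powr (I / ennreal ?v) (r - 1) = top"
      using top r W t by (simp add: enn_powr_def ennreal_mult_eq_top_iff)
    then show ?thesis using top by (simp only: top_unique ennreal_neq_top)
  qed
qed

end

text \<open>The weights of the statement are only Lebesgue measurable and may vanish on a null set.\<close>

locale weight_representative = positive_weight w'
  for w' :: "real ^ 'n \<Rightarrow> real" +
  fixes w :: "real ^ 'n \<Rightarrow> real"
  assumes w_eq: "AE x in lborel. w x = w' x" and weight: "weight w"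
begin

lemma enn_avg_w:
  assumes "0 < t"
  shows "enn_avg (ball z t) (\<lambda>x. ennreal (w x)) = ennreal (W (ball z t) / ball_vol TYPE(real ^ 'n) t)"
    and "enn_avg (ball z t) (\<lambda>x. ennreal \<bar>w x\<bar>) = ennreal (W (ball z t) / ball_vol TYPE(real ^ 'n) t)"
proof -
  have "AE x in lborel. ennreal (w x) = ennreal (w' x)" "AE x in lborel. ennreal \<bar>w x\<bar> = ennreal (w' x)"
    using w_eq by (eventually_elim, use w_pos in \<open>simp add: less_imp_le\<close>)+
  then show "enn_avg (ball z t) (\<lambda>x. ennreal (w x)) = ennreal (W (ball z t) / ball_vol TYPE(real ^ 'n) t)"
    "enn_avg (ball z t) (\<lambda>x. ennreal \<bar>w x\<bar>) = ennreal (W (ball z t) / ball_vol TYPE(real ^ 'n) t)"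
    using assms by (simp_all add: enn_avg_def nn_integral_lebesgue_cong_AE nn_integral_W_ball emeasure_ball ennreal_divide_real)
qed

lemma enn_avg_sigma:
  assumes "0 < t" "1 < r"
  shows "enn_avg (ball z t) (\<lambda>x. enn_powr (ennreal (w x)) (1 - conj_exponent r))
    = (\<integral>\<^sup>+x\<in>ball z t. ennreal (w' x powr (- 1 / (r - 1))) \<partial>lborel) / ennreal (ball_vol TYPE(real ^ 'n) t)"
proof -
  have "1 - conj_exponent r = - 1 / (r - 1)" using assms by (simp add: conj_exponent_def field_simps)
  moreover have "- 1 / (r - 1) < 0" using assms by simp
  ultimately have "AE x in lborel. enn_powr (ennreal (w x)) (1 - conj_exponent r) = ennreal (w' x powr (- 1 / (r - 1)))"
    using w_eq by (auto elim!: eventually_mono simp: enn_powr_neg_ennreal w_pos simp del: divide_minus_left)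
  then show ?thesis using assms by (simp add: enn_avg_def nn_integral_lebesgue_cong_AE emeasure_ball)
qed

lemma Ap_const_le_iff:
  assumes "1 < r" "0 \<le> K"
  shows "Ap_const r w \<le> ennreal K \<longleftrightarrow> Ap_bound r K"
proof -
  have "Ap_const r w \<le> ennreal K \<longleftrightarrow> (\<forall>z t. 0 < t \<longrightarrow>
      enn_avg (ball z t) (\<lambda>x. ennreal (w x)) * enn_powr (enn_avg (ball z t) (\<lambda>x. enn_powr (ennreal (w x)) (1 - conj_exponent r))) (r - 1) \<le> ennreal K)"
    using assms by (auto simp: Ap_const_def SUP_le_iff)
  also have "\<dots> \<longleftrightarrow> Ap_bound r K"
  proof -
    have "enn_avg (ball z t) (\<lambda>x. ennreal (w x)) * enn_powr (enn_avg (ball z t) (\<lambda>x. enn_powr (ennreal (w x)) (1 - conj_exponent r))) (r - 1) \<le> ennreal K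
      \<longleftrightarrow> (\<integral>\<^sup>+x\<in>ball z t. ennreal (w' x powr (- 1 / (r - 1))) \<partial>lborel)
        \<le> ennreal (ball_vol TYPE(real ^ 'n) t * (K * ball_vol TYPE(real ^ 'n) t / W (ball z t)) powr (1 / (r - 1)))"
      if "0 < t" for z t
      unfolding enn_avg_w(1)[OF that] enn_avg_sigma[OF that assms(1)] by (rule Ap_bound_iff_ball[OF assms that])
    then show ?thesis unfolding Ap_bound_def by blast
  qed
  finally show ?thesis .
qed

text \<open>The constant is positive because the value zero would make the integral of the positive
  dual weight over the unit ball vanish. Positivity is what permits choosing an exponent whose
  constant exceeds half of the supremum.\<close>

lemma Ap_const_finite:
  assumes "w \<in> Ap_class r" "1 < r"
  shows "Ap_const r w = ennreal (enn2real (Ap_const r w))" "Ap_bound r (enn2real (Ap_const r w))" "0 < enn2real (Ap_const r w)"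
proof -
  show eq: "Ap_const r w = ennreal (enn2real (Ap_const r w))"
    using assms by (simp add: Ap_class_def less_top)
  then show bd: "Ap_bound r (enn2real (Ap_const r w))"
    using Ap_const_le_iff[OF assms(2), of "enn2real (Ap_const r w)"] by simp
  show "0 < enn2real (Ap_const r w)"
  proof (rule ccontr)
    assume "\<not> ?thesis"
    then have "enn2real (Ap_const r w) = 0" by (simp add: order_antisym)
    then have "(\<integral>\<^sup>+x\<in>ball 0 1. ennreal (w' x powr (- 1 / (r - 1))) \<partial>lborel) = 0"
      using bd by (auto simp: Ap_bound_def dest!: spec[of _ "0 :: real ^ 'n"] spec[of _ "1 :: real"])
    moreover have "(\<integral>\<^sup>+x\<in>ball 0 1. ennreal (w' x powr (- 1 / (r - 1))) \<partial>lborel) \<noteq> 0"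
      by (rule nn_integral_pos_of_pos) (use w_pos in \<open>auto simp: emeasure_ball order_less_imp_not_eq2\<close>)
    ultimately show False by simp
  qed
qed

lemma Ap_classI: "Ap_bound r K \<Longrightarrow> 1 < r \<Longrightarrow> 0 \<le> K \<Longrightarrow> w \<in> Ap_class r"
  using weight Ap_const_le_iff[of r K] le_less_trans[OF _ ennreal_less_top, of "Ap_const r w" K]
  by (auto simp: Ap_class_def)

text \<open>Every ball containing \<open>x\<close> competes in the maximal function at
  \<open>x\<close>, so the bound on the quotient holds for its average at almost every point of the
  ball.\<close>

lemma A1_class_bound:
  assumes "w \<in> Ap_class 1"
  shows "\<exists>K\<ge>0. A1_bound K"
proof -
  have "esssup lebesgue (\<lambda>x. HL_maximal w x / ennreal (w x)) < \<infinity>"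
    using assms by (simp add: Ap_class_def Ap_const_def)
  then obtain K where K: "esssup lebesgue (\<lambda>x. HL_maximal w x / ennreal (w x)) = ennreal K" "0 \<le> K"
    by (cases "esssup lebesgue (\<lambda>x. HL_maximal w x / ennreal (w x))") auto
  have "AE x in lebesgue. HL_maximal w x / ennreal (w x) \<le> ennreal K"
    unfolding K(1)[symmetric] by (rule esssup_AE)
  then have AEK: "AE x in lborel. HL_maximal w x / ennreal (w x) \<le> ennreal K"
    by (simp add: AE_completion_iff)
  have "A1_bound K"
    unfolding A1_bound_def
  proof (intro allI impI)
    fix z :: "real ^ 'n" and t :: real assume t: "0 < t"
    let ?v = "ball_vol TYPE(real ^ 'n) t"
    have v: "0 < ?v" using t by simp
    show "AE x in lborel. x \<in> ball z t \<longrightarrow> W (ball z t) \<le> K * ?v * w' x"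
      using AEK w_eq
    proof eventually_elim
      case (elim x)
      show ?case
      proof
        assume x: "x \<in> ball z t"
        have wx: "w x = w' x" "0 < w x" using elim w_pos[of x] by auto
        have "ennreal (W (ball z t) / ?v) \<le> HL_maximal w x"
          unfolding enn_avg_w(2)[OF t, symmetric] HL_maximal_def
          by (rule SUP_upper2[of "(z, t)"]) (use t x in auto)
        then have "ennreal (W (ball z t) / ?v) / ennreal (w x) \<le> ennreal K"
          using elim(1) by (meson divide_right_mono_ennreal order_trans)
        then have "W (ball z t) / ?v / w x \<le> K"
          using wx v K(2) by (simp add: ennreal_divide_real ennreal_le_iff)
        then show "W (ball z t) \<le> K * ?v * w' x"
          using wx v by (simp add: field_simps)
      qed
    qed
  qed
  then show ?thesis using K(2) by blast
qed

lemma Ap_class_mono: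
  assumes "w \<in> Ap_class s" "1 \<le> s" "s < r"
  shows "w \<in> Ap_class r"
proof (cases "s = 1")
  case True
  then obtain K where "0 \<le> K" "A1_bound K" using A1_class_bound assms by blast
  then show ?thesis using A1_bound_imp_Ap_bound assms True by (intro Ap_classI[of r K]) auto
next
  case False
  then have s: "1 < s" using assms by simp
  show ?thesis
    using Ap_bound_mono[OF Ap_const_finite(2)[OF assms(1) s] s] assms s
    by (intro Ap_classI[of r "enn2real (Ap_const s w)"]) auto
qed

end

context weight_representative
begin

text \<open>The critical inequality, transferred from Borel representatives of \<open>f\<close>,
  \<open>Df\<close> and the weight to the functions themselves. Exponents \<open>q\<close> below the
  critical \<open>q0\<close> follow since the underlying measure is a probability measure.\<close>

lemma weighted_mean_norm_Sobolev_Poincare: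
  fixes r p q q0 K \<rho> :: real
  assumes bd: "averaging_bound r K" and r: "1 \<le> r" "r \<le> p" "p < real CARD('n) * r" "0 < K"
    and q: "1 \<le> q" "q \<le> q0" "1 / q0 = 1 / p - 1 / (real CARD('n) * r)"
    and \<rho>: "0 < \<rho>" and f: "has_weak_gradient f Df"
  shows "weighted_mean_norm w (ball z \<rho>) q (\<lambda>x. f x - avg (ball z \<rho>) f)
     \<le> ennreal (18 * 18 ^ CARD('n) * (4 + 2 * p / (real CARD('n) * r - p)) * K powr (1 / p)) * ennreal \<rho>
        * weighted_mean_norm w (ball z \<rho>) p Df"
proof -
  let ?B = "ball z \<rho>" and ?v = "ball_vol TYPE(real ^ 'n) \<rho>" and ?W = "W (ball z \<rho>)"
  define A where "A = 18 * 18 ^ CARD('n) * (4 + 2 * p / (real CARD('n) * r - p))"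
  have p: "1 \<le> p" using r by simp
  have A: "0 < A" using r p by (auto simp: A_def intro!: mult_pos_pos add_pos_nonneg)
  have W: "0 < ?W" using \<rho> by (rule W_ball_pos)
  have v: "0 < ?v" using \<rho> by simp
  have lf: "locally_integrable f" and lD: "locally_integrable Df"
    using f by (auto simp: has_weak_gradient_def)
  obtain f0 where f0m [measurable]: "f0 \<in> borel_measurable borel" and f0: "AE x in lborel. f x = f0 x"
    using lebesgue_ex_borel_measurable[OF locally_integrable_measurable[OF lf]] by blast
  obtain g0 where g0m [measurable]: "g0 \<in> borel_measurable borel" and g0: "AE x in lborel. Df x = g0 x"
    using lebesgue_ex_borel_measurable[OF locally_integrable_measurable[OF lD]] by blast
  have f_leb [measurable]: "f \<in> borel_measurable lebesgue" and D_leb [measurable]: "Df \<in> borel_measurable lebesgue"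
    using lf lD by (auto intro: locally_integrable_measurable)
  have f0_leb: "f0 \<in> borel_measurable lebesgue" and g0_leb: "g0 \<in> borel_measurable lebesgue"
    by (auto intro: measurable_completion)
  have f0': "AE x in lebesgue. f x = f0 x" and g0': "AE x in lebesgue. Df x = g0 x"
    using f0 g0 by (simp_all add: AE_completion_iff)
  have loc: "set_integrable lborel (ball z R) F0"
    if "locally_integrable F" "AE x in lebesgue. F x = F0 x" "F0 \<in> borel_measurable borel"
    for F F0 :: "real ^ 'n \<Rightarrow> 'b::euclidean_space" and R
  proof -
    have "F absolutely_integrable_on cball z R" using that(1) by (simp add: locally_integrable_def)
    then have "F absolutely_integrable_on ball z R" by (rule set_integrable_subset) auto
    then have "integrable lebesgue (\<lambda>x. indicator (ball z R) x *\<^sub>R F x)" by (simp add: set_integrable_def)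
    moreover have m0: "(\<lambda>x. indicator (ball z R) x *\<^sub>R F0 x) \<in> borel_measurable borel"
      using that(3) by (intro borel_measurable_scaleR borel_measurable_indicator) auto
    moreover have "(\<lambda>x. indicator (ball z R) x *\<^sub>R F0 x) \<in> borel_measurable lebesgue"
      using m0 by (intro measurable_completion) simp
    moreover have "AE x in lebesgue. indicator (ball z R) x *\<^sub>R F x = indicator (ball z R) x *\<^sub>R F0 x"
      using that(2) by eventually_elim simp
    ultimately have "integrable lebesgue (\<lambda>x. indicator (ball z R) x *\<^sub>R F0 x)"
      using integrable_cong_AE_imp by blast
    then show ?thesis unfolding set_integrable_def using m0 by (subst (asm) integrable_completion) auto
  qed
  have av: "avg ?B f = (LINT y:?B|lborel. f0 y) / ?v"
  proof -
    have "(LINT y:?B|lebesgue. f y) = (LINT y:?B|lebesgue. f0 y)"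
      unfolding set_lebesgue_integral_def
    proof (rule integral_cong_AE)
      show "(\<lambda>x. indicator ?B x *\<^sub>R f x) \<in> borel_measurable lebesgue"
        by (intro borel_measurable_scaleR borel_measurable_indicator f_leb) auto
      show "(\<lambda>x. indicator ?B x *\<^sub>R f0 x) \<in> borel_measurable lebesgue"
        by (intro borel_measurable_scaleR borel_measurable_indicator f0_leb) auto
      show "AE x in lebesgue. indicator ?B x *\<^sub>R f x = indicator ?B x *\<^sub>R f0 x"
        using f0' by eventually_elim simp
    qed
    also have "\<dots> = (LINT y:?B|lborel. f0 y)"
    proof -
      have "(\<lambda>x. indicator ?B x *\<^sub>R f0 x) \<in> borel_measurable lborel"
        by (intro borel_measurable_scaleR borel_measurable_indicator) auto
      then show ?thesis unfolding set_lebesgue_integral_def by (rule integral_completion)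
    qed
    finally show ?thesis using \<rho> by (simp add: avg_def content_ball)
  qed
  have test: "(LINT x|lborel. f0 x *\<^sub>R \<phi>' x) = - (LINT x|lborel. \<phi> x *\<^sub>R g0 x)"
    if \<phi>: "\<And>x. GDERIV \<phi> x :> \<phi>' x" "continuous_on UNIV \<phi>'" "compact (closure {x. \<phi> x \<noteq> 0})" for \<phi> \<phi>'
  proof -
    have "continuous_on UNIV \<phi>"
      using \<phi>(1) by (rule GDERIV_imp_continuous_on)
    then have b: "\<phi> \<in> borel_measurable borel" "\<phi>' \<in> borel_measurable borel"
      using \<phi>(2) by (auto intro: borel_measurable_continuous_onI)
    then have l: "\<phi> \<in> borel_measurable lebesgue" "\<phi>' \<in> borel_measurable lebesgue"
      by (auto intro: measurable_completion)
    have "(LINT x|lborel. f0 x *\<^sub>R \<phi>' x) = (LINT x|lebesgue. f0 x *\<^sub>R \<phi>' x)"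
      using b by (intro integral_completion[symmetric]) auto
    also have "\<dots> = (LINT x|lebesgue. f x *\<^sub>R \<phi>' x)"
    proof (rule integral_cong_AE)
      show "AE x in lebesgue. f0 x *\<^sub>R \<phi>' x = f x *\<^sub>R \<phi>' x" using f0' by eventually_elim simp
    qed (use l f0_leb in auto)
    also have "\<dots> = - (LINT x|lebesgue. \<phi> x *\<^sub>R Df x)"
      using f \<phi> unfolding has_weak_gradient_def by blast
    also have "(LINT x|lebesgue. \<phi> x *\<^sub>R Df x) = (LINT x|lebesgue. \<phi> x *\<^sub>R g0 x)"
    proof (rule integral_cong_AE)
      show "AE x in lebesgue. \<phi> x *\<^sub>R Df x = \<phi> x *\<^sub>R g0 x" using g0' by eventually_elim simp
    qed (use l g0_leb in auto)
    also have "\<dots> = (LINT x|lborel. \<phi> x *\<^sub>R g0 x)"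
      using b by (intro integral_completion) auto
    finally show ?thesis .
  qed
  define a where "a = avg ?B f"
  have Wden: "(\<integral>\<^sup>+x\<in>?B. ennreal (w x) \<partial>lebesgue) = ennreal ?W"
  proof -
    have "AE x in lborel. ennreal (w x) = ennreal (w' x)" using w_eq by eventually_elim simp
    then show ?thesis by (simp add: nn_integral_lebesgue_cong_AE nn_integral_W_ball)
  qed
  have num: "(\<integral>\<^sup>+x\<in>?B. ennreal (norm (Df x) powr p * w x) \<partial>lebesgue) = (\<integral>\<^sup>+x\<in>?B. ennreal (norm (g0 x) powr p * w' x) \<partial>lborel)"
  proof (rule nn_integral_lebesgue_cong_AE)
    show "AE x in lborel. ennreal (norm (Df x) powr p * w x) = ennreal (norm (g0 x) powr p * w' x)"
      using w_eq g0 by eventually_elim simp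
  qed
  have LHS: "weighted_mean_norm w ?B q (\<lambda>x. f x - a) = enn_powr (\<integral>\<^sup>+x. ennreal (\<bar>f0 x - a\<bar> powr q) \<partial>N z \<rho>) (1 / q)"
  proof -
    have "(\<integral>\<^sup>+x\<in>?B. ennreal (norm (f x - a) powr q * w x) \<partial>lebesgue) = (\<integral>\<^sup>+x\<in>?B. ennreal (\<bar>f0 x - a\<bar> powr q * w' x) \<partial>lborel)"
    proof (rule nn_integral_lebesgue_cong_AE)
      show "AE x in lborel. ennreal (norm (f x - a) powr q * w x) = ennreal (\<bar>f0 x - a\<bar> powr q * w' x)"
        using w_eq f0 by eventually_elim simp
    qed
    also have "\<dots> / ennreal ?W = (\<integral>\<^sup>+x\<in>?B. ennreal (\<bar>f0 x - a\<bar> powr q) * ennreal (w' x / ?W) \<partial>lborel)"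
    proof -
      have "(\<integral>\<^sup>+x\<in>?B. ennreal (\<bar>f0 x - a\<bar> powr q) * ennreal (w' x / ?W) \<partial>lborel)
         = (\<integral>\<^sup>+x. ennreal (\<bar>f0 x - a\<bar> powr q * w' x) * indicator ?B x / ennreal ?W \<partial>lborel)"
      proof (intro nn_integral_cong)
        fix x
        have "ennreal (\<bar>f0 x - a\<bar> powr q) * ennreal (w' x / ?W) = ennreal (\<bar>f0 x - a\<bar> powr q * w' x) / ennreal ?W"
          using W w_pos[of x] by (simp add: ennreal_divide_real flip: ennreal_mult'')
        then show "ennreal (\<bar>f0 x - a\<bar> powr q) * ennreal (w' x / ?W) * indicator ?B x
           = ennreal (\<bar>f0 x - a\<bar> powr q * w' x) * indicator ?B x / ennreal ?W"
          by (simp add: indicator_def)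
      qed
      also have "\<dots> = (\<integral>\<^sup>+x. ennreal (\<bar>f0 x - a\<bar> powr q * w' x) * indicator ?B x \<partial>lborel) / ennreal ?W"
        by (rule nn_integral_divide) measurable
      finally show ?thesis by simp
    qed
    also have "\<dots> = (\<integral>\<^sup>+x. ennreal (\<bar>f0 x - a\<bar> powr q) \<partial>N z \<rho>)"
      by (rule nn_integral_N[symmetric]) measurable
    finally show ?thesis by (simp add: weighted_mean_norm_def Wden)
  qed
  define J where "J = (\<integral>\<^sup>+x\<in>?B. ennreal (norm (g0 x) powr p * w' x) \<partial>lborel)"
  have RHS: "weighted_mean_norm w ?B p Df = enn_powr (J / ennreal ?W) (1 / p)"
    by (simp add: weighted_mean_norm_def num Wden J_def)
  show ?thesis
  proof (cases J)
    \<comment> \<open>An infinite energy makes the right-hand side infinite, as the constant in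
      front is positive.\<close>
    case top
    have "enn_powr (J / ennreal ?W) (1 / p) = top"
      using top p by (simp add: enn_powr_def ennreal_top_divide)
    then have "ennreal (A * K powr (1 / p)) * ennreal \<rho> * weighted_mean_norm w ?B p Df = top"
      using A r \<rho> by (simp add: RHS ennreal_mult_eq_top_iff flip: ennreal_mult')
    then show ?thesis by (simp add: A_def)
  next
    case (real X)
    then have X: "0 \<le> X" by simp
    have "weighted_mean_norm w ?B p Df = ennreal ((X / ?W) powr (1 / p))"
      using real W p by (simp add: RHS ennreal_divide_real enn_powr_ennreal)
    then have R: "ennreal (A * K powr (1 / p)) * ennreal \<rho> * weighted_mean_norm w ?B p Df
       = ennreal (A * (\<rho> * (K * X / ?W) powr (1 / p)))"
      using A \<rho> r W X by (simp add: powr_mult powr_divide mult_ac flip: ennreal_mult')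
    define D where "D = A * (\<rho> * (K * X / ?W) powr (1 / p))"
    have D: "0 \<le> D" using A \<rho> by (simp add: D_def)
    have q0: "0 < q0" "0 < q" using q by auto
    have pd: "p < real DIM(real ^ 'n) * r" and qd: "1 / q0 = 1 / p - 1 / (real DIM(real ^ 'n) * r)"
      using r(3) q(3) by simp_all
    have XB: "(\<integral>\<^sup>+x\<in>?B. ennreal (norm (g0 x) powr p * w' x) \<partial>lborel) \<le> ennreal X"
      using real by (simp add: J_def)
    have main: "(\<integral>\<^sup>+x. ennreal (\<bar>f0 x - a\<bar> powr q0) \<partial>N z \<rho>) \<le> ennreal (D powr q0)"
      unfolding D_def A_def a_def av
      using Sobolev_Poincare_critical[OF f0m g0m loc[OF lf f0' f0m] loc[OF lD g0' g0m] test bd r(1,2) pd less_imp_le[OF r(4)] \<rho> X XB qd]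
      by simp
    interpret N: prob_space "N z \<rho>" by (rule prob_space_N) fact
    have one: "(\<integral>\<^sup>+x. ennreal 1 \<partial>N z \<rho>) \<le> ennreal 1"
      using N.emeasure_space_1 by simp
    \<comment> \<open>Monotonicity of power means, as Hoelder's inequality with the constant one as
      second function.\<close>
    have "(\<integral>\<^sup>+x. ennreal (\<bar>f0 x - a\<bar> powr q) \<partial>N z \<rho>)
       = (\<integral>\<^sup>+x. ennreal ((\<bar>f0 x - a\<bar> powr q0) powr (q / q0) * 1 powr (1 - q / q0)) \<partial>N z \<rho>)"
      using q0 by (simp add: powr_powr)
    also have "\<dots> \<le> ennreal ((D powr q0) powr (q / q0) * 1 powr (1 - q / q0))"
      by (rule nn_integral_Holder) (use q q0 main one in auto)
    also have "\<dots> = ennreal (D powr q)" using q0 by (simp add: powr_powr)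
    finally have "enn_powr (\<integral>\<^sup>+x. ennreal (\<bar>f0 x - a\<bar> powr q) \<partial>N z \<rho>) (1 / q) \<le> ennreal D"
      by (rule enn_powr_le) (use D q0 in auto)
    then have "weighted_mean_norm w ?B q (\<lambda>x. f x - a) \<le> ennreal D" by (simp only: LHS)
    then show ?thesis using R unfolding A_def D_def a_def by simp
  qed
qed

end

text \<open>If the weight vanishes on a set of positive measure and is positive on another, some
  ball meets both in positive measure. There the negative power has infinite integral while the
  average of \<open>w\<close> is positive; for \<open>s = 1\<close> the positive maximal function is
  divided by zero on a set of positive measure. In both cases the constant is infinite.\<close>

lemma Ap_class_null_or_pos:
  fixes w :: "real ^ 'n \<Rightarrow> real"
  assumes w: "w \<in> Ap_class s" and s: "1 \<le> s"
  shows "(AE x in lborel. w x = 0) \<or> (AE x in lborel. 0 < w x)"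
proof (rule ccontr)
  assume neg: "\<not> ?thesis"
  have nn: "0 \<le> w x" for x using w by (simp add: Ap_class_def weight_def)
  have [measurable]: "w \<in> borel_measurable lebesgue"
    using w by (intro locally_integrable_measurable) (simp add: Ap_class_def weight_def)
  \<comment> \<open>Exhaustion by balls about the origin, so that the larger of two radii gives one
    ball for both sets.\<close>
  have cover: "\<exists>R>0. emeasure lebesgue (S \<inter> ball 0 R) \<noteq> 0" if "S \<in> sets lebesgue" "S \<notin> null_sets lebesgue" for S :: "(real ^ 'n) set"
  proof (rule ccontr)
    assume "\<not> ?thesis"
    then have "S \<inter> ball 0 (real (Suc k)) \<in> null_sets lebesgue" for k
      using that(1) by (auto simp: null_sets_def)
    then have "(\<Union>k. S \<inter> ball 0 (real (Suc k))) \<in> null_sets lebesgue" by (rule null_sets_UN)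
    moreover have "(\<Union>k. S \<inter> ball 0 (real (Suc k))) = S"
    proof -
      have "\<exists>k. norm x < real (Suc k)" for x :: "real ^ 'n"
        using reals_Archimedean2[of "norm x"] by (metis less_Suc_eq of_nat_less_iff order_less_trans lessI)
      then show ?thesis by auto
    qed
    ultimately show False using that(2) by simp
  qed
  define P where "P = {x. 0 < w x}"
  define Z where "Z = {x. w x = 0}"
  have sets: "P \<in> sets lebesgue" "Z \<in> sets lebesgue"
    using measurable_sets[of w lebesgue borel "{0<..}"] measurable_sets[of w lebesgue borel "{0}"]
    by (simp_all add: P_def Z_def vimage_def)
  have "Z \<notin> null_sets lebesgue"
  proof
    assume "Z \<in> null_sets lebesgue"
    then have "AE x in lebesgue. x \<notin> Z" by (rule AE_not_in)
    then have "AE x in lebesgue. 0 < w x" by eventually_elim (use nn in \<open>auto simp: Z_def less_le\<close>)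
    then show False using neg by (simp add: AE_completion_iff)
  qed
  then obtain R1 where R1: "0 < R1" "emeasure lebesgue (Z \<inter> ball 0 R1) \<noteq> 0" using cover[OF sets(2)] by blast
  have "P \<notin> null_sets lebesgue"
  proof
    assume "P \<in> null_sets lebesgue"
    then have "AE x in lebesgue. x \<notin> P" by (rule AE_not_in)
    then have "AE x in lebesgue. w x = 0" by eventually_elim (use nn in \<open>auto simp: P_def less_le\<close>)
    then show False using neg by (simp add: AE_completion_iff)
  qed
  then obtain R2 where R2: "0 < R2" "emeasure lebesgue (P \<inter> ball 0 R2) \<noteq> 0" using cover[OF sets(1)] by blast
  define R where "R = max R1 R2"
  have R: "0 < R" using R1 by (simp add: R_def)
  have ZR: "emeasure lebesgue (Z \<inter> ball 0 R) \<noteq> 0"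
  proof -
    have "emeasure lebesgue (Z \<inter> ball 0 R1) \<le> emeasure lebesgue (Z \<inter> ball 0 R)"
      using sets by (intro emeasure_mono) (auto simp: R_def)
    then show ?thesis using R1(2) by (metis le_zero_eq)
  qed
  have wR: "(\<integral>\<^sup>+x\<in>ball 0 R. ennreal (w x) \<partial>lebesgue) \<noteq> 0"
  proof
    assume "(\<integral>\<^sup>+x\<in>ball 0 R. ennreal (w x) \<partial>lebesgue) = 0"
    moreover have "(\<lambda>x. ennreal (w x)) \<in> borel_measurable lebesgue" by measurable
    then have "(\<lambda>x. ennreal (w x) * indicator (ball 0 R) x) \<in> borel_measurable lebesgue"
      by (intro borel_measurable_times_ennreal borel_measurable_indicator) auto
    note nn_integral_0_iff_AE[OF this]
    ultimately have "AE x in lebesgue. ennreal (w x) * indicator (ball 0 R) x = 0"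
      by blast
    then have "AE x in lebesgue. x \<notin> P \<inter> ball 0 R2"
      by eventually_elim (auto simp: P_def R_def indicator_def ennreal_eq_0_iff split: if_splits)
    then have "P \<inter> ball 0 R2 \<in> null_sets lebesgue"
      using sets by (subst AE_iff_null_sets) auto
    then show False using R2(2) by (simp add: null_sets_def)
  qed
  have avg0: "enn_avg (ball 0 R) (\<lambda>x. ennreal (w x)) \<noteq> 0"
    using wR R by (simp add: enn_avg_def emeasure_ball ennreal_divide_eq_0_iff)
  have "Ap_const s w = \<infinity>"
  proof (cases "s = 1")
    case True
    have "\<not> (AE x in lebesgue. HL_maximal w x / ennreal (w x) < \<infinity>)"
    proof
      assume "AE x in lebesgue. HL_maximal w x / ennreal (w x) < \<infinity>"
      then have "AE x in lebesgue. x \<notin> Z \<inter> ball 0 R"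
      proof eventually_elim
        case (elim x)
        show ?case
        proof
          assume x: "x \<in> Z \<inter> ball 0 R"
          have "enn_avg (ball 0 R) (\<lambda>x. ennreal \<bar>w x\<bar>) \<le> HL_maximal w x"
            unfolding HL_maximal_def by (rule SUP_upper2[of "(0, R)"]) (use R x in auto)
          then have "HL_maximal w x \<noteq> 0" using avg0 nn by auto
          then have "HL_maximal w x / ennreal (w x) = \<infinity>"
            using x by (simp add: Z_def ennreal_divide_zero)
          then show False using elim by simp
        qed
      qed
      then have "Z \<inter> ball 0 R \<in> null_sets lebesgue"
        using sets by (subst AE_iff_null_sets) auto
      then show False using ZR by (simp add: null_sets_def)
    qed
    moreover have "AE x in lebesgue. HL_maximal w x / ennreal (w x) < \<infinity>" if "esssup lebesgue (\<lambda>x. HL_maximal w x / ennreal (w x)) < \<infinity>"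
      using esssup_AE by (rule eventually_mono) (rule le_less_trans[OF _ that])
    ultimately have "\<not> esssup lebesgue (\<lambda>x. HL_maximal w x / ennreal (w x)) < \<infinity>" by blast
    then show ?thesis using True by (auto simp: Ap_const_def less_top[symmetric])
  next
    case False
    then have s1: "1 < s" using s by simp
    have neg_exp: "1 - conj_exponent s < 0" using s1 by (simp add: conj_exponent_def field_simps)
    have "\<infinity> * emeasure lebesgue (Z \<inter> ball 0 R) = (\<integral>\<^sup>+x. \<infinity> * indicator (Z \<inter> ball 0 R) x \<partial>lebesgue)"
      using sets by (subst nn_integral_cmult_indicator) auto
    also have "\<dots> \<le> (\<integral>\<^sup>+x\<in>ball 0 R. enn_powr (ennreal (w x)) (1 - conj_exponent s) \<partial>lebesgue)"
      using neg_exp by (intro nn_integral_mono) (auto simp: indicator_def Z_def enn_powr_def)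
    finally have "(\<integral>\<^sup>+x\<in>ball 0 R. enn_powr (ennreal (w x)) (1 - conj_exponent s) \<partial>lebesgue) = \<infinity>"
      using ZR by (simp add: ennreal_top_mult top_unique)
    then have "enn_avg (ball 0 R) (\<lambda>x. enn_powr (ennreal (w x)) (1 - conj_exponent s)) = \<infinity>"
      using R by (simp add: enn_avg_def emeasure_ball ennreal_top_divide)
    then have "enn_powr (enn_avg (ball 0 R) (\<lambda>x. enn_powr (ennreal (w x)) (1 - conj_exponent s))) (s - 1) = \<infinity>"
      using s1 by (simp add: enn_powr_def)
    then have "enn_avg (ball 0 R) (\<lambda>x. ennreal (w x))
              * enn_powr (enn_avg (ball 0 R) (\<lambda>x. enn_powr (ennreal (w x)) (1 - conj_exponent s))) (s - 1) = \<infinity>"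
      using avg0 by (simp add: ennreal_mult_eq_top_iff)
    moreover have "enn_avg (ball 0 R) (\<lambda>x. ennreal (w x))
              * enn_powr (enn_avg (ball 0 R) (\<lambda>x. enn_powr (ennreal (w x)) (1 - conj_exponent s))) (s - 1) \<le> Ap_const s w"
      using False R unfolding Ap_const_def by (simp, intro SUP_upper2[of "(0, R)"]) auto
    ultimately show ?thesis by (simp add: top_unique)
  qed
  then show False using w by (simp add: Ap_class_def)
qed

lemma exists_weight_representative:
  fixes w :: "real ^ 'n \<Rightarrow> real"
  assumes w: "weight w" and pos: "AE x in lborel. 0 < w x"
  obtains w' where "weight_representative w' w"
proof -
  have loc: "locally_integrable w" and nn: "\<And>x. 0 \<le> w x" using w by (auto simp: weight_def)
  obtain w0 where w0: "w0 \<in> borel_measurable borel" "AE x in lborel. w x = w0 x"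
    using lebesgue_ex_borel_measurable[OF locally_integrable_measurable[OF loc]] by blast
  define w' where "w' x = (if 0 < w0 x then w0 x else 1)" for x
  have eq: "AE x in lborel. w x = w' x"
    using w0(2) pos by eventually_elim (simp add: w'_def)
  have "weight_representative w' w"
  proof
    show "w' \<in> borel_measurable borel" unfolding w'_def[abs_def] using w0(1) by measurable
    show "0 < w' x" for x by (simp add: w'_def)
    show "(\<integral>\<^sup>+x\<in>ball z t. ennreal (w' x) \<partial>lborel) < \<infinity>" for z t
    proof -
      have "AE x in lborel. ennreal (w x) = ennreal (w' x)" using eq by eventually_elim simp
      then have "(\<integral>\<^sup>+x\<in>ball z t. ennreal (w' x) \<partial>lborel) = (\<integral>\<^sup>+x\<in>ball z t. ennreal (w x) \<partial>lebesgue)"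
        by (simp add: nn_integral_lebesgue_cong_AE)
      also have "\<dots> \<le> (\<integral>\<^sup>+x. ennreal (norm (indicator (cball z t) x *\<^sub>R w x)) \<partial>lebesgue)"
        using nn by (intro nn_integral_mono) (auto simp: indicator_def)
      also have "\<dots> < \<infinity>"
        using loc unfolding locally_integrable_def set_integrable_def integrable_iff_bounded by simp
      finally show ?thesis .
    qed
  qed (use eq w in auto)
  then show thesis by (rule that)
qed

theorem theorem2p16:
  "\<exists>c > 0. \<exists>K :: real \<Rightarrow> real.
     (\<forall>p. 1 \<le> p \<and> p < real CARD('n) \<longrightarrow>
        K p = c * (real CARD('n) * p / (real CARD('n) - p))) \<and>
     (\<forall>(w :: real ^ 'n \<Rightarrow> real) p pw q.
        1 \<le> p \<and> p < real CARD('n) * ell w \<and> w \<in> Ap_class p \<and>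
        1 / p - 1 / pw = 1 / real CARD('n) * (1 / ell w) \<and>
        1 \<le> q \<and> q < pw \<longrightarrow>
        (\<exists>r > ell w. w \<in> Ap_class r \<and>
          (\<forall>z \<rho> f Df. 0 < \<rho> \<and> has_weak_gradient f Df \<longrightarrow>
             weighted_mean_norm w (ball z \<rho>) q (\<lambda>x. f x - avg (ball z \<rho>) f)
             \<le> ennreal (K p * enn2real (Ap_const r w) powr (1 / p)) * ennreal \<rho>
               * weighted_mean_norm w (ball z \<rho>) p Df)))"
proof -
  define n where "n = real CARD('n)"
  \<comment> \<open>The factor \<open>18 * 18 ^ n\<close> of the inequality, times four for
    comparing its \<open>4 + 2 * p / (n - p)\<close> with the Sobolev exponent, times two for
    replacing the supremum of the constants by a nearby value.\<close>
  define c :: real where "c = 144 * 18 ^ CARD('n)"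
  \<comment> \<open>For \<open>p \<ge> n\<close> any positive value works: then
    \<open>ell w > 1\<close>, hence the constants are unbounded and absorb every factor.\<close>
  define K where "K p = (if p < n then c * (n * p / (n - p)) else 1)" for p :: real
  have n1: "1 \<le> n" by (simp add: n_def Suc_le_eq)
  have c: "0 < c" by (simp add: c_def)
  have Kpos: "0 < K p" if "1 \<le> p" for p using that n1 c by (auto simp: K_def)
  have main: "\<exists>r > ell w. w \<in> Ap_class r \<and>
      (\<forall>z \<rho> f Df. 0 < \<rho> \<and> has_weak_gradient f Df \<longrightarrow>
         weighted_mean_norm w (ball z \<rho>) q (\<lambda>x. f x - avg (ball z \<rho>) f)
         \<le> ennreal (K p * enn2real (Ap_const r w) powr (1 / p)) * ennreal \<rho> * weighted_mean_norm w (ball z \<rho>) p Df)"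
    if p: "1 \<le> p" "p < n * ell w" "w \<in> Ap_class p" and pw: "1 / p - 1 / pw = 1 / n * (1 / ell w)" and q: "1 \<le> q" "q < pw"
    for w :: "real ^ 'n \<Rightarrow> real" and p pw q
  proof -
    define e where "e = ell w"
    define A where "A = {s. 1 \<le> s \<and> w \<in> Ap_class s}"
    have eA: "e = Inf A" by (simp add: e_def ell_def A_def)
    have pA: "p \<in> A" using p by (simp add: A_def)
    have bdd: "bdd_below A" by (rule bdd_belowI[of _ 1]) (simp add: A_def)
    have e_le: "e \<le> s" if "s \<in> A" for s unfolding eA using that bdd by (rule cInf_lower)
    have e1: "1 \<le> e" unfolding eA using pA by (intro cInf_greatest) (auto simp: A_def)
    have w: "weight w" using p(3) by (simp add: Ap_class_def)
    have pw': "1 / p - 1 / pw = 1 / (n * e)" using pw by (simp add: e_def)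
    have pne: "p < n * e" using p(2) by (simp add: e_def)
    from Ap_class_null_or_pos[OF p(3,1)] show ?thesis
    proof
      \<comment> \<open>The product \<open>0 * \<infinity> = 0\<close> gives such a weight the
        constant zero, and it belongs to the class. The left-hand side of the inequality is then
        zero by the convention \<open>0 / 0 = 0\<close>.\<close>
      assume zero: "AE x in lborel. w x = 0"
      have B0: "(\<integral>\<^sup>+x\<in>B. ennreal (w x) \<partial>lebesgue) = 0" for B
      proof -
        have "(\<integral>\<^sup>+x\<in>B. ennreal (w x) \<partial>lebesgue) = (\<integral>\<^sup>+x\<in>B. (\<lambda>_. 0) x \<partial>lborel)"
          by (rule nn_integral_lebesgue_cong_AE) (use zero in eventually_elim, simp)
        then show ?thesis by simp
      qed
      have "enn_avg B (\<lambda>x. ennreal (w x)) = 0" for B by (simp add: enn_avg_def B0)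
      then have "Ap_const (e + 1) w \<le> ennreal 0"
        using e1 by (simp add: Ap_const_def split_def SUP_bot[where 'a=ennreal, unfolded bot_ennreal])
      then have cls: "w \<in> Ap_class (e + 1)" using w by (simp add: Ap_class_def)
      have "weighted_mean_norm w B q h = 0" for B and h :: "real ^ 'n \<Rightarrow> real"
      proof -
        have "(\<integral>\<^sup>+x\<in>B. ennreal (norm (h x) powr q * w x) \<partial>lebesgue) = (\<integral>\<^sup>+x\<in>B. (\<lambda>_. 0) x \<partial>lborel)"
          by (rule nn_integral_lebesgue_cong_AE) (use zero in eventually_elim, simp)
        then show ?thesis using q by (simp add: weighted_mean_norm_def B0 enn_powr_def)
      qed
      then show ?thesis using cls by (intro exI[of _ "e + 1"]) (simp add: e_def)
    next
      assume "AE x in lborel. 0 < w x"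
      then obtain w' where "weight_representative w' w" by (rule exists_weight_representative[OF w])
      then interpret weight_representative w' w .
      have cls: "w \<in> Ap_class r" if r: "e < r" for r
      proof -
        obtain s where "s \<in> A" "s < r" using r pA bdd unfolding eA by (subst (asm) cInf_less_iff) auto
        then show ?thesis using Ap_class_mono by (auto simp: A_def)
      qed
      have Apc: "Ap_bound r (enn2real (Ap_const r w))" "0 < enn2real (Ap_const r w)" if "e < r" for r
        using Ap_const_finite[OF cls[OF that]] that e1 by auto
      let ?k = "\<lambda>r. enn2real (Ap_const r w)"
      show ?thesis
      proof (cases "\<exists>M. \<forall>r>e. ?k r \<le> M")
        case True
        then obtain M where M: "\<And>r. e < r \<Longrightarrow> ?k r \<le> M" by blast
        define A' where "A' = (SUP r\<in>{e<..}. ?k r)"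
        have bA: "bdd_above (?k ` {e<..})" using M by (intro bdd_aboveI[of _ M]) auto
        have kA: "?k r \<le> A'" if "e < r" for r unfolding A'_def using that bA by (intro cSUP_upper) auto
        have A': "0 < A'" using Apc(2)[of "e + 1"] kA[of "e + 1"] by simp
        have ApA: "Ap_bound r A'" if r: "e < r" for r
        proof -
          have "Ap_const r w = ennreal (?k r)" using Ap_const_finite(1)[OF cls[OF r]] r e1 by simp
          also have "\<dots> \<le> ennreal A'" using kA[OF r] by (rule ennreal_leI)
          finally show ?thesis using r e1 A' by (subst Ap_const_le_iff[symmetric]) auto
        qed
        \<comment> \<open>With \<open>e > 1\<close> a bound uniform over all \<open>r > e\<close>
          would put \<open>w\<close> into a class below its own infimum.\<close>
        have e_eq: "e = 1"
        proof (rule ccontr)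
          assume "e \<noteq> 1"
          then have "1 < e" using e1 by simp
          from Ap_bound_open[OF ApA this less_imp_le[OF A']]
          obtain s K' where s: "1 < s" "s < e" "0 \<le> K'" "Ap_bound s K'" by auto
          have "w \<in> Ap_class s" by (rule Ap_classI[OF s(4,1,3)])
          then have "e \<le> s" using s by (intro e_le) (simp add: A_def)
          then show False using s by simp
        qed
        have avb: "averaging_bound 1 A'"
          using A1_bound_limit[of A'] ApA A' e_eq by (intro A1_bound_averaging) auto
        \<comment> \<open>The inequality is available with \<open>A'\<close> at
          \<open>r = 1\<close>, but the statement asks for the constant of one exponent strictly
          above \<open>ell w\<close>. Half of the supremum is exceeded by some \<open>r\<close>, at
          the cost of \<open>2 powr (1 / p) \<le> 2\<close>.\<close>
        have "\<exists>r\<in>{e<..}. A' / 2 < ?k r"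
        proof (rule ccontr)
          assume "\<not> ?thesis"
          then have "A' \<le> A' / 2" unfolding A'_def by (intro cSUP_least) (auto simp: not_less)
          then show False using A' by simp
        qed
        then obtain r where r: "e < r" "A' / 2 < ?k r" by auto
        have pn: "p < n" using pne e_eq by simp
        have const: "18 * 18 ^ CARD('n) * (4 + 2 * p / (real CARD('n) * 1 - p)) * A' powr (1 / p) \<le> K p * ?k r powr (1 / p)"
        proof -
          have "A' powr (1 / p) \<le> (2 * ?k r) powr (1 / p)" using r A' p by (intro powr_mono2) auto
          also have "\<dots> = 2 powr (1 / p) * ?k r powr (1 / p)" by (simp add: powr_mult)
          also have "\<dots> \<le> 2 * ?k r powr (1 / p)"
          proof (rule mult_right_mono)
            have "(2::real) powr (1 / p) \<le> 2 powr 1" using p by (intro powr_mono) auto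
            then show "(2::real) powr (1 / p) \<le> 2" by simp
          qed simp
          finally have a: "A' powr (1 / p) \<le> 2 * ?k r powr (1 / p)" .
          have "4 + 2 * p / (n - p) = (4 * n - 2 * p) / (n - p)" using pn by (simp add: field_simps)
          also have "\<dots> \<le> 4 * (n * p) / (n - p)"
          proof (rule divide_right_mono)
            have "n * 1 \<le> n * p" using n1 p by (intro mult_left_mono) auto
            then show "4 * n - 2 * p \<le> 4 * (n * p)" using p by simp
          qed (use pn in simp)
          finally have b: "4 + 2 * p / (n - p) \<le> 4 * (n * p / (n - p))" by simp
          have "18 * 18 ^ CARD('n) * (4 + 2 * p / (n - p)) * A' powr (1 / p)
             \<le> 18 * 18 ^ CARD('n) * (4 * (n * p / (n - p))) * (2 * ?k r powr (1 / p))"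
            using pn p n1 by (intro mult_mono a b mult_left_mono) auto
          also have "\<dots> = K p * ?k r powr (1 / p)" using pn by (simp add: K_def c_def)
          finally show ?thesis by (simp add: n_def)
        qed
        show ?thesis
        proof (intro exI[of _ r] conjI allI impI)
          show "ell w < r" using r by (simp add: e_def)
          show "w \<in> Ap_class r" by (rule cls) fact
          fix z :: "real ^ 'n" and \<rho> :: real and f :: "real ^ 'n \<Rightarrow> real" and Df :: "real ^ 'n \<Rightarrow> real ^ 'n" assume *: "0 < \<rho> \<and> has_weak_gradient f Df"
          have "weighted_mean_norm w (ball z \<rho>) q (\<lambda>x. f x - avg (ball z \<rho>) f)
            \<le> ennreal (18 * 18 ^ CARD('n) * (4 + 2 * p / (real CARD('n) * 1 - p)) * A' powr (1 / p)) * ennreal \<rho> * weighted_mean_norm w (ball z \<rho>) p Df"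
          proof (rule weighted_mean_norm_Sobolev_Poincare[OF avb])
            \<comment> \<open>Since \<open>e = 1\<close>, the exponent \<open>pw\<close> is itself
              critical for \<open>r = 1\<close>, so every \<open>q < pw\<close> is covered.\<close>
            show "1 / pw = 1 / p - 1 / (real CARD('n) * 1)" using pw' e_eq by (simp add: n_def)
          qed (use p q pn A' * in \<open>auto simp: n_def\<close>)
          also have "\<dots> \<le> ennreal (K p * ?k r powr (1 / p)) * ennreal \<rho> * weighted_mean_norm w (ball z \<rho>) p Df"
            by (intro mult_right_mono ennreal_leI const) auto
          finally show "weighted_mean_norm w (ball z \<rho>) q (\<lambda>x. f x - avg (ball z \<rho>) f)
            \<le> ennreal (K p * ?k r powr (1 / p)) * ennreal \<rho> * weighted_mean_norm w (ball z \<rho>) p Df" .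
        qed
      next
        case False
        \<comment> \<open>If the infimum were \<open>p\<close> itself, membership in that class
          would bound the constants of all larger exponents, against the case assumption. Thus
          \<open>(e, p]\<close> contains admissible exponents.\<close>
        have "e \<noteq> p"
        proof
          assume ep: "e = p"
          have "\<exists>M\<ge>0. \<forall>r>p. Ap_bound r M"
          proof (cases "p = 1")
            case True
            then show ?thesis using A1_class_bound A1_bound_imp_Ap_bound p(3) by blast
          next
            case False
            then have "1 < p" using p by simp
            from Ap_const_finite(2,3)[OF p(3) this] this show ?thesis
              by (intro exI[of _ "?k p"]) (auto intro: Ap_bound_mono)
          qed
          then obtain M where M: "0 \<le> M" "\<And>r. p < r \<Longrightarrow> Ap_bound r M" by blast
          have "?k r \<le> M" if "e < r" for r
          proof -
            have "Ap_const r w \<le> ennreal M" using M that ep p by (subst Ap_const_le_iff) auto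
            then show ?thesis using enn2real_mono[of "Ap_const r w" "ennreal M"] M by simp
          qed
          then show False using False by blast
        qed
        then have ep: "e < p" using e_le[OF pA] by simp
        have ne: "0 < n * e" using n1 e1 by simp
        have pwpos: "0 < pw" using q by simp
        have qlt: "1 / p - 1 / q < 1 / (n * e)"
          unfolding pw'[symmetric] using q pwpos by (simp add: frac_less2)
        \<comment> \<open>The last condition says that \<open>q\<close> does not exceed the critical
          exponent belonging to \<open>r\<close>. As \<open>q < pw\<close> is strict, it leaves room
          for \<open>r\<close> above \<open>e\<close>; for \<open>q \<le> p\<close> it holds for
          every \<open>r\<close>, in particular for \<open>p\<close>.\<close>
        have "\<exists>r. e < r \<and> r \<le> p \<and> 1 / p - 1 / q \<le> 1 / (n * r)"
        proof (cases "1 / p - 1 / q \<le> 0")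
          case True
          have "0 \<le> 1 / (n * p)" using n1 p by simp
          then show ?thesis using True ep by (intro exI[of _ p]) linarith
        next
          case False
          define t where "t = 1 / p - 1 / q"
          have t: "0 < t" "t < 1 / (n * e)" using False qlt by (auto simp: t_def)
          have et: "e < 1 / (n * t)" using t n1 e1 by (simp add: field_simps)
          define r where "r = min p (1 / (n * t))"
          have "e < r" "r \<le> p" using et ep by (auto simp: r_def)
          moreover have "t \<le> 1 / (n * r)"
          proof -
            have r0: "0 < r" using \<open>e < r\<close> e1 by simp
            have "r \<le> 1 / (n * t)" by (simp add: r_def)
            then have "r * (n * t) \<le> 1" using t n1 by (simp add: field_simps)
            then show ?thesis using r0 n1 by (simp add: field_simps)
          qed
          ultimately show ?thesis by (auto simp: t_def)
        qed
        then obtain r where r: "e < r" "r \<le> p" "1 / p - 1 / q \<le> 1 / (n * r)" by blast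
        have r1: "1 < r" using r e1 by simp
        have "n * e < n * r" using r(1) n1 by simp
        then have pnr: "p < n * r" using pne by linarith
        define q0 where "q0 = 1 / (1 / p - 1 / (n * r))"
        have q0inv: "0 < 1 / p - 1 / (n * r)" using pnr p by (simp add: frac_less2)
        have q0: "1 / q0 = 1 / p - 1 / (real CARD('n) * r)" by (simp add: q0_def n_def)
        have "1 / p - 1 / (n * r) \<le> 1 / q" using r(3) by linarith
        then have qq0: "q \<le> q0" using q0inv q by (simp add: q0_def field_simps)
        define C0 where "C0 = 18 * 18 ^ CARD('n) * (4 + 2 * p / (real CARD('n) * r - p)) * ?k r powr (1 / p)"
        have avb: "averaging_bound r (?k r)" using Apc[OF r(1)] r1 by (intro Ap_bound_averaging) auto
        have C0: "0 \<le> C0" using pnr p by (simp add: C0_def n_def)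
        \<comment> \<open>The inequality is proved with \<open>r\<close>, but the constant is stated
          with \<open>r2\<close>: unboundedness provides an exponent whose constant, to the power
          \<open>1 / p\<close>, exceeds \<open>C0 / K p\<close>. Since \<open>C0\<close> depends on
          \<open>w\<close>, \<open>p\<close> and \<open>r\<close> only, \<open>r2\<close> serves all
          balls and functions.\<close>
        obtain r2 where r2: "e < r2" "(C0 / K p) powr p < ?k r2" using False by (auto simp: not_le)
        have const: "C0 \<le> K p * ?k r2 powr (1 / p)"
        proof -
          have "((C0 / K p) powr p) powr (1 / p) \<le> ?k r2 powr (1 / p)" using r2 p by (intro powr_mono2) auto
          then have "C0 / K p \<le> ?k r2 powr (1 / p)" using p C0 Kpos[OF p(1)] by (simp add: powr_powr)
          then show ?thesis using Kpos[OF p(1)] by (simp add: field_simps)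
        qed
        show ?thesis
        proof (intro exI[of _ r2] conjI allI impI)
          show "ell w < r2" using r2 by (simp add: e_def)
          show "w \<in> Ap_class r2" by (rule cls) fact
          fix z :: "real ^ 'n" and \<rho> :: real and f :: "real ^ 'n \<Rightarrow> real" and Df :: "real ^ 'n \<Rightarrow> real ^ 'n" assume *: "0 < \<rho> \<and> has_weak_gradient f Df"
          have "weighted_mean_norm w (ball z \<rho>) q (\<lambda>x. f x - avg (ball z \<rho>) f)
            \<le> ennreal C0 * ennreal \<rho> * weighted_mean_norm w (ball z \<rho>) p Df"
            unfolding C0_def
            by (rule weighted_mean_norm_Sobolev_Poincare[OF avb _ _ _ _ _ qq0 q0]) (use r r1 p q pnr Apc * in \<open>auto simp: n_def\<close>)
          also have "\<dots> \<le> ennreal (K p * ?k r2 powr (1 / p)) * ennreal \<rho> * weighted_mean_norm w (ball z \<rho>) p Df"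
            by (intro mult_right_mono ennreal_leI const) auto
          finally show "weighted_mean_norm w (ball z \<rho>) q (\<lambda>x. f x - avg (ball z \<rho>) f)
            \<le> ennreal (K p * ?k r2 powr (1 / p)) * ennreal \<rho> * weighted_mean_norm w (ball z \<rho>) p Df" .
        qed
      qed
    qed
  qed
  have "\<forall>p. 1 \<le> p \<and> p < real CARD('n) \<longrightarrow> K p = c * (real CARD('n) * p / (real CARD('n) - p))"
    by (simp add: K_def n_def)
  with c main[unfolded n_def] show ?thesis by blast
qed

end
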